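(* Let $k$ be a field, $P$ a finite connected poset, $T\in\mathrm{Int}(P)$, and $C\in\mathcal U(T)$ with $C\neq T$. There is an isomorphism of cochain complexes $$\mathrm{Hom}_{\Lambda_P}(\mathsf Q_\bullet(T),\mathsf L(C))\cong C^\bullet\bigl(\mathrm{Simp}(I_T(C)),\Gamma_T^-(C);k\bigr)[-1],$$ where $C^\bullet(K,L;k)$ is the relative simplicial cochain complex. Consequently, for every $n\ge1$, $$\mathrm{Ext}^n_{\Lambda_P}(\Delta(T),\mathsf L(C))\cong\widetilde H^{n-2}(\Gamma_T^-(C);k).$$
   Context: A subset $S\subseteq P$ is connected if any $x,y\in S$ are joined by a sequence $x=x_0,\dots,x_r=y$ in $S$ with $x_{i-1},x_i$ comparable for all $i$; convex if $x,y\in S$ and $x\le z\le y$ imply $z\in S$; an interval if it is nonempty, connected and convex. $\mathrm{Int}(P)$ is the set of intervals of $P$; $\pi_0(X)$ is the set of connected components of $X\subseteq P$, with $\pi_0(\varnothing)=\varnothing$. Representations of $P$ are functors from $P$ to finite-dimensional $k$-vector spaces, with morphism spaces $\mathrm{Hom}_P$. For $S\in\mathrm{Int}(P)$, $\mathbb I_S$ is the representation with $\mathbb I_S(x)=k$ for $x\in S$ and $0$ otherwise, and $\mathbb I_S(x\le y)=\mathrm{id}$ if $x,y\in S$ and $0$ otherwise. Put $G_P=\bigoplus_{S\in\mathrm{Int}(P)}\mathbb I_S$ and $\Lambda_P=\mathrm{End}_P(G_P)^{\mathrm{op}}$; $e_S\in\Lambda_P$ is the idempotent of the summand $\mathbb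 I_S$, so $e_R\Lambda_Pe_S=\mathrm{Hom}_P(\mathbb I_R,\mathbb I_S)$. All modules are finitely generated left modules. $\mathsf P(S)=\Lambda_Pe_S=\bigoplus_R\mathrm{Hom}_P(\mathbb I_R,\mathbb I_S)$ and $\mathsf L(S)=\mathsf P(S)/\operatorname{rad}\mathsf P(S)$. A morphism $f\colon\mathbb I_R\to\mathbb I_S$ induces $f_*\colon\mathsf P(R)\to\mathsf P(S)$, $g\mapsto f\circ g$. $\Lambda_P$ carries the quasi-hereditary order on $\mathrm{Int}(P)$ given by $R\preceq S$ iff $R=S$ or $|R|>|S|$. The standard module $\Delta(S)$ is the largest quotient of $\mathsf P(S)$ all of whose composition factors are of the form $\mathsf L(R)$ with $R\preceq S$. A subset $C\subseteq S$ is a relative upset in $S$ if $c\in C$, $x\in S$, $c\le x$ imply $x\in C$. $\mathcal U(S)$ is the set of intervals contained in $S$ that are relative upsets in $S$. For $U\in\mathcal U(S)$, $j_{U,S}\colon\mathbb I_U\to\mathbb I_S$ is the map that is the identity at points of $U$ and zero elsewhere. Let $U_1,\dots,U_m$ be an ordering of the inclusion-maximal elements of $\mathcal U(T)\setminus\{T\}$; for $J\subseteq[m]$ put $U_J=\bigcap_{j\in J}U_j$, $U_\varnothing=T$. The complex $\mathsf Q_\bullet(T)$ of projective modules has $\mathsf Q_q(T)=\bigoplus_{J\subseteq[m],|J|=q}\bigoplus_{C\in\pi_0(U_J)}\mathsf P(C)$ for $q\ge0$, with differential $d_q$ ($q\ge1$) given on the summand $\mathsf P(C)$ indexed by $(J,C)$,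 $J=\{j_0<\dots<j_{q-1}\}$, by $\sum_{r=0}^{q-1}(-1)^r(j_{C,C^{J_r}})_*$ into the summands $\mathsf P(C^{J_r})$ indexed by $(J_r,C^{J_r})$, where $J_r=J\setminus\{j_r\}$ and $C^{J_r}$ is the component of $U_{J_r}$ containing $C$. For $C\in\mathcal U(T)$, $C\ne T$: $I_T(C)=\{i\in[m]\mid C\subseteq U_i\}$ (nonempty); for $J\subseteq I_T(C)$, $\mathrm{comp}_J(C)$ is the unique connected component of $U_J$ containing $C$; $\Gamma_T^-(C)=\{J\subseteq I_T(C)\mid C\subsetneq\mathrm{comp}_J(C)\}$, a simplicial complex containing the empty face. $\mathrm{Simp}(X)=\{F\mid F\subseteq X\}$ is the full simplex on $X$. The shift is $(C^\bullet[-1])^n=C^{n-1}$ with negated differential. Reduced cohomology uses the empty face in degree $-1$; in particular $\widetilde H^{-1}(\{\varnothing\};k)=k$. *)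

theory Defs
  imports
    "HOL-Algebra.Module"
    "HOL-Algebra.AbelCoset"
    "HOL-Algebra.Algebraic_Closure_Type"
begin

section \<open>Left modules over a (noncommutative) ring\<close>

text \<open>
  Modules are records of type \<^typ>\<open>('a, 'm) module\<close>; their fields \<^const>\<open>monoid.mult\<close> and \<^const>\<open>one\<close> carry
  no meaning. The library locale \<^locale>\<open>module\<close> demands a commutative ring of scalars, hence the
  locale below. A \<open>k\<close>-algebra is also a record of type \<^typ>\<open>('k, 'a) module\<close>, this time with a
  meaningful ring multiplication. The field \<open>k\<close> is a type of class \<^class>\<open>field\<close>, turned into a ring
  record by \<^const>\<open>ring_of_type_algebra\<close>.
\<close>

locale left_module = R?: ring R + M?: abelian_group M
  for R :: "('a, 'b) ring_scheme" (structure) and M :: "('a, 'm, 'c) module_scheme" (structure) +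
  assumes smult_closed: "\<lbrakk>a \<in> carrier R; x \<in> carrier M\<rbrakk> \<Longrightarrow> a \<odot>\<^bsub>M\<^esub> x \<in> carrier M"
    and smult_l_distr: "\<lbrakk>a \<in> carrier R; b \<in> carrier R; x \<in> carrier M\<rbrakk> \<Longrightarrow>
      (a \<oplus> b) \<odot>\<^bsub>M\<^esub> x = a \<odot>\<^bsub>M\<^esub> x \<oplus>\<^bsub>M\<^esub> b \<odot>\<^bsub>M\<^esub> x"
    and smult_r_distr: "\<lbrakk>a \<in> carrier R; x \<in> carrier M; y \<in> carrier M\<rbrakk> \<Longrightarrow>
      a \<odot>\<^bsub>M\<^esub> (x \<oplus>\<^bsub>M\<^esub> y) = a \<odot>\<^bsub>M\<^esub> x \<oplus>\<^bsub>M\<^esub> a \<odot>\<^bsub>M\<^esub> y"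
    and smult_assoc: "\<lbrakk>a \<in> carrier R; b \<in> carrier R; x \<in> carrier M\<rbrakk> \<Longrightarrow>
      (a \<otimes> b) \<odot>\<^bsub>M\<^esub> x = a \<odot>\<^bsub>M\<^esub> (b \<odot>\<^bsub>M\<^esub> x)"
    and smult_one: "x \<in> carrier M \<Longrightarrow> \<one> \<odot>\<^bsub>M\<^esub> x = x"

abbreviation scalars :: "'k::field ring"
  where "scalars \<equiv> ring_of_type_algebra"

definition regular_module :: "('a, 'b) ring_scheme \<Rightarrow> ('a, 'a) module"
  where "regular_module R = \<lparr>carrier = carrier R, monoid.mult = monoid.mult R, one = one R,
    zero = zero R, add = add R, module.smult = monoid.mult R\<rparr>"

text \<open>Homomorphisms are extensional functions on the carrier, so that equality is pointwise.\<close>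

definition lmod_hom ::
    "('a, 'b) ring_scheme \<Rightarrow> ('a, 'm, 'c) module_scheme \<Rightarrow> ('a, 'n, 'd) module_scheme \<Rightarrow> ('m \<Rightarrow> 'n) set"
  where "lmod_hom R M N = {f \<in> carrier M \<rightarrow>\<^sub>E carrier N.
    (\<forall>x\<in>carrier M. \<forall>y\<in>carrier M. f (x \<oplus>\<^bsub>M\<^esub> y) = f x \<oplus>\<^bsub>N\<^esub> f y) \<and>
    (\<forall>a\<in>carrier R. \<forall>x\<in>carrier M. f (a \<odot>\<^bsub>M\<^esub> x) = a \<odot>\<^bsub>N\<^esub> f x)}"

definition lmod_iso ::
    "('a, 'b) ring_scheme \<Rightarrow> ('a, 'm, 'c) module_scheme \<Rightarrow> ('a, 'n, 'd) module_scheme \<Rightarrow> bool"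
  where "lmod_iso R M N \<longleftrightarrow> (\<exists>f\<in>lmod_hom R M N. bij_betw f (carrier M) (carrier N))"

definition quot_module :: "('a, 'm, 'c) module_scheme \<Rightarrow> 'm set \<Rightarrow> ('a, 'm set) module"
  where "quot_module M N = \<lparr>carrier = a_rcosets\<^bsub>M\<^esub> N, monoid.mult = undefined, one = undefined,
    zero = N, add = (<+>\<^bsub>M\<^esub>), module.smult = (\<lambda>a Y. \<Union>y\<in>Y. N +>\<^bsub>M\<^esub> (a \<odot>\<^bsub>M\<^esub> y))\<rparr>"

text \<open>The direct sum of a family indexed by a finite set \<open>I\<close> (only finite \<open>I\<close> occur below).\<close>

definition direct_sum :: "'i set \<Rightarrow> ('i \<Rightarrow> ('a, 'm) module) \<Rightarrow> ('a, 'i \<Rightarrow> 'm) module"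
  where "direct_sum I M = \<lparr>carrier = (\<Pi>\<^sub>E i\<in>I. carrier (M i)), monoid.mult = undefined, one = undefined,
    zero = (\<lambda>i\<in>I. \<zero>\<^bsub>M i\<^esub>), add = (\<lambda>f g. \<lambda>i\<in>I. f i \<oplus>\<^bsub>M i\<^esub> g i),
    module.smult = (\<lambda>a f. \<lambda>i\<in>I. a \<odot>\<^bsub>M i\<^esub> f i)\<rparr>"

definition summand_inj :: "'i set \<Rightarrow> ('i \<Rightarrow> ('a, 'm) module) \<Rightarrow> 'i \<Rightarrow> 'm \<Rightarrow> 'i \<Rightarrow> 'm"
  where "summand_inj I M i x = (\<lambda>j\<in>I. if j = i then x else \<zero>\<^bsub>M j\<^esub>)"

definition maximal_submodule :: "'m set \<Rightarrow> ('a, 'b) ring_scheme \<Rightarrow> ('a, 'm, 'c) module_scheme \<Rightarrow> bool"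
  where "maximal_submodule N R M \<longleftrightarrow> submodule N R M \<and> N \<noteq> carrier M \<and>
    (\<forall>N'. submodule N' R M \<and> N \<subseteq> N' \<longrightarrow> N' = N \<or> N' = carrier M)"

definition module_rad :: "('a, 'b) ring_scheme \<Rightarrow> ('a, 'm, 'c) module_scheme \<Rightarrow> 'm set"
  where "module_rad R M = carrier M \<inter> \<Inter>{N. maximal_submodule N R M}"

definition simple_module :: "('a, 'b) ring_scheme \<Rightarrow> ('a, 'm, 'c) module_scheme \<Rightarrow> bool"
  where "simple_module R M \<longleftrightarrow> carrier M \<noteq> {\<zero>\<^bsub>M\<^esub>} \<and>
    (\<forall>N. submodule N R M \<longrightarrow> N = {\<zero>\<^bsub>M\<^esub>} \<or> N = carrier M)"

definition subquotient :: "('a, 'm) module \<Rightarrow> 'm set \<Rightarrow> 'm set \<Rightarrow> ('a, 'm set) module"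
  where "subquotient M B A = quot_module (M\<lparr>carrier := B\<rparr>) A"

definition composition_series ::
    "('a, 'b) ring_scheme \<Rightarrow> ('a, 'm) module \<Rightarrow> nat \<Rightarrow> (nat \<Rightarrow> 'm set) \<Rightarrow> bool"
  where "composition_series R M l c \<longleftrightarrow> c 0 = {\<zero>\<^bsub>M\<^esub>} \<and> c l = carrier M \<and>
    (\<forall>i\<le>l. submodule (c i) R M) \<and>
    (\<forall>i<l. c i \<subseteq> c (Suc i) \<and> simple_module R (subquotient M (c (Suc i)) (c i)))"

text \<open>Finitely generated projective: a direct summand of \<open>R\<^sup>n\<close>.\<close>

definition fg_projective :: "('a, 'b) ring_scheme \<Rightarrow> ('a, 'm) module \<Rightarrow> bool"
  where "fg_projective R M \<longleftrightarrow> left_module R M \<and>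
    (\<exists>n::nat. \<exists>s\<in>lmod_hom R M (direct_sum {..<n} (\<lambda>_. regular_module R)).
      \<exists>p\<in>lmod_hom R (direct_sum {..<n} (\<lambda>_. regular_module R)) M.
        \<forall>x\<in>carrier M. p (s x) = x)"


section \<open>Complexes and Ext\<close>

text \<open>
  The same record serves for chain complexes (\<open>diff K n\<close> lowers the degree) and cochain complexes
  (\<open>diff K n\<close> raises the degree); all complexes are indexed by the integers.
\<close>

record ('a, 'm) graded_complex =
  obj :: "int \<Rightarrow> ('a, 'm) module"
  diff :: "int \<Rightarrow> 'm \<Rightarrow> 'm"

definition cochain_iso ::
    "('a, 'b) ring_scheme \<Rightarrow> ('a, 'm) graded_complex \<Rightarrow> ('a, 'n) graded_complex \<Rightarrow> bool"
  where "cochain_iso R K L \<longleftrightarrow> (\<exists>\<phi>. \<forall>n.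
    \<phi> n \<in> lmod_hom R (obj K n) (obj L n) \<and>
    bij_betw (\<phi> n) (carrier (obj K n)) (carrier (obj L n)) \<and>
    (\<forall>x\<in>carrier (obj K n). \<phi> (n + 1) (diff K n x) = diff L n (\<phi> n x)))"

definition cohomology :: "('a, 'm) graded_complex \<Rightarrow> int \<Rightarrow> ('a, 'm set) module"
  where "cohomology K n = subquotient (obj K n)
    {x \<in> carrier (obj K n). diff K n x = \<zero>\<^bsub>obj K (n + 1)\<^esub>}
    (diff K (n - 1) ` carrier (obj K (n - 1)))"

text \<open>\<open>K[-1]\<close>, that is \<open>K[-1]\<^sup>n = K\<^sup>n\<^sup>-\<^sup>1\<close> with negated differential.\<close>

definition shift :: "('a, 'm) graded_complex \<Rightarrow> ('a, 'm) graded_complex"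
  where "shift K = \<lparr>obj = (\<lambda>n. obj K (n - 1)),
    diff = (\<lambda>n x. \<ominus>\<^bsub>obj K n\<^esub> (diff K (n - 1) x))\<rparr>"

text \<open>
  For modules over a \<open>k\<close>-algebra \<open>A\<close>, \<open>Hom\<^sub>A(M, N)\<close> is a vector space over \<open>k\<close>, which acts through
  \<open>k \<rightarrow> A\<close>, \<open>c \<mapsto> c \<cdot> 1\<close>.
\<close>

definition Hom_space ::
    "('k, 'a) module \<Rightarrow> ('a, 'm) module \<Rightarrow> ('a, 'n) module \<Rightarrow> ('k, 'm \<Rightarrow> 'n) module"
  where "Hom_space A M N = \<lparr>carrier = lmod_hom A M N, monoid.mult = undefined, one = undefined,
    zero = (\<lambda>x\<in>carrier M. \<zero>\<^bsub>N\<^esub>), add = (\<lambda>f g. \<lambda>x\<in>carrier M. f x \<oplus>\<^bsub>N\<^esub> g x),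
    module.smult = (\<lambda>c f. \<lambda>x\<in>carrier M. (c \<odot>\<^bsub>A\<^esub> \<one>\<^bsub>A\<^esub>) \<odot>\<^bsub>N\<^esub> f x)\<rparr>"

definition Hom_complex ::
    "('k, 'a) module \<Rightarrow> ('a, 'm) graded_complex \<Rightarrow> ('a, 'n) module \<Rightarrow> ('k, 'm \<Rightarrow> 'n) graded_complex"
  where "Hom_complex A K N = \<lparr>obj = (\<lambda>n. Hom_space A (obj K n) N),
    diff = (\<lambda>n f. \<lambda>x\<in>carrier (obj K (n + 1)). f (diff K (n + 1) x))\<rparr>"

definition projective_resolution ::
    "('a, 'b) ring_scheme \<Rightarrow> ('a, 'x) graded_complex \<Rightarrow> ('x \<Rightarrow> 'm) \<Rightarrow> ('a, 'm) module \<Rightarrow> bool"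
  where "projective_resolution R K \<epsilon> M \<longleftrightarrow>
    (\<forall>q. fg_projective R (obj K q)) \<and>
    (\<forall>q<0. carrier (obj K q) = {\<zero>\<^bsub>obj K q\<^esub>}) \<and>
    (\<forall>q. diff K q \<in> lmod_hom R (obj K q) (obj K (q - 1))) \<and>
    (\<forall>q\<ge>1. {x \<in> carrier (obj K q). diff K q x = \<zero>\<^bsub>obj K (q - 1)\<^esub>}
        = diff K (q + 1) ` carrier (obj K (q + 1))) \<and>
    \<epsilon> \<in> lmod_hom R (obj K 0) M \<and> \<epsilon> ` carrier (obj K 0) = carrier M \<and>
    {x \<in> carrier (obj K 0). \<epsilon> x = \<zero>\<^bsub>M\<^esub>} = diff K 1 ` carrier (obj K 1)"

text \<open>
  \<open>Ext\<close> is computed from a chosen resolution by finitely generated projectives. The carrier type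
  \<^typ>\<open>nat \<Rightarrow> 'a\<close> is large enough to accommodate every \<open>A\<^sup>n\<close> and all its submodules; hence a
  finitely generated module over a finite-dimensional algebra \<open>A\<close> always has a resolution over
  this type, and the choice does not matter up to isomorphism.
\<close>

definition chosen_resolution ::
    "('k, 'a) module \<Rightarrow> ('a, 'm) module \<Rightarrow> ('a, nat \<Rightarrow> 'a) graded_complex"
  where "chosen_resolution A M = (SOME K. \<exists>\<epsilon>. projective_resolution A K \<epsilon> M)"

definition Ext ::
    "('k, 'a) module \<Rightarrow> nat \<Rightarrow> ('a, 'm) module \<Rightarrow> ('a, 'n) module \<Rightarrow> ('k, ((nat \<Rightarrow> 'a) \<Rightarrow> 'n) set) module"
  where "Ext A n M N = cohomology (Hom_complex A (chosen_resolution A M) N) (int n)"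


section \<open>Simplicial cochains\<close>

text \<open>
  Simplicial complexes are families of finite vertex sets closed under subsets; vertices are
  natural numbers, and faces are oriented by their order. A face \<open>F\<close> has dimension \<open>card F - 1\<close>, so
  the empty face, if present, sits in degree \<open>-1\<close>. Relative cochains of \<open>(K, L)\<close> are cochains of
  \<open>K\<close> vanishing on \<open>L\<close>; cochains in degree \<open>n\<close> are extended by \<open>0\<close> to sets which are not
  \<open>n\<close>-faces.
\<close>

definition faces :: "nat set set \<Rightarrow> int \<Rightarrow> nat set set"
  where "faces K n = {F \<in> K. int (card F) = n + 1}"

definition rel_cochains :: "nat set set \<Rightarrow> nat set set \<Rightarrow> ('k::field, nat set \<Rightarrow> 'k) graded_complex"
  where "rel_cochains K L = \<lparr>
    obj = (\<lambda>n. \<lparr>carrier = {\<phi>. \<forall>F. F \<notin> faces K n - L \<longrightarrow> \<phi> F = 0}, monoid.mult = undefined, one = undefined,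
      zero = (\<lambda>F. 0), add = (\<lambda>\<phi> \<psi> F. \<phi> F + \<psi> F), module.smult = (\<lambda>c \<phi> F. c * \<phi> F)\<rparr>),
    diff = (\<lambda>n \<phi> F. if F \<in> faces K (n + 1)
      then \<Sum>i\<in>F. (-1) ^ card {j \<in> F. j < i} * \<phi> (F - {i}) else 0)\<rparr>"

text \<open>
  Reduced cochains include the empty face, so they are the cochains relative to the void complex
  \<open>{}\<close>, which has no faces at all.
\<close>

definition reduced_cohomology :: "nat set set \<Rightarrow> int \<Rightarrow> ('k::field, (nat set \<Rightarrow> 'k) set) module"
  where "reduced_cohomology K n = cohomology (rel_cochains K {}) n"


section \<open>Intervals of a finite poset\<close>

definition joined_in :: "'p::order set \<Rightarrow> 'p \<Rightarrow> 'p \<Rightarrow> bool"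
  where "joined_in S = (\<lambda>x y. x \<in> S \<and> y \<in> S \<and> (x \<le> y \<or> y \<le> x))\<^sup>*\<^sup>*"

definition poset_connected :: "'p::order set \<Rightarrow> bool"
  where "poset_connected S \<longleftrightarrow> (\<forall>x\<in>S. \<forall>y\<in>S. joined_in S x y)"

definition order_convex :: "'p::order set \<Rightarrow> bool"
  where "order_convex S \<longleftrightarrow> (\<forall>x\<in>S. \<forall>y\<in>S. \<forall>z. x \<le> z \<and> z \<le> y \<longrightarrow> z \<in> S)"

definition intervals :: "'p::order set set"
  where "intervals = {S. S \<noteq> {} \<and> poset_connected S \<and> order_convex S}"

definition pi0 :: "'p::order set \<Rightarrow> 'p set set"
  where "pi0 A = {{y \<in> A. joined_in A x y} |x. x \<in> A}"

definition relative_upset :: "'p::order set \<Rightarrow> 'p set \<Rightarrow> bool"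
  where "relative_upset C S \<longleftrightarrow> C \<subseteq> S \<and> (\<forall>c\<in>C. \<forall>x\<in>S. c \<le> x \<longrightarrow> x \<in> C)"

definition upset_intervals :: "'p::order set \<Rightarrow> 'p set set"
  where "upset_intervals S = {U \<in> intervals. relative_upset U S}"

definition maximal_proper_upsets :: "'p::order set \<Rightarrow> 'p set set"
  where "maximal_proper_upsets T = {V \<in> upset_intervals T - {T}.
    \<forall>W\<in>upset_intervals T - {T}. V \<subseteq> W \<longrightarrow> V = W}"

text \<open>The component of \<open>A\<close> containing a nonempty connected subset \<open>C\<close>.\<close>

definition component_containing :: "'p::order set \<Rightarrow> 'p set \<Rightarrow> 'p set"
  where "component_containing A C = (THE D. D \<in> pi0 A \<and> C \<subseteq> D)"


section \<open>Representations of a poset\<close>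

text \<open>
  A representation consists of vector spaces \<open>V x\<close> and structure maps \<open>V x \<rightarrow> V y\<close> for \<open>x \<le> y\<close>;
  the values of \<open>rmap\<close> at other pairs are irrelevant.
\<close>

record ('p, 'k, 'v) rep =
  rspace :: "'p \<Rightarrow> ('k, 'v) module"
  rmap :: "'p \<Rightarrow> 'p \<Rightarrow> 'v \<Rightarrow> 'v"

definition rep_hom ::
    "('p::order, 'k::field, 'v) rep \<Rightarrow> ('p, 'k, 'w) rep \<Rightarrow> ('p \<Rightarrow> 'v \<Rightarrow> 'w) set"
  where "rep_hom V W = {\<eta>. (\<forall>x. \<eta> x \<in> lmod_hom scalars (rspace V x) (rspace W x)) \<and>
    (\<forall>x y. x \<le> y \<longrightarrow> (\<forall>v\<in>carrier (rspace V x). \<eta> y (rmap V x y v) = rmap W x y (\<eta> x v)))}"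

text \<open>\<open>g\<close> followed by \<open>f\<close>, where \<open>g\<close> is a morphism with source \<open>V\<close>.\<close>

definition rep_comp ::
    "('p, 'k, 'u) rep \<Rightarrow> ('p \<Rightarrow> 'v \<Rightarrow> 'w) \<Rightarrow> ('p \<Rightarrow> 'u \<Rightarrow> 'v) \<Rightarrow> ('p \<Rightarrow> 'u \<Rightarrow> 'w)"
  where "rep_comp V f g = (\<lambda>x. compose (carrier (rspace V x)) (f x) (g x))"

text \<open>The \<open>k\<close>-algebra \<open>End(V)\<^sup>o\<^sup>p\<close>: the product of \<open>a\<close> and \<open>b\<close> is \<open>b \<circ> a\<close>.\<close>

definition End_op :: "('p::order, 'k::field, 'v) rep \<Rightarrow> ('k, 'p \<Rightarrow> 'v \<Rightarrow> 'v) module"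
  where "End_op V = \<lparr>carrier = rep_hom V V,
    monoid.mult = (\<lambda>a b. rep_comp V b a),
    one = (\<lambda>x. \<lambda>v\<in>carrier (rspace V x). v),
    zero = (\<lambda>x. \<lambda>v\<in>carrier (rspace V x). \<zero>\<^bsub>rspace V x\<^esub>),
    add = (\<lambda>a b x. \<lambda>v\<in>carrier (rspace V x). a x v \<oplus>\<^bsub>rspace V x\<^esub> b x v),
    module.smult = (\<lambda>c a x. \<lambda>v\<in>carrier (rspace V x). c \<odot>\<^bsub>rspace V x\<^esub> a x v)\<rparr>"

definition interval_rep :: "'p::order set \<Rightarrow> ('p, 'k::field, 'k) rep"
  where "interval_rep S = \<lparr>
    rspace = (\<lambda>x. \<lparr>carrier = (if x \<in> S then UNIV else {0}), monoid.mult = undefined, one = undefined,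
      zero = 0, add = (+), module.smult = (*)\<rparr>),
    rmap = (\<lambda>x y v. if x \<in> S \<and> y \<in> S then v else 0)\<rparr>"

definition G_rep :: "('p::{finite,order}, 'k::field, 'p set \<Rightarrow> 'k) rep"
  where "G_rep = \<lparr>
    rspace = (\<lambda>x. direct_sum intervals (\<lambda>S. rspace (interval_rep S) x)),
    rmap = (\<lambda>x y v. \<lambda>S\<in>intervals. rmap (interval_rep S) x y (v S))\<rparr>"

type_synonym ('p, 'k) endo = "'p \<Rightarrow> ('p set \<Rightarrow> 'k) \<Rightarrow> ('p set \<Rightarrow> 'k)"

definition Lambda_alg :: "('k::field, ('p::{finite,order}, 'k) endo) module"
  where "Lambda_alg = End_op G_rep"

text \<open>
  A morphism \<open>f\<close> from \<open>\<I>\<^sub>R\<close> to \<open>\<I>\<^sub>S\<close> viewed as an element of \<open>e\<^sub>R \<Lambda> e\<^sub>S\<close>, that is, preceded by the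
  projection from \<open>G\<close> onto \<open>\<I>\<^sub>R\<close> and followed by the inclusion of \<open>\<I>\<^sub>S\<close> into \<open>G\<close>.
\<close>

definition as_endo :: "'p::{finite,order} set \<Rightarrow> 'p set \<Rightarrow> ('p \<Rightarrow> 'k \<Rightarrow> 'k) \<Rightarrow> ('p, 'k::field) endo"
  where "as_endo R S f = (\<lambda>x. \<lambda>v\<in>carrier (rspace G_rep x).
    summand_inj intervals (\<lambda>S'. rspace (interval_rep S') x) S (f x (v R)))"

definition idem :: "'p::{finite,order} set \<Rightarrow> ('p, 'k::field) endo"
  where "idem S = as_endo S S (\<lambda>x v. v)"

definition proj :: "'p::{finite,order} set \<Rightarrow> (('p, 'k::field) endo, ('p, 'k) endo) module"
  where "proj S = (regular_module Lambda_alg)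
    \<lparr>carrier := {a \<otimes>\<^bsub>Lambda_alg\<^esub> idem S |a. a \<in> carrier Lambda_alg}\<rparr>"

definition simp_top :: "'p::{finite,order} set \<Rightarrow> (('p, 'k::field) endo, ('p, 'k) endo set) module"
  where "simp_top S = quot_module (proj S) (module_rad Lambda_alg (proj S))"

definition qh_le :: "'p set \<Rightarrow> 'p set \<Rightarrow> bool"
  where "qh_le R S \<longleftrightarrow> R = S \<or> card R > card S"

text \<open>The largest quotient with the required property is the one by the least such submodule.\<close>

definition standard :: "'p::{finite,order} set \<Rightarrow> (('p, 'k::field) endo, ('p, 'k) endo set) module"
  where "standard S = quot_module (proj S)
    (LEAST N. submodule N Lambda_alg (proj S) \<and>
      (\<forall>l c i. composition_series Lambda_alg (quot_module (proj S) N) l c \<and> i < l \<longrightarrow>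
        (\<exists>R\<in>intervals. qh_le R S \<and>
          lmod_iso Lambda_alg (subquotient (quot_module (proj S) N) (c (Suc i)) (c i))
            (simp_top R :: (('p, 'k) endo, ('p, 'k) endo set) module))))"

text \<open>The map \<open>f\<^sub>*\<close> induced by a morphism \<open>f\<close> from \<open>\<I>\<^sub>R\<close> to \<open>\<I>\<^sub>S\<close>.\<close>

definition push ::
    "'p::{finite,order} set \<Rightarrow> 'p set \<Rightarrow> ('p \<Rightarrow> 'k::field \<Rightarrow> 'k) \<Rightarrow> ('p, 'k) endo \<Rightarrow> ('p, 'k) endo"
  where "push R S f = (\<lambda>g\<in>carrier (proj R). rep_comp G_rep (as_endo R S f) g)"

definition j_map :: "'p::order set \<Rightarrow> 'p set \<Rightarrow> 'p \<Rightarrow> 'k::field \<Rightarrow> 'k"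
  where "j_map U S = (\<lambda>x. \<lambda>v\<in>carrier (rspace (interval_rep U) x). if x \<in> U then v else 0)"


section \<open>The complex \<open>Q(T)\<close> and the complex \<open>\<Gamma>(C)\<close>\<close>

text \<open>
  Throughout, \<open>U 1, \<dots>, U m\<close> enumerate the maximal elements of \<open>upset_intervals T - {T}\<close>. Since
  all of them are subsets of \<open>T\<close>, intersecting with \<open>T\<close> only matters for \<open>J = {}\<close>.
\<close>

definition U_inter :: "'p set \<Rightarrow> (nat \<Rightarrow> 'p set) \<Rightarrow> nat set \<Rightarrow> 'p set"
  where "U_inter T U J = T \<inter> (\<Inter>j\<in>J. U j)"

definition Q_index :: "'p::order set \<Rightarrow> (nat \<Rightarrow> 'p set) \<Rightarrow> nat \<Rightarrow> int \<Rightarrow> (nat set \<times> 'p set) set"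
  where "Q_index T U m q =
    {(J, D). J \<subseteq> {1..m} \<and> int (card J) = q \<and> D \<in> pi0 (U_inter T U J)}"

definition Q_obj :: "'p::{finite,order} set \<Rightarrow> (nat \<Rightarrow> 'p set) \<Rightarrow> nat \<Rightarrow> int \<Rightarrow>
    (('p, 'k::field) endo, nat set \<times> 'p set \<Rightarrow> ('p, 'k) endo) module"
  where "Q_obj T U m q = direct_sum (Q_index T U m q) (\<lambda>(J, D). proj D)"

text \<open>
  The sum runs over the summands \<open>(J, D)\<close> of the source and over \<open>i \<in> J\<close>; if
  \<open>i = j\<^sub>r\<close> in the increasing enumeration of \<open>J\<close> starting with \<open>j\<^sub>0\<close>, then \<open>r = card {j \<in> J. j < i}\<close>.
\<close>

definition Q_diff :: "'p::{finite,order} set \<Rightarrow> (nat \<Rightarrow> 'p set) \<Rightarrow> nat \<Rightarrow> int \<Rightarrow>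
    (nat set \<times> 'p set \<Rightarrow> ('p, 'k::field) endo) \<Rightarrow> (nat set \<times> 'p set \<Rightarrow> ('p, 'k) endo)"
  where "Q_diff T U m q = (\<lambda>f\<in>carrier (Q_obj T U m q).
    finsum (Q_obj T U m (q - 1)) (\<lambda>(J, D).
      finsum (Q_obj T U m (q - 1)) (\<lambda>i.
        let J' = J - {i}; D' = component_containing (U_inter T U J') D;
            y = push D D' (j_map D D') (f (J, D))
        in summand_inj (Q_index T U m (q - 1)) (\<lambda>(J, D). proj D) (J', D')
             (if even (card {j \<in> J. j < i}) then y else \<ominus>\<^bsub>proj D'\<^esub> y)) J)
      (Q_index T U m q))"

definition Q_complex :: "'p::{finite,order} set \<Rightarrow> (nat \<Rightarrow> 'p set) \<Rightarrow> nat \<Rightarrow>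
    (('p, 'k::field) endo, nat set \<times> 'p set \<Rightarrow> ('p, 'k) endo) graded_complex"
  where "Q_complex T U m = \<lparr>obj = Q_obj T U m, diff = Q_diff T U m\<rparr>"

definition I_set :: "(nat \<Rightarrow> 'p set) \<Rightarrow> nat \<Rightarrow> 'p set \<Rightarrow> nat set"
  where "I_set U m C = {i \<in> {1..m}. C \<subseteq> U i}"

definition Gamma_minus :: "'p::order set \<Rightarrow> (nat \<Rightarrow> 'p set) \<Rightarrow> nat \<Rightarrow> 'p set \<Rightarrow> nat set set"
  where "Gamma_minus T U m C =
    {J. J \<subseteq> I_set U m C \<and> C \<subset> component_containing (U_inter T U J) C}"

end

theory Submission
  imports Defs
begin

text \<open>
  A morphism \<open>\<I>\<^sub>R \<rightarrow> \<I>\<^sub>S\<close> is a scalar function on \<open>R \<inter> S\<close>, so \<open>\<Lambda>\<close> is an algebra of matrices of functions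
  with pointwise product. A homomorphism from \<open>P(D)\<close> to \<open>L(C)\<close> is determined by the image of the
  idempotent \<open>e\<^sub>D\<close>, and is zero unless \<open>D = C\<close>. Hence \<open>Hom(Q\<^sub>q(T), L(C))\<close> has one coordinate for each
  \<open>J\<close> of size \<open>q\<close> such that \<open>C\<close> is a component of \<open>U\<^sub>J\<close>, that is, for each face of the full simplex on
  \<open>I\<^sub>T(C)\<close> outside \<open>\<Gamma>(C)\<close>.

  \<open>Q(T)\<close> is a projective resolution of \<open>\<Delta>(T)\<close>. Indeed, an element of \<open>e\<^sub>R Q(T)\<close> gives, at each point
  \<open>x\<close> of \<open>R \<inter> T\<close>, a function on the subsets of \<open>{1..m}\<close>, and the differential is the alternating sum
  over faces. If that function is nonzero in positive degree, then the component \<open>E\<close> of \<open>x\<close> in \<open>R \<inter> T\<close>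
  is an upset of \<open>T\<close> different from \<open>T\<close>, so \<open>E \<subseteq> U\<^sub>i\<close> for some \<open>i\<close>, and the cone over \<open>i\<close> is a contraction.
  In degree zero the elements that are killed by the augmentation are those with no component \<open>E = T\<close>.

  Therefore \<open>Ext\<close> is the cohomology of the complex above, and since the full simplex on the nonempty
  set \<open>I\<^sub>T(C)\<close> is acyclic, the connecting map identifies it with the reduced cohomology of \<open>\<Gamma>(C)\<close>.
\<close>

section \<open>Left modules, submodules and quotients\<close>

text \<open>Two difficulties stay hidden in the outline. \<open>standard\<close> is defined through
  all composition series of a quotient, and such a condition has force only if a series exists;
  hence a length function for submodules of \<open>P(S)\<close> is constructed. Factors
  \<open>L(R)\<close> are recognised by elements that the idempotent of \<open>R\<close> does not
  kill: some idempotent detects any nonzero element because their sum is 1, and idempotence passes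
  the detection from a module to one of its composition factors. \<open>Ext\<close> is computed from
  an arbitrarily chosen resolution carried by \<open>nat \<Rightarrow> 'a\<close>, while
  \<open>Q(T)\<close> consists of families indexed by pairs \<open>(J, D)\<close>. Transport along
  an injection shows that there is something to choose, and comparison of resolutions makes the
  result independent of the choice. The components in the index set of \<open>Q(T)\<close> are the
  combinatorial nuisance. Since \<open>U_J\<close> is an upset of \<open>T\<close>, the sum of the
  interval representations of its components is the indicator representation of \<open>U_J\<close>,
  which is a subrepresentation of that of \<open>T\<close>. In these terms the differential is the
  boundary map of a simplex at each point.\<close>

lemma left_moduleI:
  fixes R (structure) and M (structure)
  assumes "ring R" and "abelian_group M"
    and "\<And>a x. \<lbrakk>a \<in> carrier R; x \<in> carrier M\<rbrakk> \<Longrightarrow> a \<odot>\<^bsub>M\<^esub> x \<in> carrier M"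
    and "\<And>a b x. \<lbrakk>a \<in> carrier R; b \<in> carrier R; x \<in> carrier M\<rbrakk> \<Longrightarrow>
      (a \<oplus>\<^bsub>R\<^esub> b) \<odot>\<^bsub>M\<^esub> x = a \<odot>\<^bsub>M\<^esub> x \<oplus>\<^bsub>M\<^esub> b \<odot>\<^bsub>M\<^esub> x"
    and "\<And>a x y. \<lbrakk>a \<in> carrier R; x \<in> carrier M; y \<in> carrier M\<rbrakk> \<Longrightarrow>
      a \<odot>\<^bsub>M\<^esub> (x \<oplus>\<^bsub>M\<^esub> y) = a \<odot>\<^bsub>M\<^esub> x \<oplus>\<^bsub>M\<^esub> a \<odot>\<^bsub>M\<^esub> y"
    and "\<And>a b x. \<lbrakk>a \<in> carrier R; b \<in> carrier R; x \<in> carrier M\<rbrakk> \<Longrightarrow>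
      (a \<otimes>\<^bsub>R\<^esub> b) \<odot>\<^bsub>M\<^esub> x = a \<odot>\<^bsub>M\<^esub> (b \<odot>\<^bsub>M\<^esub> x)"
    and "\<And>x. x \<in> carrier M \<Longrightarrow> \<one>\<^bsub>R\<^esub> \<odot>\<^bsub>M\<^esub> x = x"
  shows "left_module R M"
  using assms by (intro left_module.intro left_module_axioms.intro) auto

context left_module
begin

lemma left_module: "left_module R M" ..

lemma smult_l_null: "x \<in> carrier M \<Longrightarrow> \<zero>\<^bsub>R\<^esub> \<odot>\<^bsub>M\<^esub> x = \<zero>\<^bsub>M\<^esub>"
  by (metis M.add.r_cancel_one' R.l_zero R.zero_closed smult_closed smult_l_distr)

lemma smult_r_null: "a \<in> carrier R \<Longrightarrow> a \<odot>\<^bsub>M\<^esub> \<zero>\<^bsub>M\<^esub> = \<zero>\<^bsub>M\<^esub>"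
  by (metis M.add.r_cancel_one' M.l_zero M.zero_closed smult_closed smult_r_distr)

lemma minus_one_smult:
  assumes "x \<in> carrier M" shows "(\<ominus>\<^bsub>R\<^esub> \<one>\<^bsub>R\<^esub>) \<odot>\<^bsub>M\<^esub> x = \<ominus>\<^bsub>M\<^esub> x"
proof -
  have "(\<ominus>\<^bsub>R\<^esub> \<one>\<^bsub>R\<^esub>) \<odot>\<^bsub>M\<^esub> x \<oplus>\<^bsub>M\<^esub> x = (\<ominus>\<^bsub>R\<^esub> \<one>\<^bsub>R\<^esub> \<oplus>\<^bsub>R\<^esub> \<one>\<^bsub>R\<^esub>) \<odot>\<^bsub>M\<^esub> x"
    using assms by (simp add: smult_l_distr smult_one)
  also have "\<dots> = \<zero>\<^bsub>M\<^esub>" using assms by (simp add: R.l_neg smult_l_null)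
  finally show ?thesis using assms by (simp add: M.minus_equality smult_closed)
qed

lemma smult_minus:
  assumes "a \<in> carrier R" "x \<in> carrier M" shows "a \<odot>\<^bsub>M\<^esub> (\<ominus>\<^bsub>M\<^esub> x) = \<ominus>\<^bsub>M\<^esub> (a \<odot>\<^bsub>M\<^esub> x)"
proof -
  have "a \<odot>\<^bsub>M\<^esub> (\<ominus>\<^bsub>M\<^esub> x) \<oplus>\<^bsub>M\<^esub> a \<odot>\<^bsub>M\<^esub> x = \<zero>\<^bsub>M\<^esub>"
    using assms by (metis M.a_inv_closed M.l_neg smult_r_distr smult_r_null)
  then show ?thesis using assms by (metis M.a_inv_closed M.minus_equality smult_closed)
qed

lemma diff_eq_zero_iff:
  assumes "x \<in> carrier M" "y \<in> carrier M" shows "x \<ominus>\<^bsub>M\<^esub> y = \<zero>\<^bsub>M\<^esub> \<longleftrightarrow> x = y"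
proof
  assume "x \<ominus>\<^bsub>M\<^esub> y = \<zero>\<^bsub>M\<^esub>"
  then have "(x \<oplus>\<^bsub>M\<^esub> \<ominus>\<^bsub>M\<^esub> y) \<oplus>\<^bsub>M\<^esub> y = \<zero>\<^bsub>M\<^esub> \<oplus>\<^bsub>M\<^esub> y" by (simp add: a_minus_def)
  then show "x = y" using assms by (simp add: M.add.m_assoc M.l_neg)
qed (use assms in \<open>simp add: a_minus_def M.r_neg\<close>)

text \<open>Negatives are multiples by \<open>\<ominus> \<one>\<close>, so closure under addition
  and scalars already gives a subgroup.\<close>

lemma submoduleI:
  assumes "N \<subseteq> carrier M" "\<zero>\<^bsub>M\<^esub> \<in> N"
    and "\<And>x y. \<lbrakk>x \<in> N; y \<in> N\<rbrakk> \<Longrightarrow> x \<oplus>\<^bsub>M\<^esub> y \<in> N"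
    and "\<And>a x. \<lbrakk>a \<in> carrier R; x \<in> N\<rbrakk> \<Longrightarrow> a \<odot>\<^bsub>M\<^esub> x \<in> N"
  shows "submodule N R M"
proof -
  have neg: "\<ominus>\<^bsub>M\<^esub> x \<in> N" if "x \<in> N" for x
    using assms(4)[of "\<ominus>\<^bsub>R\<^esub> \<one>\<^bsub>R\<^esub>" x] that assms(1) minus_one_smult[of x] by auto
  show ?thesis
    apply (intro submodule.intro subgroup.intro)
    using assms neg by (auto simp: submodule_axioms_def a_inv_def)
qed

lemma submoduleD:
  assumes "submodule N R M"
  shows "N \<subseteq> carrier M" "\<zero>\<^bsub>M\<^esub> \<in> N"
    "\<And>x y. \<lbrakk>x \<in> N; y \<in> N\<rbrakk> \<Longrightarrow> x \<oplus>\<^bsub>M\<^esub> y \<in> N"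
    "\<And>a x. \<lbrakk>a \<in> carrier R; x \<in> N\<rbrakk> \<Longrightarrow> a \<odot>\<^bsub>M\<^esub> x \<in> N"
    "\<And>x. x \<in> N \<Longrightarrow> \<ominus>\<^bsub>M\<^esub> x \<in> N"
    "\<And>x y. \<lbrakk>x \<in> N; y \<in> N\<rbrakk> \<Longrightarrow> x \<ominus>\<^bsub>M\<^esub> y \<in> N"
proof -
  have 1: "subgroup N (add_monoid M)" using assms by (simp add: submodule_def)
  show a: "N \<subseteq> carrier M" "\<zero>\<^bsub>M\<^esub> \<in> N" "\<And>x y. \<lbrakk>x \<in> N; y \<in> N\<rbrakk> \<Longrightarrow> x \<oplus>\<^bsub>M\<^esub> y \<in> N"
    using subgroup.subset[OF 1] subgroup.one_closed[OF 1] subgroup.m_closed[OF 1] by auto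
  show b: "\<And>a x. \<lbrakk>a \<in> carrier R; x \<in> N\<rbrakk> \<Longrightarrow> a \<odot>\<^bsub>M\<^esub> x \<in> N"
    using submodule.smult_closed[OF assms] by auto
  show c: "\<And>x. x \<in> N \<Longrightarrow> \<ominus>\<^bsub>M\<^esub> x \<in> N"
    using a b minus_one_smult by (metis R.a_inv_closed R.one_closed subsetD)
  show "\<And>x y. \<lbrakk>x \<in> N; y \<in> N\<rbrakk> \<Longrightarrow> x \<ominus>\<^bsub>M\<^esub> y \<in> N"
    using a c by (simp add: a_minus_def)
qed

lemma carrier_submodule: "submodule (carrier M) R M"
  by (rule submoduleI) (auto intro: smult_closed)

lemma zero_submodule: "submodule {\<zero>\<^bsub>M\<^esub>} R M"
  by (rule submoduleI) (auto intro: smult_r_null)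

lemma left_module_restrict:
  assumes "submodule N R M" shows "left_module R (M\<lparr>carrier := N\<rparr>)"
proof -
  note N = submoduleD[OF assms]
  show ?thesis
  proof (rule left_moduleI)
    show "abelian_group (M\<lparr>carrier := N\<rparr>)"
      by (rule abelian_groupI)
        (use N in \<open>auto simp: M.add.m_assoc subset_iff intro: M.add.m_comm intro!: bexI[of _ "\<ominus>\<^bsub>M\<^esub> x" for x] M.l_neg\<close>)
  qed (use N in \<open>auto simp: smult_l_distr smult_r_distr smult_assoc smult_one subset_iff
      intro: R.ring_axioms\<close>)
qed

lemma submodule_restrict:
  assumes "submodule N R M" "N \<subseteq> B" "submodule B R M"
  shows "submodule N R (M\<lparr>carrier := B\<rparr>)"
proof -
  interpret B: left_module R "M\<lparr>carrier := B\<rparr>" by (rule left_module_restrict[OF assms(3)])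
  show ?thesis using submoduleD[OF assms(1)] assms(2) by (intro B.submoduleI) auto
qed

lemma coset_iff:
  assumes N: "submodule N R M" and xy: "x \<in> carrier M" "y \<in> carrier M"
  shows "N +>\<^bsub>M\<^esub> x = N +>\<^bsub>M\<^esub> y \<longleftrightarrow> x \<ominus>\<^bsub>M\<^esub> y \<in> N"
proof
  note N' = submoduleD[OF N]
  assume "N +>\<^bsub>M\<^esub> x = N +>\<^bsub>M\<^esub> y"
  moreover have "x \<in> N +>\<^bsub>M\<^esub> x" using N' xy by (force simp: a_r_coset_def')
  ultimately obtain n where "n \<in> N" "x = n \<oplus>\<^bsub>M\<^esub> y" by (auto simp: a_r_coset_def')
  then show "x \<ominus>\<^bsub>M\<^esub> y \<in> N"
    using N'(1) xy by (simp add: a_minus_def M.add.m_assoc M.r_neg subset_iff)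
next
  note N' = submoduleD[OF N]
  assume "x \<ominus>\<^bsub>M\<^esub> y \<in> N"
  moreover have "x = (x \<ominus>\<^bsub>M\<^esub> y) \<oplus>\<^bsub>M\<^esub> y"
    using xy by (simp add: a_minus_def M.add.m_assoc M.l_neg)
  ultimately have "x \<in> N +>\<^bsub>M\<^esub> y" by (auto simp: a_r_coset_def')
  then show "N +>\<^bsub>M\<^esub> x = N +>\<^bsub>M\<^esub> y"
    using M.a_repr_independence[of x N y] xy N by (simp add: submodule_def)
qed

lemma coset_self: "submodule N R M \<Longrightarrow> x \<in> carrier M \<Longrightarrow> x \<in> N +>\<^bsub>M\<^esub> x"
  using submoduleD(2)[of N] by (force simp: a_r_coset_def')

lemma coset_zero: "submodule N R M \<Longrightarrow> N +>\<^bsub>M\<^esub> \<zero>\<^bsub>M\<^esub> = N"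
  using submoduleD(1)[of N] by simp

lemma coset_eq_zero_iff:
  assumes "submodule N R M" "x \<in> carrier M"
  shows "N +>\<^bsub>M\<^esub> x = N \<longleftrightarrow> x \<in> N"
  using M.a_coset_join1[of N x] M.a_coset_join2[of x N] assms by (auto simp: submodule_def)

lemma carrier_quot: "carrier (quot_module M N) = (\<lambda>x. N +>\<^bsub>M\<^esub> x) ` carrier M"
  by (auto simp: quot_module_def A_RCOSETS_def')

lemma zero_quot: "\<zero>\<^bsub>quot_module M N\<^esub> = N"
  by (simp add: quot_module_def)

lemma add_quot:
  assumes "submodule N R M" "x \<in> carrier M" "y \<in> carrier M"
  shows "(N +>\<^bsub>M\<^esub> x) \<oplus>\<^bsub>quot_module M N\<^esub> (N +>\<^bsub>M\<^esub> y) = N +>\<^bsub>M\<^esub> (x \<oplus>\<^bsub>M\<^esub> y)"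
proof -
  interpret abelian_subgroup N M
    by (rule abelian_subgroupI3) (use assms in \<open>auto intro: additive_subgroupI
      simp: submodule_def M.abelian_group_axioms\<close>)
  show ?thesis using assms by (simp add: quot_module_def a_rcos_sum)
qed

text \<open>In \<open>quot_module\<close> a scalar acts on a coset through a union over all its
  elements. The union collapses because representatives differ by elements of \<open>N\<close>,
  whose multiples stay in \<open>N\<close>, and because a coset is never empty.\<close>

lemma smult_quot:
  assumes N: "submodule N R M" and a: "a \<in> carrier R" and x: "x \<in> carrier M"
  shows "a \<odot>\<^bsub>quot_module M N\<^esub> (N +>\<^bsub>M\<^esub> x) = N +>\<^bsub>M\<^esub> (a \<odot>\<^bsub>M\<^esub> x)"
proof -
  note N' = submoduleD[OF N]
  have eq: "N +>\<^bsub>M\<^esub> (a \<odot>\<^bsub>M\<^esub> y) = N +>\<^bsub>M\<^esub> (a \<odot>\<^bsub>M\<^esub> x)" if y: "y \<in> N +>\<^bsub>M\<^esub> x" for y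
  proof -
    obtain n where n: "n \<in> N" "y = n \<oplus>\<^bsub>M\<^esub> x" using y by (auto simp: a_r_coset_def')
    have nc: "n \<in> carrier M" using n N' by auto
    have "a \<odot>\<^bsub>M\<^esub> y \<ominus>\<^bsub>M\<^esub> a \<odot>\<^bsub>M\<^esub> x = a \<odot>\<^bsub>M\<^esub> n"
      using n nc a x by (simp add: smult_r_distr a_minus_def M.add.m_assoc M.r_neg smult_closed)
    then show ?thesis
      using n nc a x N' by (subst coset_iff[OF N]) (auto simp: smult_closed)
  qed
  have "a \<odot>\<^bsub>quot_module M N\<^esub> (N +>\<^bsub>M\<^esub> x) = (\<Union>y\<in>N +>\<^bsub>M\<^esub> x. N +>\<^bsub>M\<^esub> (a \<odot>\<^bsub>M\<^esub> y))"
    by (simp add: quot_module_def)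
  also have "\<dots> = N +>\<^bsub>M\<^esub> (a \<odot>\<^bsub>M\<^esub> x)"
    using eq coset_self[OF N x] by blast
  finally show ?thesis .
qed

end

section \<open>Homomorphisms, kernels and images\<close>

lemma lmod_homI:
  assumes "\<And>x. x \<in> carrier M \<Longrightarrow> f x \<in> carrier N"
    and "\<And>x y. \<lbrakk>x \<in> carrier M; y \<in> carrier M\<rbrakk> \<Longrightarrow> f (x \<oplus>\<^bsub>M\<^esub> y) = f x \<oplus>\<^bsub>N\<^esub> f y"
    and "\<And>a x. \<lbrakk>a \<in> carrier R; x \<in> carrier M\<rbrakk> \<Longrightarrow> f (a \<odot>\<^bsub>M\<^esub> x) = a \<odot>\<^bsub>N\<^esub> f x"
    and "left_module R M"
  shows "restrict f (carrier M) \<in> lmod_hom R M N"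
proof -
  interpret left_module R M by fact
  show ?thesis using assms by (auto simp: lmod_hom_def smult_closed)
qed

lemma lmod_homD:
  assumes "f \<in> lmod_hom R M N"
  shows "x \<in> carrier M \<Longrightarrow> f x \<in> carrier N"
    and "\<lbrakk>x \<in> carrier M; y \<in> carrier M\<rbrakk> \<Longrightarrow> f (x \<oplus>\<^bsub>M\<^esub> y) = f x \<oplus>\<^bsub>N\<^esub> f y"
    and "\<lbrakk>a \<in> carrier R; x \<in> carrier M\<rbrakk> \<Longrightarrow> f (a \<odot>\<^bsub>M\<^esub> x) = a \<odot>\<^bsub>N\<^esub> f x"
    and "f \<in> extensional (carrier M)"
  using assms by (auto simp: lmod_hom_def PiE_def)

lemma lmod_hom_eqI:
  assumes "f \<in> lmod_hom R M N" "g \<in> lmod_hom R M N" "\<And>x. x \<in> carrier M \<Longrightarrow> f x = g x"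
  shows "f = g"
  using assms lmod_homD(4) by (metis extensionalityI)

lemma lmod_hom_zero:
  assumes "left_module R M" "left_module R N" "f \<in> lmod_hom R M N"
  shows "f \<zero>\<^bsub>M\<^esub> = \<zero>\<^bsub>N\<^esub>"
proof -
  interpret M: left_module R M by fact
  interpret N: left_module R N by fact
  have "f \<zero>\<^bsub>M\<^esub> \<oplus>\<^bsub>N\<^esub> f \<zero>\<^bsub>M\<^esub> = f \<zero>\<^bsub>M\<^esub>"
    using lmod_homD(2)[OF assms(3), of "\<zero>\<^bsub>M\<^esub>" "\<zero>\<^bsub>M\<^esub>"] by simp
  then show ?thesis
    using lmod_homD(1)[OF assms(3) M.M.zero_closed]
      N.M.add.r_cancel_one'[of "f \<zero>\<^bsub>M\<^esub>" "f \<zero>\<^bsub>M\<^esub>"] by auto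
qed

lemma lmod_hom_minus:
  assumes "left_module R M" "left_module R N" "f \<in> lmod_hom R M N" "x \<in> carrier M" "y \<in> carrier M"
  shows "f (\<ominus>\<^bsub>M\<^esub> x) = \<ominus>\<^bsub>N\<^esub> f x" "f (x \<ominus>\<^bsub>M\<^esub> y) = f x \<ominus>\<^bsub>N\<^esub> f y"
proof -
  interpret M: left_module R M by fact
  interpret N: left_module R N by fact
  note f = lmod_homD[OF assms(3)]
  have n: "f (\<ominus>\<^bsub>M\<^esub> x) = \<ominus>\<^bsub>N\<^esub> f x" if "x \<in> carrier M" for x
    using f(3)[of "\<ominus>\<^bsub>R\<^esub> \<one>\<^bsub>R\<^esub>" x] f(1)[of x] that M.minus_one_smult[of x] N.minus_one_smult[of "f x"]
    by simp
  then show "f (\<ominus>\<^bsub>M\<^esub> x) = \<ominus>\<^bsub>N\<^esub> f x" using assms by blast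
  show "f (x \<ominus>\<^bsub>M\<^esub> y) = f x \<ominus>\<^bsub>N\<^esub> f y" using n f assms by (simp add: a_minus_def)
qed

lemma lmod_hom_comp:
  assumes "f \<in> lmod_hom R M N" "g \<in> lmod_hom R N L" "left_module R M"
  shows "(\<lambda>x\<in>carrier M. g (f x)) \<in> lmod_hom R M L"
  using lmod_homD[OF assms(1)] lmod_homD[OF assms(2)] by (intro lmod_homI assms(3)) auto

lemma lmod_hom_add:
  assumes "f \<in> lmod_hom R M N" "g \<in> lmod_hom R M N" "left_module R M" "left_module R N"
  shows "(\<lambda>x\<in>carrier M. f x \<oplus>\<^bsub>N\<^esub> g x) \<in> lmod_hom R M N"
proof -
  interpret N: left_module R N by fact
  show ?thesis
    using lmod_homD(1-3)[OF assms(1)] lmod_homD(1-3)[OF assms(2)]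
    by (intro lmod_homI assms(3)) (simp_all add: N.smult_r_distr N.M.add.m_ac)
qed

lemma lmod_hom_diff:
  assumes "f \<in> lmod_hom R M N" "g \<in> lmod_hom R M N" "left_module R M" "left_module R N"
  shows "(\<lambda>x\<in>carrier M. f x \<ominus>\<^bsub>N\<^esub> g x) \<in> lmod_hom R M N"
proof -
  interpret N: left_module R N by fact
  show ?thesis
    using lmod_homD(1-3)[OF assms(1)] lmod_homD(1-3)[OF assms(2)]
    by (intro lmod_homI assms(3))
      (simp_all add: a_minus_def N.smult_r_distr N.smult_minus N.M.minus_add N.M.add.m_ac N.smult_closed)
qed

lemma lmod_hom_id:
  assumes "left_module R M" shows "(\<lambda>x\<in>carrier M. x) \<in> lmod_hom R M M"
  using assms by (intro lmod_homI) auto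

lemma kernel_submodule:
  assumes "left_module R M" "left_module R N" "f \<in> lmod_hom R M N"
  shows "submodule {x \<in> carrier M. f x = \<zero>\<^bsub>N\<^esub>} R M"
proof -
  interpret M: left_module R M by fact
  interpret N: left_module R N by fact
  show ?thesis
    using lmod_homD[OF assms(3)] lmod_hom_zero[OF assms]
    by (intro M.submoduleI) (auto simp: M.smult_closed N.smult_r_null)
qed

lemma image_submodule:
  assumes "left_module R M" "left_module R N" "f \<in> lmod_hom R M N" "submodule L R M"
  shows "submodule (f ` L) R N"
proof -
  interpret M: left_module R M by fact
  interpret N: left_module R N by fact
  note L = M.submoduleD[OF assms(4)]
  note f = lmod_homD[OF assms(3)]
  show ?thesis
  proof (rule N.submoduleI)
    show "f ` L \<subseteq> carrier N" using f L by auto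
    show "\<zero>\<^bsub>N\<^esub> \<in> f ` L" using lmod_hom_zero[OF assms(1-3)] L by force
    show "x \<oplus>\<^bsub>N\<^esub> y \<in> f ` L" if "x \<in> f ` L" "y \<in> f ` L" for x y
    proof -
      obtain u v where "u \<in> L" "v \<in> L" "x = f u" "y = f v" using \<open>x \<in> f ` L\<close> \<open>y \<in> f ` L\<close> by auto
      then have "x \<oplus>\<^bsub>N\<^esub> y = f (u \<oplus>\<^bsub>M\<^esub> v)" using f(2)[of u v] L(1) by (simp add: subset_iff)
      then show ?thesis using L \<open>u \<in> L\<close> \<open>v \<in> L\<close> by auto
    qed
    show "a \<odot>\<^bsub>N\<^esub> x \<in> f ` L" if a: "a \<in> carrier R" and x: "x \<in> f ` L" for a x
    proof -
      obtain u where "u \<in> L" "x = f u" using x by auto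
      then have "a \<odot>\<^bsub>N\<^esub> x = f (a \<odot>\<^bsub>M\<^esub> u)" using f(3)[of a u] L(1) a by (simp add: subset_iff)
      then show ?thesis using L a \<open>u \<in> L\<close> by auto
    qed
  qed
qed

lemma vimage_submodule:
  assumes "left_module R M" "left_module R N" "f \<in> lmod_hom R M N" "submodule L R N"
  shows "submodule {x \<in> carrier M. f x \<in> L} R M"
proof -
  interpret M: left_module R M by fact
  interpret N: left_module R N by fact
  show ?thesis
    using lmod_homD[OF assms(3)] lmod_hom_zero[OF assms(1-3)] N.submoduleD[OF assms(4)]
    by (intro M.submoduleI) (auto simp: M.smult_closed)
qed

text \<open>The axioms pass to any record \<open>N\<close> that is the image of a module under a map
  compatible with the operations; nothing has to be known about \<open>N\<close> beforehand. This
  serves both quotients and transported modules.\<close>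

lemma left_module_image:
  assumes M: "left_module R M"
    and p: "p ` carrier M = carrier N" "p \<zero>\<^bsub>M\<^esub> = \<zero>\<^bsub>N\<^esub>"
    and add: "\<And>x y. \<lbrakk>x \<in> carrier M; y \<in> carrier M\<rbrakk> \<Longrightarrow> p x \<oplus>\<^bsub>N\<^esub> p y = p (x \<oplus>\<^bsub>M\<^esub> y)"
    and smult: "\<And>a x. \<lbrakk>a \<in> carrier R; x \<in> carrier M\<rbrakk> \<Longrightarrow> a \<odot>\<^bsub>N\<^esub> p x = p (a \<odot>\<^bsub>M\<^esub> x)"
  shows "left_module R N"
proof -
  interpret M: left_module R M by fact
  have N: "\<exists>u\<in>carrier M. x = p u" if "x \<in> carrier N" for x using p(1) that by auto
  have pc: "p x \<in> carrier N" if "x \<in> carrier M" for x using p(1) that by auto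
  show ?thesis
  proof (rule left_moduleI)
    show "abelian_group N"
    proof (rule abelian_groupI)
      show "\<zero>\<^bsub>N\<^esub> \<in> carrier N" using p by force
      fix x assume "x \<in> carrier N"
      then obtain u where u: "u \<in> carrier M" "x = p u" using N by blast
      show "\<zero>\<^bsub>N\<^esub> \<oplus>\<^bsub>N\<^esub> x = x" using u add[of "\<zero>\<^bsub>M\<^esub>" u] p by simp
      show "\<exists>y\<in>carrier N. y \<oplus>\<^bsub>N\<^esub> x = \<zero>\<^bsub>N\<^esub>"
        using u add[of "\<ominus>\<^bsub>M\<^esub> u" u] p by (intro bexI[of _ "p (\<ominus>\<^bsub>M\<^esub> u)"]) (auto simp: M.M.l_neg pc)
      fix y assume "y \<in> carrier N"
      then obtain v where v: "v \<in> carrier M" "y = p v" using N by blast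
      show "x \<oplus>\<^bsub>N\<^esub> y \<in> carrier N" using u v by (simp add: add pc)
      show "x \<oplus>\<^bsub>N\<^esub> y = y \<oplus>\<^bsub>N\<^esub> x" using u v by (simp add: add M.M.add.m_comm)
      fix z assume "z \<in> carrier N"
      then obtain w where w: "w \<in> carrier M" "z = p w" using N by blast
      show "x \<oplus>\<^bsub>N\<^esub> y \<oplus>\<^bsub>N\<^esub> z = x \<oplus>\<^bsub>N\<^esub> (y \<oplus>\<^bsub>N\<^esub> z)" using u v w by (simp add: add M.M.add.m_assoc)
    qed
    fix a x assume a: "a \<in> carrier R" and "x \<in> carrier N"
    then obtain u where u: "u \<in> carrier M" "x = p u" using N by blast
    show "a \<odot>\<^bsub>N\<^esub> x \<in> carrier N" using a u by (simp add: smult pc M.smult_closed)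
    show "\<And>b. b \<in> carrier R \<Longrightarrow> (a \<oplus>\<^bsub>R\<^esub> b) \<odot>\<^bsub>N\<^esub> x = a \<odot>\<^bsub>N\<^esub> x \<oplus>\<^bsub>N\<^esub> b \<odot>\<^bsub>N\<^esub> x"
      using a u by (simp add: smult add M.smult_closed M.smult_l_distr)
    show "\<And>b. b \<in> carrier R \<Longrightarrow> (a \<otimes>\<^bsub>R\<^esub> b) \<odot>\<^bsub>N\<^esub> x = a \<odot>\<^bsub>N\<^esub> (b \<odot>\<^bsub>N\<^esub> x)"
      using a u by (simp add: smult add M.smult_closed M.smult_assoc)
    fix y assume "y \<in> carrier N"
    then obtain v where v: "v \<in> carrier M" "y = p v" using N by blast
    show "a \<odot>\<^bsub>N\<^esub> (x \<oplus>\<^bsub>N\<^esub> y) = a \<odot>\<^bsub>N\<^esub> x \<oplus>\<^bsub>N\<^esub> a \<odot>\<^bsub>N\<^esub> y"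
      using a u v by (simp add: smult add M.smult_closed M.smult_r_distr)
  next
    fix x assume "x \<in> carrier N"
    then obtain u where u: "u \<in> carrier M" "x = p u" using N by blast
    show "\<one>\<^bsub>R\<^esub> \<odot>\<^bsub>N\<^esub> x = x" using u by (simp add: smult M.smult_one)
  qed (rule M.R.ring_axioms)
qed

lemma left_module_quot:
  assumes "left_module R M" "submodule N R M" shows "left_module R (quot_module M N)"
proof -
  interpret left_module R M by fact
  show ?thesis
    by (rule left_module_image[of R M "\<lambda>x. N +>\<^bsub>M\<^esub> x"])
      (use assms in \<open>simp_all add: carrier_quot zero_quot add_quot smult_quot coset_zero\<close>)
qed

lemma quot_map_hom:
  assumes "left_module R M" "submodule N R M"
  shows "(\<lambda>x\<in>carrier M. N +>\<^bsub>M\<^esub> x) \<in> lmod_hom R M (quot_module M N)"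
proof -
  interpret left_module R M by fact
  show ?thesis using assms
    by (intro lmod_homI) (auto simp: carrier_quot add_quot smult_quot)
qed

lemma left_module_subquotient:
  assumes "left_module R M" "submodule A R M" "submodule B R M" "A \<subseteq> B"
  shows "left_module R (subquotient M B A)"
proof -
  interpret left_module R M by fact
  show ?thesis unfolding subquotient_def
    by (intro left_module_quot left_module_restrict submodule_restrict assms)
qed

section \<open>Isomorphism criteria for quotients and subquotients\<close>

lemma lmod_iso_trans:
  assumes "lmod_iso R M N" "lmod_iso R N L" "left_module R M"
  shows "lmod_iso R M L"
proof -
  obtain f g where f: "f \<in> lmod_hom R M N" "bij_betw f (carrier M) (carrier N)"
    and g: "g \<in> lmod_hom R N L" "bij_betw g (carrier N) (carrier L)"
    using assms by (auto simp: lmod_iso_def)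
  have "bij_betw (\<lambda>x\<in>carrier M. g (f x)) (carrier M) (carrier L)"
    using bij_betw_trans[OF f(2) g(2)] by (rule bij_betw_cong[THEN iffD1, rotated]) simp
  then show ?thesis using lmod_hom_comp[OF f(1) g(1) assms(3)] unfolding lmod_iso_def by blast
qed

lemma lmod_iso_sym:
  assumes "lmod_iso R M N" "left_module R M" "left_module R N"
  shows "lmod_iso R N M"
proof -
  interpret M: left_module R M by fact
  interpret N: left_module R N by fact
  obtain f where f: "f \<in> lmod_hom R M N" "bij_betw f (carrier M) (carrier N)"
    using assms by (auto simp: lmod_iso_def)
  let ?g = "inv_into (carrier M) f"
  note fD = lmod_homD[OF f(1)]
  have g: "?g y \<in> carrier M" "f (?g y) = y" if "y \<in> carrier N" for y
    using f(2) that by (auto simp: bij_betw_def inv_into_into f_inv_into_f)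
  have gf: "?g (f x) = x" if "x \<in> carrier M" for x
    using f(2) that by (auto simp: bij_betw_def)
  have "restrict ?g (carrier N) \<in> lmod_hom R N M"
  proof (rule lmod_homI)
    show "?g (x \<oplus>\<^bsub>N\<^esub> y) = ?g x \<oplus>\<^bsub>M\<^esub> ?g y" if "x \<in> carrier N" "y \<in> carrier N" for x y
      using gf[of "?g x \<oplus>\<^bsub>M\<^esub> ?g y"] g \<open>x \<in> carrier N\<close> \<open>y \<in> carrier N\<close> fD by simp
    show "?g (a \<odot>\<^bsub>N\<^esub> x) = a \<odot>\<^bsub>M\<^esub> ?g x" if "a \<in> carrier R" "x \<in> carrier N" for a x
      using gf[of "a \<odot>\<^bsub>M\<^esub> ?g x"] g \<open>x \<in> carrier N\<close> \<open>a \<in> carrier R\<close> fD M.smult_closed by simp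
  qed (use g assms in auto)
  moreover have "bij_betw (restrict ?g (carrier N)) (carrier N) (carrier M)"
    using bij_betw_inv_into[OF f(2)] by (rule bij_betw_cong[THEN iffD1, rotated]) simp
  ultimately show ?thesis unfolding lmod_iso_def by blast
qed

text \<open>Both \<open>N\<close> and \<open>L\<close> are quotients of \<open>M\<close> by the same
  kernel. The isomorphism sends \<open>y\<close> to the value of \<open>q\<close> at any preimage of
  \<open>y\<close> under \<open>p\<close>; equality of the kernels makes the choice
  irrelevant.\<close>

lemma lmod_iso_same_kernel:
  assumes M: "left_module R M" "left_module R N" "left_module R L"
    and p: "p \<in> lmod_hom R M N" "p ` carrier M = carrier N"
    and q: "q \<in> lmod_hom R M L" "q ` carrier M = carrier L"
    and ker: "\<And>x. x \<in> carrier M \<Longrightarrow> p x = \<zero>\<^bsub>N\<^esub> \<longleftrightarrow> q x = \<zero>\<^bsub>L\<^esub>"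
  shows "lmod_iso R N L"
proof -
  interpret M: left_module R M by fact
  interpret N: left_module R N by fact
  interpret L: left_module R L by fact
  have eq: "p x = p y \<longleftrightarrow> q x = q y" if xy: "x \<in> carrier M" "y \<in> carrier M" for x y
  proof -
    have "p x = p y \<longleftrightarrow> p (x \<ominus>\<^bsub>M\<^esub> y) = \<zero>\<^bsub>N\<^esub>"
      using lmod_hom_minus(2)[OF M(1,2) p(1) xy] lmod_homD(1)[OF p(1)] xy
      by (metis N.diff_eq_zero_iff)
    moreover have "q x = q y \<longleftrightarrow> q (x \<ominus>\<^bsub>M\<^esub> y) = \<zero>\<^bsub>L\<^esub>"
      using lmod_hom_minus(2)[OF M(1,3) q(1) xy] lmod_homD(1)[OF q(1)] xy
      by (metis L.diff_eq_zero_iff)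
    ultimately show ?thesis using ker[of "x \<ominus>\<^bsub>M\<^esub> y"] xy by simp
  qed
  define s where "s = inv_into (carrier M) p"
  have s: "s y \<in> carrier M" "p (s y) = y" if "y \<in> carrier N" for y
    using that p(2) by (auto simp: s_def inv_into_into f_inv_into_f)
  have qs: "q (s (p x)) = q x" if "x \<in> carrier M" for x
    using eq[of "s (p x)" x] s lmod_homD(1)[OF p(1)] that by auto
  have hom: "(\<lambda>y\<in>carrier N. q (s y)) \<in> lmod_hom R N L"
  proof (rule lmod_homI)
    show "q (s (x \<oplus>\<^bsub>N\<^esub> y)) = q (s x) \<oplus>\<^bsub>L\<^esub> q (s y)" if "x \<in> carrier N" "y \<in> carrier N" for x y
      using qs[of "s x \<oplus>\<^bsub>M\<^esub> s y"] s \<open>x \<in> carrier N\<close> \<open>y \<in> carrier N\<close> lmod_homD[OF p(1)] lmod_homD[OF q(1)]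
      by simp
    show "q (s (a \<odot>\<^bsub>N\<^esub> x)) = a \<odot>\<^bsub>L\<^esub> q (s x)" if "a \<in> carrier R" "x \<in> carrier N" for a x
      using qs[of "a \<odot>\<^bsub>M\<^esub> s x"] s \<open>x \<in> carrier N\<close> \<open>a \<in> carrier R\<close> lmod_homD[OF p(1)] lmod_homD[OF q(1)]
        M.smult_closed by simp
  qed (use s lmod_homD(1)[OF q(1)] assms in auto)
  have "bij_betw (\<lambda>y\<in>carrier N. q (s y)) (carrier N) (carrier L)"
  proof (rule bij_betw_imageI)
    show "inj_on (\<lambda>y\<in>carrier N. q (s y)) (carrier N)"
    proof (rule inj_onI)
      fix x y assume *: "x \<in> carrier N" "y \<in> carrier N"
        "(\<lambda>y\<in>carrier N. q (s y)) x = (\<lambda>y\<in>carrier N. q (s y)) y"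
      then have "p (s x) = p (s y)" using eq[of "s x" "s y"] s by simp
      then show "x = y" using s * by simp
    qed
    have "q x \<in> (\<lambda>y\<in>carrier N. q (s y)) ` carrier N" if "x \<in> carrier M" for x
      using qs[OF that] lmod_homD(1)[OF p(1) that] by (intro image_eqI[of _ _ "p x"]) simp_all
    then have "carrier L \<subseteq> (\<lambda>y\<in>carrier N. q (s y)) ` carrier N"
      unfolding q(2)[symmetric] by (rule image_subsetI)
    moreover have "(\<lambda>y\<in>carrier N. q (s y)) ` carrier N \<subseteq> carrier L"
      by (rule image_subsetI, rule lmod_homD(1)[OF hom])
    ultimately show "(\<lambda>y\<in>carrier N. q (s y)) ` carrier N = carrier L" by (rule equalityI[rotated])
  qed
  with hom show ?thesis unfolding lmod_iso_def by blast
qed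

text \<open>Surjectivity is required modulo \<open>B\<close>, the form in which it arises in
  cohomology: a cocycle is hit up to a coboundary.\<close>

lemma lmod_iso_quot:
  assumes M: "left_module R M" "left_module R N" and A: "submodule A R M" "submodule B R N"
    and f: "f \<in> lmod_hom R M N"
    and ker: "\<And>x. x \<in> carrier M \<Longrightarrow> f x \<in> B \<longleftrightarrow> x \<in> A"
    and surj: "\<And>y. y \<in> carrier N \<Longrightarrow> \<exists>x\<in>carrier M. y \<ominus>\<^bsub>N\<^esub> f x \<in> B"
  shows "lmod_iso R (quot_module M A) (quot_module N B)"
proof -
  interpret M: left_module R M by fact
  interpret N: left_module R N by fact
  let ?p = "\<lambda>x\<in>carrier M. A +>\<^bsub>M\<^esub> x" and ?q = "\<lambda>x\<in>carrier N. B +>\<^bsub>N\<^esub> x"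
  let ?r = "\<lambda>x\<in>carrier M. ?q (f x)"
  have r: "?r \<in> lmod_hom R M (quot_module N B)"
    by (rule lmod_hom_comp[OF f quot_map_hom[OF M(2) A(2)] M(1)])
  show ?thesis
  proof (rule lmod_iso_same_kernel[OF M(1) left_module_quot left_module_quot quot_map_hom])
    show "(\<lambda>x\<in>carrier M. A +>\<^bsub>M\<^esub> x) ` carrier M = carrier (quot_module M A)"
      by (auto simp: M.carrier_quot)
    have "\<exists>x\<in>carrier M. Y = ?r x" if Y: "Y \<in> carrier (quot_module N B)" for Y
    proof -
      obtain y where y: "y \<in> carrier N" "Y = B +>\<^bsub>N\<^esub> y" using Y by (auto simp: N.carrier_quot)
      obtain x where x: "x \<in> carrier M" "y \<ominus>\<^bsub>N\<^esub> f x \<in> B" using surj[OF y(1)] by auto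
      then have "Y = B +>\<^bsub>N\<^esub> f x" using y lmod_homD(1)[OF f] N.coset_iff[OF A(2)] by auto
      then show ?thesis using x lmod_homD(1)[OF f] by auto
    qed
    then show "?r ` carrier M = carrier (quot_module N B)"
      using lmod_homD(1)[OF r] by blast
    show "?p x = \<zero>\<^bsub>quot_module M A\<^esub> \<longleftrightarrow> ?r x = \<zero>\<^bsub>quot_module N B\<^esub>" if x: "x \<in> carrier M" for x
      using x lmod_homD(1)[OF f x] ker[OF x]
      by (simp add: M.zero_quot N.zero_quot M.coset_eq_zero_iff[OF A(1)] N.coset_eq_zero_iff[OF A(2)])
  qed (use assms r in auto)
qed

text \<open>Cohomology is a subquotient of a module of cochains, and \<open>f\<close> is a map on
  the level of cochains that has to respect the operations on \<open>B\<close>. Independence of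
  \<open>Ext\<close> from the resolution, the connecting map of a pair and the invariance of
  cohomology under isomorphism of complexes are all instances.\<close>

lemma lmod_iso_subquotient:
  assumes M: "left_module R M" "left_module R M'"
    and A: "submodule A R M" "submodule B R M" "A \<subseteq> B"
    and A': "submodule A' R M'" "submodule B' R M'" "A' \<subseteq> B'"
    and f: "\<And>x. x \<in> B \<Longrightarrow> f x \<in> B'"
      "\<And>x y. \<lbrakk>x \<in> B; y \<in> B\<rbrakk> \<Longrightarrow> f (x \<oplus>\<^bsub>M\<^esub> y) = f x \<oplus>\<^bsub>M'\<^esub> f y"
      "\<And>a x. \<lbrakk>a \<in> carrier R; x \<in> B\<rbrakk> \<Longrightarrow> f (a \<odot>\<^bsub>M\<^esub> x) = a \<odot>\<^bsub>M'\<^esub> f x"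
    and ker: "\<And>x. x \<in> B \<Longrightarrow> f x \<in> A' \<longleftrightarrow> x \<in> A"
    and surj: "\<And>y. y \<in> B' \<Longrightarrow> \<exists>x\<in>B. \<exists>a\<in>A'. y = a \<oplus>\<^bsub>M'\<^esub> f x"
  shows "lmod_iso R (subquotient M B A) (subquotient M' B' A')"
proof -
  interpret M: left_module R M by fact
  interpret M': left_module R M' by fact
  let ?M = "M\<lparr>carrier := B\<rparr>" and ?M' = "M'\<lparr>carrier := B'\<rparr>"
  interpret B: left_module R ?M by (rule M.left_module_restrict) fact
  interpret B': left_module R ?M' by (rule M'.left_module_restrict) fact
  have h: "restrict f (carrier ?M) \<in> lmod_hom R ?M ?M'"
    by (rule lmod_homI) (use f B.left_module in auto)
  have sA': "submodule A' R ?M'" by (intro M'.submodule_restrict A')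
  show ?thesis unfolding subquotient_def
  proof (rule lmod_iso_quot[OF B.left_module B'.left_module _ sA' h])
    show "submodule A R ?M" by (intro M.submodule_restrict A)
    show "\<exists>x\<in>carrier ?M. y \<ominus>\<^bsub>?M'\<^esub> restrict f (carrier ?M) x \<in> A'" if "y \<in> carrier ?M'" for y
    proof -
      have yB: "y \<in> B'" using that by simp
      obtain x a where xa: "x \<in> B" "a \<in> A'" "y = a \<oplus>\<^bsub>M'\<^esub> f x" using surj[OF yB] by blast
      have fx: "f x \<in> carrier ?M'" "a \<in> carrier ?M'" using f xa A' by auto
      have "y \<ominus>\<^bsub>?M'\<^esub> f x = (a \<oplus>\<^bsub>?M'\<^esub> f x) \<ominus>\<^bsub>?M'\<^esub> f x" using xa by simp
      also have "\<dots> = a" using fx by (simp only: a_minus_def B'.M.add.m_assoc B'.M.r_neg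
        B'.M.a_inv_closed B'.M.r_zero)
      finally show ?thesis using xa by (intro bexI[of _ x]) auto
    qed
  qed (use ker in simp)
qed


section \<open>Direct sums and projective modules\<close>

lemma lmod_hom_finsum:
  assumes "left_module R M" "left_module R N" "f \<in> lmod_hom R M N" "g \<in> A \<rightarrow> carrier M"
  shows "f (finsum M g A) = finsum N (\<lambda>a. f (g a)) A"
proof -
  interpret M: left_module R M by fact
  interpret N: left_module R N by fact
  note f = lmod_homD[OF assms(3)]
  show ?thesis using assms(4)
  proof (induction A rule: infinite_finite_induct)
    case (insert a A)
    then have "f (finsum M g A) = finsum N (\<lambda>a. f (g a)) A" and g: "g \<in> A \<rightarrow> carrier M" "g a \<in> carrier M"
      by auto
    moreover have "finsum M g A \<in> carrier M" using g by (intro M.M.finsum_closed)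
    moreover have "(\<lambda>a. f (g a)) \<in> A \<rightarrow> carrier N" using g(1) f(1) by blast
    ultimately show ?case using insert.hyps f by simp
  qed (use lmod_hom_zero[OF assms(1-3)] in \<open>simp_all\<close>)
qed

lemma direct_sum_mem: "f \<in> carrier (direct_sum I M) \<Longrightarrow> i \<in> I \<Longrightarrow> f i \<in> carrier (M i)"
  by (auto simp: direct_sum_def)

lemma direct_sum_extensional: "f \<in> carrier (direct_sum I M) \<Longrightarrow> f \<in> extensional I"
  by (auto simp: direct_sum_def PiE_def)

lemma direct_sum_memI:
  "(\<And>i. i \<in> I \<Longrightarrow> f i \<in> carrier (M i)) \<Longrightarrow> restrict f I \<in> carrier (direct_sum I M)"
  by (auto simp: direct_sum_def)

lemma direct_sum_apply:
  assumes "i \<in> I"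
  shows "(f \<oplus>\<^bsub>direct_sum I M\<^esub> g) i = f i \<oplus>\<^bsub>M i\<^esub> g i" "(a \<odot>\<^bsub>direct_sum I M\<^esub> f) i = a \<odot>\<^bsub>M i\<^esub> f i"
    "\<zero>\<^bsub>direct_sum I M\<^esub> i = \<zero>\<^bsub>M i\<^esub>"
  using assms by (simp_all add: direct_sum_def)

lemma left_module_direct_sum:
  assumes "ring R" and "\<And>i. i \<in> I \<Longrightarrow> left_module R (M i)"
  shows "left_module R (direct_sum I M)"
proof -
  have ag: "abelian_group (M i)" if "i \<in> I" for i
    using assms(2)[OF that] by (simp add: left_module_def)
  note G = abelian_groupE[OF ag]
  show ?thesis
  proof (rule left_moduleI)
    show "abelian_group (direct_sum I M)"
    proof (rule abelian_groupI)
      fix x y z assume x: "x \<in> carrier (direct_sum I M)" and y: "y \<in> carrier (direct_sum I M)"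
        and z: "z \<in> carrier (direct_sum I M)"
      show "x \<oplus>\<^bsub>direct_sum I M\<^esub> y \<in> carrier (direct_sum I M)"
        using direct_sum_mem[OF x] direct_sum_mem[OF y] G(1) by (auto simp: direct_sum_def)
      show "x \<oplus>\<^bsub>direct_sum I M\<^esub> y \<oplus>\<^bsub>direct_sum I M\<^esub> z = x \<oplus>\<^bsub>direct_sum I M\<^esub> (y \<oplus>\<^bsub>direct_sum I M\<^esub> z)"
        using x y z by (auto simp: direct_sum_def PiE_mem intro!: restrict_ext G(3))
      show "x \<oplus>\<^bsub>direct_sum I M\<^esub> y = y \<oplus>\<^bsub>direct_sum I M\<^esub> x"
        using x y by (auto simp: direct_sum_def PiE_mem intro!: restrict_ext G(4))
    next
      show "\<zero>\<^bsub>direct_sum I M\<^esub> \<in> carrier (direct_sum I M)"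
        using G(2) by (auto simp: direct_sum_def)
    next
      fix x assume x: "x \<in> carrier (direct_sum I M)"
      show "\<zero>\<^bsub>direct_sum I M\<^esub> \<oplus>\<^bsub>direct_sum I M\<^esub> x = x"
        using direct_sum_mem[OF x] G(5) direct_sum_extensional[OF x]
        by (intro extensionalityI[of _ I]) (auto simp: direct_sum_def)
      have "\<forall>i\<in>I. \<exists>y\<in>carrier (M i). y \<oplus>\<^bsub>M i\<^esub> x i = \<zero>\<^bsub>M i\<^esub>"
        using x G(6) by (auto simp: direct_sum_def PiE_mem)
      then obtain y where "\<And>i. i \<in> I \<Longrightarrow> y i \<in> carrier (M i) \<and> y i \<oplus>\<^bsub>M i\<^esub> x i = \<zero>\<^bsub>M i\<^esub>"
        by metis
      then show "\<exists>y\<in>carrier (direct_sum I M). y \<oplus>\<^bsub>direct_sum I M\<^esub> x = \<zero>\<^bsub>direct_sum I M\<^esub>"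
        by (intro bexI[of _ "restrict y I"]) (auto simp: direct_sum_def intro!: restrict_ext)
    qed
  next
    fix a x assume a: "a \<in> carrier R" and x: "x \<in> carrier (direct_sum I M)"
    note xi = direct_sum_mem[OF x]
    show "a \<odot>\<^bsub>direct_sum I M\<^esub> x \<in> carrier (direct_sum I M)"
      using left_module.smult_closed[OF assms(2) a xi] by (auto simp: direct_sum_def)
    show "(a \<oplus>\<^bsub>R\<^esub> b) \<odot>\<^bsub>direct_sum I M\<^esub> x =
        a \<odot>\<^bsub>direct_sum I M\<^esub> x \<oplus>\<^bsub>direct_sum I M\<^esub> b \<odot>\<^bsub>direct_sum I M\<^esub> x" if "b \<in> carrier R" for b
      by (auto simp: direct_sum_def
        intro!: restrict_ext left_module.smult_l_distr[OF assms(2) a that xi])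
    show "(a \<otimes>\<^bsub>R\<^esub> b) \<odot>\<^bsub>direct_sum I M\<^esub> x = a \<odot>\<^bsub>direct_sum I M\<^esub> (b \<odot>\<^bsub>direct_sum I M\<^esub> x)"
      if "b \<in> carrier R" for b
      by (auto simp: direct_sum_def
        intro!: restrict_ext left_module.smult_assoc[OF assms(2) a that xi])
    show "a \<odot>\<^bsub>direct_sum I M\<^esub> (x \<oplus>\<^bsub>direct_sum I M\<^esub> y) =
        a \<odot>\<^bsub>direct_sum I M\<^esub> x \<oplus>\<^bsub>direct_sum I M\<^esub> a \<odot>\<^bsub>direct_sum I M\<^esub> y"
      if "y \<in> carrier (direct_sum I M)" for y
      by (auto simp: direct_sum_def
        intro!: restrict_ext left_module.smult_r_distr[OF assms(2) a xi direct_sum_mem[OF that]])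
  next
    fix x assume x: "x \<in> carrier (direct_sum I M)"
    show "\<one>\<^bsub>R\<^esub> \<odot>\<^bsub>direct_sum I M\<^esub> x = x"
      using left_module.smult_one[OF assms(2) direct_sum_mem[OF x]] direct_sum_extensional[OF x]
      by (intro extensionalityI[of _ I]) (auto simp: direct_sum_def)
  qed (rule assms(1))
qed

lemma component_hom:
  assumes "ring R" and "\<And>i. i \<in> I \<Longrightarrow> left_module R (M i)" and "i \<in> I"
  shows "(\<lambda>f\<in>carrier (direct_sum I M). f i) \<in> lmod_hom R (direct_sum I M) (M i)"
  using assms(3)
  by (intro lmod_homI left_module_direct_sum assms(1,2)) (auto simp: direct_sum_def PiE_mem)

lemma finsum_direct_sum:
  assumes "ring R" and "\<And>i. i \<in> I \<Longrightarrow> left_module R (M i)"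
    and "i \<in> I" and "g \<in> A \<rightarrow> carrier (direct_sum I M)"
  shows "finsum (direct_sum I M) g A i = finsum (M i) (\<lambda>a. g a i) A"
proof -
  interpret left_module R "direct_sum I M" by (rule left_module_direct_sum) fact+
  interpret Mi: left_module R "M i" by (rule assms(2)) fact
  have "finsum (direct_sum I M) g A i = finsum (M i) (\<lambda>a. (\<lambda>f\<in>carrier (direct_sum I M). f i) (g a)) A"
    using lmod_hom_finsum[OF left_module Mi.left_module component_hom[OF assms(1-3)] assms(4)]
      M.finsum_closed[OF assms(4)] by simp
  also have "\<dots> = finsum (M i) (\<lambda>a. g a i) A"
    by (rule Mi.M.finsum_cong')
      (use assms(3,4) in \<open>auto simp: Pi_iff direct_sum_def PiE_mem\<close>)
  finally show ?thesis .
qed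

lemma summand_inj_closed:
  assumes "\<And>i. i \<in> I \<Longrightarrow> left_module R (M i)" "x \<in> carrier (M i)"
  shows "summand_inj I M i x \<in> carrier (direct_sum I M)"
proof -
  have "\<zero>\<^bsub>M j\<^esub> \<in> carrier (M j)" if "j \<in> I" for j
    using left_module.axioms(2)[OF assms(1)[OF that]] by (rule abelian_groupE(2))
  then show ?thesis using assms(2) by (auto simp: direct_sum_def summand_inj_def)
qed

lemma summand_inj_smult:
  assumes "\<And>i. i \<in> I \<Longrightarrow> left_module R (M i)" "a \<in> carrier R"
  shows "summand_inj I M i (a \<odot>\<^bsub>M i\<^esub> x) = a \<odot>\<^bsub>direct_sum I M\<^esub> summand_inj I M i x"
  using left_module.smult_r_null[OF assms(1) assms(2)]
  by (auto simp: direct_sum_def summand_inj_def intro!: restrict_ext)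

lemma direct_sum_decomp:
  assumes "ring R" and M: "\<And>i. i \<in> I \<Longrightarrow> left_module R (M i)" and "finite I"
    and f: "f \<in> carrier (direct_sum I M)"
  shows "f = finsum (direct_sum I M) (\<lambda>i. summand_inj I M i (f i)) I"
proof -
  interpret left_module R "direct_sum I M" by (rule left_module_direct_sum) fact+
  have fi: "f i \<in> carrier (M i)" if "i \<in> I" for i using f that by (auto simp: direct_sum_def)
  have S: "(\<lambda>i. summand_inj I M i (f i)) \<in> I \<rightarrow> carrier (direct_sum I M)"
    by (rule Pi_I, rule summand_inj_closed[of I R M, OF M]) (simp_all add: fi)
  have E: "x \<in> extensional I" if "x \<in> carrier (direct_sum I M)" for x
    using that by (auto simp: direct_sum_def PiE_def)
  show ?thesis
  proof (rule extensionalityI[OF E[OF f] E[OF M.finsum_closed[OF S]]])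
    fix j assume j: "j \<in> I"
    interpret Mj: left_module R "M j" by (rule M) fact
    have "finsum (direct_sum I M) (\<lambda>i. summand_inj I M i (f i)) I j =
        finsum (M j) (\<lambda>i. if j = i then f i else \<zero>\<^bsub>M j\<^esub>) I"
      using finsum_direct_sum[OF assms(1) M j S] j by (simp add: summand_inj_def)
    also have "\<dots> = finsum (M j) (\<lambda>i. if j = i then f j else \<zero>\<^bsub>M j\<^esub>) I"
      by (rule Mj.M.finsum_cong') (use fi j in auto)
    also have "\<dots> = f j"
      using Mj.M.finsum_singleton[OF j assms(3), of "\<lambda>_. f j"] fi[OF j] by simp
    finally show "f j = finsum (direct_sum I M) (\<lambda>i. summand_inj I M i (f i)) I j" by simp
  qed
qed

section \<open>Projective modules and the lifting property\<close>

lemma left_module_regular: "ring R \<Longrightarrow> left_module R (regular_module R)"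
proof -
  assume R: "ring R"
  interpret ring R by fact
  show ?thesis
    by (rule left_moduleI[OF R abelian_groupI])
      (auto simp: regular_module_def l_distr r_distr m_assoc a_assoc l_neg intro: a_comm
        intro!: bexI[of _ "\<ominus>\<^bsub>R\<^esub> x" for x])
qed

text \<open>The lift is along a map whose image contains that of \<open>f\<close>, since this is
  what exactness supplies in a resolution. Preimages are chosen for the images of the standard basis
  of the free module, and the resulting map is precomposed with the section
  \<open>s\<close>.\<close>

lemma fg_projective_lift:
  assumes P: "fg_projective R P" and R: "ring R" and M: "left_module R M" "left_module R N"
    and d: "d \<in> lmod_hom R M N" and f: "f \<in> lmod_hom R P N"
    and im: "f ` carrier P \<subseteq> d ` carrier M"
  shows "\<exists>g\<in>lmod_hom R P M. \<forall>x\<in>carrier P. d (g x) = f x"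
proof -
  have PM: "left_module R P" using P by (simp add: fg_projective_def)
  obtain n :: nat and s p where s: "s \<in> lmod_hom R P (direct_sum {..<n} (\<lambda>_. regular_module R))"
    and p: "p \<in> lmod_hom R (direct_sum {..<n} (\<lambda>_. regular_module R)) P"
    and ps: "\<And>x. x \<in> carrier P \<Longrightarrow> p (s x) = x"
    using P by (auto simp: fg_projective_def)
  let ?F = "direct_sum {..<n} (\<lambda>_. regular_module R)"
  let ?e = "\<lambda>i. summand_inj {..<n} (\<lambda>_. regular_module R) i \<one>\<^bsub>R\<^esub>"
  interpret M: left_module R M by fact
  interpret N: left_module R N by fact
  interpret P: left_module R P by fact
  note reg = left_module_regular[OF R]
  interpret F: left_module R ?F by (rule left_module_direct_sum[OF R reg])
  have e: "?e i \<in> carrier ?F" for i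
    by (rule summand_inj_closed[OF reg]) (simp add: regular_module_def)
  have "f (p (?e i)) \<in> d ` carrier M" for i
    using im lmod_homD(1)[OF p e[of i]] by (meson image_subset_iff)
  then have "\<exists>y\<in>carrier M. d y = f (p (?e i))" for i by (metis (no_types) imageE)
  then obtain y where y: "\<And>i. y i \<in> carrier M" "\<And>i. d (y i) = f (p (?e i))" by metis
  define g0 where "g0 v = finsum M (\<lambda>i. v i \<odot>\<^bsub>M\<^esub> y i) {..<n}" for v
  have vc: "v i \<in> carrier R" if "v \<in> carrier ?F" "i < n" for v i
    using that by (auto simp: direct_sum_def regular_module_def)
  have vy: "(\<lambda>i. v i \<odot>\<^bsub>M\<^esub> y i) \<in> {..<n} \<rightarrow> carrier M" if "v \<in> carrier ?F" for v
    using vc[OF that] y M.smult_closed by auto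
  have g0: "restrict g0 (carrier ?F) \<in> lmod_hom R ?F M"
  proof (rule lmod_homI)
    fix v w assume v: "v \<in> carrier ?F" and w: "w \<in> carrier ?F"
    show "g0 v \<in> carrier M" unfolding g0_def by (rule M.M.finsum_closed[OF vy[OF v]])
    have "g0 (v \<oplus>\<^bsub>?F\<^esub> w) = finsum M (\<lambda>i. v i \<odot>\<^bsub>M\<^esub> y i \<oplus>\<^bsub>M\<^esub> w i \<odot>\<^bsub>M\<^esub> y i) {..<n}"
      unfolding g0_def
      by (rule M.M.finsum_cong') (use v w vc y in
        \<open>auto simp: direct_sum_def regular_module_def M.smult_l_distr intro!: M.smult_closed M.M.a_closed\<close>)
    also have "\<dots> = g0 v \<oplus>\<^bsub>M\<^esub> g0 w"
      unfolding g0_def by (rule M.M.finsum_addf[OF vy[OF v] vy[OF w]])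
    finally show "g0 (v \<oplus>\<^bsub>?F\<^esub> w) = g0 v \<oplus>\<^bsub>M\<^esub> g0 w" .
  next
    fix v a assume a: "a \<in> carrier R" and v: "v \<in> carrier ?F"
    \<comment> \<open>Over a noncommutative ring, multiplication by \<open>a\<close> is additive but
      in general not a homomorphism, so \<open>lmod_hom_finsum\<close> does not apply and the sum is
      treated by induction.\<close>
    have sm: "restrict ((\<odot>\<^bsub>M\<^esub>) a) (carrier M) (finsum M (\<lambda>i. v i \<odot>\<^bsub>M\<^esub> y i) {..<n}) =
        finsum M (\<lambda>i. a \<odot>\<^bsub>M\<^esub> (v i \<odot>\<^bsub>M\<^esub> y i)) {..<n}"
    proof -
      have "a \<odot>\<^bsub>M\<^esub> finsum M (\<lambda>i. v i \<odot>\<^bsub>M\<^esub> y i) A = finsum M (\<lambda>i. a \<odot>\<^bsub>M\<^esub> (v i \<odot>\<^bsub>M\<^esub> y i)) A"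
        if "finite A" "A \<subseteq> {..<n}" for A
        using that
      proof (induction A rule: finite_induct)
        case (insert i A)
        have c: "(\<lambda>i. v i \<odot>\<^bsub>M\<^esub> y i) \<in> A \<rightarrow> carrier M" "v i \<odot>\<^bsub>M\<^esub> y i \<in> carrier M"
          using vy[OF v] insert.prems by auto
        then have "(\<lambda>i. a \<odot>\<^bsub>M\<^esub> (v i \<odot>\<^bsub>M\<^esub> y i)) \<in> A \<rightarrow> carrier M" using a M.smult_closed by auto
        then show ?case using insert c a M.M.finsum_closed[OF c(1)]
          by (simp add: M.smult_r_distr M.smult_closed)
      qed (use a M.smult_r_null in simp)
      then show ?thesis using M.M.finsum_closed[OF vy[OF v]] by simp
    qed
    have "g0 (a \<odot>\<^bsub>?F\<^esub> v) = finsum M (\<lambda>i. a \<odot>\<^bsub>M\<^esub> (v i \<odot>\<^bsub>M\<^esub> y i)) {..<n}"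
      unfolding g0_def
      by (rule M.M.finsum_cong') (use v vc a y in
        \<open>auto simp: direct_sum_def regular_module_def M.smult_assoc intro!: M.smult_closed\<close>)
    with sm show "g0 (a \<odot>\<^bsub>?F\<^esub> v) = a \<odot>\<^bsub>M\<^esub> g0 v"
      using M.M.finsum_closed[OF vy[OF v]] by (simp add: g0_def)
  qed (rule F.left_module)
  have dg0: "d (g0 v) = f (p v)" if v: "v \<in> carrier ?F" for v
  proof -
    have si: "summand_inj {..<n} (\<lambda>_. regular_module R) i (v i) = v i \<odot>\<^bsub>?F\<^esub> ?e i" if "i < n" for i
      using summand_inj_smult[of "{..<n}" R "\<lambda>_. regular_module R" "v i" i "\<one>\<^bsub>R\<^esub>"] reg vc[OF v that]
      by (simp add: regular_module_def)
    have ve: "(\<lambda>i. v i \<odot>\<^bsub>?F\<^esub> ?e i) \<in> {..<n} \<rightarrow> carrier ?F"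
      using vc[OF v] e F.smult_closed by auto
    have pe: "(\<lambda>i. p (v i \<odot>\<^bsub>?F\<^esub> ?e i)) \<in> {..<n} \<rightarrow> carrier P"
      using ve lmod_homD(1)[OF p] by auto
    have "v = finsum ?F (\<lambda>i. summand_inj {..<n} (\<lambda>_. regular_module R) i (v i)) {..<n}"
      by (rule direct_sum_decomp[OF R reg _ v]) simp
    also have "\<dots> = finsum ?F (\<lambda>i. v i \<odot>\<^bsub>?F\<^esub> ?e i) {..<n}"
      by (rule F.M.finsum_cong') (use si ve in auto)
    finally have "f (p v) = f (p (finsum ?F (\<lambda>i. v i \<odot>\<^bsub>?F\<^esub> ?e i) {..<n}))" by simp
    also have "\<dots> = finsum N (\<lambda>i. f (p (v i \<odot>\<^bsub>?F\<^esub> ?e i))) {..<n}"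
      using lmod_hom_finsum[OF F.left_module PM p ve] lmod_hom_finsum[OF PM M(2) f pe] by simp
    also have "\<dots> = finsum N (\<lambda>i. d (v i \<odot>\<^bsub>M\<^esub> y i)) {..<n}"
    proof (rule N.M.finsum_cong')
      show "(\<lambda>i. d (v i \<odot>\<^bsub>M\<^esub> y i)) \<in> {..<n} \<rightarrow> carrier N" using vy[OF v] lmod_homD(1)[OF d] by auto
      show "f (p (v i \<odot>\<^bsub>?F\<^esub> ?e i)) = d (v i \<odot>\<^bsub>M\<^esub> y i)" if "i \<in> {..<n}" for i
        using that vc[OF v] e[of i] y[of i] lmod_homD(1)[OF p e[of i]]
        by (simp add: lmod_homD(3)[OF p] lmod_homD(3)[OF f] lmod_homD(3)[OF d])
    qed simp
    also have "\<dots> = d (g0 v)" unfolding g0_def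
      by (rule lmod_hom_finsum[OF M d vy[OF v], symmetric])
    finally show ?thesis by simp
  qed
  have "(\<lambda>x\<in>carrier P. restrict g0 (carrier ?F) (s x)) \<in> lmod_hom R P M"
    by (rule lmod_hom_comp[OF s g0 PM])
  moreover have "d ((\<lambda>x\<in>carrier P. restrict g0 (carrier ?F) (s x)) x) = f x" if "x \<in> carrier P" for x
    using that lmod_homD(1)[OF s that] dg0 ps by simp
  ultimately show ?thesis by blast
qed

text \<open>Each summand is a retract of one copy of the ring, so the sum is a retract of
  \<open>card I\<close> copies. The set \<open>I\<close> is enumerated because
  \<open>fg_projective\<close> speaks about the index sets \<open>{..<n}\<close>.\<close>

lemma fg_projective_direct_sum:
  assumes R: "ring R" and M: "\<And>i. i \<in> I \<Longrightarrow> left_module R (M i)" and fin: "finite I"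
    and s: "\<And>i. i \<in> I \<Longrightarrow> s i \<in> lmod_hom R (M i) (regular_module R)"
    and p: "\<And>i. i \<in> I \<Longrightarrow> p i \<in> lmod_hom R (regular_module R) (M i)"
    and ps: "\<And>i x. i \<in> I \<Longrightarrow> x \<in> carrier (M i) \<Longrightarrow> p i (s i x) = x"
  shows "fg_projective R (direct_sum I M)"
proof -
  obtain b where b: "bij_betw b {..<card I} I"
    using ex_bij_betw_nat_finite[OF fin] by (auto simp: atLeast0LessThan)
  let ?F = "direct_sum {..<card I} (\<lambda>_. regular_module R)"
  let ?S = "\<lambda>f. \<lambda>k\<in>{..<card I}. s (b k) (f (b k))"
  let ?c = "inv_into {..<card I} b"
  let ?P = "\<lambda>v. \<lambda>i\<in>I. p i (v (?c i))"
  have bI: "b k \<in> I" if "k < card I" for k using b that by (auto simp: bij_betw_def)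
  have c: "?c i < card I" "b (?c i) = i" if "i \<in> I" for i
    using b that inv_into_into[of i b "{..<card I}"] by (auto simp: bij_betw_def f_inv_into_f)
  have LM: "left_module R (direct_sum I M)" by (rule left_module_direct_sum[OF R M])
  have LF: "left_module R ?F" by (rule left_module_direct_sum[OF R left_module_regular[OF R]])
  have "restrict ?S (carrier (direct_sum I M)) \<in> lmod_hom R (direct_sum I M) ?F"
  proof (rule lmod_homI[OF _ _ _ LM])
    fix f g assume f: "f \<in> carrier (direct_sum I M)" and g: "g \<in> carrier (direct_sum I M)"
    note sb = lmod_homD[OF s[OF bI]] and fb = direct_sum_mem[OF f bI] and gb = direct_sum_mem[OF g bI]
    show "?S f \<in> carrier ?F" by (rule direct_sum_memI) (simp add: sb(1) fb)
    show "?S (f \<oplus>\<^bsub>direct_sum I M\<^esub> g) = ?S f \<oplus>\<^bsub>?F\<^esub> ?S g"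
      by (auto simp: direct_sum_def bI intro!: restrict_ext sb(2) fb gb)
  next
    fix f a assume a: "a \<in> carrier R" and f: "f \<in> carrier (direct_sum I M)"
    note sb = lmod_homD[OF s[OF bI]] and fb = direct_sum_mem[OF f bI]
    show "?S (a \<odot>\<^bsub>direct_sum I M\<^esub> f) = a \<odot>\<^bsub>?F\<^esub> ?S f"
      by (auto simp: direct_sum_def bI intro!: restrict_ext sb(3) fb a)
  qed
  moreover have "restrict ?P (carrier ?F) \<in> lmod_hom R ?F (direct_sum I M)"
  proof (rule lmod_homI[OF _ _ _ LF])
    fix f g assume f: "f \<in> carrier ?F" and g: "g \<in> carrier ?F"
    have ci: "?c i \<in> {..<card I}" if "i \<in> I" for i using c(1)[OF that] by simp
    note pb = lmod_homD[OF p] and fb = direct_sum_mem[OF f ci] and gb = direct_sum_mem[OF g ci]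
    show "?P f \<in> carrier (direct_sum I M)" by (rule direct_sum_memI) (simp add: pb(1) fb)
    show "?P (f \<oplus>\<^bsub>?F\<^esub> g) = ?P f \<oplus>\<^bsub>direct_sum I M\<^esub> ?P g"
      by (auto simp: direct_sum_def c intro!: restrict_ext pb(2) fb gb)
  next
    fix f a assume a: "a \<in> carrier R" and f: "f \<in> carrier ?F"
    have ci: "?c i \<in> {..<card I}" if "i \<in> I" for i using c(1)[OF that] by simp
    note pb = lmod_homD[OF p] and fb = direct_sum_mem[OF f ci]
    show "?P (a \<odot>\<^bsub>?F\<^esub> f) = a \<odot>\<^bsub>direct_sum I M\<^esub> ?P f"
      by (auto simp: direct_sum_def c intro!: restrict_ext pb(3) fb a)
  qed
  moreover have "restrict ?P (carrier ?F) (restrict ?S (carrier (direct_sum I M)) f) = f"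
    if f: "f \<in> carrier (direct_sum I M)" for f
  proof -
    have S: "?S f \<in> carrier ?F"
      by (rule direct_sum_memI) (simp add: lmod_homD(1)[OF s[OF bI]] direct_sum_mem[OF f bI])
    show ?thesis
      by (rule extensionalityI[OF _ direct_sum_extensional[OF f]])
        (use S f in \<open>auto simp: c ps direct_sum_mem\<close>)
  qed
  ultimately show ?thesis unfolding fg_projective_def using LM by blast
qed

section \<open>Projective resolutions and Ext\<close>

text \<open>
  The part of a complex in nonnegative degrees: \<open>D n\<close> is the differential out of degree \<open>n + 1\<close>.
\<close>

definition nat_resolution ::
    "('a, 'b) ring_scheme \<Rightarrow> (nat \<Rightarrow> ('a, 'x) module) \<Rightarrow> (nat \<Rightarrow> 'x \<Rightarrow> 'x) \<Rightarrow> ('x \<Rightarrow> 'm) \<Rightarrow>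
      ('a, 'm) module \<Rightarrow> bool"
  where "nat_resolution R P D \<epsilon> M \<longleftrightarrow> (\<forall>n. fg_projective R (P n)) \<and>
    (\<forall>n. D n \<in> lmod_hom R (P (Suc n)) (P n)) \<and>
    (\<forall>n. {x \<in> carrier (P (Suc n)). D n x = \<zero>\<^bsub>P n\<^esub>} = D (Suc n) ` carrier (P (Suc (Suc n)))) \<and>
    \<epsilon> \<in> lmod_hom R (P 0) M \<and> \<epsilon> ` carrier (P 0) = carrier M \<and>
    {x \<in> carrier (P 0). \<epsilon> x = \<zero>\<^bsub>M\<^esub>} = D 0 ` carrier (P (Suc 0))"

text \<open>Comparison maps and homotopies are built degree by degree with dependent choice over the
  naturals, so the integer indices are left behind here.\<close>

lemma nat_resolution_of_resolution:
  assumes "projective_resolution R K \<epsilon> M"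
  shows "nat_resolution R (\<lambda>n. obj K (int n)) (\<lambda>n. diff K (int (Suc n))) \<epsilon> M"
proof -
  have e: "int (Suc n) - 1 = int n" "int (Suc n) + 1 = int (Suc (Suc n))" for n by auto
  have ex: "{x \<in> carrier (obj K q). diff K q x = \<zero>\<^bsub>obj K (q - 1)\<^esub>} =
      diff K (q + 1) ` carrier (obj K (q + 1))" if "1 \<le> q" for q
    using assms that unfolding projective_resolution_def by blast
  have "diff K (int (Suc n)) \<in> lmod_hom R (obj K (int (Suc n))) (obj K (int n))" for n
    using assms e(1)[of n] unfolding projective_resolution_def by metis
  moreover have "{x \<in> carrier (obj K (int (Suc n))). diff K (int (Suc n)) x = \<zero>\<^bsub>obj K (int n)\<^esub>} =
      diff K (int (Suc (Suc n))) ` carrier (obj K (int (Suc (Suc n))))" for n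
  proof -
    have "{x \<in> carrier (obj K (int (Suc n))). diff K (int (Suc n)) x = \<zero>\<^bsub>obj K (int (Suc n) - 1)\<^esub>} =
      diff K (int (Suc n) + 1) ` carrier (obj K (int (Suc n) + 1))"
      by (rule ex) simp
    then show ?thesis unfolding e .
  qed
  ultimately show ?thesis using assms unfolding projective_resolution_def nat_resolution_def
    by (simp add: add.commute)
qed

section \<open>Comparison maps and homotopies\<close>

locale lmod_resolution =
  fixes R :: "('a, 'b) ring_scheme" and P :: "nat \<Rightarrow> ('a, 'x) module"
    and D :: "nat \<Rightarrow> 'x \<Rightarrow> 'x" and \<epsilon> :: "'x \<Rightarrow> 'm" and M :: "('a, 'm) module"
  assumes res: "nat_resolution R P D \<epsilon> M" and R: "ring R" and M: "left_module R M"
begin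

lemma proj: "fg_projective R (P n)" and D: "D n \<in> lmod_hom R (P (Suc n)) (P n)"
  and aug: "\<epsilon> \<in> lmod_hom R (P 0) M" and aug_surj: "\<epsilon> ` carrier (P 0) = carrier M"
  using res by (auto simp: nat_resolution_def)

lemma P: "left_module R (P n)"
  using proj[of n] by (simp add: fg_projective_def)

lemma exact: "D n ` carrier (P (Suc n)) =
    (case n of 0 \<Rightarrow> {x \<in> carrier (P 0). \<epsilon> x = \<zero>\<^bsub>M\<^esub>}
     | Suc k \<Rightarrow> {x \<in> carrier (P (Suc k)). D k x = \<zero>\<^bsub>P k\<^esub>})"
  using res by (auto simp: nat_resolution_def split: nat.split)

lemma exactD:
  "x \<in> carrier (P 0) \<Longrightarrow> \<epsilon> x = \<zero>\<^bsub>M\<^esub> \<Longrightarrow> x \<in> D 0 ` carrier (P (Suc 0))"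
  "x \<in> carrier (P (Suc n)) \<Longrightarrow> D n x = \<zero>\<^bsub>P n\<^esub> \<Longrightarrow> x \<in> D (Suc n) ` carrier (P (Suc (Suc n)))"
proof -
  show "x \<in> carrier (P 0) \<Longrightarrow> \<epsilon> x = \<zero>\<^bsub>M\<^esub> \<Longrightarrow> x \<in> D 0 ` carrier (P (Suc 0))"
    by (simp add: exact)
  show "x \<in> carrier (P (Suc n)) \<Longrightarrow> D n x = \<zero>\<^bsub>P n\<^esub> \<Longrightarrow> x \<in> D (Suc n) ` carrier (P (Suc (Suc n)))"
    by (simp add: exact)
qed

lemma D_closed: "x \<in> carrier (P (Suc n)) \<Longrightarrow> D n x \<in> carrier (P n)"
  by (rule lmod_homD(1)[OF D])

lemma aug_D: "x \<in> carrier (P (Suc 0)) \<Longrightarrow> \<epsilon> (D 0 x) = \<zero>\<^bsub>M\<^esub>"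
  using exact[of 0] by auto

lemma D_D: "x \<in> carrier (P (Suc (Suc n))) \<Longrightarrow> D n (D (Suc n) x) = \<zero>\<^bsub>P n\<^esub>"
  using exact[of "Suc n"] by auto

end

text \<open>The next lift exists as soon as the map just built sends boundaries to boundaries. This
  condition is part of the invariant \<open>ok\<close>; it follows from commutation with the
  differentials, or with the augmentations in degree 0, and from exactness of the second
  complex.\<close>

lemma comparison_map:
  assumes "lmod_resolution R P D \<epsilon> M" "lmod_resolution R P' D' \<epsilon>' M"
  shows "\<exists>\<phi>. (\<forall>n. \<phi> n \<in> lmod_hom R (P n) (P' n)) \<and> (\<forall>x\<in>carrier (P 0). \<epsilon>' (\<phi> 0 x) = \<epsilon> x) \<and>
    (\<forall>n. \<forall>x\<in>carrier (P (Suc n)). D' n (\<phi> (Suc n) x) = \<phi> n (D n x))"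
proof -
  interpret K: lmod_resolution R P D \<epsilon> M by fact
  interpret L: lmod_resolution R P' D' \<epsilon>' M by fact
  define ok where "ok n f \<longleftrightarrow> f \<in> lmod_hom R (P n) (P' n) \<and>
    (n = 0 \<longrightarrow> (\<forall>x\<in>carrier (P 0). \<epsilon>' (f x) = \<epsilon> x)) \<and>
    (\<forall>x\<in>carrier (P (Suc n)). f (D n x) \<in> D' n ` carrier (P' (Suc n)))" for n f
  define rel where "rel n f g \<longleftrightarrow> (\<forall>x\<in>carrier (P (Suc n)). D' n (g x) = f (D n x))" for n f g
  have "\<exists>\<phi>. \<forall>n. ok n (\<phi> n) \<and> rel n (\<phi> n) (\<phi> (Suc n))"
  proof (rule dependent_nat_choice)
    obtain f where f: "f \<in> lmod_hom R (P 0) (P' 0)" "\<And>x. x \<in> carrier (P 0) \<Longrightarrow> \<epsilon>' (f x) = \<epsilon> x"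
      using fg_projective_lift[OF K.proj K.R L.P K.M L.aug K.aug] lmod_homD(1)[OF K.aug]
        L.aug_surj by blast
    have "f (D 0 x) \<in> D' 0 ` carrier (P' (Suc 0))" if "x \<in> carrier (P (Suc 0))" for x
      using that f(2)[of "D 0 x"] K.D_closed[OF that] K.aug_D[OF that] lmod_homD(1)[OF f(1)]
      by (intro L.exactD) auto
    then show "\<exists>f. ok 0 f" using f unfolding ok_def by auto
  next
    fix f n assume f: "ok n f"
    have fh: "f \<in> lmod_hom R (P n) (P' n)" using f by (simp add: ok_def)
    have "(\<lambda>x\<in>carrier (P (Suc n)). f (D n x)) ` carrier (P (Suc n)) \<subseteq> D' n ` carrier (P' (Suc n))"
      using f by (auto simp: ok_def)
    then obtain g where g: "g \<in> lmod_hom R (P (Suc n)) (P' (Suc n))"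
      "\<And>x. x \<in> carrier (P (Suc n)) \<Longrightarrow> D' n (g x) = f (D n x)"
      using fg_projective_lift[OF K.proj K.R L.P L.P L.D lmod_hom_comp[OF K.D fh K.P]] by auto
    have "g (D (Suc n) x) \<in> D' (Suc n) ` carrier (P' (Suc (Suc n)))"
      if "x \<in> carrier (P (Suc (Suc n)))" for x
      using that g(2)[of "D (Suc n) x"] K.D_closed[OF that] K.D_D[OF that] lmod_homD(1)[OF g(1)]
        lmod_hom_zero[OF K.P L.P fh]
      by (intro L.exactD) auto
    then show "\<exists>g. ok (Suc n) g \<and> rel n f g" using g unfolding ok_def rel_def by auto
  qed
  then obtain \<phi> where "\<And>n. ok n (\<phi> n)" "\<And>n. rel n (\<phi> n) (\<phi> (Suc n))" by auto
  then show ?thesis unfolding ok_def rel_def by blast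
qed

text \<open>The invariant \<open>ok\<close> is the homotopy equation in degree \<open>n\<close>
  evaluated on boundaries, where the term with the previous homotopy vanishes. It turns
  \<open>\<alpha>\<close> minus \<open>h\<close> after \<open>D\<close>, one degree higher, into a
  map to cycles, and projectivity lifts that map through the next differential.\<close>

lemma null_homotopy:
  assumes "lmod_resolution R P D \<epsilon> M" "lmod_resolution R P' D' \<epsilon>' M"
    and \<alpha>: "\<And>n. \<alpha> n \<in> lmod_hom R (P n) (P' n)"
    and \<alpha>0: "\<And>x. x \<in> carrier (P 0) \<Longrightarrow> \<epsilon>' (\<alpha> 0 x) = \<zero>\<^bsub>M\<^esub>"
    and \<alpha>D: "\<And>n x. x \<in> carrier (P (Suc n)) \<Longrightarrow> D' n (\<alpha> (Suc n) x) = \<alpha> n (D n x)"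
  shows "\<exists>h. (\<forall>n. h n \<in> lmod_hom R (P n) (P' (Suc n))) \<and>
    (\<forall>n. \<forall>x\<in>carrier (P (Suc n)). \<alpha> (Suc n) x = D' (Suc n) (h (Suc n) x) \<oplus>\<^bsub>P' (Suc n)\<^esub> h n (D n x))"
proof -
  interpret K: lmod_resolution R P D \<epsilon> M by fact
  interpret L: lmod_resolution R P' D' \<epsilon>' M by fact
  define ok where "ok n h \<longleftrightarrow> h \<in> lmod_hom R (P n) (P' (Suc n)) \<and>
    (\<forall>x\<in>carrier (P (Suc n)). D' n (h (D n x)) = \<alpha> n (D n x))" for n h
  define rel where "rel n h g \<longleftrightarrow> (\<forall>x\<in>carrier (P (Suc n)).
    \<alpha> (Suc n) x = D' (Suc n) (g x) \<oplus>\<^bsub>P' (Suc n)\<^esub> h (D n x))" for n h g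
  have "\<exists>h. \<forall>n. ok n (h n) \<and> rel n (h n) (h (Suc n))"
  proof (rule dependent_nat_choice)
    have "\<alpha> 0 ` carrier (P 0) \<subseteq> D' 0 ` carrier (P' (Suc 0))"
      using L.exactD(1) \<alpha>0 lmod_homD(1)[OF \<alpha>] by auto
    then obtain h where h: "h \<in> lmod_hom R (P 0) (P' (Suc 0))"
      "\<And>x. x \<in> carrier (P 0) \<Longrightarrow> D' 0 (h x) = \<alpha> 0 x"
      using fg_projective_lift[OF K.proj K.R L.P L.P L.D \<alpha>] by blast
    then show "\<exists>h. ok 0 h" using K.D_closed unfolding ok_def by blast
  next
    fix h n assume h: "ok n h"
    interpret Q: left_module R "P' (Suc n)" by (rule L.P)
    interpret Q0: left_module R "P' n" by (rule L.P)
    have hh: "h \<in> lmod_hom R (P n) (P' (Suc n))" using h by (simp add: ok_def)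
    let ?b = "\<lambda>x\<in>carrier (P (Suc n)). \<alpha> (Suc n) x \<ominus>\<^bsub>P' (Suc n)\<^esub> (\<lambda>x\<in>carrier (P (Suc n)). h (D n x)) x"
    have hD: "(\<lambda>x\<in>carrier (P (Suc n)). h (D n x)) \<in> lmod_hom R (P (Suc n)) (P' (Suc n))"
      by (rule lmod_hom_comp[OF K.D hh K.P])
    have b: "?b \<in> lmod_hom R (P (Suc n)) (P' (Suc n))"
      by (rule lmod_hom_diff[OF \<alpha> hD K.P L.P])
    have "D' n (?b x) = \<zero>\<^bsub>P' n\<^esub>" if x: "x \<in> carrier (P (Suc n))" for x
    proof -
      have c: "h (D n x) \<in> carrier (P' (Suc n))" "\<alpha> (Suc n) x \<in> carrier (P' (Suc n))"
        using x lmod_homD(1)[OF hh] lmod_homD(1)[OF \<alpha>] K.D_closed by auto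
      have "D' n (?b x) = D' n (\<alpha> (Suc n) x) \<ominus>\<^bsub>P' n\<^esub> D' n (h (D n x))"
        using lmod_hom_minus(2)[OF L.P L.P L.D c(2,1)] x by simp
      also have "\<dots> = \<zero>\<^bsub>P' n\<^esub>"
        using h x \<alpha>D[OF x] c lmod_homD(1)[OF L.D c(1)] by (subst Q0.diff_eq_zero_iff) (auto simp: ok_def)
      finally show ?thesis .
    qed
    then have "?b ` carrier (P (Suc n)) \<subseteq> D' (Suc n) ` carrier (P' (Suc (Suc n)))"
      using L.exactD(2) lmod_homD(1)[OF b] by blast
    then obtain g where g: "g \<in> lmod_hom R (P (Suc n)) (P' (Suc (Suc n)))"
      "\<And>x. x \<in> carrier (P (Suc n)) \<Longrightarrow> D' (Suc n) (g x) = ?b x"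
      using fg_projective_lift[OF K.proj K.R L.P L.P L.D b] by blast
    have r: "rel n h g" unfolding rel_def
    proof
      fix x assume x: "x \<in> carrier (P (Suc n))"
      have c: "h (D n x) \<in> carrier (P' (Suc n))" "\<alpha> (Suc n) x \<in> carrier (P' (Suc n))"
        using x lmod_homD(1)[OF hh] lmod_homD(1)[OF \<alpha>] K.D_closed by auto
      then show "\<alpha> (Suc n) x = D' (Suc n) (g x) \<oplus>\<^bsub>P' (Suc n)\<^esub> h (D n x)"
        using g(2)[OF x] x by (simp add: a_minus_def Q.M.add.m_assoc Q.M.l_neg)
    qed
    have "ok (Suc n) g" unfolding ok_def
    proof (intro conjI ballI g)
      fix x assume x: "x \<in> carrier (P (Suc (Suc n)))"
      have c: "D (Suc n) x \<in> carrier (P (Suc n))" by (rule K.D_closed[OF x])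
      have "D' (Suc n) (g (D (Suc n) x)) = \<alpha> (Suc n) (D (Suc n) x) \<ominus>\<^bsub>P' (Suc n)\<^esub> \<zero>\<^bsub>P' (Suc n)\<^esub>"
        using g(2)[OF c] c K.D_D[OF x] lmod_hom_zero[OF K.P L.P hh] by simp
      then show "D' (Suc n) (g (D (Suc n) x)) = \<alpha> (Suc n) (D (Suc n) x)"
        using lmod_homD(1)[OF \<alpha> c] by (simp add: a_minus_def)
    qed
    with r show "\<exists>g. ok (Suc n) g \<and> rel n h g" by blast
  qed
  then obtain h where h: "\<And>n. ok n (h n)" "\<And>n. rel n (h n) (h (Suc n))" by auto
  show ?thesis
  proof (intro exI[of _ h] conjI allI ballI)
    show "h n \<in> lmod_hom R (P n) (P' (Suc n))" for n using h(1)[of n] by (simp add: ok_def)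
    show "\<alpha> (Suc n) x = D' (Suc n) (h (Suc n) x) \<oplus>\<^bsub>P' (Suc n)\<^esub> h n (D n x)"
      if "x \<in> carrier (P (Suc n))" for n x using h(2)[of n] that by (simp add: rel_def)
  qed
qed

text \<open>This is \<open>null_homotopy\<close> for the identity minus \<open>\<psi>\<close> after
  \<open>\<phi>\<close>. The equation is solved for \<open>x\<close>, so that a homomorphism applied
  to it splits into three summands without any subtraction.\<close>

lemma comparison_homotopy_inverse:
  assumes "lmod_resolution R P D \<epsilon> M" "lmod_resolution R P' D' \<epsilon>' M"
    and \<phi>: "\<And>n. \<phi> n \<in> lmod_hom R (P n) (P' n)" "\<And>x. x \<in> carrier (P 0) \<Longrightarrow> \<epsilon>' (\<phi> 0 x) = \<epsilon> x"
      "\<And>n x. x \<in> carrier (P (Suc n)) \<Longrightarrow> D' n (\<phi> (Suc n) x) = \<phi> n (D n x)"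
    and \<psi>: "\<And>n. \<psi> n \<in> lmod_hom R (P' n) (P n)" "\<And>x. x \<in> carrier (P' 0) \<Longrightarrow> \<epsilon> (\<psi> 0 x) = \<epsilon>' x"
      "\<And>n x. x \<in> carrier (P' (Suc n)) \<Longrightarrow> D n (\<psi> (Suc n) x) = \<psi> n (D' n x)"
  shows "\<exists>h. (\<forall>n. h n \<in> lmod_hom R (P n) (P (Suc n))) \<and>
    (\<forall>n. \<forall>x\<in>carrier (P (Suc n)). x = (D (Suc n) (h (Suc n) x) \<oplus>\<^bsub>P (Suc n)\<^esub> h n (D n x))
      \<oplus>\<^bsub>P (Suc n)\<^esub> \<psi> (Suc n) (\<phi> (Suc n) x))"
proof -
  interpret K: lmod_resolution R P D \<epsilon> M by fact
  interpret L: lmod_resolution R P' D' \<epsilon>' M by fact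
  interpret M: left_module R M by (rule K.M)
  let ?c = "\<lambda>n. \<lambda>x\<in>carrier (P n). \<psi> n (\<phi> n x)" and ?i = "\<lambda>n. \<lambda>x\<in>carrier (P n). x"
  define \<alpha> where "\<alpha> n = (\<lambda>x\<in>carrier (P n). ?i n x \<ominus>\<^bsub>P n\<^esub> ?c n x)" for n
  have \<alpha>: "\<alpha> n \<in> lmod_hom R (P n) (P n)" for n unfolding \<alpha>_def
    by (rule lmod_hom_diff[OF lmod_hom_id[OF K.P] lmod_hom_comp[OF \<phi>(1) \<psi>(1) K.P] K.P K.P])
  have c: "\<phi> n x \<in> carrier (P' n)" "\<psi> n (\<phi> n x) \<in> carrier (P n)" if "x \<in> carrier (P n)" for n x
    using lmod_homD(1)[OF \<phi>(1) that] lmod_homD(1)[OF \<psi>(1)] by auto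
  have "\<epsilon> (\<alpha> 0 x) = \<zero>\<^bsub>M\<^esub>" if x: "x \<in> carrier (P 0)" for x
    using lmod_hom_minus(2)[OF K.P K.M K.aug x c(2)[OF x]] x \<phi>(2)[OF x] \<psi>(2)[OF c(1)[OF x]]
      lmod_homD(1)[OF K.aug x] M.diff_eq_zero_iff by (simp add: \<alpha>_def)
  moreover have "D n (\<alpha> (Suc n) x) = \<alpha> n (D n x)" if x: "x \<in> carrier (P (Suc n))" for n x
    using lmod_hom_minus(2)[OF K.P K.P K.D x c(2)[OF x]] x \<phi>(3)[OF x] \<psi>(3)[OF c(1)[OF x]]
      K.D_closed[OF x] by (simp add: \<alpha>_def)
  ultimately obtain h where h: "\<And>n. h n \<in> lmod_hom R (P n) (P (Suc n))"
    "\<And>n x. x \<in> carrier (P (Suc n)) \<Longrightarrow>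
      \<alpha> (Suc n) x = D (Suc n) (h (Suc n) x) \<oplus>\<^bsub>P (Suc n)\<^esub> h n (D n x)"
    using null_homotopy[OF assms(1,1) \<alpha>] by blast
  have "x = \<alpha> n x \<oplus>\<^bsub>P n\<^esub> \<psi> n (\<phi> n x)" if x: "x \<in> carrier (P n)" for n x
  proof -
    interpret Q: left_module R "P n" by (rule K.P)
    show ?thesis using x c[OF x] by (simp add: \<alpha>_def a_minus_def Q.M.add.m_assoc Q.M.l_neg)
  qed
  then show ?thesis using h by (intro exI[of _ h]) metis
qed

text \<open>The algebra structure acts on \<open>Hom_space\<close> through the ring map from
  \<open>k\<close> given by the multiples of \<open>\<one>\<close>. Centrality is what keeps a
  scalar multiple of a homomorphism linear.\<close>

locale unital_algebra = ring A for A :: "('k::field, 'a) module" (structure) +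
  assumes scalar_closed: "c \<odot>\<^bsub>A\<^esub> \<one> \<in> carrier A"
    and scalar_add: "(c + d) \<odot>\<^bsub>A\<^esub> \<one> = c \<odot>\<^bsub>A\<^esub> \<one> \<oplus> d \<odot>\<^bsub>A\<^esub> \<one>"
    and scalar_mult: "(c * d) \<odot>\<^bsub>A\<^esub> \<one> = (c \<odot>\<^bsub>A\<^esub> \<one>) \<otimes> (d \<odot>\<^bsub>A\<^esub> \<one>)"
    and scalar_one: "1 \<odot>\<^bsub>A\<^esub> \<one> = \<one>"
    and scalar_central: "a \<in> carrier A \<Longrightarrow> (c \<odot>\<^bsub>A\<^esub> \<one>) \<otimes> a = a \<otimes> (c \<odot>\<^bsub>A\<^esub> \<one>)"

lemma scalars_simps [simp]:
  "carrier scalars = UNIV" "x \<oplus>\<^bsub>scalars\<^esub> y = x + y" "x \<otimes>\<^bsub>scalars\<^esub> y = x * y"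
  "\<one>\<^bsub>scalars\<^esub> = 1" "\<zero>\<^bsub>scalars\<^esub> = 0"
  by (simp_all add: ring_of_type_algebra_def)

lemma restrict_eq_const_iff: "(\<lambda>x\<in>B. f x) = (\<lambda>x\<in>B. z) \<longleftrightarrow> (\<forall>x\<in>B. f x = z)"
  by (auto simp: fun_eq_iff)

lemma Hom_space_simps:
  "carrier (Hom_space A M N) = lmod_hom A M N"
  "\<zero>\<^bsub>Hom_space A M N\<^esub> = (\<lambda>x\<in>carrier M. \<zero>\<^bsub>N\<^esub>)"
  "f \<oplus>\<^bsub>Hom_space A M N\<^esub> g = (\<lambda>x\<in>carrier M. f x \<oplus>\<^bsub>N\<^esub> g x)"
  "c \<odot>\<^bsub>Hom_space A M N\<^esub> f = (\<lambda>x\<in>carrier M. (c \<odot>\<^bsub>A\<^esub> \<one>\<^bsub>A\<^esub>) \<odot>\<^bsub>N\<^esub> f x)"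
  by (simp_all add: Hom_space_def)

context unital_algebra
begin

lemma scalar_mult_hom:
  assumes "left_module A M" "left_module A N" "f \<in> lmod_hom A M N"
  shows "(\<lambda>x\<in>carrier M. (c \<odot>\<^bsub>A\<^esub> \<one>) \<odot>\<^bsub>N\<^esub> f x) \<in> lmod_hom A M N"
proof -
  interpret N: left_module A N by fact
  note f = lmod_homD[OF assms(3)]
  show ?thesis
  proof (rule lmod_homI[OF _ _ _ assms(1)])
    show "(c \<odot>\<^bsub>A\<^esub> \<one>) \<odot>\<^bsub>N\<^esub> f x \<in> carrier N" if "x \<in> carrier M" for x
      using f(1)[OF that] scalar_closed by (intro N.smult_closed)
    show "(c \<odot>\<^bsub>A\<^esub> \<one>) \<odot>\<^bsub>N\<^esub> f (x \<oplus>\<^bsub>M\<^esub> y) = (c \<odot>\<^bsub>A\<^esub> \<one>) \<odot>\<^bsub>N\<^esub> f x \<oplus>\<^bsub>N\<^esub> (c \<odot>\<^bsub>A\<^esub> \<one>) \<odot>\<^bsub>N\<^esub> f y"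
      if "x \<in> carrier M" "y \<in> carrier M" for x y
      using f(1,2) that scalar_closed by (simp add: N.smult_r_distr)
    show "(c \<odot>\<^bsub>A\<^esub> \<one>) \<odot>\<^bsub>N\<^esub> f (a \<odot>\<^bsub>M\<^esub> x) = a \<odot>\<^bsub>N\<^esub> ((c \<odot>\<^bsub>A\<^esub> \<one>) \<odot>\<^bsub>N\<^esub> f x)"
      if "a \<in> carrier A" "x \<in> carrier M" for a x
      using f(1,3) that scalar_closed scalar_central[OF that(1)] N.smult_assoc by metis
  qed
qed

lemma left_module_Hom_space:
  assumes "left_module A M" "left_module A N"
  shows "left_module scalars (Hom_space A M N)"
proof -
  interpret M: left_module A M by fact
  interpret N: left_module A N by fact
  have z: "(\<lambda>x\<in>carrier M. \<zero>\<^bsub>N\<^esub>) \<in> lmod_hom A M N"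
    by (rule lmod_homI) (auto simp: N.smult_r_null M.left_module)
  show ?thesis
  proof (rule left_moduleI)
    show "abelian_group (Hom_space A M N)"
    proof (rule abelian_groupI; unfold Hom_space_simps)
      fix f g h assume f: "f \<in> lmod_hom A M N" and g: "g \<in> lmod_hom A M N" and h: "h \<in> lmod_hom A M N"
      note c = lmod_homD(1)[OF f] lmod_homD(1)[OF g] lmod_homD(1)[OF h]
      show "(\<lambda>x\<in>carrier M. f x \<oplus>\<^bsub>N\<^esub> g x) \<in> lmod_hom A M N"
        by (rule lmod_hom_add[OF f g assms])
      show "(\<lambda>x\<in>carrier M. (\<lambda>x\<in>carrier M. f x \<oplus>\<^bsub>N\<^esub> g x) x \<oplus>\<^bsub>N\<^esub> h x) =
          (\<lambda>x\<in>carrier M. f x \<oplus>\<^bsub>N\<^esub> (\<lambda>x\<in>carrier M. g x \<oplus>\<^bsub>N\<^esub> h x) x)"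
        using c by (auto simp: N.M.add.m_assoc intro!: restrict_ext)
      show "(\<lambda>x\<in>carrier M. f x \<oplus>\<^bsub>N\<^esub> g x) = (\<lambda>x\<in>carrier M. g x \<oplus>\<^bsub>N\<^esub> f x)"
        using c by (auto simp: N.M.add.m_comm intro!: restrict_ext)
    next
      show "(\<lambda>x\<in>carrier M. \<zero>\<^bsub>N\<^esub>) \<in> lmod_hom A M N" by (rule z)
    next
      fix f assume f: "f \<in> lmod_hom A M N"
      show "(\<lambda>x\<in>carrier M. (\<lambda>x\<in>carrier M. \<zero>\<^bsub>N\<^esub>) x \<oplus>\<^bsub>N\<^esub> f x) = f"
        using lmod_homD(1,4)[OF f] by (intro extensionalityI[of _ "carrier M"]) auto
      show "\<exists>g\<in>lmod_hom A M N. (\<lambda>x\<in>carrier M. g x \<oplus>\<^bsub>N\<^esub> f x) = (\<lambda>x\<in>carrier M. \<zero>\<^bsub>N\<^esub>)"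
      proof (rule bexI)
        show "(\<lambda>x\<in>carrier M. (\<lambda>x\<in>carrier M. \<zero>\<^bsub>N\<^esub>) x \<ominus>\<^bsub>N\<^esub> f x) \<in> lmod_hom A M N" (is "?g \<in> _")
          by (rule lmod_hom_diff[OF z f assms])
        show "(\<lambda>x\<in>carrier M. ?g x \<oplus>\<^bsub>N\<^esub> f x) = (\<lambda>x\<in>carrier M. \<zero>\<^bsub>N\<^esub>)"
          using lmod_homD(1)[OF f] by (auto simp: a_minus_def N.M.l_neg intro!: restrict_ext)
      qed
    qed
  next
    fix c d f assume "f \<in> carrier (Hom_space A M N)"
    then have f: "f \<in> lmod_hom A M N" by (simp add: Hom_space_simps)
    note fc = lmod_homD(1)[OF f]
    show "c \<odot>\<^bsub>Hom_space A M N\<^esub> f \<in> carrier (Hom_space A M N)"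
      unfolding Hom_space_simps by (rule scalar_mult_hom[OF assms f])
    show "(c \<oplus>\<^bsub>scalars\<^esub> d) \<odot>\<^bsub>Hom_space A M N\<^esub> f = c \<odot>\<^bsub>Hom_space A M N\<^esub> f \<oplus>\<^bsub>Hom_space A M N\<^esub> d \<odot>\<^bsub>Hom_space A M N\<^esub> f"
      unfolding Hom_space_simps
      by (rule restrict_ext) (simp add: scalar_add N.smult_l_distr scalar_closed fc)
    show "(c \<otimes>\<^bsub>scalars\<^esub> d) \<odot>\<^bsub>Hom_space A M N\<^esub> f = c \<odot>\<^bsub>Hom_space A M N\<^esub> (d \<odot>\<^bsub>Hom_space A M N\<^esub> f)"
      unfolding Hom_space_simps
      by (rule restrict_ext) (simp add: scalar_mult N.smult_assoc scalar_closed fc)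
    show "\<one>\<^bsub>scalars\<^esub> \<odot>\<^bsub>Hom_space A M N\<^esub> f = f"
      unfolding Hom_space_simps using lmod_homD(4)[OF f]
      by (intro extensionalityI[of _ "carrier M"]) (auto simp: scalar_one N.smult_one fc)
    fix g assume "g \<in> carrier (Hom_space A M N)"
    then have g: "g \<in> lmod_hom A M N" by (simp add: Hom_space_simps)
    show "c \<odot>\<^bsub>Hom_space A M N\<^esub> (f \<oplus>\<^bsub>Hom_space A M N\<^esub> g) =
        c \<odot>\<^bsub>Hom_space A M N\<^esub> f \<oplus>\<^bsub>Hom_space A M N\<^esub> c \<odot>\<^bsub>Hom_space A M N\<^esub> g"
      unfolding Hom_space_simps
      by (rule restrict_ext) (simp add: N.smult_r_distr scalar_closed fc lmod_homD(1)[OF g])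
  qed (rule ring_from_type_algebra)
qed

lemma precompose_hom:
  assumes "left_module A M" "left_module A M'" "left_module A N" "d \<in> lmod_hom A M M'"
  shows "(\<lambda>f\<in>lmod_hom A M' N. \<lambda>x\<in>carrier M. f (d x)) \<in>
    lmod_hom scalars (Hom_space A M' N) (Hom_space A M N)"
proof -
  have "restrict (\<lambda>f. \<lambda>x\<in>carrier M. f (d x)) (carrier (Hom_space A M' N)) \<in>
      lmod_hom scalars (Hom_space A M' N) (Hom_space A M N)"
  proof (rule lmod_homI[OF _ _ _ left_module_Hom_space[OF assms(2,3)]])
    show "(\<lambda>x\<in>carrier M. f (d x)) \<in> carrier (Hom_space A M N)"
      if "f \<in> carrier (Hom_space A M' N)" for f
      using that lmod_hom_comp[OF assms(4) _ assms(1)] by (simp add: Hom_space_simps)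
  qed (use lmod_homD(1)[OF assms(4)] in \<open>auto simp: Hom_space_simps intro!: restrict_ext\<close>)
  then show ?thesis by (simp add: Hom_space_simps)
qed

text \<open>Cocycles and coboundaries of \<open>Hom(P, N)\<close> in degree \<open>n + 1\<close>.\<close>

definition Hom_cocycles where
  "Hom_cocycles P D N n = {f \<in> lmod_hom A (P (Suc n)) N.
    \<forall>x\<in>carrier (P (Suc (Suc n))). f (D (Suc n) x) = \<zero>\<^bsub>N\<^esub>}"

definition Hom_coboundaries where
  "Hom_coboundaries P D N n = (\<lambda>g. \<lambda>x\<in>carrier (P (Suc n)). g (D n x)) ` lmod_hom A (P n) N"

lemma cohomology_Hom_complex:
  "cohomology (Hom_complex A K N) (int (Suc n)) =
    subquotient (Hom_space A (obj K (int (Suc n))) N)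
      (Hom_cocycles (\<lambda>n. obj K (int n)) (\<lambda>n. diff K (int (Suc n))) N n)
      (Hom_coboundaries (\<lambda>n. obj K (int n)) (\<lambda>n. diff K (int (Suc n))) N n)"
proof -
  have e: "int (Suc n) - 1 = int n" "int (Suc n) + 1 = int (Suc (Suc n))" "int n + 1 = int (Suc n)" by auto
  show ?thesis
    unfolding cohomology_def Hom_complex_def graded_complex.simps e Hom_cocycles_def
      Hom_coboundaries_def Hom_space_simps restrict_eq_const_iff ..
qed

lemma
  assumes res: "lmod_resolution A P D \<epsilon> M" and N: "left_module A N"
  shows Hom_cocycles_submodule: "submodule (Hom_cocycles P D N n) scalars (Hom_space A (P (Suc n)) N)"
    and Hom_coboundaries_submodule:
      "submodule (Hom_coboundaries P D N n) scalars (Hom_space A (P (Suc n)) N)"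
    and Hom_coboundaries_subset: "Hom_coboundaries P D N n \<subseteq> Hom_cocycles P D N n"
proof -
  interpret K: lmod_resolution A P D \<epsilon> M by fact
  note S = left_module_Hom_space[OF K.P N]
  have "Hom_cocycles P D N n = {f \<in> carrier (Hom_space A (P (Suc n)) N).
      (\<lambda>f\<in>lmod_hom A (P (Suc n)) N. \<lambda>x\<in>carrier (P (Suc (Suc n))). f (D (Suc n) x)) f =
        \<zero>\<^bsub>Hom_space A (P (Suc (Suc n))) N\<^esub>}"
    unfolding Hom_cocycles_def Hom_space_simps by (rule Collect_cong) (simp add: restrict_eq_const_iff cong: conj_cong)
  then show "submodule (Hom_cocycles P D N n) scalars (Hom_space A (P (Suc n)) N)"
    using kernel_submodule[OF S S precompose_hom[OF K.P K.P N K.D]] by simp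
  have "Hom_coboundaries P D N n = (\<lambda>f\<in>lmod_hom A (P n) N. \<lambda>x\<in>carrier (P (Suc n)). f (D n x)) `
      carrier (Hom_space A (P n) N)"
    unfolding Hom_coboundaries_def Hom_space_simps by simp
  then show "submodule (Hom_coboundaries P D N n) scalars (Hom_space A (P (Suc n)) N)"
    using image_submodule[OF S S precompose_hom[OF K.P K.P N K.D] left_module.carrier_submodule[OF S]]
    by simp
  show "Hom_coboundaries P D N n \<subseteq> Hom_cocycles P D N n"
  proof
    fix u assume "u \<in> Hom_coboundaries P D N n"
    then obtain g where g: "g \<in> lmod_hom A (P n) N" "u = (\<lambda>x\<in>carrier (P (Suc n)). g (D n x))"
      by (auto simp: Hom_coboundaries_def)
    have "u \<in> lmod_hom A (P (Suc n)) N" unfolding g(2) by (rule lmod_hom_comp[OF K.D g(1) K.P])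
    moreover have "u (D (Suc n) x) = \<zero>\<^bsub>N\<^esub>" if "x \<in> carrier (P (Suc (Suc n)))" for x
      using K.D_closed[OF that] K.D_D[OF that] lmod_hom_zero[OF K.P N g(1)] by (simp add: g(2))
    ultimately show "u \<in> Hom_cocycles P D N n" by (simp add: Hom_cocycles_def)
  qed
qed

text \<open>Precomposition with \<open>\<psi>\<close> is injective on classes: if
  \<open>u \<psi> = g D'\<close>, then writing \<open>x\<close> through the homotopy
  \<open>h\<close> and using \<open>u D = 0\<close> gives \<open>u = (u h + g \<phi>) D\<close>. It
  is onto because the other homotopy gives \<open>y = (y k) D' + (y \<phi>) \<psi>\<close> for every
  cocycle \<open>y\<close>.\<close>

lemma Hom_cohomology_iso:
  assumes K: "lmod_resolution A P D \<epsilon> M" and L: "lmod_resolution A P' D' \<epsilon>' M" and N: "left_module A N"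
  shows "lmod_iso scalars
    (subquotient (Hom_space A (P (Suc n)) N) (Hom_cocycles P D N n) (Hom_coboundaries P D N n))
    (subquotient (Hom_space A (P' (Suc n)) N) (Hom_cocycles P' D' N n) (Hom_coboundaries P' D' N n))"
proof -
  interpret K: lmod_resolution A P D \<epsilon> M by fact
  interpret L: lmod_resolution A P' D' \<epsilon>' M by fact
  interpret N: left_module A N by fact
  obtain \<phi> where \<phi>: "\<And>n. \<phi> n \<in> lmod_hom A (P n) (P' n)"
    "\<And>x. x \<in> carrier (P 0) \<Longrightarrow> \<epsilon>' (\<phi> 0 x) = \<epsilon> x"
    "\<And>n x. x \<in> carrier (P (Suc n)) \<Longrightarrow> D' n (\<phi> (Suc n) x) = \<phi> n (D n x)"
    using comparison_map[OF K L] by blast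
  obtain \<psi> where \<psi>: "\<And>n. \<psi> n \<in> lmod_hom A (P' n) (P n)"
    "\<And>x. x \<in> carrier (P' 0) \<Longrightarrow> \<epsilon> (\<psi> 0 x) = \<epsilon>' x"
    "\<And>n x. x \<in> carrier (P' (Suc n)) \<Longrightarrow> D n (\<psi> (Suc n) x) = \<psi> n (D' n x)"
    using comparison_map[OF L K] by blast
  obtain h where h: "\<And>n. h n \<in> lmod_hom A (P n) (P (Suc n))"
    "\<And>n x. x \<in> carrier (P (Suc n)) \<Longrightarrow> x = (D (Suc n) (h (Suc n) x) \<oplus>\<^bsub>P (Suc n)\<^esub> h n (D n x))
      \<oplus>\<^bsub>P (Suc n)\<^esub> \<psi> (Suc n) (\<phi> (Suc n) x)"
    using comparison_homotopy_inverse[OF K L \<phi> \<psi>] by blast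
  obtain k where k: "\<And>n. k n \<in> lmod_hom A (P' n) (P' (Suc n))"
    "\<And>n x. x \<in> carrier (P' (Suc n)) \<Longrightarrow> x = (D' (Suc n) (k (Suc n) x) \<oplus>\<^bsub>P' (Suc n)\<^esub> k n (D' n x))
      \<oplus>\<^bsub>P' (Suc n)\<^esub> \<phi> (Suc n) (\<psi> (Suc n) x)"
    using comparison_homotopy_inverse[OF L K \<psi> \<phi>] by blast
  note c = K.D_closed L.D_closed lmod_homD(1)[OF \<phi>(1)] lmod_homD(1)[OF \<psi>(1)] lmod_homD(1)[OF h(1)]
    lmod_homD(1)[OF k(1)]
  let ?f = "\<lambda>u. \<lambda>x\<in>carrier (P' (Suc n)). u (\<psi> (Suc n) x)"
  show ?thesis
  proof (rule lmod_iso_subquotient[where f = ?f])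
    fix u v a assume u: "u \<in> Hom_cocycles P D N n"
    have uh: "u \<in> lmod_hom A (P (Suc n)) N" and uD: "\<And>x. x \<in> carrier (P (Suc (Suc n))) \<Longrightarrow> u (D (Suc n) x) = \<zero>\<^bsub>N\<^esub>"
      using u by (auto simp: Hom_cocycles_def)
    have fh: "?f u \<in> lmod_hom A (P' (Suc n)) N" by (rule lmod_hom_comp[OF \<psi>(1) uh L.P])
    show "?f u \<in> Hom_cocycles P' D' N n"
      using fh c by (auto simp: Hom_cocycles_def \<psi>(3)[symmetric] uD)
    show "?f u \<in> Hom_coboundaries P' D' N n \<longleftrightarrow> u \<in> Hom_coboundaries P D N n"
    proof
      assume "?f u \<in> Hom_coboundaries P' D' N n"
      then obtain g where g: "g \<in> lmod_hom A (P' n) N" "?f u = (\<lambda>x\<in>carrier (P' (Suc n)). g (D' n x))"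
        by (auto simp: Hom_coboundaries_def)
      then have g': "u (\<psi> (Suc n) x) = g (D' n x)" if "x \<in> carrier (P' (Suc n))" for x
        using that by (metis restrict_apply')
      let ?w = "\<lambda>x\<in>carrier (P n). (\<lambda>x\<in>carrier (P n). u (h n x)) x \<oplus>\<^bsub>N\<^esub> (\<lambda>x\<in>carrier (P n). g (\<phi> n x)) x"
      have w: "?w \<in> lmod_hom A (P n) N"
        by (rule lmod_hom_add[OF lmod_hom_comp[OF h(1) uh K.P] lmod_hom_comp[OF \<phi>(1) g(1) K.P] K.P N])
      have "u = (\<lambda>x\<in>carrier (P (Suc n)). ?w (D n x))"
      proof (rule extensionalityI[OF lmod_homD(4)[OF uh]])
        fix x assume x: "x \<in> carrier (P (Suc n))"
        interpret Q: left_module A "P (Suc n)" by (rule K.P)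
        have cc: "D (Suc n) (h (Suc n) x) \<in> carrier (P (Suc n))" "h n (D n x) \<in> carrier (P (Suc n))"
          "\<psi> (Suc n) (\<phi> (Suc n) x) \<in> carrier (P (Suc n))" "h (Suc n) x \<in> carrier (P (Suc (Suc n)))"
          "\<phi> (Suc n) x \<in> carrier (P' (Suc n))" "D n x \<in> carrier (P n)"
          "D (Suc n) (h (Suc n) x) \<oplus>\<^bsub>P (Suc n)\<^esub> h n (D n x) \<in> carrier (P (Suc n))"
          using x c by auto
        have "u x = u ((D (Suc n) (h (Suc n) x) \<oplus>\<^bsub>P (Suc n)\<^esub> h n (D n x)) \<oplus>\<^bsub>P (Suc n)\<^esub> \<psi> (Suc n) (\<phi> (Suc n) x))"
          using h(2)[OF x] by simp
        also have "\<dots> = (\<zero>\<^bsub>N\<^esub> \<oplus>\<^bsub>N\<^esub> u (h n (D n x))) \<oplus>\<^bsub>N\<^esub> g (D' n (\<phi> (Suc n) x))"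
          using cc by (simp add: lmod_homD(2)[OF uh] uD g')
        also have "\<dots> = ?w (D n x)"
          using cc lmod_homD(1)[OF uh] by (simp add: \<phi>(3)[OF x])
        finally show "u x = (\<lambda>x\<in>carrier (P (Suc n)). ?w (D n x)) x" using x by simp
      qed simp
      then show "u \<in> Hom_coboundaries P D N n" using w unfolding Hom_coboundaries_def by blast
    next
      assume "u \<in> Hom_coboundaries P D N n"
      then obtain g where g: "g \<in> lmod_hom A (P n) N" "u = (\<lambda>x\<in>carrier (P (Suc n)). g (D n x))"
        by (auto simp: Hom_coboundaries_def)
      have "?f u = (\<lambda>x\<in>carrier (P' (Suc n)). (\<lambda>x\<in>carrier (P' n). g (\<psi> n x)) (D' n x))"
        by (rule restrict_ext) (use c in \<open>simp add: g(2) \<psi>(3)\<close>)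
      moreover have "(\<lambda>x\<in>carrier (P' n). g (\<psi> n x)) \<in> lmod_hom A (P' n) N"
        by (rule lmod_hom_comp[OF \<psi>(1) g(1) L.P])
      ultimately show "?f u \<in> Hom_coboundaries P' D' N n" unfolding Hom_coboundaries_def by blast
    qed
    show "?f (u \<oplus>\<^bsub>Hom_space A (P (Suc n)) N\<^esub> v) = ?f u \<oplus>\<^bsub>Hom_space A (P' (Suc n)) N\<^esub> ?f v"
      using c by (auto simp: Hom_space_simps intro!: restrict_ext)
    show "?f (a \<odot>\<^bsub>Hom_space A (P (Suc n)) N\<^esub> u) = a \<odot>\<^bsub>Hom_space A (P' (Suc n)) N\<^esub> ?f u"
      using c by (auto simp: Hom_space_simps intro!: restrict_ext)
  next
    fix y assume y: "y \<in> Hom_cocycles P' D' N n"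
    have yh: "y \<in> lmod_hom A (P' (Suc n)) N" and yD: "\<And>x. x \<in> carrier (P' (Suc (Suc n))) \<Longrightarrow> y (D' (Suc n) x) = \<zero>\<^bsub>N\<^esub>"
      using y by (auto simp: Hom_cocycles_def)
    let ?u = "\<lambda>x\<in>carrier (P (Suc n)). y (\<phi> (Suc n) x)"
    have u: "?u \<in> Hom_cocycles P D N n"
      using lmod_hom_comp[OF \<phi>(1) yh K.P] c by (auto simp: Hom_cocycles_def \<phi>(3)[symmetric] yD)
    let ?w = "\<lambda>x\<in>carrier (P' n). y (k n x)"
    have w: "?w \<in> lmod_hom A (P' n) N" by (rule lmod_hom_comp[OF k(1) yh L.P])
    let ?b = "\<lambda>x\<in>carrier (P' (Suc n)). ?w (D' n x)"
    have "y = ?b \<oplus>\<^bsub>Hom_space A (P' (Suc n)) N\<^esub> ?f ?u" unfolding Hom_space_simps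
    proof (rule extensionalityI[OF lmod_homD(4)[OF yh]])
      fix x assume x: "x \<in> carrier (P' (Suc n))"
      interpret Q: left_module A "P' (Suc n)" by (rule L.P)
      have cc: "D' (Suc n) (k (Suc n) x) \<in> carrier (P' (Suc n))" "k n (D' n x) \<in> carrier (P' (Suc n))"
        "\<phi> (Suc n) (\<psi> (Suc n) x) \<in> carrier (P' (Suc n))" "k (Suc n) x \<in> carrier (P' (Suc (Suc n)))"
        "\<psi> (Suc n) x \<in> carrier (P (Suc n))" "D' n x \<in> carrier (P' n)"
        "D' (Suc n) (k (Suc n) x) \<oplus>\<^bsub>P' (Suc n)\<^esub> k n (D' n x) \<in> carrier (P' (Suc n))"
        using x c by auto
      have "y x = y ((D' (Suc n) (k (Suc n) x) \<oplus>\<^bsub>P' (Suc n)\<^esub> k n (D' n x)) \<oplus>\<^bsub>P' (Suc n)\<^esub> \<phi> (Suc n) (\<psi> (Suc n) x))"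
        using k(2)[OF x] by simp
      also have "\<dots> = (\<zero>\<^bsub>N\<^esub> \<oplus>\<^bsub>N\<^esub> y (k n (D' n x))) \<oplus>\<^bsub>N\<^esub> y (\<phi> (Suc n) (\<psi> (Suc n) x))"
        using cc by (simp add: lmod_homD(2)[OF yh] yD)
      finally show "y x = (\<lambda>x\<in>carrier (P' (Suc n)). ?b x \<oplus>\<^bsub>N\<^esub> ?f ?u x) x"
        using x cc lmod_homD(1)[OF yh] by simp
    qed simp
    moreover have "?b \<in> Hom_coboundaries P' D' N n" using w unfolding Hom_coboundaries_def by blast
    ultimately show "\<exists>u\<in>Hom_cocycles P D N n. \<exists>b\<in>Hom_coboundaries P' D' N n.
        y = b \<oplus>\<^bsub>Hom_space A (P' (Suc n)) N\<^esub> ?f u" using u by blast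
  qed (intro left_module_Hom_space K.P L.P N Hom_cocycles_submodule[OF K N] Hom_cocycles_submodule[OF L N]
      Hom_coboundaries_submodule[OF K N] Hom_coboundaries_submodule[OF L N]
      Hom_coboundaries_subset[OF K N] Hom_coboundaries_subset[OF L N])+
qed

end

section \<open>Transport of a resolution to another carrier type\<close>

definition push_module :: "('x \<Rightarrow> 'y) \<Rightarrow> ('a, 'x) module \<Rightarrow> ('a, 'y) module" where
  "push_module \<tau> M = \<lparr>carrier = \<tau> ` carrier M, monoid.mult = undefined, one = undefined,
    zero = \<tau> \<zero>\<^bsub>M\<^esub>,
    add = (\<lambda>x y. \<tau> (inv_into (carrier M) \<tau> x \<oplus>\<^bsub>M\<^esub> inv_into (carrier M) \<tau> y)),
    module.smult = (\<lambda>a x. \<tau> (a \<odot>\<^bsub>M\<^esub> inv_into (carrier M) \<tau> x))\<rparr>"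

lemma
  assumes M: "left_module R M" and \<tau>: "inj_on \<tau> (carrier M)"
  shows left_module_push: "left_module R (push_module \<tau> M)"
    and push_hom: "restrict \<tau> (carrier M) \<in> lmod_hom R M (push_module \<tau> M)"
    and pull_hom: "restrict (inv_into (carrier M) \<tau>) (\<tau> ` carrier M) \<in> lmod_hom R (push_module \<tau> M) M"
proof -
  interpret left_module R M by fact
  show *: "left_module R (push_module \<tau> M)"
    by (rule left_module_image[OF M, of \<tau>])
      (use \<tau> in \<open>simp_all add: push_module_def smult_closed\<close>)
  show "restrict \<tau> (carrier M) \<in> lmod_hom R M (push_module \<tau> M)"
    by (rule lmod_homI[OF _ _ _ M]) (use \<tau> in \<open>simp_all add: push_module_def\<close>)
  have "restrict (inv_into (carrier M) \<tau>) (carrier (push_module \<tau> M)) \<in> lmod_hom R (push_module \<tau> M) M"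
    by (rule lmod_homI[OF _ _ _ *])
      (use \<tau> in \<open>auto simp: push_module_def smult_closed\<close>)
  then show "restrict (inv_into (carrier M) \<tau>) (\<tau> ` carrier M) \<in> lmod_hom R (push_module \<tau> M) M"
    by (simp add: push_module_def)
qed

lemma fg_projective_push:
  assumes P: "fg_projective R M" and \<tau>: "inj_on \<tau> (carrier M)"
  shows "fg_projective R (push_module \<tau> M)"
proof -
  have M: "left_module R M" using P by (simp add: fg_projective_def)
  obtain n :: nat and s p where s: "s \<in> lmod_hom R M (direct_sum {..<n} (\<lambda>_. regular_module R))"
    and p: "p \<in> lmod_hom R (direct_sum {..<n} (\<lambda>_. regular_module R)) M"
    and ps: "\<And>x. x \<in> carrier M \<Longrightarrow> p (s x) = x"
    using P by (auto simp: fg_projective_def)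
  let ?F = "direct_sum {..<n} (\<lambda>_. regular_module R)"
  let ?i = "restrict (inv_into (carrier M) \<tau>) (\<tau> ` carrier M)"
  have F: "left_module R ?F"
    using left_module.axioms(1)[OF M] left_module_regular by (intro left_module_direct_sum)
  let ?s = "\<lambda>x\<in>carrier (push_module \<tau> M). s (?i x)"
  let ?p = "\<lambda>v\<in>carrier ?F. restrict \<tau> (carrier M) (p v)"
  have "?s \<in> lmod_hom R (push_module \<tau> M) ?F"
    by (rule lmod_hom_comp[OF pull_hom[OF M \<tau>] s left_module_push[OF M \<tau>]])
  moreover have "?p \<in> lmod_hom R ?F (push_module \<tau> M)"
    by (rule lmod_hom_comp[OF p push_hom[OF M \<tau>] F])
  moreover have "\<forall>x\<in>carrier (push_module \<tau> M). ?p (?s x) = x"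
    using \<tau> ps lmod_homD(1)[OF s] by (auto simp: push_module_def)
  ultimately show ?thesis unfolding fg_projective_def using left_module_push[OF M \<tau>] by blast
qed

text \<open>Supplies a resolution over the carrier type that is fixed in
  \<open>chosen_resolution\<close>; without one, the choice made there would say nothing.\<close>

lemma projective_resolution_push:
  fixes K :: "('a, 'x) graded_complex" and \<tau> :: "int \<Rightarrow> 'x \<Rightarrow> 'y"
  assumes K: "projective_resolution R K \<epsilon> M" and M: "left_module R M"
    and \<tau>: "\<And>q. inj_on (\<tau> q) (carrier (obj K q))"
  shows "\<exists>(K' :: ('a, 'y) graded_complex) \<epsilon>'. projective_resolution R K' \<epsilon>' M"
proof -
  let ?i = "\<lambda>q. restrict (inv_into (carrier (obj K q)) (\<tau> q)) (\<tau> q ` carrier (obj K q))"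
  let ?P = "\<lambda>q. push_module (\<tau> q) (obj K q)"
  \<comment> \<open>The nested restrictions mirror two applications of \<open>lmod_hom_comp\<close>,
    from which linearity of \<open>dd\<close> is read off.\<close>
  define dd where "dd q = (\<lambda>x\<in>carrier (?P q). restrict (\<tau> (q - 1)) (carrier (obj K (q - 1)))
      ((\<lambda>x\<in>carrier (?P q). diff K q (?i q x)) x))" for q
  define ee where "ee = (\<lambda>x\<in>carrier (?P 0). \<epsilon> (?i 0 x))"
  have P: "fg_projective R (obj K q)" and d: "diff K q \<in> lmod_hom R (obj K q) (obj K (q - 1))"
    and eps: "\<epsilon> \<in> lmod_hom R (obj K 0) M" "\<epsilon> ` carrier (obj K 0) = carrier M"
      "{x \<in> carrier (obj K 0). \<epsilon> x = \<zero>\<^bsub>M\<^esub>} = diff K 1 ` carrier (obj K 1)"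
    and neg: "q < 0 \<Longrightarrow> carrier (obj K q) = {\<zero>\<^bsub>obj K q\<^esub>}"
    and ex: "q \<ge> 1 \<Longrightarrow> {x \<in> carrier (obj K q). diff K q x = \<zero>\<^bsub>obj K (q - 1)\<^esub>}
        = diff K (q + 1) ` carrier (obj K (q + 1))" for q
    using K by (auto simp: projective_resolution_def)
  have L: "left_module R (obj K q)" for q using P[of q] by (simp add: fg_projective_def)
  have C: "carrier (?P q) = \<tau> q ` carrier (obj K q)" "\<zero>\<^bsub>?P q\<^esub> = \<tau> q \<zero>\<^bsub>obj K q\<^esub>" for q
    by (simp_all add: push_module_def)
  have dc: "diff K q x \<in> carrier (obj K (q - 1))" if "x \<in> carrier (obj K q)" for q x
    using lmod_homD(1)[OF d that] .
  have zc: "\<zero>\<^bsub>obj K q\<^esub> \<in> carrier (obj K q)" for q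
    using left_module.axioms(2)[OF L[of q]] by (rule abelian_groupE(2))
  have dt: "dd q (\<tau> q x) = \<tau> (q - 1) (diff K q x)" if "x \<in> carrier (obj K q)" for q x
    using that \<tau>[of q] dc[OF that] by (simp add: C dd_def)
  have et: "ee (\<tau> 0 x) = \<epsilon> x" if "x \<in> carrier (obj K 0)" for x
    using that \<tau>[of 0] by (simp add: C ee_def)
  have im: "dd (q + 1) ` carrier (?P (q + 1)) = \<tau> q ` (diff K (q + 1) ` carrier (obj K (q + 1)))" for q
    unfolding C(1) image_image using dt[of _ "q + 1"] by (intro image_cong) simp_all
  have z0: "\<tau> q x = \<tau> q \<zero>\<^bsub>obj K q\<^esub> \<longleftrightarrow> x = \<zero>\<^bsub>obj K q\<^esub>" if "x \<in> carrier (obj K q)" for q x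
    using inj_on_eq_iff[OF \<tau> that zc] .
  have "projective_resolution R \<lparr>obj = ?P, diff = dd\<rparr> ee M"
    unfolding projective_resolution_def graded_complex.simps
  proof (intro conjI allI impI)
    show "fg_projective R (?P q)" for q by (rule fg_projective_push[OF P \<tau>])
    show "carrier (?P q) = {\<zero>\<^bsub>?P q\<^esub>}" if "q < 0" for q using neg[OF that] by (simp add: C)
    show "dd q \<in> lmod_hom R (?P q) (?P (q - 1))" for q
      unfolding dd_def by (intro lmod_hom_comp[OF lmod_hom_comp[OF pull_hom[OF L \<tau>] d left_module_push[OF L \<tau>]]
            push_hom[OF L \<tau>] left_module_push[OF L \<tau>]])
    show "ee \<in> lmod_hom R (?P 0) M"
      unfolding ee_def by (rule lmod_hom_comp[OF pull_hom[OF L \<tau>] eps(1) left_module_push[OF L \<tau>]])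
    show "ee ` carrier (?P 0) = carrier M"
      unfolding C(1) image_image eps(2)[symmetric] using et by (intro image_cong) simp_all
    show "{x \<in> carrier (?P q). dd q x = \<zero>\<^bsub>?P (q - 1)\<^esub>} = dd (q + 1) ` carrier (?P (q + 1))"
      if "1 \<le> q" for q
    proof -
      have "{x \<in> carrier (?P q). dd q x = \<zero>\<^bsub>?P (q - 1)\<^esub>} =
          \<tau> q ` {x \<in> carrier (obj K q). diff K q x = \<zero>\<^bsub>obj K (q - 1)\<^esub>}"
        using dt z0[OF dc] unfolding C by fastforce
      then show ?thesis unfolding im ex[OF that] .
    qed
    have "{x \<in> carrier (?P 0). ee x = \<zero>\<^bsub>M\<^esub>} = \<tau> 0 ` {x \<in> carrier (obj K 0). \<epsilon> x = \<zero>\<^bsub>M\<^esub>}"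
      using et unfolding C by fastforce
    then show "{x \<in> carrier (?P 0). ee x = \<zero>\<^bsub>M\<^esub>} = dd 1 ` carrier (?P 1)"
      using im[of 0] unfolding eps(3) by simp
  qed
  then show ?thesis by blast
qed

text \<open>The embedding \<open>\<tau>\<close> shows that \<open>chosen_resolution\<close> picks a
  true resolution, which is then compared with \<open>K\<close>. In a positive degree
  \<open>Suc k\<close> the incoming cochains sit in the natural degree \<open>k\<close>, so the
  truncated complexes suffice.\<close>

theorem (in unital_algebra) Ext_iso_cohomology:
  fixes K :: "('a, 'x) graded_complex" and M :: "('a, 'm) module" and N :: "('a, 'n) module"
    and \<tau> :: "int \<Rightarrow> 'x \<Rightarrow> nat \<Rightarrow> 'a"
  assumes K: "projective_resolution A K \<epsilon> M" and M: "left_module A M" and N: "left_module A N"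
    and \<tau>: "\<And>q. inj_on (\<tau> q) (carrier (obj K q))" and n: "n \<ge> 1"
  shows "lmod_iso scalars (Ext A n M N) (cohomology (Hom_complex A K N) (int n))"
    and "left_module scalars (Ext A n M N)"
    and "left_module scalars (cohomology (Hom_complex A K N) (int n))"
proof -
  obtain k where k: "n = Suc k" using n by (cases n) auto
  have "\<exists>K' \<epsilon>'. projective_resolution A (K' :: ('a, nat \<Rightarrow> 'a) graded_complex) \<epsilon>' M"
    by (rule projective_resolution_push[OF K M \<tau>])
  then have "\<exists>\<epsilon>'. projective_resolution A (chosen_resolution A M) \<epsilon>' M"
    unfolding chosen_resolution_def by (rule someI_ex)
  then obtain \<epsilon>' where \<epsilon>': "projective_resolution A (chosen_resolution A M) \<epsilon>' M" by blast
  have R: "lmod_resolution A (\<lambda>n. obj L (int n)) (\<lambda>n. diff L (int (Suc n))) e M"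
    if "projective_resolution A L e M" for L :: "('a, 'z) graded_complex" and e
    by (rule lmod_resolution.intro[OF nat_resolution_of_resolution[OF that] ring_axioms M])
  have S: "left_module scalars (cohomology (Hom_complex A L N) (int n))"
    if L: "projective_resolution A L e M" for L :: "('a, 'z) graded_complex" and e
    unfolding k cohomology_Hom_complex
    by (intro left_module_subquotient left_module_Hom_space lmod_resolution.P[OF R[OF L]] N
        Hom_cocycles_submodule[OF R[OF L] N] Hom_coboundaries_submodule[OF R[OF L] N]
        Hom_coboundaries_subset[OF R[OF L] N])
  show "left_module scalars (Ext A n M N)" unfolding Ext_def by (rule S[OF \<epsilon>'])
  show "left_module scalars (cohomology (Hom_complex A K N) (int n))" by (rule S[OF K])
  show "lmod_iso scalars (Ext A n M N) (cohomology (Hom_complex A K N) (int n))"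
    unfolding Ext_def k cohomology_Hom_complex by (rule Hom_cohomology_iso[OF R[OF \<epsilon>'] R[OF K] N])
qed

section \<open>Signed sums over faces\<close>

text \<open>For \<open>i\<close> outside \<open>F\<close> this counts the place at which
  \<open>i\<close> would be inserted, so the same sign serves for deleting \<open>i\<close> from a
  face and for adding it.\<close>

definition pos_sign :: "nat \<Rightarrow> nat set \<Rightarrow> 'k::comm_ring_1" where
  "pos_sign i F = (-1) ^ card {j \<in> F. j < i}"

lemma pos_sign_square: "pos_sign i F * pos_sign i F = 1"
  by (simp add: pos_sign_def flip: power_add)

lemma pos_sign_remove: "pos_sign i (F - {i}) = pos_sign i F"
proof -
  have "{j \<in> F - {i}. j < i} = {j \<in> F. j < i}" by auto
  then show ?thesis by (simp add: pos_sign_def)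
qed

lemma pos_sign_insert_self: "pos_sign i (insert i F) = pos_sign i F"
proof -
  have "{j \<in> insert i F. j < i} = {j \<in> F. j < i}" by auto
  then show ?thesis by (simp add: pos_sign_def)
qed

lemma pos_sign_insert:
  assumes "finite F" "b \<notin> F"
  shows "pos_sign a (insert b F) = (if b < a then - pos_sign a F else pos_sign a F)"
proof -
  have "{j \<in> insert b F. j < a} = (if b < a then insert b {j \<in> F. j < a} else {j \<in> F. j < a})"
    by auto
  then show ?thesis using assms by (simp add: pos_sign_def)
qed

text \<open>Exactly one of \<open>a < b\<close> and \<open>b < a\<close> holds, so exactly one of
  the two insertions changes a sign. The first form yields that differentials square to zero, the
  next one the cancellation in the cone identities.\<close>

lemma pos_sign_swap:
  assumes "finite J" "a \<noteq> b" "a \<notin> J" "b \<notin> J"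
  shows "pos_sign a (insert b J) * pos_sign b J = - (pos_sign b (insert a J) * pos_sign a J)"
  using assms by (auto simp: pos_sign_insert)

lemma pos_sign_swap':
  assumes "finite J" "a \<noteq> b" "a \<notin> J" "b \<notin> J"
  shows "pos_sign a (insert b J) * pos_sign b (insert a J) = - (pos_sign a J * pos_sign b J)"
  using assms by (auto simp: pos_sign_insert)

text \<open>Terms with \<open>j < i\<close> are paired with terms with \<open>i < j\<close>.
  Cancellation in pairs avoids halving a sum, so characteristic 2 is included.\<close>

lemma sum_antisymmetric:
  fixes g :: "'i::linorder \<Rightarrow> 'i \<Rightarrow> 'b::ab_group_add"
  assumes fin: "finite A" and g: "\<And>i j. \<lbrakk>i \<in> A; j \<in> A; i \<noteq> j\<rbrakk> \<Longrightarrow> g i j = - g j i"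
  shows "(\<Sum>i\<in>A. \<Sum>j\<in>A - {i}. g i j) = 0"
proof -
  have split: "(\<Sum>j\<in>A - {i}. g i j) = (\<Sum>j\<in>{j \<in> A. j < i}. g i j) + (\<Sum>j\<in>{j \<in> A. i < j}. g i j)" for i
  proof -
    have "A - {i} = {j \<in> A. j < i} \<union> {j \<in> A. i < j}" by auto
    moreover have "{j \<in> A. j < i} \<inter> {j \<in> A. i < j} = {}" by auto
    ultimately show ?thesis using fin by (simp add: sum.union_disjoint)
  qed
  have "(\<Sum>i\<in>A. \<Sum>j\<in>{j \<in> A. i < j}. g i j) = (\<Sum>j\<in>A. \<Sum>i\<in>{i \<in> A. i < j}. g i j)"
    by (rule sum.swap_restrict[OF fin fin])
  also have "\<dots> = (\<Sum>j\<in>A. - (\<Sum>i\<in>{i \<in> A. i < j}. g j i))"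
    unfolding sum_negf[symmetric] by (intro sum.cong refl g) auto
  finally show ?thesis by (simp add: split sum.distrib sum_negf)
qed

text \<open>Read a function on finite sets as the coefficients of exterior monomials, and let
  \<open>e\<close> be the formal sum of all basis vectors. Then this is left multiplication by
  \<open>e\<close>, and \<open>cocone a\<close> is contraction with the dual of the vector
  \<open>a\<close>. Dually, \<open>face_sum\<close> is a contraction, namely the boundary map of the
  augmented simplex on \<open>I\<close>, and \<open>cone a\<close> is multiplication by the vector
  \<open>a\<close>. No degrees are mentioned, which frees the identities from index
  bookkeeping.\<close>

definition coface_sum :: "(nat set \<Rightarrow> 'k::comm_ring_1) \<Rightarrow> nat set \<Rightarrow> 'k" where
  "coface_sum \<phi> F = (\<Sum>i\<in>F. pos_sign i F * \<phi> (F - {i}))"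

definition face_sum :: "nat set \<Rightarrow> (nat set \<Rightarrow> 'k::comm_ring_1) \<Rightarrow> nat set \<Rightarrow> 'k" where
  "face_sum I h J = (\<Sum>i\<in>I - J. pos_sign i J * h (insert i J))"

definition cocone :: "nat \<Rightarrow> (nat set \<Rightarrow> 'k::comm_ring_1) \<Rightarrow> nat set \<Rightarrow> 'k" where
  "cocone a \<phi> F = (if a \<in> F then 0 else pos_sign a F * \<phi> (insert a F))"

definition cone :: "nat \<Rightarrow> (nat set \<Rightarrow> 'k::comm_ring_1) \<Rightarrow> nat set \<Rightarrow> 'k" where
  "cone a h J = (if a \<in> J then pos_sign a J * h (J - {a}) else 0)"

lemma coface_sum_coface_sum:
  assumes "finite F" shows "coface_sum (coface_sum \<phi>) F = 0"
proof -
  have "coface_sum (coface_sum \<phi>) F =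
      (\<Sum>i\<in>F. \<Sum>j\<in>F - {i}. pos_sign i F * pos_sign j (F - {i}) * \<phi> (F - {i} - {j}))"
    by (simp add: coface_sum_def sum_distrib_left mult.assoc)
  also have "\<dots> = 0"
  proof (rule sum_antisymmetric[OF assms])
    fix i j assume ij: "i \<in> F" "j \<in> F" "i \<noteq> j"
    let ?J = "F - {i} - {j}"
    have "insert j ?J = F - {i}" "insert i ?J = F - {j}" "F - {j} - {i} = ?J" using ij by auto
    then show "pos_sign i F * pos_sign j (F - {i}) * \<phi> (F - {i} - {j}) =
        - (pos_sign j F * pos_sign i (F - {j}) * \<phi> (F - {j} - {i}))"
      using pos_sign_swap[of ?J i j, where 'a = 'a] ij assms
        pos_sign_remove[of i F, where 'a = 'a] pos_sign_remove[of j F, where 'a = 'a]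
        pos_sign_remove[of i "F - {j}", where 'a = 'a] pos_sign_remove[of j "F - {i}", where 'a = 'a]
      by simp
  qed
  finally show ?thesis .
qed

text \<open>The anticommutator of a contraction and a multiplication is the pairing of the two
  vectors, here 1. If \<open>a\<close> lies in \<open>F\<close>, only the summand
  \<open>i = a\<close> survives; otherwise the summand of \<open>a\<close> yields
  \<open>\<phi> F\<close> and all others cancel.\<close>

lemma coface_sum_cocone:
  assumes F: "finite F"
  shows "coface_sum (cocone a \<phi>) F + cocone a (coface_sum \<phi>) F = \<phi> F"
proof (cases "a \<in> F")
  case True
  have "coface_sum (cocone a \<phi>) F = (\<Sum>i\<in>F. if i = a then pos_sign a F * cocone a \<phi> (F - {a}) else 0)"
    unfolding coface_sum_def using True by (intro sum.cong refl) (auto simp: cocone_def)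
  also have "\<dots> = \<phi> F"
    using True F by (simp add: cocone_def pos_sign_remove insert_absorb pos_sign_square flip: mult.assoc)
  finally show ?thesis using True by (simp add: cocone_def)
next
  case False
  have 1: "coface_sum (cocone a \<phi>) F =
      (\<Sum>i\<in>F. pos_sign i F * pos_sign a (F - {i}) * \<phi> (insert a (F - {i})))"
    unfolding coface_sum_def using False by (intro sum.cong refl) (simp add: cocone_def mult.assoc)
  have "cocone a (coface_sum \<phi>) F = pos_sign a F * (pos_sign a (insert a F) * \<phi> (insert a F - {a}) +
      (\<Sum>i\<in>F. pos_sign i (insert a F) * \<phi> (insert a F - {i})))"
    using False F by (simp add: cocone_def coface_sum_def)
  also have "\<dots> = \<phi> F + (\<Sum>i\<in>F. pos_sign a F * pos_sign i (insert a F) * \<phi> (insert a F - {i}))"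
    using False
    by (simp add: distrib_left sum_distrib_left pos_sign_insert_self pos_sign_square flip: mult.assoc)
  also have "(\<Sum>i\<in>F. pos_sign a F * pos_sign i (insert a F) * \<phi> (insert a F - {i})) =
      - (\<Sum>i\<in>F. pos_sign i F * pos_sign a (F - {i}) * \<phi> (insert a (F - {i})))"
    unfolding sum_negf[symmetric]
  proof (rule sum.cong[OF refl])
    fix i assume i: "i \<in> F"
    let ?J = "F - {i}"
    have e: "insert i ?J = F" "insert a F - {i} = insert a ?J" "pos_sign i (insert a F) = (pos_sign i (insert a ?J) :: 'a)"
      "pos_sign i F = (pos_sign i ?J :: 'a)"
    proof -
      show 1: "insert i ?J = F" "insert a F - {i} = insert a ?J" using i False by auto
      show "pos_sign i (insert a F) = (pos_sign i (insert a ?J) :: 'a)"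
        using pos_sign_remove[of i "insert a F", where 'a = 'a] 1 by simp
      show "pos_sign i F = (pos_sign i ?J :: 'a)" by (simp add: pos_sign_remove)
    qed
    have "pos_sign a F * pos_sign i (insert a ?J) = - (pos_sign a ?J * pos_sign i ?J :: 'a)"
      using pos_sign_swap'[of ?J a i, where 'a = 'a] i False F e(1) by auto
    then show "pos_sign a F * pos_sign i (insert a F) * \<phi> (insert a F - {i}) =
        - (pos_sign i F * pos_sign a (F - {i}) * \<phi> (insert a (F - {i})))"
      by (simp add: e mult.commute)
  qed
  finally show ?thesis unfolding 1 by simp
qed

lemma face_sum_face_sum:
  assumes I: "finite I" and J: "J \<subseteq> I" shows "face_sum I (face_sum I h) J = 0"
proof -
  have d: "I - insert i J = (I - J) - {i}" for i by auto
  have "face_sum I (face_sum I h) J =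
      (\<Sum>i\<in>I - J. \<Sum>j\<in>(I - J) - {i}. pos_sign i J * pos_sign j (insert i J) * h (insert j (insert i J)))"
    by (simp add: face_sum_def sum_distrib_left mult.assoc d)
  also have "\<dots> = 0"
  proof (rule sum_antisymmetric)
    show "finite (I - J)" using I by simp
    have J: "finite J" using I J finite_subset by blast
    show "pos_sign i J * pos_sign j (insert i J) * h (insert j (insert i J)) =
        - (pos_sign j J * pos_sign i (insert j J) * h (insert i (insert j J)))"
      if "i \<in> I - J" "j \<in> I - J" "i \<noteq> j" for i j
      using pos_sign_swap[of J j i, where 'a = 'a] that J
      by (simp add: insert_commute mult.commute)
  qed
  finally show ?thesis .
qed

text \<open>The dual of the cocone identity. The contraction sums over \<open>I\<close>, so the
  pairing with the vector \<open>a\<close> is 1 exactly when \<open>a\<close> is a vertex of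
  \<open>I\<close>.\<close>

lemma face_sum_cone:
  assumes I: "finite I" and J: "J \<subseteq> I" and a: "a \<in> I"
  shows "face_sum I (cone a h) J + cone a (face_sum I h) J = h J"
proof (cases "a \<in> J")
  case False
  have "face_sum I (cone a h) J = (\<Sum>i\<in>I - J. if i = a then pos_sign a J * cone a h (insert a J) else 0)"
    unfolding face_sum_def using False by (intro sum.cong refl) (auto simp: cone_def)
  also have "\<dots> = h J"
    using False I a by (simp add: cone_def pos_sign_insert_self pos_sign_square flip: mult.assoc)
  finally show ?thesis using False by (simp add: cone_def)
next
  case True
  let ?K = "J - {a}"
  have fK: "finite ?K" using I J finite_subset by auto
  have IK: "I - ?K = insert a (I - J)" using a True by auto
  have aJ: "insert a ?K = J" using True by auto
  have "cone a (face_sum I h) J = pos_sign a J * (pos_sign a ?K * h J +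
      (\<Sum>i\<in>I - J. pos_sign i ?K * h (insert i ?K)))"
    using True I by (simp add: cone_def face_sum_def IK aJ insert_absorb)
  also have "\<dots> = h J + (\<Sum>i\<in>I - J. pos_sign a J * pos_sign i ?K * h (insert i ?K))"
    by (simp add: distrib_left sum_distrib_left pos_sign_remove pos_sign_square flip: mult.assoc)
  also have "(\<Sum>i\<in>I - J. pos_sign a J * pos_sign i ?K * h (insert i ?K)) = - face_sum I (cone a h) J"
    unfolding face_sum_def sum_negf[symmetric]
  proof (rule sum.cong[OF refl])
    fix i assume i: "i \<in> I - J"
    have e: "insert i J - {a} = insert i ?K" "pos_sign a (insert i J) = (pos_sign a (insert i ?K) :: 'a)"
      "pos_sign a J = (pos_sign a ?K :: 'a)"
    proof -
      show 1: "insert i J - {a} = insert i ?K" using i True by auto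
      show "pos_sign a (insert i J) = (pos_sign a (insert i ?K) :: 'a)"
        using pos_sign_remove[of a "insert i J", where 'a = 'a] 1 by simp
      show "pos_sign a J = (pos_sign a ?K :: 'a)" by (simp add: pos_sign_remove)
    qed
    have "pos_sign i J * pos_sign a (insert i ?K) = - (pos_sign i ?K * pos_sign a ?K :: 'a)"
      using pos_sign_swap'[of ?K i a, where 'a = 'a] i True fK aJ by auto
    then have "pos_sign i J * cone a h (insert i J) = - (pos_sign i ?K * pos_sign a ?K) * h (insert i ?K)"
      using True e by (simp add: cone_def flip: mult.assoc)
    then show "pos_sign a J * pos_sign i ?K * h (insert i ?K) = - (pos_sign i J * cone a h (insert i J))"
      by (simp add: e mult.commute)
  qed
  finally show ?thesis by simp
qed

section \<open>Relative cochains of a simplex\<close>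

text \<open>The record of a cochain group in \<open>rel_cochains\<close>, for an arbitrary support.
  The coordinates of a homomorphism from a term of \<open>Q(T)\<close> to a simple module form such
  a space too, over an index set that is recognised as a set of faces only later.\<close>

definition functions_on :: "'f set \<Rightarrow> ('k::field, 'f \<Rightarrow> 'k) module" where
  "functions_on S = \<lparr>carrier = {\<phi>. \<forall>F. F \<notin> S \<longrightarrow> \<phi> F = 0}, monoid.mult = undefined, one = undefined,
      zero = (\<lambda>F. 0), add = (\<lambda>\<phi> \<psi> F. \<phi> F + \<psi> F), module.smult = (\<lambda>c \<phi> F. c * \<phi> F)\<rparr>"

lemma functions_on_simps:
  "\<phi> \<in> carrier (functions_on S) \<longleftrightarrow> (\<forall>F. F \<notin> S \<longrightarrow> \<phi> F = 0)"
  "\<zero>\<^bsub>functions_on S\<^esub> = (\<lambda>F. 0)" "\<phi> \<oplus>\<^bsub>functions_on S\<^esub> \<psi> = (\<lambda>F. \<phi> F + \<psi> F)"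
  "c \<odot>\<^bsub>functions_on S\<^esub> \<phi> = (\<lambda>F. c * \<phi> F)"
  by (simp_all add: functions_on_def)

lemma left_module_functions_on: "left_module scalars (functions_on S)"
proof (rule left_moduleI)
  show "abelian_group (functions_on S)"
  proof (rule abelian_groupI)
    show "\<exists>y\<in>carrier (functions_on S). y \<oplus>\<^bsub>functions_on S\<^esub> x = \<zero>\<^bsub>functions_on S\<^esub>"
      if "x \<in> carrier (functions_on S)" for x
      using that by (intro bexI[of _ "\<lambda>F. - x F"]) (simp_all add: functions_on_simps)
  qed (simp_all add: functions_on_simps add_ac)
qed (simp_all add: functions_on_simps algebra_simps ring_from_type_algebra)

lemma minus_functions_on:
  assumes "\<phi> \<in> carrier (functions_on S)" shows "\<ominus>\<^bsub>functions_on S\<^esub> \<phi> = (\<lambda>F. - \<phi> F)"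
proof -
  interpret left_module scalars "functions_on S" by (rule left_module_functions_on)
  show ?thesis using assms by (intro M.minus_equality) (simp_all add: functions_on_simps)
qed

lemma rel_cochains_simps:
  "obj (rel_cochains K L) n = functions_on (faces K n - L)"
  "diff (rel_cochains K L) n \<phi> = (\<lambda>F. if F \<in> faces K (n + 1) then coface_sum \<phi> F else 0)"
  by (simp_all add: rel_cochains_def functions_on_def coface_sum_def pos_sign_def cong: if_cong)

lemma coface_sum_linear:
  "coface_sum (\<lambda>F. \<phi> F + \<psi> F) F = coface_sum \<phi> F + coface_sum \<psi> F"
  "coface_sum (\<lambda>F. \<phi> F - \<psi> F) F = coface_sum \<phi> F - coface_sum \<psi> F"
  "coface_sum (\<lambda>F. - \<phi> F) F = - coface_sum \<phi> F"
  "coface_sum (\<lambda>F. c * \<phi> F) F = c * coface_sum \<phi> F"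
  by (simp_all add: coface_sum_def algebra_simps sum.distrib sum_subtractf sum_negf sum_distrib_left)

lemma coface_sum_cong:
  "(\<And>i. i \<in> F \<Longrightarrow> \<phi> (F - {i}) = \<psi> (F - {i})) \<Longrightarrow> coface_sum \<phi> F = coface_sum \<psi> F"
  by (simp add: coface_sum_def)

text \<open>The void family \<open>{}\<close> qualifies, so that reduced cochains are an instance of
  relative ones.\<close>

definition simplicial :: "nat set set \<Rightarrow> bool" where
  "simplicial K \<longleftrightarrow> (\<forall>G\<in>K. finite G \<and> (\<forall>H. H \<subseteq> G \<longrightarrow> H \<in> K))"

lemma face_remove:
  assumes "simplicial K" "F \<in> faces K (n + 1)" "i \<in> F"
  shows "F - {i} \<in> faces K n"
proof -
  have "F \<in> K" and c: "int (card F) = n + 2" using assms(2) by (simp_all add: faces_def)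
  then have F: "finite F" "F - {i} \<in> K" using assms(1) by (simp_all add: simplicial_def)
  have "int (card (F - {i})) = n + 1"
    using card_Suc_Diff1[OF F(1) assms(3)] c by linarith
  with F(2) show ?thesis unfolding faces_def by blast
qed

section \<open>Cohomology of a pair of complexes\<close>

definition rel_cocycles :: "nat set set \<Rightarrow> nat set set \<Rightarrow> int \<Rightarrow> (nat set \<Rightarrow> 'k::field) set" where
  "rel_cocycles K L n = {\<phi> \<in> carrier (functions_on (faces K n - L)). \<forall>F\<in>faces K (n + 1). coface_sum \<phi> F = 0}"

definition rel_coboundaries :: "nat set set \<Rightarrow> nat set set \<Rightarrow> int \<Rightarrow> (nat set \<Rightarrow> 'k::field) set" where
  "rel_coboundaries K L n = (\<lambda>\<psi> F. if F \<in> faces K n then coface_sum \<psi> F else 0) `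
    carrier (functions_on (faces K (n - 1) - L))"

lemma cohomology_rel_cochains:
  "cohomology (rel_cochains K L) n =
    subquotient (functions_on (faces K n - L)) (rel_cocycles K L n) (rel_coboundaries K L n)"
proof -
  have "(\<lambda>F. if F \<in> faces K (n + 1) then coface_sum \<phi> F else 0) = (\<lambda>F. 0) \<longleftrightarrow>
      (\<forall>F\<in>faces K (n + 1). coface_sum \<phi> F = 0)" for \<phi> :: "nat set \<Rightarrow> 'a"
    by (auto simp: fun_eq_iff)
  then show ?thesis
    by (simp add: cohomology_def rel_cochains_simps rel_cocycles_def rel_coboundaries_def
      functions_on_simps(2))
qed

lemma
  fixes K L :: "nat set set"
  assumes K: "simplicial K" and L: "simplicial L"
  shows rel_cocycles_submodule: "submodule (rel_cocycles K L n) (scalars :: 'k::field ring) (functions_on (faces K n - L))"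
    and rel_coboundaries_submodule: "submodule (rel_coboundaries K L n) (scalars :: 'k ring) (functions_on (faces K n - L))"
    and rel_coboundaries_subset: "rel_coboundaries K L n \<subseteq> (rel_cocycles K L n :: (nat set \<Rightarrow> 'k) set)"
proof -
  interpret left_module "scalars :: 'k ring" "functions_on (faces K n - L) :: ('k, nat set \<Rightarrow> 'k) module"
    by (rule left_module_functions_on)
  show "submodule (rel_cocycles K L n) (scalars :: 'k ring) (functions_on (faces K n - L))"
    by (rule submoduleI)
      (auto simp: rel_cocycles_def functions_on_simps coface_sum_linear coface_sum_def[of "\<lambda>F. 0"])
  let ?d = "\<lambda>(\<psi> :: nat set \<Rightarrow> 'k) F. if F \<in> faces K n then coface_sum \<psi> F else 0"
  \<comment> \<open>A face of a set in \<open>L\<close> lies in \<open>L\<close> again, and there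
    \<open>\<psi>\<close> vanishes.\<close>
  have van: "?d \<psi> F = 0" if "\<psi> \<in> carrier (functions_on (faces K (n - 1) - L))" "F \<in> L" for \<psi> F
    using that L by (auto simp: functions_on_simps coface_sum_def simplicial_def intro!: sum.neutral)
  have dM: "?d \<psi> \<in> carrier (functions_on (faces K n - L))"
    if "\<psi> \<in> carrier (functions_on (faces K (n - 1) - L))" for \<psi>
    unfolding functions_on_simps
  proof (intro allI impI)
    show "?d \<psi> F = 0" if "F \<notin> faces K n - L" for F
      using van[OF \<open>\<psi> \<in> _\<close>, of F] that by (cases "F \<in> L") auto
  qed
  have "restrict ?d (carrier (functions_on (faces K (n - 1) - L))) \<in>
      lmod_hom scalars (functions_on (faces K (n - 1) - L)) (functions_on (faces K n - L))"
    by (rule lmod_homI[OF dM _ _ left_module_functions_on])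
      (auto simp: functions_on_simps coface_sum_linear)
  from image_submodule[OF left_module_functions_on left_module_functions_on this
      left_module.carrier_submodule[OF left_module_functions_on]]
  show "submodule (rel_coboundaries K L n) (scalars :: 'k ring) (functions_on (faces K n - L))"
    by (simp add: rel_coboundaries_def)
  have "coface_sum (?d \<psi>) F = 0" if F: "F \<in> faces K (n + 1)" for \<psi> F
  proof -
    have fF: "finite F" using F K by (simp add: faces_def simplicial_def)
    have "coface_sum (?d \<psi>) F = coface_sum (coface_sum \<psi>) F"
      by (rule coface_sum_cong) (use face_remove[OF K F] in simp)
    then show ?thesis by (simp add: coface_sum_coface_sum[OF fF])
  qed
  then show "rel_coboundaries K L n \<subseteq> (rel_cocycles K L n :: (nat set \<Rightarrow> 'k) set)"
    using dM by (auto simp: rel_coboundaries_def rel_cocycles_def)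
qed

text \<open>A sign changes neither the kernel nor the image of a differential, so the two cohomology
  records are equal and no isomorphism has to be carried along.\<close>

lemma cohomology_shift_rel_cochains:
  assumes L: "simplicial L"
  shows "cohomology (shift (rel_cochains K L)) n = cohomology (rel_cochains K L) (n - 1)"
proof -
  let ?d = "\<lambda>n (\<psi> :: nat set \<Rightarrow> 'a) F. if F \<in> faces K n then coface_sum \<psi> F else 0"
  have dM: "?d n \<psi> \<in> carrier (functions_on (faces K n - L))"
    if "\<psi> \<in> carrier (functions_on (faces K (n - 1) - L))" for \<psi> n
  proof -
    have van: "?d n \<psi> F = 0" if "F \<in> L" for F
      using \<open>\<psi> \<in> _\<close> that L
      by (auto simp: functions_on_simps coface_sum_def simplicial_def intro!: sum.neutral)
    show ?thesis unfolding functions_on_simps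
    proof (intro allI impI)
      show "?d n \<psi> F = 0" if "F \<notin> faces K n - L" for F
        using van[of F] that by (cases "F \<in> L") auto
    qed
  qed
  have m: "\<ominus>\<^bsub>functions_on (faces K n - L)\<^esub> (?d n \<psi>) = ?d n (\<lambda>F. - \<psi> F)"
    if "\<psi> \<in> carrier (functions_on (faces K (n - 1) - L))" for \<psi> n
    using minus_functions_on[OF dM[OF that]] by (auto simp: coface_sum_linear)
  have "(\<lambda>\<psi>. \<ominus>\<^bsub>functions_on (faces K (n - 1) - L)\<^esub> (?d (n - 1) \<psi>)) ` carrier (functions_on (faces K (n - 2) - L)) =
      ?d (n - 1) ` carrier (functions_on (faces K (n - 2) - L))" (is "?f ` ?X = ?g ` ?X")
  proof -
    have fg: "?f \<psi> = ?g (\<lambda>F. - \<psi> F)" if "\<psi> \<in> ?X" for \<psi> using m[of \<psi> "n - 1"] that by simp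
    have neg: "(\<lambda>F. - \<psi> F) \<in> ?X" if "\<psi> \<in> ?X" for \<psi> using that by (simp add: functions_on_simps)
    show ?thesis
    proof (intro equalityI image_subsetI)
      show "?f \<psi> \<in> ?g ` ?X" if "\<psi> \<in> ?X" for \<psi> unfolding fg[OF that] by (rule imageI[OF neg[OF that]])
      show "?g \<psi> \<in> ?f ` ?X" if "\<psi> \<in> ?X" for \<psi>
        using fg[OF neg[OF that]] neg[OF that]
        by (intro image_eqI[of _ _ "\<lambda>F. - \<psi> F"]) (simp_all only: minus_minus)
    qed
  qed
  moreover have "\<ominus>\<^bsub>functions_on (faces K n - L)\<^esub> (?d n \<psi>) = (\<lambda>F. 0) \<longleftrightarrow> ?d n \<psi> = (\<lambda>F. 0)"
    if "\<psi> \<in> carrier (functions_on (faces K (n - 1) - L))" for \<psi>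
    unfolding minus_functions_on[OF dM[OF that]] by (auto simp: fun_eq_iff)
  ultimately show ?thesis
    by (simp add: cohomology_def shift_def rel_cochains_simps functions_on_simps(2) cong: conj_cong)
qed

text \<open>
  The connecting isomorphism of the pair: the full simplex on a nonempty vertex set is acyclic.
\<close>

lemma relative_simplex_cohomology:
  fixes I :: "nat set" and L :: "nat set set"
  assumes I: "finite I" "a \<in> I" and L: "L \<subseteq> Pow I" "simplicial L"
  shows "lmod_iso (scalars :: 'k::field ring) (cohomology (rel_cochains (Pow I) L) n)
      (reduced_cohomology L (n - 1))"
    and "left_module (scalars :: 'k ring) (cohomology (rel_cochains (Pow I) L) n)"
proof -
  have K: "simplicial (Pow I)" using I(1) finite_subset by (auto simp: simplicial_def)
  have V: "simplicial {}" by (simp add: simplicial_def)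
  note PK = rel_cocycles_submodule[OF K L(2)] rel_coboundaries_submodule[OF K L(2)]
    rel_coboundaries_subset[OF K L(2)]
  note PL = rel_cocycles_submodule[OF L(2) V] rel_coboundaries_submodule[OF L(2) V]
    rel_coboundaries_subset[OF L(2) V]
  let ?P = "faces (Pow I)"
  \<comment> \<open>Cochains of \<open>L\<close> are already extended by 0 to all other sets, so the
    connecting map is just the coboundary in the full simplex.\<close>
  define f where "f = (\<lambda>(\<phi> :: nat set \<Rightarrow> 'k) F. if F \<in> ?P n then coface_sum \<phi> F else 0)"
  have fin: "finite F" if "F \<in> ?P q" for F q using that K by (simp add: faces_def simplicial_def)
  have rem: "F - {i} \<in> ?P q" if "F \<in> ?P (q + 1)" "i \<in> F" for F i q
    by (rule face_remove[OF K that])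
  have remL: "F - {i} \<in> faces L q" if "F \<in> faces L (q + 1)" "i \<in> F" for F i q
    by (rule face_remove[OF L(2) that])
  have ins: "insert a F \<in> ?P (q + 1)" if "F \<in> ?P q" "a \<notin> F" for F q
    using that I fin[OF that(1)] by (simp add: faces_def)
  have LP: "F \<in> ?P q" if "F \<in> faces L q" for F q using that L(1) by (auto simp: faces_def)
  have n1: "n - 1 + 1 = n" by simp
  show lm: "left_module (scalars :: 'k ring) (cohomology (rel_cochains (Pow I) L) n)"
    unfolding cohomology_rel_cochains by (intro left_module_subquotient left_module_functions_on PK)
  have lmr: "left_module (scalars :: 'k ring) (reduced_cohomology L (n - 1))"
    unfolding reduced_cohomology_def cohomology_rel_cochains
    by (intro left_module_subquotient left_module_functions_on PL)
  have "lmod_iso (scalars :: 'k ring) (reduced_cohomology L (n - 1)) (cohomology (rel_cochains (Pow I) L) n)"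
    unfolding reduced_cohomology_def cohomology_rel_cochains
  proof (rule lmod_iso_subquotient[OF left_module_functions_on left_module_functions_on PL(2,1,3) PK(2,1,3), where f = f])
    fix \<phi> :: "nat set \<Rightarrow> 'k" assume "\<phi> \<in> rel_cocycles L {} (n - 1)"
    then have supp: "\<And>F. F \<notin> faces L (n - 1) \<Longrightarrow> \<phi> F = 0"
      and cocyc: "\<And>F. F \<in> faces L n \<Longrightarrow> coface_sum \<phi> F = 0"
      by (auto simp: rel_cocycles_def functions_on_simps)
    have cs: "coface_sum (f \<phi>) F = coface_sum (coface_sum \<phi>) F" if "F \<in> ?P (n + 1)" for F
      by (rule coface_sum_cong) (use rem[OF that] in \<open>simp add: f_def\<close>)
    have van: "f \<phi> F = 0" if "F \<in> L" for F using cocyc[of F] that by (auto simp: f_def faces_def)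
    show "f \<phi> \<in> rel_cocycles (Pow I) L n"
      unfolding rel_cocycles_def functions_on_simps mem_Collect_eq
    proof (intro conjI allI impI ballI)
      show "f \<phi> F = 0" if "F \<notin> ?P n - L" for F
        using van[of F] that by (cases "F \<in> L") (auto simp: f_def)
      show "coface_sum (f \<phi>) F = 0" if "F \<in> ?P (n + 1)" for F
        using cs[OF that] coface_sum_coface_sum[OF fin[OF that]] by simp
    qed
    show "f \<phi> \<in> rel_coboundaries (Pow I) L n \<longleftrightarrow> \<phi> \<in> rel_coboundaries L {} (n - 1)"
    proof
      assume "f \<phi> \<in> rel_coboundaries (Pow I) L n"
      then obtain \<rho> where \<rho>2: "f \<phi> = (\<lambda>F. if F \<in> ?P n then coface_sum \<rho> F else 0)"
        and "\<rho> \<in> carrier (functions_on (?P (n - 1) - L))"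
        unfolding rel_coboundaries_def by (rule imageE)
      then have \<rho>1: "\<And>F. F \<notin> ?P (n - 1) - L \<Longrightarrow> \<rho> F = 0" unfolding functions_on_simps by blast
      \<comment> \<open>Since \<open>f \<phi>\<close> is the coboundary of \<open>\<rho>\<close>,
        the difference is a cocycle of the full simplex and hence the coboundary of its cocone. It
        agrees with \<open>\<phi>\<close> on \<open>L\<close>, so the cocone restricted to
        \<open>L\<close> is a primitive of \<open>\<phi>\<close>.\<close>
      define \<chi> where "\<chi> = (\<lambda>F. \<phi> F - \<rho> F)"
      have "coface_sum \<chi> F = 0" if "F \<in> ?P n" for F
        using fun_cong[OF \<rho>2, of F] that by (simp add: \<chi>_def coface_sum_linear f_def)
      then have "cocone a (coface_sum \<chi>) F = 0" if "F \<in> ?P (n - 1)" for F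
        using ins[OF that] by (auto simp: cocone_def)
      then have \<chi>: "\<chi> F = coface_sum (cocone a \<chi>) F" if "F \<in> ?P (n - 1)" for F
        using coface_sum_cocone[OF fin[OF that], of a \<chi>] that by simp
      define \<psi> where "\<psi> F = (if F \<in> faces L (n - 1 - 1) then cocone a \<chi> F else 0)" for F
      have "\<phi> = (\<lambda>F. if F \<in> faces L (n - 1) then coface_sum \<psi> F else 0)"
      proof
        fix F
        show "\<phi> F = (if F \<in> faces L (n - 1) then coface_sum \<psi> F else 0)"
        proof (cases "F \<in> faces L (n - 1)")
          case True
          have "coface_sum \<psi> F = coface_sum (cocone a \<chi>) F"
            by (rule coface_sum_cong) (use remL[of F "n - 1 - 1"] True in \<open>simp add: \<psi>_def\<close>)
          moreover have "\<rho> F = 0" using True by (intro \<rho>1) (auto simp: faces_def)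
          ultimately show ?thesis using \<chi>[OF LP[OF True]] True by (simp add: \<chi>_def)
        qed (simp add: supp)
      qed
      moreover have "\<psi> \<in> carrier (functions_on (faces L (n - 1 - 1) - {}))"
        by (auto simp: functions_on_simps \<psi>_def)
      ultimately show "\<phi> \<in> rel_coboundaries L {} (n - 1)" unfolding rel_coboundaries_def by blast
    next
      assume "\<phi> \<in> rel_coboundaries L {} (n - 1)"
      then obtain \<psi> where \<psi>: "\<phi> = (\<lambda>F. if F \<in> faces L (n - 1) then coface_sum \<psi> F else 0)"
        by (auto simp: rel_coboundaries_def functions_on_simps)
      \<comment> \<open>Subtracting from \<open>\<phi>\<close> the coboundary of
        \<open>\<psi>\<close> taken in the full simplex leaves a cochain that vanishes on
        \<open>L\<close> and still has the coboundary of \<open>\<phi>\<close>.\<close>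
      define \<rho> where "\<rho> F = (if F \<in> ?P (n - 1) then \<phi> F - coface_sum \<psi> F else 0)" for F
      have van: "\<rho> F = 0" if "F \<in> L" for F using that by (auto simp: \<rho>_def \<psi> faces_def)
      have "\<rho> \<in> carrier (functions_on (?P (n - 1) - L))" unfolding functions_on_simps
      proof (intro allI impI)
        show "\<rho> F = 0" if "F \<notin> ?P (n - 1) - L" for F
          using van[of F] that by (cases "F \<in> L") (auto simp: \<rho>_def)
      qed
      moreover have "f \<phi> = (\<lambda>F. if F \<in> ?P n then coface_sum \<rho> F else 0)"
      proof
        fix F
        have "coface_sum \<rho> F = coface_sum \<phi> F" if F: "F \<in> ?P n"
        proof -
          have "coface_sum \<rho> F = coface_sum (\<lambda>F. \<phi> F - coface_sum \<psi> F) F"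
            by (rule coface_sum_cong) (use rem[of F "n - 1"] F in \<open>simp add: \<rho>_def\<close>)
          then show ?thesis by (simp add: coface_sum_linear coface_sum_coface_sum[OF fin[OF F]])
        qed
        then show "f \<phi> F = (if F \<in> ?P n then coface_sum \<rho> F else 0)" by (simp add: f_def)
      qed
      ultimately show "f \<phi> \<in> rel_coboundaries (Pow I) L n" unfolding rel_coboundaries_def by blast
    qed
  next
    fix z :: "nat set \<Rightarrow> 'k" assume "z \<in> rel_cocycles (Pow I) L n"
    then have supp: "\<And>F. F \<notin> ?P n - L \<Longrightarrow> z F = 0"
      and cocyc: "\<And>F. F \<in> ?P (n + 1) \<Longrightarrow> coface_sum z F = 0"
      by (auto simp: rel_cocycles_def functions_on_simps)
    \<comment> \<open>The cocone of \<open>z\<close> is a primitive of \<open>z\<close> in the full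
      simplex. Its part on \<open>L\<close> is the preimage sought; the remaining part
      \<open>\<rho>\<close> is a relative cochain and accounts for a relative coboundary.\<close>
    define \<phi> where "\<phi> F = (if F \<in> faces L (n - 1) then cocone a z F else 0)" for F
    define \<rho> where "\<rho> F = (if F \<in> ?P (n - 1) - L then cocone a z F else 0)" for F
    have z: "coface_sum (cocone a z) F = z F" if "F \<in> ?P n" for F
    proof -
      have "cocone a (coface_sum z) F = 0" using ins[OF that] cocyc by (auto simp: cocone_def)
      then show ?thesis using coface_sum_cocone[OF fin[OF that], of a z] by simp
    qed
    have "coface_sum \<phi> F = 0" if F: "F \<in> faces L n" for F
    proof -
      have "coface_sum \<phi> F = coface_sum (cocone a z) F"
        by (rule coface_sum_cong) (use remL[of F "n - 1"] F in \<open>simp add: \<phi>_def\<close>)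
      also have "\<dots> = z F" by (rule z[OF LP[OF F]])
      also have "\<dots> = 0" using F by (intro supp) (auto simp: faces_def)
      finally show ?thesis .
    qed
    then have "\<phi> \<in> rel_cocycles L {} (n - 1)" by (auto simp: rel_cocycles_def functions_on_simps \<phi>_def)
    moreover have "(\<lambda>F. if F \<in> ?P n then coface_sum \<rho> F else 0) \<in> rel_coboundaries (Pow I) L n"
      unfolding rel_coboundaries_def by (rule imageI) (auto simp: functions_on_simps \<rho>_def)
    moreover have "z = (\<lambda>F. (if F \<in> ?P n then coface_sum \<rho> F else 0) + f \<phi> F)"
    proof
      fix F
      have "coface_sum \<rho> F + coface_sum \<phi> F = z F" if F: "F \<in> ?P n"
      proof -
        have "coface_sum \<rho> F + coface_sum \<phi> F = coface_sum (\<lambda>F. \<rho> F + \<phi> F) F"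
          by (simp add: coface_sum_linear)
        also have "\<dots> = coface_sum (cocone a z) F"
          by (rule coface_sum_cong) (use rem[of F "n - 1"] F in \<open>auto simp: \<rho>_def \<phi>_def faces_def\<close>)
        finally show ?thesis using z[OF F] by simp
      qed
      then show "z F = (if F \<in> ?P n then coface_sum \<rho> F else 0) + f \<phi> F"
        using supp[of F] by (auto simp: f_def)
    qed
    ultimately show "\<exists>\<phi>\<in>rel_cocycles L {} (n - 1). \<exists>b\<in>rel_coboundaries (Pow I) L n.
        z = b \<oplus>\<^bsub>functions_on (?P n - L)\<^esub> f \<phi>"
      unfolding functions_on_simps
      by (intro bexI[of _ \<phi>] bexI[of _ "\<lambda>F. if F \<in> ?P n then coface_sum \<rho> F else 0"])
  qed (auto simp: functions_on_simps f_def coface_sum_linear)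
  then show "lmod_iso (scalars :: 'k ring) (cohomology (rel_cochains (Pow I) L) n)
      (reduced_cohomology L (n - 1))"
    by (rule lmod_iso_sym[OF _ lmr lm])
qed

section \<open>Components and upsets of a poset\<close>

definition component :: "'p::order set \<Rightarrow> 'p \<Rightarrow> 'p set" where
  "component S x = {y \<in> S. joined_in S x y}"

lemma joined_in_refl: "joined_in S x x"
  by (simp add: joined_in_def)

lemma joined_in_trans: "joined_in S x y \<Longrightarrow> joined_in S y z \<Longrightarrow> joined_in S x z"
  by (simp add: joined_in_def)

lemma joined_in_sym: "joined_in S x y \<Longrightarrow> joined_in S y x"
  unfolding joined_in_def by (rule sympD[OF symp_rtranclp]) (auto intro: sympI)

lemma joined_in_step: "x \<in> S \<Longrightarrow> y \<in> S \<Longrightarrow> x \<le> y \<or> y \<le> x \<Longrightarrow> joined_in S x y"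
  unfolding joined_in_def by (rule r_into_rtranclp) simp

lemma joined_in_mono: "S \<subseteq> S' \<Longrightarrow> joined_in S x y \<Longrightarrow> joined_in S' x y"
  unfolding joined_in_def by (erule rtranclp_mono[THEN predicate2D, rotated]) auto

text \<open>Connectedness of a component refers to chains inside it, so the chain that joins
  \<open>x\<close> to \<open>y\<close> must be seen not to leave the component.\<close>

lemma joined_in_component:
  assumes "joined_in S x y" "x \<in> S" shows "joined_in (component S x) x y"
  using assms(1) unfolding joined_in_def
proof (induction rule: rtranclp_induct)
  case (step y z)
  have "joined_in S x y" "joined_in S y z"
    using step.hyps by (auto simp: joined_in_def)
  then have "y \<in> component S x" "z \<in> component S x"
    using step.hyps joined_in_trans by (auto simp: component_def)
  then show ?case using step by (intro rtranclp.rtrancl_into_rtrancl[OF step.IH]) simp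
qed simp

lemma component_self: "x \<in> S \<Longrightarrow> x \<in> component S x"
  by (simp add: component_def joined_in_refl)

lemma component_subset: "component S x \<subseteq> S"
  by (auto simp: component_def)

lemma component_eq: "y \<in> component S x \<Longrightarrow> component S y = component S x"
  unfolding component_def using joined_in_trans joined_in_sym by blast

lemma component_mono: "S \<subseteq> S' \<Longrightarrow> component S x \<subseteq> component S' x"
  unfolding component_def using joined_in_mono by blast

lemma component_closed:
  "y \<in> component S x \<Longrightarrow> z \<in> S \<Longrightarrow> y \<le> z \<or> z \<le> y \<Longrightarrow> z \<in> component S x"
  unfolding component_def using joined_in_step[of y S z] joined_in_trans[of S x y z] by blast

lemma connected_component: "x \<in> S \<Longrightarrow> poset_connected (component S x)"
  unfolding poset_connected_def
  using joined_in_component joined_in_trans joined_in_sym component_def by (metis mem_Collect_eq)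

lemma pi0_eq: "pi0 S = component S ` S"
  by (auto simp: pi0_def component_def)

lemma pi0_component: "D \<in> pi0 S \<Longrightarrow> x \<in> D \<Longrightarrow> D = component S x"
  unfolding pi0_eq using component_eq by blast

lemma pi0D:
  assumes "D \<in> pi0 S" shows "D \<noteq> {}" "D \<subseteq> S" "poset_connected D"
  using assms component_self component_subset connected_component unfolding pi0_eq by fast+

lemma connected_subset_component:
  assumes "poset_connected C" "C \<subseteq> S" "x \<in> C" shows "C \<subseteq> component S x"
  using assms joined_in_mono[OF assms(2)] unfolding poset_connected_def component_def by blast

text \<open>Replaces the definite description by the component of any point of \<open>C\<close>, the
  form used in all later computations.\<close>

lemma component_containing_eq:
  assumes "poset_connected C" "C \<subseteq> S" "x \<in> C"
  shows "component_containing S C = component S x"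
  unfolding component_containing_def
proof (rule the_equality)
  show "component S x \<in> pi0 S \<and> C \<subseteq> component S x"
    using connected_subset_component[OF assms] assms by (auto simp: pi0_eq)
  show "D = component S x" if "D \<in> pi0 S \<and> C \<subseteq> D" for D
    using pi0_component[of D S x] that assms(3) by blast
qed

lemma pi0_connected: "S \<noteq> {} \<Longrightarrow> poset_connected S \<Longrightarrow> pi0 S = {S}"
  using connected_subset_component[of S S] component_subset[of S] unfolding pi0_eq by blast

lemma component_interval:
  assumes S: "order_convex S" and x: "x \<in> S" shows "component S x \<in> intervals"
proof -
  have "z \<in> component S x" if "u \<in> component S x" "v \<in> component S x" "u \<le> z" "z \<le> v" for u v z
  proof -
    have "z \<in> S" using S that component_subset[of S x] unfolding order_convex_def by blast
    then show ?thesis using component_closed that by blast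
  qed
  then have "order_convex (component S x)" unfolding order_convex_def by blast
  then show ?thesis using connected_component[OF x] component_self[OF x] unfolding intervals_def by blast
qed

lemma relative_upset_convex:
  "relative_upset C S \<Longrightarrow> order_convex S \<Longrightarrow> order_convex C"
  unfolding relative_upset_def order_convex_def by blast

text \<open>A larger element of \<open>T\<close> stays in \<open>S\<close>, and an element of
  \<open>S\<close> comparable with the component stays in the component.\<close>

lemma relative_upset_component:
  assumes "relative_upset S T" "x \<in> S" shows "relative_upset (component S x) T"
  unfolding relative_upset_def
proof (intro conjI ballI impI)
  show "component S x \<subseteq> T" using component_subset[of S x] assms(1) by (auto simp: relative_upset_def)
  show "z \<in> component S x" if "y \<in> component S x" "z \<in> T" "y \<le> z" for y z
  proof (rule component_closed[OF that(1)])
    have "y \<in> S" using that(1) component_subset[of S x] by auto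
    then show "z \<in> S" using that assms(1) unfolding relative_upset_def by blast
  qed (simp add: that)
qed

lemma intervalsD:
  assumes "S \<in> intervals" shows "S \<noteq> {}" "poset_connected S" "order_convex S"
  using assms by (auto simp: intervals_def)

section \<open>Intersections of maximal proper upsets\<close>

locale upset_cover =
  fixes T :: "'p::{finite,order} set" and U :: "nat \<Rightarrow> 'p set" and m :: nat
  assumes T: "T \<in> intervals" and U: "bij_betw U {1..m} (maximal_proper_upsets T)"
begin

lemma U_upset:
  assumes "j \<in> {1..m}"
  shows "relative_upset (U j) T" "U j \<noteq> T" "U j \<in> intervals" "U j \<subseteq> T"
proof -
  have "U j \<in> maximal_proper_upsets T" using U assms by (auto simp: bij_betw_def)
  then show "relative_upset (U j) T" "U j \<noteq> T" "U j \<in> intervals" "U j \<subseteq> T"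
    by (auto simp: maximal_proper_upsets_def upset_intervals_def relative_upset_def)
qed

lemma exists_cover:
  assumes "C \<in> upset_intervals T" "C \<noteq> T" shows "\<exists>j\<in>{1..m}. C \<subseteq> U j"
proof -
  have "finite (upset_intervals T - {T})" "C \<in> upset_intervals T - {T}" using assms by auto
  then obtain V where V: "V \<in> upset_intervals T - {T}" "C \<subseteq> V"
    "\<forall>W\<in>upset_intervals T - {T}. V \<subseteq> W \<longrightarrow> V = W"
    using finite_has_maximal2[of "upset_intervals T - {T}" C] by auto
  then have "V \<in> maximal_proper_upsets T" unfolding maximal_proper_upsets_def by blast
  then have "V \<in> U ` {1..m}" using U unfolding bij_betw_def by simp
  then obtain j where "j \<in> {1..m}" "V = U j" by (rule imageE)
  then show ?thesis using V(2) by (intro bexI[of _ j]) simp_all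
qed

abbreviation UJ :: "nat set \<Rightarrow> 'p set" where "UJ \<equiv> U_inter T U"

lemma UJ_subset: "UJ J \<subseteq> T"
  by (simp add: U_inter_def)

lemma UJ_empty: "UJ {} = T"
  by (simp add: U_inter_def)

lemma UJ_mono: "J' \<subseteq> J \<Longrightarrow> UJ J \<subseteq> UJ J'"
  by (auto simp: U_inter_def)

lemma UJ_insert: "UJ (insert j J) = U j \<inter> UJ J"
  by (auto simp: U_inter_def)

lemma UJ_upset: "J \<subseteq> {1..m} \<Longrightarrow> relative_upset (UJ J) T"
  unfolding relative_upset_def
proof (intro conjI ballI impI)
  show "UJ J \<subseteq> T" by (rule UJ_subset)
  assume J: "J \<subseteq> {1..m}"
  show "z \<in> UJ J" if y: "y \<in> UJ J" and z: "z \<in> T" "y \<le> z" for y z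
  proof -
    have "z \<in> U j" if "j \<in> J" for j
    proof -
      have "y \<in> U j" using y that by (simp add: U_inter_def)
      then show ?thesis using U_upset(1)[of j] J that z unfolding relative_upset_def by blast
    qed
    then show ?thesis using z by (simp add: U_inter_def)
  qed
qed

lemma UJ_convex: "J \<subseteq> {1..m} \<Longrightarrow> order_convex (UJ J)"
  using relative_upset_convex[OF UJ_upset] T by (auto simp: intervals_def)

lemma UJ_component_interval: "J \<subseteq> {1..m} \<Longrightarrow> x \<in> UJ J \<Longrightarrow> component (UJ J) x \<in> intervals"
  by (rule component_interval[OF UJ_convex])

lemma pi0_UJ_interval: "J \<subseteq> {1..m} \<Longrightarrow> D \<in> pi0 (UJ J) \<Longrightarrow> D \<in> intervals"
  using UJ_component_interval by (auto simp: pi0_eq)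

lemma pi0_UJ_upset: "J \<subseteq> {1..m} \<Longrightarrow> D \<in> pi0 (UJ J) \<Longrightarrow> relative_upset D T"
  using relative_upset_component[OF UJ_upset] by (auto simp: pi0_eq)

lemma component_containing_UJ:
  assumes "D \<in> pi0 (UJ J)" "x \<in> D" "J' \<subseteq> J"
  shows "component_containing (UJ J') D = component (UJ J') x"
  using component_containing_eq[of D "UJ J'" x] pi0D[OF assms(1)] assms UJ_mono[OF assms(3)] by blast

lemma component_containing_pi0:
  assumes "D \<in> pi0 (UJ J)" "J' \<subseteq> J" shows "component_containing (UJ J') D \<in> pi0 (UJ J')"
proof -
  obtain x where x: "x \<in> D" using pi0D(1)[OF assms(1)] by blast
  have "x \<in> UJ J'" using x pi0D(2)[OF assms(1)] UJ_mono[OF assms(2)] by blast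
  then show ?thesis using component_containing_UJ[OF assms(1) x assms(2)] by (simp add: pi0_eq)
qed

lemma component_containing_supset:
  assumes "D \<in> pi0 (UJ J)" "J' \<subseteq> J" shows "D \<subseteq> component_containing (UJ J') D"
proof -
  obtain x where x: "x \<in> D" using pi0D(1)[OF assms(1)] by blast
  show ?thesis using component_containing_UJ[OF assms(1) x assms(2)]
      pi0_component[OF assms(1) x] component_mono[OF UJ_mono[OF assms(2)], of x] by simp
qed

text \<open>The component always contains \<open>C\<close>, so failing to contain it strictly means
  being equal to it. This turns the faces outside \<open>Gamma_minus\<close> into the indices of
  those summands of \<open>Q(T)\<close> that are copies of \<open>P(C)\<close>.\<close>

lemma not_Gamma_iff:
  assumes C: "C \<in> upset_intervals T"
  shows "J \<in> Pow (I_set U m C) - Gamma_minus T U m C \<longleftrightarrow> J \<subseteq> {1..m} \<and> C \<in> pi0 (UJ J)"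
proof -
  have C': "C \<subseteq> T" "C \<noteq> {}" "poset_connected C"
    using C by (auto simp: upset_intervals_def relative_upset_def intervals_def)
  then obtain x where x: "x \<in> C" by blast
  show ?thesis
  proof (cases "J \<subseteq> I_set U m C")
    case True
    then have CJ: "C \<subseteq> UJ J" and Jm: "J \<subseteq> {1..m}" using C' by (auto simp: U_inter_def I_set_def)
    have cc: "component_containing (UJ J) C = component (UJ J) x"
      by (rule component_containing_eq[OF C'(3) CJ x])
    have "C \<subseteq> component (UJ J) x" by (rule connected_subset_component[OF C'(3) CJ x])
    then have "J \<notin> Gamma_minus T U m C \<longleftrightarrow> C = component (UJ J) x"
      using True by (auto simp: Gamma_minus_def cc)
    also have "\<dots> \<longleftrightarrow> C \<in> pi0 (UJ J)"
      using pi0_component[of C "UJ J" x] x CJ by (auto simp: pi0_eq)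
    finally show ?thesis using True Jm by simp
  next
    case False
    have "J \<subseteq> I_set U m C" if "J \<subseteq> {1..m}" "C \<in> pi0 (UJ J)"
      using pi0D(2)[OF that(2)] that(1) by (auto simp: U_inter_def I_set_def)
    then show ?thesis using False by auto
  qed
qed

text \<open>Fewer sets have a larger intersection and thus a larger component around
  \<open>C\<close>, so strict containment is inherited by subsets of a face.\<close>

lemma simplicial_Gamma:
  assumes C: "C \<in> upset_intervals T"
  shows "simplicial (Gamma_minus T U m C)"
proof -
  have C': "C \<subseteq> T" "C \<noteq> {}" "poset_connected C"
    using C by (auto simp: upset_intervals_def relative_upset_def intervals_def)
  then obtain x where x: "x \<in> C" by blast
  have cc: "component_containing (UJ J) C = component (UJ J) x" if "J \<subseteq> I_set U m C" for J
    using that C' by (intro component_containing_eq x) (auto simp: U_inter_def I_set_def)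
  have fin: "finite G" if "G \<in> Gamma_minus T U m C" for G
  proof (rule finite_subset)
    show "G \<subseteq> {1..m}" using that by (auto simp: Gamma_minus_def I_set_def)
  qed simp
  have "H \<in> Gamma_minus T U m C" if "G \<in> Gamma_minus T U m C" "H \<subseteq> G" for G H
  proof -
    have G: "G \<subseteq> I_set U m C" "C \<subset> component (UJ G) x" and H: "H \<subseteq> I_set U m C"
      using that cc by (auto simp: Gamma_minus_def)
    then have "C \<subset> component (UJ H) x" using component_mono[OF UJ_mono[OF that(2)], of x] by blast
    then show ?thesis using cc[OF H] H by (simp add: Gamma_minus_def)
  qed
  then show ?thesis using fin by (auto simp: simplicial_def)
qed

end

section \<open>Matrix coordinates on the algebra\<close>

type_synonym ('p, 'k) coeffs = "'p set \<Rightarrow> 'p set \<Rightarrow> 'p \<Rightarrow> 'k"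

abbreviation G_space :: "'p::{finite,order} \<Rightarrow> ('k::field, 'p set \<Rightarrow> 'k) module" where
  "G_space x \<equiv> rspace G_rep x"

text \<open>The basis vector of the summand of \<open>R\<close> if \<open>x\<close> lies in
  \<open>R\<close>. Elsewhere it has to be 0, since that summand has no nonzero vector at
  \<open>x\<close>.\<close>

definition unit_vec :: "'p::{finite,order} set \<Rightarrow> 'p \<Rightarrow> 'p set \<Rightarrow> 'k::field" where
  "unit_vec R x = (\<lambda>S\<in>intervals. if S = R \<and> x \<in> S then 1 else 0)"

text \<open>
  The component of \<open>a\<close> from the summand of \<open>R\<close> to the summand of \<open>S\<close>, a scalar at every point \<open>x\<close>.
\<close>

definition cf :: "('p::{finite,order}, 'k::field) endo \<Rightarrow> ('p, 'k) coeffs" where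
  "cf a R S x = (if S \<in> intervals then a x (unit_vec R x) S else 0)"

text \<open>The second condition is naturality along \<open>x \<le> y\<close>. It is imposed even if
  \<open>x\<close> lies outside \<open>S\<close> or \<open>y\<close> outside \<open>R\<close>: there
  one of the two values is 0 by the first condition and forces the other to vanish, which is what
  the naturality square says in those cases.\<close>

definition admissible :: "('p::{finite,order}, 'k::field) coeffs \<Rightarrow> bool" where
  "admissible c \<longleftrightarrow> (\<forall>R S x. c R S x \<noteq> 0 \<longrightarrow> R \<in> intervals \<and> S \<in> intervals \<and> x \<in> R \<and> x \<in> S) \<and>
    (\<forall>R S x y. x \<le> y \<and> x \<in> R \<and> y \<in> S \<longrightarrow> c R S x = c R S y)"

definition endo_of :: "('p::{finite,order}, 'k::field) coeffs \<Rightarrow> ('p, 'k) endo" where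
  "endo_of c = (\<lambda>x. \<lambda>v\<in>carrier (G_space x). \<lambda>S\<in>intervals. \<Sum>R\<in>intervals. c R S x * v R)"

lemma G_space_simps:
  "v \<in> carrier (G_space x) \<longleftrightarrow> v \<in> extensional intervals \<and> (\<forall>S\<in>intervals. x \<notin> S \<longrightarrow> v S = 0)"
  "\<zero>\<^bsub>G_space x\<^esub> = (\<lambda>S\<in>intervals. 0)"
  "v \<oplus>\<^bsub>G_space x\<^esub> w = (\<lambda>S\<in>intervals. v S + w S)"
  "c \<odot>\<^bsub>G_space x\<^esub> v = (\<lambda>S\<in>intervals. c * v S)"
  by (auto simp: G_rep_def direct_sum_def interval_rep_def PiE_def Pi_iff split: if_splits)

lemma rmap_G_rep: "rmap G_rep x y v = (\<lambda>S\<in>intervals. if x \<in> S \<and> y \<in> S then v S else 0)"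
  by (simp add: G_rep_def interval_rep_def)

lemma unit_vec_closed: "unit_vec R x \<in> carrier (G_space x)"
  by (auto simp: G_space_simps unit_vec_def)

lemma unit_vec_zero: "x \<notin> R \<or> R \<notin> intervals \<Longrightarrow> unit_vec R x = (\<lambda>S\<in>intervals. 0)"
  by (auto simp: unit_vec_def intro!: restrict_ext)

lemma left_module_G_space: "left_module scalars (G_space x)"
proof (rule left_moduleI)
  show "abelian_group (G_space x)"
  proof (rule abelian_groupI)
    show "\<exists>w\<in>carrier (G_space x). w \<oplus>\<^bsub>G_space x\<^esub> v = \<zero>\<^bsub>G_space x\<^esub>"
      if "v \<in> carrier (G_space x)" for v
      using that by (intro bexI[of _ "\<lambda>S\<in>intervals. - v S"]) (auto simp: G_space_simps intro!: restrict_ext)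
    show "\<zero>\<^bsub>G_space x\<^esub> \<oplus>\<^bsub>G_space x\<^esub> v = v" if "v \<in> carrier (G_space x)" for v
      using that by (intro extensionalityI[of _ intervals]) (auto simp: G_space_simps)
  qed (auto simp: G_space_simps add_ac intro!: restrict_ext)
  show "\<one>\<^bsub>scalars\<^esub> \<odot>\<^bsub>G_space x\<^esub> v = v" if "v \<in> carrier (G_space x)" for v
    using that by (intro extensionalityI[of _ intervals]) (auto simp: G_space_simps)
qed (auto simp: G_space_simps algebra_simps ring_from_type_algebra intro!: restrict_ext)

lemma admissibleD:
  assumes "admissible c"
  shows "c R S x \<noteq> 0 \<Longrightarrow> R \<in> intervals \<and> S \<in> intervals \<and> x \<in> R \<and> x \<in> S"
    and "x \<notin> R \<Longrightarrow> c R S x = 0" "x \<notin> S \<Longrightarrow> c R S x = 0"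
    and "R \<notin> intervals \<Longrightarrow> c R S x = 0" "S \<notin> intervals \<Longrightarrow> c R S x = 0"
    and "x \<le> y \<Longrightarrow> x \<in> R \<Longrightarrow> y \<in> S \<Longrightarrow> c R S x = c R S y"
  using assms unfolding admissible_def by blast+

lemma carrier_Lambda: "carrier Lambda_alg = rep_hom G_rep G_rep"
  by (simp add: Lambda_alg_def End_op_def)

lemma endo_of_closed:
  assumes v: "v \<in> carrier (G_space x)" and c: "admissible c"
  shows "endo_of c x v \<in> carrier (G_space x)"
  using v admissibleD(3)[OF c] by (auto simp: endo_of_def G_space_simps)

lemma endo_of_mem:
  assumes c: "admissible c" shows "endo_of c \<in> carrier Lambda_alg"
  unfolding carrier_Lambda rep_hom_def mem_Collect_eq
proof (intro conjI allI impI ballI)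
  fix x :: 'a
  have "restrict (endo_of c x) (carrier (G_space x)) \<in> lmod_hom scalars (G_space x) (G_space x)"
    by (rule lmod_homI[OF endo_of_closed[OF _ c] _ _ left_module_G_space])
      (auto simp: endo_of_def G_space_simps distrib_left sum.distrib sum_distrib_left mult.left_commute
        intro!: restrict_ext sum.cong)
  then show "endo_of c x \<in> lmod_hom scalars (G_space x) (G_space x)" by (simp add: endo_of_def)
next
  fix x y :: 'a and v :: "'a set \<Rightarrow> 'b" assume xy: "x \<le> y" and v: "v \<in> carrier (G_space x)"
  have rv: "rmap G_rep x y v \<in> carrier (G_space y)"
    by (auto simp: rmap_G_rep G_space_simps)
  show "endo_of c y (rmap G_rep x y v) = rmap G_rep x y (endo_of c x v)"
  proof (rule extensionalityI[of _ intervals])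
    fix S :: "'a set" assume S: "S \<in> intervals"
    have "c R S y * (if x \<in> R \<and> y \<in> R then v R else 0) = (if x \<in> S \<and> y \<in> S then c R S x * v R else 0)"
      if R: "R \<in> intervals" for R
    proof (cases "y \<in> S \<and> x \<in> R")
      case True
      then have "c R S x = c R S y" using admissibleD(6)[OF c xy] by blast
      then show ?thesis using True admissibleD(2)[OF c, of y R S] admissibleD(3)[OF c, of x S R] by auto
    next
      case False
      then show ?thesis using admissibleD(3)[OF c, of y S R] v R by (auto simp: G_space_simps)
    qed
    then have "(\<Sum>R\<in>intervals. c R S y * (if x \<in> R \<and> y \<in> R then v R else 0)) =
        (\<Sum>R\<in>intervals. if x \<in> S \<and> y \<in> S then c R S x * v R else 0)" by (rule sum.cong[OF refl])
    then show "endo_of c y (rmap G_rep x y v) S = rmap G_rep x y (endo_of c x v) S"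
      using v rv S by (auto simp: endo_of_def rmap_G_rep)
  qed (use rv in \<open>auto simp: endo_of_def rmap_G_rep\<close>)
qed

lemma cf_endo_of:
  assumes c: "admissible c" shows "cf (endo_of c) = c"
proof (intro ext)
  fix R S :: "'a set" and x :: 'a
  show "cf (endo_of c) R S x = c R S x"
  proof (cases "S \<in> intervals")
    case True
    have "cf (endo_of c) R S x = (\<Sum>Q\<in>intervals. c Q S x * unit_vec R x Q)"
      using True unit_vec_closed[of R x, where 'b = 'b] by (simp add: cf_def endo_of_def)
    also have "\<dots> = (\<Sum>Q\<in>intervals. if Q = R then c R S x else 0)"
      using admissibleD(2)[OF c, of x R S] by (intro sum.cong refl) (auto simp: unit_vec_def)
    also have "\<dots> = c R S x" using admissibleD(4)[OF c, of R S x] by auto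
    finally show ?thesis .
  qed (use admissibleD(5)[OF c, of S R x] in \<open>simp add: cf_def\<close>)
qed

text \<open>Linearity at the point \<open>x\<close>, used along the truncations \<open>w A\<close>
  of \<open>v\<close> by induction on the finite set \<open>A\<close> of summands.\<close>

lemma Lambda_expand:
  assumes a: "a \<in> carrier Lambda_alg" and v: "v \<in> carrier (G_space x)" and S: "S \<in> intervals"
  shows "a x v S = (\<Sum>R\<in>intervals. cf a R S x * v R)"
proof -
  have ax: "a x \<in> lmod_hom scalars (G_space x) (G_space x)"
    using a by (simp add: carrier_Lambda rep_hom_def)
  note h = lmod_homD[OF ax]
  define w where "w A = (\<lambda>S\<in>intervals. if S \<in> A then v S else 0)" for A
  have wc: "w A \<in> carrier (G_space x)" for A using v by (auto simp: w_def G_space_simps)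
  have "a x (w A) S = (\<Sum>R\<in>A. cf a R S x * v R)" if "finite A" "A \<subseteq> intervals" for A
    using that
  proof (induction A rule: finite_induct)
    case empty
    have wz: "w {} = \<zero>\<^bsub>G_space x\<^esub>" by (simp add: w_def G_space_simps)
    have e: "a x (w {}) = \<zero>\<^bsub>G_space x\<^esub>"
      unfolding wz by (rule lmod_hom_zero[OF left_module_G_space left_module_G_space ax])
    have "a x (w {}) S = 0" unfolding e using S by (simp add: G_space_simps)
    then show ?case by simp
  next
    case (insert R A)
    have R: "R \<in> intervals" using insert.prems by simp
    have sc: "v R \<odot>\<^bsub>G_space x\<^esub> unit_vec R x \<in> carrier (G_space x)"
      using unit_vec_closed[of R x] by (auto simp: G_space_simps)
    have "w (insert R A) = w A \<oplus>\<^bsub>G_space x\<^esub> (v R \<odot>\<^bsub>G_space x\<^esub> unit_vec R x)"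
      using insert.hyps v R
      by (auto simp: w_def G_space_simps unit_vec_def intro!: restrict_ext)
    then have "a x (w (insert R A)) = a x (w A) \<oplus>\<^bsub>G_space x\<^esub> (v R \<odot>\<^bsub>G_space x\<^esub> a x (unit_vec R x))"
      using h(2)[OF wc sc] h(3)[OF _ unit_vec_closed, of "v R" R] by simp
    then show ?case using insert S by (simp add: G_space_simps cf_def)
  qed
  from this[of intervals] have "a x (w intervals) S = (\<Sum>R\<in>intervals. cf a R S x * v R)" by simp
  moreover have "w intervals = v"
    using v by (intro extensionalityI[of _ intervals]) (auto simp: w_def G_space_simps)
  ultimately show ?thesis by simp
qed

lemma admissible_cf:
  assumes a: "a \<in> carrier Lambda_alg" shows "admissible (cf a)"
  unfolding admissible_def
proof (intro conjI allI impI)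
  have ax: "a x \<in> lmod_hom scalars (G_space x) (G_space x)" for x
    using a by (simp add: carrier_Lambda rep_hom_def)
  have z: "a x (\<lambda>S\<in>intervals. 0) = (\<lambda>S\<in>intervals. 0)" for x
    using lmod_hom_zero[OF left_module_G_space left_module_G_space ax, of x] by (simp add: G_space_simps)
  have c: "a x (unit_vec R x) \<in> carrier (G_space x)" for R x
    by (rule lmod_homD(1)[OF ax unit_vec_closed])
  have xR: "x \<in> R \<and> R \<in> intervals" if "cf a R S x \<noteq> 0" for R S x
  proof (rule ccontr)
    assume "\<not> (x \<in> R \<and> R \<in> intervals)"
    then have "unit_vec R x = (\<lambda>S\<in>intervals. 0 :: 'b)" using unit_vec_zero[of x R] by blast
    then have "a x (unit_vec R x) = (\<lambda>S\<in>intervals. 0)" by (simp only: z)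
    then show False using that by (simp add: cf_def split: if_splits)
  qed
  have xS: "x \<in> S \<and> S \<in> intervals" if "cf a R S x \<noteq> 0" for R S x
    using that c[of x R] by (auto simp: cf_def G_space_simps split: if_splits)
  fix R S :: "'a set" and x :: 'a
  assume "cf a R S x \<noteq> 0"
  then show "R \<in> intervals" "S \<in> intervals" "x \<in> R" "x \<in> S" using xR xS by auto
next
  have ax: "a x \<in> lmod_hom scalars (G_space x) (G_space x)" for x
    using a by (simp add: carrier_Lambda rep_hom_def)
  have z: "a x (\<lambda>S\<in>intervals. 0) = (\<lambda>S\<in>intervals. 0)" for x
    using lmod_hom_zero[OF left_module_G_space left_module_G_space ax, of x] by (simp add: G_space_simps)
  have c: "a x (unit_vec R x) \<in> carrier (G_space x)" for R x
    by (rule lmod_homD(1)[OF ax unit_vec_closed])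
  fix R S :: "'a set" and x y :: 'a assume xy: "x \<le> y \<and> x \<in> R \<and> y \<in> S"
  show "cf a R S x = cf a R S y"
  proof (cases "S \<in> intervals")
    case True
    have "a y (rmap G_rep x y (unit_vec R x)) = rmap G_rep x y (a x (unit_vec R x))"
      using a xy unit_vec_closed[of R x, where 'b = 'b] by (simp add: carrier_Lambda rep_hom_def)
    then have "a y (rmap G_rep x y (unit_vec R x)) S = rmap G_rep x y (a x (unit_vec R x)) S" by simp
    also have "\<dots> = cf a R S x"
      using True xy c[of x R] by (auto simp: rmap_G_rep cf_def G_space_simps)
    also have "rmap G_rep x y (unit_vec R x) = unit_vec R y"
      using xy by (auto simp: rmap_G_rep unit_vec_def intro!: restrict_ext)
    finally show ?thesis using True by (simp add: cf_def)
  qed (simp add: cf_def)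
qed

lemma endo_of_cf:
  assumes a: "a \<in> carrier Lambda_alg" shows "endo_of (cf a) = a"
proof
  fix x :: 'a
  have ax: "a x \<in> lmod_hom scalars (G_space x) (G_space x)"
    using a by (simp add: carrier_Lambda rep_hom_def)
  show "endo_of (cf a) x = a x"
  proof (rule extensionalityI[OF _ lmod_homD(4)[OF ax]])
    fix v :: "'a set \<Rightarrow> 'b" assume v: "v \<in> carrier (G_space x)"
    show "endo_of (cf a) x v = a x v"
    proof (rule extensionalityI[of _ intervals])
      show "a x v \<in> extensional intervals" using lmod_homD(1)[OF ax v] by (simp add: G_space_simps)
    qed (use v Lambda_expand[OF a v] in \<open>auto simp: endo_of_def\<close>)
  qed (simp add: endo_of_def)
qed

lemma Lambda_eqI:
  assumes "a \<in> carrier Lambda_alg" "b \<in> carrier Lambda_alg" "\<And>R S x. cf a R S x = cf b R S x"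
  shows "a = b"
proof -
  have "cf a = cf b" using assms(3) by (intro ext)
  then show ?thesis using endo_of_cf[OF assms(1)] endo_of_cf[OF assms(2)] by metis
qed

text \<open>The multiplication is opposite to composition, so the product runs in the written order:
  \<open>c\<close> leads from \<open>R\<close> to \<open>Q\<close>, then \<open>d\<close> from
  \<open>Q\<close> to \<open>S\<close>, separately at each point.\<close>

definition mult_coeffs :: "('p::{finite,order}, 'k::field) coeffs \<Rightarrow> ('p, 'k) coeffs \<Rightarrow> ('p, 'k) coeffs" where
  "mult_coeffs c d R S x = (\<Sum>Q\<in>intervals. c R Q x * d Q S x)"

lemma admissibleI:
  assumes "\<And>R S x. c R S x \<noteq> 0 \<Longrightarrow> R \<in> intervals \<and> S \<in> intervals \<and> x \<in> R \<and> x \<in> S"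
    and "\<And>R S x y. x \<le> y \<Longrightarrow> x \<in> R \<Longrightarrow> y \<in> S \<Longrightarrow> c R S x = c R S y"
  shows "admissible c"
  using assms unfolding admissible_def by blast

lemma admissible_mult:
  assumes c: "admissible c" and d: "admissible d" shows "admissible (mult_coeffs c d)"
proof (rule admissibleI)
  fix R S :: "'a set" and x :: 'a assume "mult_coeffs c d R S x \<noteq> 0"
  then obtain Q where "c R Q x * d Q S x \<noteq> 0"
    unfolding mult_coeffs_def by (rule sum.not_neutral_contains_not_neutral)
  then have "c R Q x \<noteq> 0" "d Q S x \<noteq> 0" by auto
  then show "R \<in> intervals \<and> S \<in> intervals \<and> x \<in> R \<and> x \<in> S"
    using admissibleD(1)[OF c, of R Q x] admissibleD(1)[OF d, of Q S x] by blast
next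
  fix R S :: "'a set" and x y :: 'a assume xy: "x \<le> y" "x \<in> R" "y \<in> S"
  show "mult_coeffs c d R S x = mult_coeffs c d R S y"
    unfolding mult_coeffs_def
  proof (rule sum.cong[OF refl])
    fix Q :: "'a set" assume "Q \<in> intervals"
    \<comment> \<open>If just one of the two points lies in \<open>Q\<close>, the product vanishes
      at both: a coefficient is 0 outside its index sets, and naturality of that factor carries the
      0 to the other point.\<close>
    consider "x \<in> Q" "y \<in> Q" | "x \<in> Q" "y \<notin> Q" | "x \<notin> Q" "y \<in> Q" | "x \<notin> Q" "y \<notin> Q" by blast
    then show "c R Q x * d Q S x = c R Q y * d Q S y"
    proof cases
      case 1
      then show ?thesis using admissibleD(6)[OF c xy(1,2), of Q] admissibleD(6)[OF d xy(1) _ xy(3), of Q] by simp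
    next
      case 2
      then show ?thesis using admissibleD(3)[OF c, of y Q R] admissibleD(2)[OF d, of y Q S]
          admissibleD(6)[OF d xy(1) _ xy(3), of Q] by simp
    next
      case 3
      then show ?thesis using admissibleD(3)[OF c, of x Q R] admissibleD(6)[OF c xy(1,2), of Q] by simp
    next
      case 4
      then show ?thesis using admissibleD(3)[OF c, of x Q R] admissibleD(3)[OF c, of y Q R] by simp
    qed
  qed
qed

lemma admissible_linear:
  assumes c: "admissible c" and d: "admissible d"
  shows "admissible (\<lambda>R S x. c R S x + d R S x)" and "admissible (\<lambda>R S x. k * c R S x)"
proof -
  have *: "c R S x = c R S y" "d R S x = d R S y" if "x \<le> y" "x \<in> R" "y \<in> S" for R S x y
    using admissibleD(6)[OF c that] admissibleD(6)[OF d that] .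
  show "admissible (\<lambda>R S x. c R S x + d R S x)"
  proof (rule admissibleI)
    fix R S x assume "c R S x + d R S x \<noteq> 0"
    then have "c R S x \<noteq> 0 \<or> d R S x \<noteq> 0" by auto
    then show "R \<in> intervals \<and> S \<in> intervals \<and> x \<in> R \<and> x \<in> S"
      using admissibleD(1)[OF c, of R S x] admissibleD(1)[OF d, of R S x] by blast
  qed (use * in metis)
  show "admissible (\<lambda>R S x. k * c R S x)"
  proof (rule admissibleI)
    fix R S x assume "k * c R S x \<noteq> 0"
    then show "R \<in> intervals \<and> S \<in> intervals \<and> x \<in> R \<and> x \<in> S"
      using admissibleD(1)[OF c, of R S x] by simp
  qed (use * in metis)
qed

text \<open>For a relative upset \<open>D\<close> of \<open>D'\<close>, the morphism that is the identity on \<open>D\<close>.\<close>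

definition incl_coeffs :: "'p::{finite,order} set \<Rightarrow> 'p set \<Rightarrow> ('p, 'k::field) coeffs" where
  "incl_coeffs D D' R S x = (if R = D \<and> S = D' \<and> x \<in> D then 1 else 0)"

lemma admissible_incl:
  assumes "D \<in> intervals" "D' \<in> intervals" "relative_upset D D'"
  shows "admissible (incl_coeffs D D')"
  using assms by (intro admissibleI) (auto simp: incl_coeffs_def relative_upset_def split: if_splits)

lemma admissible_zero: "admissible (\<lambda>R S x. 0)"
  by (simp add: admissible_def)

lemma admissible_one:
  "admissible (\<lambda>R S x. if R = S \<and> S \<in> intervals \<and> x \<in> S then 1 else 0)"
  by (intro admissibleI) (auto split: if_splits)

lemma endo_of_eqI:
  assumes "\<And>x v S. v \<in> carrier (G_space x) \<Longrightarrow> S \<in> intervals \<Longrightarrow>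
      a x v S = (\<Sum>R\<in>intervals. c R S x * v R)"
    and "\<And>x. a x \<in> extensional (carrier (G_space x))"
    and "\<And>x v. v \<in> carrier (G_space x) \<Longrightarrow> a x v \<in> extensional intervals"
  shows "a = endo_of c"
proof
  fix x :: 'a show "a x = endo_of c x"
  proof (rule extensionalityI[OF assms(2)])
    fix v :: "'a set \<Rightarrow> 'b" assume v: "v \<in> carrier (G_space x)"
    show "a x v = endo_of c x v"
      by (rule extensionalityI[OF assms(3)[OF v]]) (use v assms(1) in \<open>auto simp: endo_of_def\<close>)
  qed (simp add: endo_of_def)
qed

section \<open>Ring structure in coordinates\<close>

lemma add_endo_of: "endo_of c \<oplus>\<^bsub>Lambda_alg\<^esub> endo_of d = endo_of (\<lambda>R S x. c R S x + d R S x)"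
  by (rule endo_of_eqI)
    (auto simp: Lambda_alg_def End_op_def endo_of_def G_space_simps distrib_right sum.distrib)

lemma smult_endo_of: "k \<odot>\<^bsub>Lambda_alg\<^esub> endo_of c = endo_of (\<lambda>R S x. k * c R S x)"
  by (rule endo_of_eqI)
    (auto simp: Lambda_alg_def End_op_def endo_of_def G_space_simps sum_distrib_left mult.assoc)

lemma zero_endo_of: "\<zero>\<^bsub>Lambda_alg\<^esub> = endo_of (\<lambda>R S x. 0)"
  by (rule endo_of_eqI) (auto simp: Lambda_alg_def End_op_def G_space_simps)

lemma one_endo_of:
  "\<one>\<^bsub>Lambda_alg\<^esub> = endo_of (\<lambda>R S x. if R = S \<and> S \<in> intervals \<and> x \<in> S then 1 else 0)"
proof (rule endo_of_eqI)
  fix x :: 'a and S :: "'a set" and v :: "'a set \<Rightarrow> 'b" assume v: "v \<in> carrier (G_space x)" and S: "S \<in> intervals"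
  have "(\<Sum>R\<in>intervals. (if R = S \<and> S \<in> intervals \<and> x \<in> S then 1 else 0) * v R) =
      (\<Sum>R\<in>intervals. if R = S then v S else 0)"
    using v S by (intro sum.cong refl) (auto simp: G_space_simps)
  then show "\<one>\<^bsub>Lambda_alg\<^esub> x v S = (\<Sum>R\<in>intervals. (if R = S \<and> S \<in> intervals \<and> x \<in> S then 1 else 0) * v R)"
    using v S by (simp add: Lambda_alg_def End_op_def)
qed (auto simp: Lambda_alg_def End_op_def G_space_simps)

lemma mult_endo_of:
  assumes c: "admissible c"
  shows "endo_of c \<otimes>\<^bsub>Lambda_alg\<^esub> endo_of d = endo_of (mult_coeffs c d)"
proof (rule endo_of_eqI)
  fix x :: 'a and S :: "'a set" and v :: "'a set \<Rightarrow> 'b" assume v: "v \<in> carrier (G_space x)" and S: "S \<in> intervals"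
  have "(endo_of c \<otimes>\<^bsub>Lambda_alg\<^esub> endo_of d) x v S = endo_of d x (endo_of c x v) S"
    using v by (simp add: Lambda_alg_def End_op_def rep_comp_def compose_def)
  also have "\<dots> = (\<Sum>Q\<in>intervals. d Q S x * (\<Sum>R\<in>intervals. c R Q x * v R))"
    using S v endo_of_closed[OF v c] by (simp add: endo_of_def)
  also have "\<dots> = (\<Sum>R\<in>intervals. mult_coeffs c d R S x * v R)"
    unfolding mult_coeffs_def sum_distrib_left sum_distrib_right
    by (subst sum.swap) (simp add: mult_ac)
  finally show "(endo_of c \<otimes>\<^bsub>Lambda_alg\<^esub> endo_of d) x v S = (\<Sum>R\<in>intervals. mult_coeffs c d R S x * v R)" .
next
  fix x :: 'a show "(endo_of c \<otimes>\<^bsub>Lambda_alg\<^esub> endo_of d) x \<in> extensional (carrier (G_space x))"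
    by (simp add: Lambda_alg_def End_op_def rep_comp_def compose_def)
next
  fix x :: 'a and v :: "'a set \<Rightarrow> 'b" assume v: "v \<in> carrier (G_space x)"
  then show "(endo_of c \<otimes>\<^bsub>Lambda_alg\<^esub> endo_of d) x v \<in> extensional intervals"
    using endo_of_closed[OF v c] by (simp add: Lambda_alg_def End_op_def rep_comp_def compose_def endo_of_def)
qed

lemma cf_add:
  assumes "a \<in> carrier Lambda_alg" "b \<in> carrier Lambda_alg"
  shows "a \<oplus>\<^bsub>Lambda_alg\<^esub> b \<in> carrier Lambda_alg"
    and "cf (a \<oplus>\<^bsub>Lambda_alg\<^esub> b) R S x = cf a R S x + cf b R S x"
proof -
  have eq: "a \<oplus>\<^bsub>Lambda_alg\<^esub> b = endo_of (\<lambda>R S x. cf a R S x + cf b R S x)"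
    using add_endo_of[of "cf a" "cf b"] assms by (simp add: endo_of_cf)
  note ad = admissible_linear(1)[OF admissible_cf[OF assms(1)] admissible_cf[OF assms(2)]]
  show "a \<oplus>\<^bsub>Lambda_alg\<^esub> b \<in> carrier Lambda_alg" unfolding eq by (rule endo_of_mem[OF ad])
  show "cf (a \<oplus>\<^bsub>Lambda_alg\<^esub> b) R S x = cf a R S x + cf b R S x" unfolding eq cf_endo_of[OF ad] ..
qed

lemma cf_smult:
  assumes "a \<in> carrier Lambda_alg"
  shows "k \<odot>\<^bsub>Lambda_alg\<^esub> a \<in> carrier Lambda_alg"
    and "cf (k \<odot>\<^bsub>Lambda_alg\<^esub> a) R S x = k * cf a R S x"
proof -
  have eq: "k \<odot>\<^bsub>Lambda_alg\<^esub> a = endo_of (\<lambda>R S x. k * cf a R S x)"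
    using smult_endo_of[of k "cf a"] assms by (simp add: endo_of_cf)
  note ad = admissible_linear(2)[OF admissible_cf[OF assms(1)] admissible_zero, of k]
  show "k \<odot>\<^bsub>Lambda_alg\<^esub> a \<in> carrier Lambda_alg" unfolding eq by (rule endo_of_mem[OF ad])
  show "cf (k \<odot>\<^bsub>Lambda_alg\<^esub> a) R S x = k * cf a R S x" unfolding eq cf_endo_of[OF ad] ..
qed

lemma cf_mult:
  assumes "a \<in> carrier Lambda_alg" "b \<in> carrier Lambda_alg"
  shows "a \<otimes>\<^bsub>Lambda_alg\<^esub> b \<in> carrier Lambda_alg"
    and "cf (a \<otimes>\<^bsub>Lambda_alg\<^esub> b) R S x = (\<Sum>Q\<in>intervals. cf a R Q x * cf b Q S x)"
proof -
  have eq: "a \<otimes>\<^bsub>Lambda_alg\<^esub> b = endo_of (mult_coeffs (cf a) (cf b))"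
    using mult_endo_of[OF admissible_cf[OF assms(1)], of "cf b"] assms by (simp add: endo_of_cf)
  note ad = admissible_mult[OF admissible_cf[OF assms(1)] admissible_cf[OF assms(2)]]
  show "a \<otimes>\<^bsub>Lambda_alg\<^esub> b \<in> carrier Lambda_alg" unfolding eq by (rule endo_of_mem[OF ad])
  show "cf (a \<otimes>\<^bsub>Lambda_alg\<^esub> b) R S x = (\<Sum>Q\<in>intervals. cf a R Q x * cf b Q S x)"
    unfolding eq cf_endo_of[OF ad] mult_coeffs_def ..
qed

lemma cf_zero: "cf \<zero>\<^bsub>Lambda_alg\<^esub> R S x = 0"
  unfolding zero_endo_of cf_endo_of[OF admissible_zero] ..

lemma cf_one: "cf \<one>\<^bsub>Lambda_alg\<^esub> R S x = (if R = S \<and> S \<in> intervals \<and> x \<in> S then 1 else 0)"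
  unfolding one_endo_of cf_endo_of[OF admissible_one] ..

lemma zero_Lambda: "\<zero>\<^bsub>Lambda_alg\<^esub> \<in> carrier Lambda_alg"
  unfolding zero_endo_of by (rule endo_of_mem[OF admissible_zero])

lemma one_Lambda: "\<one>\<^bsub>Lambda_alg\<^esub> \<in> carrier Lambda_alg"
  unfolding one_endo_of by (rule endo_of_mem[OF admissible_one])

lemma cf_one_sum:
  assumes a: "a \<in> carrier Lambda_alg"
  shows "(\<Sum>Q\<in>intervals. cf \<one>\<^bsub>Lambda_alg\<^esub> R Q x * cf a Q S x) = cf a R S x"
    and "(\<Sum>Q\<in>intervals. cf a R Q x * cf \<one>\<^bsub>Lambda_alg\<^esub> Q S x) = cf a R S x"
proof -
  note c = admissibleD[OF admissible_cf[OF a]]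
  have "(\<Sum>Q\<in>intervals. cf \<one>\<^bsub>Lambda_alg\<^esub> R Q x * cf a Q S x) = (\<Sum>Q\<in>intervals. if Q = R then cf a R S x else 0)"
    using c(2)[of x R S] by (intro sum.cong refl) (auto simp: cf_one)
  then show "(\<Sum>Q\<in>intervals. cf \<one>\<^bsub>Lambda_alg\<^esub> R Q x * cf a Q S x) = cf a R S x"
    using c(4)[of R S x] by auto
  have "(\<Sum>Q\<in>intervals. cf a R Q x * cf \<one>\<^bsub>Lambda_alg\<^esub> Q S x) = (\<Sum>Q\<in>intervals. if Q = S then cf a R S x else 0)"
    using c(3)[of x S R] by (intro sum.cong refl) (auto simp: cf_one)
  then show "(\<Sum>Q\<in>intervals. cf a R Q x * cf \<one>\<^bsub>Lambda_alg\<^esub> Q S x) = cf a R S x"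
    using c(5)[of S R x] by auto
qed

lemma ring_Lambda: "ring (Lambda_alg :: ('k::field, ('p::{finite,order}, 'k) endo) module)"
proof (rule ringI)
  show "abelian_group (Lambda_alg :: ('k, ('p, 'k) endo) module)"
  proof (rule abelian_groupI)
    fix a b c :: "('p, 'k) endo"
    assume a: "a \<in> carrier Lambda_alg" and b: "b \<in> carrier Lambda_alg" and c: "c \<in> carrier Lambda_alg"
    show "a \<oplus>\<^bsub>Lambda_alg\<^esub> b \<in> carrier Lambda_alg" by (rule cf_add(1)[OF a b])
    show "a \<oplus>\<^bsub>Lambda_alg\<^esub> b \<oplus>\<^bsub>Lambda_alg\<^esub> c = a \<oplus>\<^bsub>Lambda_alg\<^esub> (b \<oplus>\<^bsub>Lambda_alg\<^esub> c)"
      by (rule Lambda_eqI) (simp_all add: a b c cf_add)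
    show "a \<oplus>\<^bsub>Lambda_alg\<^esub> b = b \<oplus>\<^bsub>Lambda_alg\<^esub> a"
      by (rule Lambda_eqI) (simp_all add: a b cf_add)
  next
    fix a :: "('p, 'k) endo" assume a: "a \<in> carrier Lambda_alg"
    show "\<zero>\<^bsub>Lambda_alg\<^esub> \<oplus>\<^bsub>Lambda_alg\<^esub> a = a"
      by (rule Lambda_eqI) (simp_all add: a cf_add zero_Lambda cf_zero)
    show "\<exists>b\<in>carrier Lambda_alg. b \<oplus>\<^bsub>Lambda_alg\<^esub> a = \<zero>\<^bsub>Lambda_alg\<^esub>"
      by (rule bexI[of _ "(-1) \<odot>\<^bsub>Lambda_alg\<^esub> a"], rule Lambda_eqI)
        (simp_all add: a cf_add cf_smult zero_Lambda cf_zero)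
  qed (rule zero_Lambda)
  show "monoid (Lambda_alg :: ('k, ('p, 'k) endo) module)"
  proof (rule monoidI)
    fix a b c :: "('p, 'k) endo"
    assume a: "a \<in> carrier Lambda_alg" and b: "b \<in> carrier Lambda_alg" and c: "c \<in> carrier Lambda_alg"
    show "a \<otimes>\<^bsub>Lambda_alg\<^esub> b \<in> carrier Lambda_alg" by (rule cf_mult(1)[OF a b])
    show "a \<otimes>\<^bsub>Lambda_alg\<^esub> b \<otimes>\<^bsub>Lambda_alg\<^esub> c = a \<otimes>\<^bsub>Lambda_alg\<^esub> (b \<otimes>\<^bsub>Lambda_alg\<^esub> c)"
    proof (rule Lambda_eqI)
      fix R S :: "'p set" and x :: 'p
      show "cf (a \<otimes>\<^bsub>Lambda_alg\<^esub> b \<otimes>\<^bsub>Lambda_alg\<^esub> c) R S x = cf (a \<otimes>\<^bsub>Lambda_alg\<^esub> (b \<otimes>\<^bsub>Lambda_alg\<^esub> c)) R S x"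
        by (simp add: a b c cf_mult sum_distrib_left sum_distrib_right mult.assoc, subst sum.swap, rule refl)
    qed (simp_all add: a b c cf_mult)
  next
    fix a :: "('p, 'k) endo" assume a: "a \<in> carrier Lambda_alg"
    show "\<one>\<^bsub>Lambda_alg\<^esub> \<otimes>\<^bsub>Lambda_alg\<^esub> a = a"
      by (rule Lambda_eqI) (simp_all add: a cf_mult one_Lambda cf_one_sum)
    show "a \<otimes>\<^bsub>Lambda_alg\<^esub> \<one>\<^bsub>Lambda_alg\<^esub> = a"
      by (rule Lambda_eqI) (simp_all add: a cf_mult one_Lambda cf_one_sum)
  qed (rule one_Lambda)
  fix a b c :: "('p, 'k) endo"
  assume a: "a \<in> carrier Lambda_alg" and b: "b \<in> carrier Lambda_alg" and c: "c \<in> carrier Lambda_alg"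
  show "(a \<oplus>\<^bsub>Lambda_alg\<^esub> b) \<otimes>\<^bsub>Lambda_alg\<^esub> c = a \<otimes>\<^bsub>Lambda_alg\<^esub> c \<oplus>\<^bsub>Lambda_alg\<^esub> b \<otimes>\<^bsub>Lambda_alg\<^esub> c"
    by (rule Lambda_eqI) (simp_all add: a b c cf_mult cf_add distrib_right sum.distrib)
  show "c \<otimes>\<^bsub>Lambda_alg\<^esub> (a \<oplus>\<^bsub>Lambda_alg\<^esub> b) = c \<otimes>\<^bsub>Lambda_alg\<^esub> a \<oplus>\<^bsub>Lambda_alg\<^esub> c \<otimes>\<^bsub>Lambda_alg\<^esub> b"
    by (rule Lambda_eqI) (simp_all add: a b c cf_mult cf_add distrib_left sum.distrib)
qed

lemma unital_algebra_Lambda: "unital_algebra (Lambda_alg :: ('k::field, ('p::{finite,order}, 'k) endo) module)"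
proof (intro unital_algebra.intro unital_algebra_axioms.intro)
  note s = cf_smult[OF one_Lambda] one_Lambda
  have l: "(\<Sum>Q\<in>intervals. k * cf \<one>\<^bsub>Lambda_alg\<^esub> R Q x * cf a Q S x) = k * cf a R S x"
    and r: "(\<Sum>Q\<in>intervals. cf a R Q x * (k * cf \<one>\<^bsub>Lambda_alg\<^esub> Q S x)) = k * cf a R S x"
    if "a \<in> carrier Lambda_alg" for a :: "('p, 'k) endo" and k R S x
    by (simp_all add: mult.assoc mult.left_commute cf_one_sum[OF that] flip: sum_distrib_left)
  have ll: "(\<Sum>Q\<in>intervals. c * cf (\<one>\<^bsub>Lambda_alg\<^esub> :: ('p, 'k) endo) R Q x * (d * cf (\<one>\<^bsub>Lambda_alg\<^esub> :: ('p, 'k) endo) Q S x)) =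
      c * d * cf (\<one>\<^bsub>Lambda_alg\<^esub> :: ('p, 'k) endo) R S x" for c d R S x
  proof -
    have "(\<Sum>Q\<in>intervals. c * cf (\<one>\<^bsub>Lambda_alg\<^esub> :: ('p, 'k) endo) R Q x * (d * cf (\<one>\<^bsub>Lambda_alg\<^esub> :: ('p, 'k) endo) Q S x)) =
        c * d * (\<Sum>Q\<in>intervals. cf (\<one>\<^bsub>Lambda_alg\<^esub> :: ('p, 'k) endo) R Q x * cf (\<one>\<^bsub>Lambda_alg\<^esub> :: ('p, 'k) endo) Q S x)"
      unfolding sum_distrib_left by (simp add: mult_ac)
    then show ?thesis by (simp only: cf_one_sum(1)[OF one_Lambda])
  qed
  fix c d :: 'k
  show "c \<odot>\<^bsub>Lambda_alg\<^esub> (\<one>\<^bsub>Lambda_alg\<^esub> :: ('p, 'k) endo) \<in> carrier Lambda_alg" by (rule s)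
  show "(c + d) \<odot>\<^bsub>Lambda_alg\<^esub> (\<one>\<^bsub>Lambda_alg\<^esub> :: ('p, 'k) endo) =
      c \<odot>\<^bsub>Lambda_alg\<^esub> \<one>\<^bsub>Lambda_alg\<^esub> \<oplus>\<^bsub>Lambda_alg\<^esub> d \<odot>\<^bsub>Lambda_alg\<^esub> \<one>\<^bsub>Lambda_alg\<^esub>"
    by (rule Lambda_eqI) (simp_all add: s cf_add distrib_right)
  show "(c * d) \<odot>\<^bsub>Lambda_alg\<^esub> (\<one>\<^bsub>Lambda_alg\<^esub> :: ('p, 'k) endo) =
      c \<odot>\<^bsub>Lambda_alg\<^esub> \<one>\<^bsub>Lambda_alg\<^esub> \<otimes>\<^bsub>Lambda_alg\<^esub> (d \<odot>\<^bsub>Lambda_alg\<^esub> \<one>\<^bsub>Lambda_alg\<^esub>)"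
    by (rule Lambda_eqI) (simp_all only: s cf_mult ll)
  show "1 \<odot>\<^bsub>Lambda_alg\<^esub> (\<one>\<^bsub>Lambda_alg\<^esub> :: ('p, 'k) endo) = \<one>\<^bsub>Lambda_alg\<^esub>"
    by (rule Lambda_eqI) (simp_all add: s)
  fix a :: "('p, 'k) endo" assume a: "a \<in> carrier Lambda_alg"
  show "c \<odot>\<^bsub>Lambda_alg\<^esub> \<one>\<^bsub>Lambda_alg\<^esub> \<otimes>\<^bsub>Lambda_alg\<^esub> a = a \<otimes>\<^bsub>Lambda_alg\<^esub> (c \<odot>\<^bsub>Lambda_alg\<^esub> \<one>\<^bsub>Lambda_alg\<^esub>)"
    by (rule Lambda_eqI) (simp_all only: a s cf_mult l r)
qed (rule ring_Lambda)

text \<open>The assumption on \<open>f\<close> concerns vectors of the fibre of \<open>R\<close> at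
  \<open>x\<close>, so that it covers the bare identity in \<open>idem\<close> as well as the
  restricted function \<open>j_map\<close>.\<close>

lemma as_endo_eq:
  assumes "S \<in> intervals" "R \<in> intervals"
    and f: "\<And>x v. (x \<notin> R \<longrightarrow> v = 0) \<Longrightarrow> f x v = (if x \<in> R then v else 0)"
  shows "as_endo R S f = endo_of (incl_coeffs R S)"
proof (rule endo_of_eqI)
  fix x :: 'a and Q :: "'a set" and v :: "'a set \<Rightarrow> 'b" assume v: "v \<in> carrier (G_space x)" and Q: "Q \<in> intervals"
  have "(\<Sum>R'\<in>intervals. incl_coeffs R S R' Q x * v R') = (\<Sum>R'\<in>intervals. if R' = R then (if Q = S \<and> x \<in> R then v R else 0) else 0)"
    by (rule sum.cong) (auto simp: incl_coeffs_def)
  moreover have "f x (v R) = (if x \<in> R then v R else 0)"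
    using v assms(2) by (intro f) (auto simp: G_space_simps)
  moreover have "\<zero>\<^bsub>rspace (interval_rep Q) x\<^esub> = (0 :: 'b)" by (simp add: interval_rep_def)
  ultimately show "as_endo R S f x v Q = (\<Sum>R'\<in>intervals. incl_coeffs R S R' Q x * v R')"
    using v Q assms by (auto simp: as_endo_def summand_inj_def)
qed (auto simp: as_endo_def summand_inj_def)

lemma idem_eq: "S \<in> intervals \<Longrightarrow> idem S = endo_of (incl_coeffs S S)"
  unfolding idem_def by (rule as_endo_eq) auto

lemma as_endo_j_map:
  "D \<in> intervals \<Longrightarrow> D' \<in> intervals \<Longrightarrow> as_endo D D' (j_map D D') = endo_of (incl_coeffs D D')"
  by (rule as_endo_eq) (auto simp: j_map_def interval_rep_def)

section \<open>Idempotents and inclusion morphisms\<close>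

lemma relative_upset_refl: "relative_upset S S"
  by (simp add: relative_upset_def)

lemma idem_Lambda:
  assumes "S \<in> intervals"
  shows "idem S \<in> carrier Lambda_alg" "cf (idem S) R Q x = (if R = S \<and> Q = S \<and> x \<in> S then 1 else 0)"
proof -
  note ad = admissible_incl[OF assms assms relative_upset_refl]
  show "idem S \<in> carrier Lambda_alg" unfolding idem_eq[OF assms] by (rule endo_of_mem[OF ad])
  show "cf (idem S) R Q x = (if R = S \<and> Q = S \<and> x \<in> S then 1 else 0)"
    unfolding idem_eq[OF assms] cf_endo_of[OF ad] by (simp add: incl_coeffs_def)
qed

definition incl :: "'p::{finite,order} set \<Rightarrow> 'p set \<Rightarrow> ('p, 'k::field) endo" where
  "incl D D' = endo_of (incl_coeffs D D')"

lemma incl_Lambda: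
  assumes "D \<in> intervals" "D' \<in> intervals" "relative_upset D D'"
  shows "incl D D' \<in> carrier Lambda_alg" "cf (incl D D') R Q x = (if R = D \<and> Q = D' \<and> x \<in> D then 1 else 0)"
  unfolding incl_def cf_endo_of[OF admissible_incl[OF assms]]
  by (rule endo_of_mem[OF admissible_incl[OF assms]]) (simp add: incl_coeffs_def)

text \<open>Following a morphism by the inclusion leaves its scalar function unchanged: it only
  moves from column \<open>D\<close> to column \<open>D'\<close>. Nothing is lost, because
  coefficients into \<open>D\<close> vanish outside \<open>D\<close>.\<close>

lemma cf_mult_incl:
  assumes "D \<in> intervals" "D' \<in> intervals" "relative_upset D D'" and a: "a \<in> carrier Lambda_alg"
  shows "cf (a \<otimes>\<^bsub>Lambda_alg\<^esub> incl D D') R Q x = (if Q = D' then cf a R D x else 0)"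
proof -
  have "cf (a \<otimes>\<^bsub>Lambda_alg\<^esub> incl D D') R Q x = (\<Sum>T\<in>intervals. if T = D then (if Q = D' then cf a R D x else 0) else 0)"
    unfolding cf_mult(2)[OF a incl_Lambda(1)[OF assms(1-3)]]
    using admissibleD(3)[OF admissible_cf[OF a], of x D R]
    by (intro sum.cong refl) (auto simp: incl_Lambda(2)[OF assms(1-3)])
  then show ?thesis using assms(1) by simp
qed

lemma incl_self: "S \<in> intervals \<Longrightarrow> incl S S = idem S"
  by (simp add: incl_def idem_eq)

section \<open>Indecomposable projectives and simple tops\<close>

lemma proj_simps:
  "\<zero>\<^bsub>proj S\<^esub> = \<zero>\<^bsub>Lambda_alg\<^esub>" "g \<oplus>\<^bsub>proj S\<^esub> h = g \<oplus>\<^bsub>Lambda_alg\<^esub> h" "a \<odot>\<^bsub>proj S\<^esub> g = a \<otimes>\<^bsub>Lambda_alg\<^esub> g"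
  by (simp_all add: proj_def regular_module_def)

text \<open>With the source as first and the target as second index, \<open>P(S)\<close> is the
  column of \<open>S\<close> in the matrix algebra.\<close>

lemma carrier_proj:
  assumes S: "S \<in> intervals"
  shows "g \<in> carrier (proj S) \<longleftrightarrow> g \<in> carrier Lambda_alg \<and> (\<forall>R Q x. Q \<noteq> S \<longrightarrow> cf g R Q x = 0)"
proof
  assume "g \<in> carrier (proj S)"
  then obtain a where a: "a \<in> carrier Lambda_alg" "g = a \<otimes>\<^bsub>Lambda_alg\<^esub> incl S S"
    by (auto simp: proj_def incl_self[OF S])
  then show "g \<in> carrier Lambda_alg \<and> (\<forall>R Q x. Q \<noteq> S \<longrightarrow> cf g R Q x = 0)"
    using cf_mult(1)[OF a(1) incl_Lambda(1)[OF S S relative_upset_refl]]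
      cf_mult_incl[OF S S relative_upset_refl a(1)] by simp
next
  assume g: "g \<in> carrier Lambda_alg \<and> (\<forall>R Q x. Q \<noteq> S \<longrightarrow> cf g R Q x = 0)"
  then have "g = g \<otimes>\<^bsub>Lambda_alg\<^esub> incl S S"
    by (intro Lambda_eqI cf_mult(1) incl_Lambda(1)[OF S S relative_upset_refl])
      (auto simp: cf_mult_incl[OF S S relative_upset_refl])
  then show "g \<in> carrier (proj S)" using g by (auto simp: proj_def incl_self[OF S])
qed

lemma left_module_proj:
  assumes S: "S \<in> intervals" shows "left_module Lambda_alg (proj S)"
proof -
  interpret left_module Lambda_alg "regular_module Lambda_alg"
    by (rule left_module_regular[OF ring_Lambda])
  have "submodule (carrier (proj S)) Lambda_alg (regular_module Lambda_alg)"
    by (rule submoduleI)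
      (auto simp: carrier_proj[OF S] regular_module_def zero_Lambda cf_zero cf_add cf_mult intro!: sum.neutral)
  from left_module_restrict[OF this] show ?thesis by (simp add: proj_def)
qed

lemma proj_eqI:
  assumes "S \<in> intervals" "g \<in> carrier (proj S)" "h \<in> carrier (proj S)"
    and "\<And>R x. cf g R S x = cf h R S x"
  shows "g = h"
proof (rule Lambda_eqI)
  show "cf g R Q x = cf h R Q x" for R Q x
    using assms by (cases "Q = S") (auto simp: carrier_proj)
qed (use assms in \<open>auto simp: carrier_proj\<close>)

lemma idem_proj: "S \<in> intervals \<Longrightarrow> idem S \<in> carrier (proj S)"
  by (auto simp: carrier_proj idem_Lambda)

lemma proj_mult_idem:
  assumes S: "S \<in> intervals" and g: "g \<in> carrier (proj S)" shows "g \<otimes>\<^bsub>Lambda_alg\<^esub> idem S = g"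
proof -
  have gL: "g \<in> carrier Lambda_alg" and g0: "\<And>R Q x. Q \<noteq> S \<Longrightarrow> cf g R Q x = 0"
    using g by (auto simp: carrier_proj[OF S])
  have "g \<otimes>\<^bsub>Lambda_alg\<^esub> incl S S = g"
    by (rule Lambda_eqI[OF cf_mult(1)[OF gL incl_Lambda(1)[OF S S relative_upset_refl]] gL])
      (simp add: cf_mult_incl[OF S S relative_upset_refl gL] g0)
  then show ?thesis by (simp add: incl_self[OF S])
qed

text \<open>In the opposite algebra, composing with the inclusion on the left becomes multiplication
  on the right.\<close>

lemma push_j_map:
  assumes D: "D \<in> intervals" "D' \<in> intervals" "relative_upset D D'" and g: "g \<in> carrier (proj D)"
  shows "push D D' (j_map D D') g = g \<otimes>\<^bsub>Lambda_alg\<^esub> incl D D'"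
    and "push D D' (j_map D D') g \<in> carrier (proj D')"
    and "cf (push D D' (j_map D D') g) R Q x = (if Q = D' then cf g R D x else 0)"
proof -
  have gL: "g \<in> carrier Lambda_alg" using g by (simp add: carrier_proj[OF D(1)])
  show eq: "push D D' (j_map D D') g = g \<otimes>\<^bsub>Lambda_alg\<^esub> incl D D'"
    using g by (simp add: push_def as_endo_j_map[OF D(1,2)] incl_def Lambda_alg_def End_op_def)
  show cf: "cf (push D D' (j_map D D') g) R Q x = (if Q = D' then cf g R D x else 0)" for R Q x
    unfolding eq by (rule cf_mult_incl[OF D gL])
  show "push D D' (j_map D D') g \<in> carrier (proj D')"
    using cf cf_mult(1)[OF gL incl_Lambda(1)[OF D]] by (simp add: carrier_proj[OF D(2)] eq)
qed

lemma minus_proj: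
  assumes S: "S \<in> intervals" and g: "g \<in> carrier (proj S)"
  shows "cf (\<ominus>\<^bsub>proj S\<^esub> g) R Q x = - cf g R Q x"
proof -
  interpret left_module Lambda_alg "proj S" by (rule left_module_proj[OF S])
  have "\<ominus>\<^bsub>proj S\<^esub> g \<in> carrier Lambda_alg" "g \<in> carrier Lambda_alg"
    using M.a_inv_closed[OF g] g by (auto simp: carrier_proj[OF S])
  then have "cf (\<ominus>\<^bsub>proj S\<^esub> g \<oplus>\<^bsub>proj S\<^esub> g) R Q x = cf (\<ominus>\<^bsub>proj S\<^esub> g) R Q x + cf g R Q x"
    by (simp add: proj_simps cf_add)
  then have "cf (\<ominus>\<^bsub>proj S\<^esub> g) R Q x + cf g R Q x = 0"
    unfolding M.l_neg[OF g] by (simp add: proj_simps cf_zero)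
  then show ?thesis by (simp add: add_eq_0_iff2)
qed

text \<open>Lets an additive functional, such as a coefficient at a point, pass from a sum formed in
  a module record to an ordinary sum in the field.\<close>

lemma additive_finsum:
  fixes \<theta> :: "'m \<Rightarrow> 'b::comm_monoid_add"
  assumes M: "abelian_monoid M" and \<theta>: "\<theta> \<zero>\<^bsub>M\<^esub> = 0"
    "\<And>x y. \<lbrakk>x \<in> carrier M; y \<in> carrier M\<rbrakk> \<Longrightarrow> \<theta> (x \<oplus>\<^bsub>M\<^esub> y) = \<theta> x + \<theta> y"
    and g: "g \<in> A \<rightarrow> carrier M"
  shows "\<theta> (finsum M g A) = (\<Sum>a\<in>A. \<theta> (g a))"
proof -
  interpret abelian_monoid M by (rule M)
  show ?thesis using g
  proof (induction A rule: infinite_finite_induct)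
    case (insert a A)
    have c: "g \<in> A \<rightarrow> carrier M" "g a \<in> carrier M" using insert.prems by auto
    then have "finsum M g (insert a A) = g a \<oplus>\<^bsub>M\<^esub> finsum M g A" by (rule finsum_insert[OF insert.hyps])
    then show ?case using \<theta>(2)[OF c(2) finsum_closed[OF c(1)]] insert.IH[OF c(1)] insert.hyps by simp
  qed (simp_all add: \<theta>(1))
qed

lemma submodule_finsum:
  assumes M: "left_module R M" and N: "submodule N R M" and g: "g \<in> A \<rightarrow> N"
  shows "finsum M g A \<in> N"
proof -
  interpret left_module R M by (rule M)
  note N' = submoduleD[OF N]
  show ?thesis using g
  proof (induction A rule: infinite_finite_induct)
    case (insert a A)
    have c: "g \<in> A \<rightarrow> carrier M" "g a \<in> carrier M" using insert.prems N'(1) by auto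
    show ?case unfolding M.finsum_insert[OF insert.hyps c]
      by (rule N'(3)) (use insert in auto)
  qed (use N'(2) in simp_all)
qed

text \<open>Submodules are closed under the algebra, so a scalar is made to act through an algebra
  element.\<close>

definition scal :: "'k::field \<Rightarrow> ('p::{finite,order}, 'k) endo \<Rightarrow> ('p, 'k) endo" where
  "scal c g = (c \<odot>\<^bsub>Lambda_alg\<^esub> \<one>\<^bsub>Lambda_alg\<^esub>) \<otimes>\<^bsub>Lambda_alg\<^esub> g"

lemma cf_scal:
  assumes "g \<in> carrier Lambda_alg" shows "cf (scal c g) R S x = c * cf g R S x"
  unfolding scal_def
  by (simp add: cf_mult(2)[OF cf_smult(1)[OF one_Lambda] assms] cf_smult(2)[OF one_Lambda]
    mult.assoc cf_one_sum(1)[OF assms] flip: sum_distrib_left)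

lemma scal_proj:
  assumes "S \<in> intervals" "g \<in> carrier (proj S)" shows "scal c g \<in> carrier (proj S)"
  using left_module.smult_closed[OF left_module_proj[OF assms(1)] cf_smult(1)[OF one_Lambda] assms(2)]
  by (simp add: scal_def proj_simps)

text \<open>Inside both intervals, naturality can be used in either direction along a comparable
  pair; hence the coefficient is constant along chains.\<close>

lemma cf_const:
  assumes a: "a \<in> carrier Lambda_alg" and C: "poset_connected C" "C \<subseteq> R" "C \<subseteq> S"
    and xy: "x \<in> C" "y \<in> C"
  shows "cf a R S x = cf a R S y"
proof -
  have "joined_in C x y" using C(1) xy by (simp add: poset_connected_def)
  then show ?thesis unfolding joined_in_def
  proof (induction rule: rtranclp_induct)
    case (step y z)
    have yz: "y \<in> R" "z \<in> S" "z \<in> R" "y \<in> S" "y \<le> z \<or> z \<le> y" using step.hyps C by auto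
    then have "cf a R S y = cf a R S z"
      using admissibleD(6)[OF admissible_cf[OF a] _ yz(1,2)]
        admissibleD(6)[OF admissible_cf[OF a] _ yz(3,4)] by metis
    with step.IH show ?case by simp
  qed simp
qed

text \<open>Inserting an idempotent isolates one summand of the matrix product as a coefficient of
  an element of the algebra, and to such a coefficient \<open>cf_const\<close> applies.\<close>

lemma cf_mult_idem:
  assumes Q: "Q \<in> intervals" and a: "a \<in> carrier Lambda_alg" and b: "b \<in> carrier Lambda_alg"
  shows "cf (a \<otimes>\<^bsub>Lambda_alg\<^esub> idem Q \<otimes>\<^bsub>Lambda_alg\<^esub> b) R S x = cf a R Q x * cf b Q S x"
    and "cf (idem Q \<otimes>\<^bsub>Lambda_alg\<^esub> b) R S x = (if R = Q then cf b Q S x else 0)"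
proof -
  have ai: "cf (a \<otimes>\<^bsub>Lambda_alg\<^esub> idem Q) R Q' x = (if Q' = Q then cf a R Q x else 0)" for Q'
    using cf_mult_incl[OF Q Q relative_upset_refl a] by (simp add: incl_self[OF Q])
  have "cf (a \<otimes>\<^bsub>Lambda_alg\<^esub> idem Q \<otimes>\<^bsub>Lambda_alg\<^esub> b) R S x =
      (\<Sum>Q'\<in>intervals. if Q' = Q then cf a R Q x * cf b Q S x else 0)"
    unfolding cf_mult(2)[OF cf_mult(1)[OF a idem_Lambda(1)[OF Q]] b] ai by (intro sum.cong refl) auto
  then show "cf (a \<otimes>\<^bsub>Lambda_alg\<^esub> idem Q \<otimes>\<^bsub>Lambda_alg\<^esub> b) R S x = cf a R Q x * cf b Q S x"
    using Q by simp
  have "cf (idem Q \<otimes>\<^bsub>Lambda_alg\<^esub> b) R S x =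
      (\<Sum>Q'\<in>intervals. if Q' = Q then (if R = Q then cf b Q S x else 0) else 0)"
    unfolding cf_mult(2)[OF idem_Lambda(1)[OF Q] b]
    using admissibleD(2)[OF admissible_cf[OF b], of x Q S]
    by (intro sum.cong refl) (auto simp: idem_Lambda(2)[OF Q])
  then show "cf (idem Q \<otimes>\<^bsub>Lambda_alg\<^esub> b) R S x = (if R = Q then cf b Q S x else 0)"
    using Q by simp
qed

text \<open>An endomorphism of an interval representation is a scalar because the interval is
  connected, so any point of \<open>S\<close> may be used to read it off.\<close>

definition top_coord :: "'p::{finite,order} set \<Rightarrow> ('p, 'k::field) endo \<Rightarrow> 'k" where
  "top_coord S a = cf a S S (SOME x. x \<in> S)"

lemma top_coord_eq:
  assumes "S \<in> intervals" "a \<in> carrier Lambda_alg" "x \<in> S" shows "top_coord S a = cf a S S x"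
  unfolding top_coord_def using assms
  by (intro cf_const[of a S]) (auto simp: intervals_def intro: someI)

lemma connected_boundary:
  assumes "poset_connected Q" "S \<subset> Q" "S \<noteq> {}"
  obtains x y where "x \<in> S" "y \<in> Q" "y \<notin> S" "x \<le> y \<or> y \<le> x"
proof -
  obtain u v where u: "u \<in> S" and v: "v \<in> Q" "v \<notin> S" using assms by blast
  have "joined_in Q u v" using assms u v by (auto simp: poset_connected_def)
  then have "v \<notin> S \<longrightarrow> (\<exists>x\<in>S. \<exists>y\<in>Q. y \<notin> S \<and> (x \<le> y \<or> y \<le> x))" unfolding joined_in_def
  proof (induction rule: rtranclp_induct)
    case (step y z) then show ?case by blast
  qed (use u in simp)
  then show ?thesis using that v by blast
qed

text \<open>
  If both factors are nonzero somewhere on \<open>S\<close>, they are nonzero on all of \<open>S\<close>, so \<open>S \<subset> Q\<close>. But then a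
  point of \<open>Q\<close> outside \<open>S\<close> that is comparable with a point of \<open>S\<close> forces one of them to vanish.
\<close>

lemma cf_through_other:
  assumes S: "S \<in> intervals" and Q: "Q \<in> intervals" "Q \<noteq> S"
    and a: "a \<in> carrier Lambda_alg" and b: "b \<in> carrier Lambda_alg" and x: "x \<in> S"
  shows "cf a S Q x * cf b Q S x = 0"
proof (rule ccontr)
  assume ne: "cf a S Q x * cf b Q S x \<noteq> 0"
  note S' = intervalsD[OF S] and Q' = intervalsD[OF Q(1)]
  let ?c = "a \<otimes>\<^bsub>Lambda_alg\<^esub> idem Q \<otimes>\<^bsub>Lambda_alg\<^esub> b"
  have c: "?c \<in> carrier Lambda_alg" by (intro cf_mult(1) a b idem_Lambda(1)[OF Q(1)])
  have nz: "cf a S Q y \<noteq> 0" "cf b Q S y \<noteq> 0" if "y \<in> S" for y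
    using cf_const[OF c S'(2) order_refl order_refl x that] ne
    by (auto simp: cf_mult_idem(1)[OF Q(1) a b])
  have "S \<subset> Q" using nz(1) admissibleD(3)[OF admissible_cf[OF a], of _ Q S] Q(2) by blast
  then obtain u v where uv: "u \<in> S" "v \<in> Q" "v \<notin> S" "u \<le> v \<or> v \<le> u"
    by (rule connected_boundary[OF Q'(2) _ S'(1)])
  then show False
    using admissibleD(6)[OF admissible_cf[OF a], of u v S Q] admissibleD(2)[OF admissible_cf[OF a], of v S Q]
      admissibleD(6)[OF admissible_cf[OF b], of v u Q S] admissibleD(3)[OF admissible_cf[OF b], of v S Q]
      nz[OF uv(1)] by auto
qed

text \<open>Products that pass through another interval vanish by \<open>cf_through_other\<close>.
  So the diagonal entry at \<open>S\<close> is a character of the algebra, the one by which it acts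
  on \<open>L(S)\<close>.\<close>

lemma top_coord_mult:
  assumes S: "S \<in> intervals" and a: "a \<in> carrier Lambda_alg" and b: "b \<in> carrier Lambda_alg"
  shows "top_coord S (a \<otimes>\<^bsub>Lambda_alg\<^esub> b) = top_coord S a * top_coord S b"
proof -
  obtain x where x: "x \<in> S" using intervalsD(1)[OF S] by blast
  have "cf (a \<otimes>\<^bsub>Lambda_alg\<^esub> b) S S x = (\<Sum>Q\<in>intervals. if Q = S then cf a S S x * cf b S S x else 0)"
    unfolding cf_mult(2)[OF a b] using cf_through_other[OF S _ _ a b x] by (intro sum.cong refl) auto
  then show ?thesis
    using S by (simp add: top_coord_eq[OF S _ x] a b cf_mult(1)[OF a b])
qed

lemma top_coord_simps:
  assumes "S \<in> intervals"
  shows "top_coord S \<zero>\<^bsub>Lambda_alg\<^esub> = 0"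
    and "a \<in> carrier Lambda_alg \<Longrightarrow> b \<in> carrier Lambda_alg \<Longrightarrow>
      top_coord S (a \<oplus>\<^bsub>Lambda_alg\<^esub> b) = top_coord S a + top_coord S b"
    and "R \<in> intervals \<Longrightarrow> top_coord S (idem R) = (if R = S then 1 else 0)"
    and "a \<in> carrier Lambda_alg \<Longrightarrow> top_coord S (scal c a) = c * top_coord S a"
  using assms by (auto simp: top_coord_def cf_zero cf_add cf_scal idem_Lambda some_in_eq intervals_def)

section \<open>Radical and simple top of an indecomposable projective\<close>

definition rad_proj :: "'p::{finite,order} set \<Rightarrow> ('p, 'k::field) endo set" where
  "rad_proj S = {g \<in> carrier (proj S). top_coord S g = 0}"

lemma rad_proj_submodule:
  assumes S: "S \<in> intervals" shows "submodule (rad_proj S) Lambda_alg (proj S)"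
proof -
  interpret left_module Lambda_alg "proj S" by (rule left_module_proj[OF S])
  have gL: "g \<in> carrier Lambda_alg" if "g \<in> carrier (proj S)" for g
    using that by (simp add: carrier_proj[OF S])
  show ?thesis
  proof (rule submoduleI)
    show "\<zero>\<^bsub>proj S\<^esub> \<in> rad_proj S"
      using M.zero_closed by (simp add: rad_proj_def proj_simps(1) top_coord_simps(1)[OF S])
    show "g \<oplus>\<^bsub>proj S\<^esub> h \<in> rad_proj S" if "g \<in> rad_proj S" "h \<in> rad_proj S" for g h
      using that M.a_closed[of g h] by (simp add: rad_proj_def proj_simps(2) top_coord_simps(2)[OF S] gL)
    show "a \<odot>\<^bsub>proj S\<^esub> g \<in> rad_proj S" if "a \<in> carrier Lambda_alg" "g \<in> rad_proj S" for a g
      using that smult_closed[of a g] by (simp add: rad_proj_def proj_simps(3) top_coord_mult[OF S] gL)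
  qed (auto simp: rad_proj_def)
qed

lemma idem_mult_proj:
  assumes S: "S \<in> intervals" and g: "g \<in> carrier (proj S)"
  shows "idem S \<otimes>\<^bsub>Lambda_alg\<^esub> g = scal (top_coord S g) (idem S)"
proof -
  have gL: "g \<in> carrier Lambda_alg" using g by (simp add: carrier_proj[OF S])
  have c: "idem S \<otimes>\<^bsub>Lambda_alg\<^esub> g \<in> carrier (proj S)"
    using left_module.smult_closed[OF left_module_proj[OF S] idem_Lambda(1)[OF S] g] by (simp add: proj_simps)
  show ?thesis
    by (rule proj_eqI[OF S c scal_proj[OF S idem_proj[OF S]]])
      (use top_coord_eq[OF S gL] admissibleD(2)[OF admissible_cf[OF gL], of _ S S] in
        \<open>auto simp: cf_mult_idem(2)[OF S gL gL] cf_scal[OF idem_Lambda(1)[OF S]] idem_Lambda(2)[OF S]\<close>)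
qed

text \<open>An element with nonzero top coordinate is carried by \<open>idem S\<close> to a nonzero
  multiple of \<open>idem S\<close>, and \<open>idem S\<close> generates \<open>P(S)\<close>. So
  \<open>rad_proj S\<close> contains every proper submodule.\<close>

lemma submodule_proj_cases:
  assumes S: "S \<in> intervals" and N: "submodule N Lambda_alg (proj S)"
  shows "N \<subseteq> rad_proj S \<or> N = carrier (proj S)"
proof (rule ccontr)
  interpret left_module Lambda_alg "proj S" by (rule left_module_proj[OF S])
  note N' = submoduleD[OF N]
  assume neg: "\<not> (N \<subseteq> rad_proj S \<or> N = carrier (proj S))"
  then obtain g where g: "g \<in> N" "top_coord S g \<noteq> 0" using N'(1) by (auto simp: rad_proj_def)
  have gc: "g \<in> carrier (proj S)" using g N'(1) by auto
  have "idem S \<otimes>\<^bsub>Lambda_alg\<^esub> g \<in> N" using N'(4)[OF idem_Lambda(1)[OF S] g(1)] by (simp add: proj_simps)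
  then have "scal (inverse (top_coord S g)) (idem S \<otimes>\<^bsub>Lambda_alg\<^esub> g) \<in> N"
    using N'(4)[OF cf_smult(1)[OF one_Lambda]] by (simp add: proj_simps scal_def)
  also have "scal (inverse (top_coord S g)) (idem S \<otimes>\<^bsub>Lambda_alg\<^esub> g) = idem S"
    unfolding idem_mult_proj[OF S gc]
    using scal_proj[OF S idem_proj[OF S]] g(2)
    by (intro proj_eqI[OF S scal_proj[OF S] idem_proj[OF S]])
      (auto simp: cf_scal carrier_proj[OF S] idem_Lambda[OF S] split: if_splits)
  finally have "idem S \<in> N" .
  then have "h \<in> N" if "h \<in> carrier (proj S)" for h
    using N'(4)[of h "idem S"] proj_mult_idem[OF S that] that by (simp add: proj_simps carrier_proj[OF S])
  then show False using neg N'(1) by blast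
qed

lemma idem_not_rad: "S \<in> intervals \<Longrightarrow> idem S \<notin> rad_proj S"
  by (simp add: rad_proj_def top_coord_simps)

lemma module_rad_proj:
  assumes S: "S \<in> intervals" shows "module_rad Lambda_alg (proj S) = rad_proj S"
proof -
  have ne: "rad_proj S \<noteq> carrier (proj S)" using idem_not_rad[OF S] idem_proj[OF S] by metis
  have "maximal_submodule (rad_proj S) Lambda_alg (proj S)"
    unfolding maximal_submodule_def
    using rad_proj_submodule[OF S] ne submodule_proj_cases[OF S] by blast
  moreover have "N = rad_proj S" if "maximal_submodule N Lambda_alg (proj S)" for N
    using that rad_proj_submodule[OF S] ne submodule_proj_cases[OF S, of N]
    unfolding maximal_submodule_def by metis
  ultimately have "{N. maximal_submodule N Lambda_alg (proj S)} = {rad_proj S}" by blast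
  then show ?thesis by (auto simp: module_rad_def rad_proj_def)
qed

lemma simp_top_eq: "S \<in> intervals \<Longrightarrow> simp_top S = quot_module (proj S) (rad_proj S)"
  by (simp add: simp_top_def module_rad_proj)

lemma left_module_simp_top: "S \<in> intervals \<Longrightarrow> left_module Lambda_alg (simp_top S)"
  unfolding simp_top_eq by (intro left_module_quot left_module_proj rad_proj_submodule)

definition top_value :: "'p::{finite,order} set \<Rightarrow> ('p, 'k::field) endo set \<Rightarrow> 'k" where
  "top_value S Y = top_coord S (SOME g. g \<in> Y)"

lemma top_value_coset:
  assumes S: "S \<in> intervals" and g: "g \<in> carrier (proj S)"
  shows "top_value S (rad_proj S +>\<^bsub>proj S\<^esub> g) = top_coord S g"
proof -
  interpret left_module Lambda_alg "proj S" by (rule left_module_proj[OF S])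
  have "(SOME h. h \<in> rad_proj S +>\<^bsub>proj S\<^esub> g) \<in> rad_proj S +>\<^bsub>proj S\<^esub> g"
    using coset_self[OF rad_proj_submodule[OF S] g] unfolding some_in_eq by blast
  then obtain r where r: "r \<in> rad_proj S" "(SOME h. h \<in> rad_proj S +>\<^bsub>proj S\<^esub> g) = r \<oplus>\<^bsub>proj S\<^esub> g"
    by (auto simp: a_r_coset_def')
  then show ?thesis using g
    by (simp add: top_value_def proj_simps top_coord_simps[OF S] rad_proj_def carrier_proj[OF S])
qed

text \<open>Identifies \<open>L(S)\<close> with the field, on which the algebra acts through the
  character \<open>top_coord S\<close>. All later computations in \<open>L(S)\<close> are carried
  out there.\<close>

lemma
  fixes S :: "'p::{finite,order} set"
  assumes S: "S \<in> intervals"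
  shows top_value_bij: "bij_betw (top_value S) (carrier (simp_top S)) (UNIV :: 'k::field set)"
    and top_value_add: "\<lbrakk>Y \<in> carrier (simp_top S); Z \<in> carrier (simp_top S)\<rbrakk> \<Longrightarrow>
      top_value S (Y \<oplus>\<^bsub>simp_top S\<^esub> Z) = top_value S Y + top_value S Z"
    and top_value_smult: "\<lbrakk>a \<in> carrier Lambda_alg; Y \<in> carrier (simp_top S)\<rbrakk> \<Longrightarrow>
      top_value S (a \<odot>\<^bsub>simp_top S\<^esub> Y) = top_coord S a * top_value S Y"
proof -
  interpret left_module Lambda_alg "proj S" by (rule left_module_proj[OF S])
  note N = rad_proj_submodule[OF S]
  have gL: "g \<in> carrier Lambda_alg" if "g \<in> carrier (proj S)" for g using that by (simp add: carrier_proj[OF S])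
  have C: "Y \<in> carrier (simp_top S) \<longleftrightarrow> (\<exists>g\<in>carrier (proj S). Y = rad_proj S +>\<^bsub>proj S\<^esub> g)" for Y
    by (auto simp: simp_top_eq[OF S] carrier_quot)
  show "top_value S (Y \<oplus>\<^bsub>simp_top S\<^esub> Z) = top_value S Y + top_value S Z"
    if YZ: "Y \<in> carrier (simp_top S)" "Z \<in> carrier (simp_top S)" for Y Z
  proof -
    obtain g h where g: "g \<in> carrier (proj S)" "Y = rad_proj S +>\<^bsub>proj S\<^esub> g"
      and h: "h \<in> carrier (proj S)" "Z = rad_proj S +>\<^bsub>proj S\<^esub> h"
      using YZ unfolding C by blast
    have "Y \<oplus>\<^bsub>simp_top S\<^esub> Z = rad_proj S +>\<^bsub>proj S\<^esub> (g \<oplus>\<^bsub>proj S\<^esub> h)"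
      unfolding g(2) h(2) simp_top_eq[OF S] by (rule add_quot[OF N g(1) h(1)])
    then have "top_value S (Y \<oplus>\<^bsub>simp_top S\<^esub> Z) = top_coord S (g \<oplus>\<^bsub>proj S\<^esub> h)"
      using top_value_coset[OF S M.a_closed[OF g(1) h(1)]] by simp
    also have "\<dots> = top_coord S g + top_coord S h"
      unfolding proj_simps by (rule top_coord_simps(2)[OF S gL[OF g(1)] gL[OF h(1)]])
    finally show ?thesis unfolding g(2) h(2) top_value_coset[OF S g(1)] top_value_coset[OF S h(1)] .
  qed
  show "top_value S (a \<odot>\<^bsub>simp_top S\<^esub> Y) = top_coord S a * top_value S Y"
    if aY: "a \<in> carrier Lambda_alg" "Y \<in> carrier (simp_top S)" for a Y
  proof -
    obtain g where g: "g \<in> carrier (proj S)" "Y = rad_proj S +>\<^bsub>proj S\<^esub> g"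
      using aY(2) unfolding C by blast
    have "a \<odot>\<^bsub>simp_top S\<^esub> Y = rad_proj S +>\<^bsub>proj S\<^esub> (a \<odot>\<^bsub>proj S\<^esub> g)"
      unfolding g(2) simp_top_eq[OF S] by (rule smult_quot[OF N that(1) g(1)])
    then have "top_value S (a \<odot>\<^bsub>simp_top S\<^esub> Y) = top_coord S (a \<odot>\<^bsub>proj S\<^esub> g)"
      using top_value_coset[OF S smult_closed[OF that(1) g(1)]] by simp
    also have "\<dots> = top_coord S a * top_coord S g"
      unfolding proj_simps by (rule top_coord_mult[OF S that(1) gL[OF g(1)]])
    finally show ?thesis unfolding g(2) top_value_coset[OF S g(1)] .
  qed
  show "bij_betw (top_value S) (carrier (simp_top S)) (UNIV :: 'k set)"
  proof (rule bij_betw_imageI)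
    show "inj_on (top_value S) (carrier (simp_top S) :: ('p, 'k) endo set set)"
    proof (rule inj_onI)
      fix Y Z :: "('p, 'k) endo set" assume "Y \<in> carrier (simp_top S)" "Z \<in> carrier (simp_top S)"
      then obtain g h where g: "g \<in> carrier (proj S)" "Y = rad_proj S +>\<^bsub>proj S\<^esub> g"
        and h: "h \<in> carrier (proj S)" "Z = rad_proj S +>\<^bsub>proj S\<^esub> h" unfolding C by blast
      assume "top_value S Y = top_value S Z"
      then have e: "top_coord S g = top_coord S h" by (simp add: g h top_value_coset[OF S])
      have "top_coord S (g \<ominus>\<^bsub>proj S\<^esub> h) = top_coord S g + top_coord S (\<ominus>\<^bsub>proj S\<^esub> h)"
        unfolding a_minus_def proj_simps
        by (rule top_coord_simps(2)[OF S gL[OF g(1)] gL[OF M.a_inv_closed[OF h(1)]]])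
      also have "top_coord S (\<ominus>\<^bsub>proj S\<^esub> h) = - top_coord S h"
        by (simp add: top_coord_def minus_proj[OF S h(1)])
      finally have "g \<ominus>\<^bsub>proj S\<^esub> h \<in> rad_proj S" using e g(1) h(1) by (simp add: rad_proj_def)
      then show "Y = Z" using coset_iff[OF N g(1) h(1)] g h by simp
    qed
    have "\<exists>Y\<in>carrier (simp_top S). c = top_value S Y" for c :: 'k
      using top_value_coset[OF S scal_proj[OF S idem_proj[OF S]], of c] scal_proj[OF S idem_proj[OF S], of c]
      by (intro bexI[of _ "rad_proj S +>\<^bsub>proj S\<^esub> scal c (idem S)"])
        (auto simp: C top_coord_simps[OF S] idem_Lambda(1)[OF S] S)
    then show "top_value S ` carrier (simp_top S) = (UNIV :: 'k set)" by blast
  qed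
qed

lemma top_value_zero:
  fixes S :: "'p::{finite,order} set"
  assumes S: "S \<in> intervals" shows "top_value S \<zero>\<^bsub>simp_top S\<^esub> = (0 :: 'k::field)"
proof -
  interpret left_module Lambda_alg "proj S :: (('p, 'k) endo, ('p, 'k) endo) module" by (rule left_module_proj[OF S])
  have "\<zero>\<^bsub>simp_top S\<^esub> = rad_proj S +>\<^bsub>proj S\<^esub> (\<zero>\<^bsub>proj S\<^esub> :: ('p, 'k) endo)"
    unfolding simp_top_eq[OF S] zero_quot coset_zero[OF rad_proj_submodule[OF S]] ..
  then have "top_value S \<zero>\<^bsub>simp_top S\<^esub> = (top_coord S \<zero>\<^bsub>proj S\<^esub> :: 'k)"
    using top_value_coset[OF S M.zero_closed] by simp
  then show ?thesis by (simp add: proj_simps top_coord_simps(1)[OF S])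
qed

section \<open>Idempotents and simple modules\<close>

lemma finsum_idem: "finsum Lambda_alg idem intervals = (\<one>\<^bsub>Lambda_alg\<^esub> :: ('p::{finite,order}, 'k::field) endo)"
proof -
  interpret ring "Lambda_alg :: ('k, ('p, 'k) endo) module" by (rule ring_Lambda)
  have c: "idem \<in> intervals \<rightarrow> carrier (Lambda_alg :: ('k, ('p, 'k) endo) module)"
    using idem_Lambda(1) by blast
  show ?thesis
  proof (rule Lambda_eqI[OF finsum_closed[OF c] one_Lambda])
    fix R S :: "'p set" and x :: 'p
    have "cf (finsum Lambda_alg (idem :: _ \<Rightarrow> ('p, 'k) endo) intervals) R S x = (\<Sum>Q\<in>intervals. cf (idem Q :: ('p, 'k) endo) R S x)"
      by (rule additive_finsum[OF abelian_monoid_axioms _ _ c]) (simp_all add: cf_zero cf_add)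
    also have "\<dots> = (\<Sum>Q\<in>intervals. if Q = S then (if R = S \<and> x \<in> S then 1 else 0) else 0)"
      by (rule sum.cong) (auto simp: idem_Lambda)
    finally show "cf (finsum Lambda_alg (idem :: _ \<Rightarrow> ('p, 'k) endo) intervals) R S x = cf (\<one>\<^bsub>Lambda_alg\<^esub> :: ('p, 'k) endo) R S x"
      by (simp add: cf_one)
  qed
qed

text \<open>The idempotents sum to 1, so they cannot all annihilate a nonzero element.\<close>

lemma exists_idem_nonzero:
  fixes F :: "(('p::{finite,order}, 'k::field) endo, 'm) module"
  assumes F: "left_module Lambda_alg F" and f: "f \<in> carrier F" "f \<noteq> \<zero>\<^bsub>F\<^esub>"
  shows "\<exists>R\<in>intervals. idem R \<odot>\<^bsub>F\<^esub> f \<noteq> \<zero>\<^bsub>F\<^esub>"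
proof (rule ccontr)
  interpret left_module Lambda_alg F by (rule F)
  assume neg: "\<not> ?thesis"
  have L: "left_module Lambda_alg (regular_module Lambda_alg)" by (rule left_module_regular[OF ring_Lambda])
  interpret L: left_module Lambda_alg "regular_module Lambda_alg" by (rule L)
  have h: "(\<lambda>a\<in>carrier (regular_module Lambda_alg). a \<odot>\<^bsub>F\<^esub> f) \<in> lmod_hom Lambda_alg (regular_module Lambda_alg) F"
    by (rule lmod_homI[OF _ _ _ L]) (use f in \<open>auto simp: regular_module_def smult_closed smult_l_distr smult_assoc\<close>)
  have c: "idem \<in> intervals \<rightarrow> carrier (regular_module Lambda_alg)"
    using idem_Lambda(1) by (auto simp: regular_module_def)
  have e: "finsum (regular_module Lambda_alg) idem intervals = finsum Lambda_alg idem intervals"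
    by (simp add: finsum_def regular_module_def finprod_def)
  have "f = \<one>\<^bsub>Lambda_alg\<^esub> \<odot>\<^bsub>F\<^esub> f" using smult_one[OF f(1)] by simp
  also have "\<dots> = (\<lambda>a\<in>carrier (regular_module Lambda_alg). a \<odot>\<^bsub>F\<^esub> f) (finsum (regular_module Lambda_alg) idem intervals)"
    unfolding e finsum_idem using one_Lambda by (simp add: regular_module_def)
  also have "\<dots> = finsum F (\<lambda>R. (\<lambda>a\<in>carrier (regular_module Lambda_alg). a \<odot>\<^bsub>F\<^esub> f) (idem R)) intervals"
    by (rule lmod_hom_finsum[OF L F h c])
  also have "\<dots> = finsum F (\<lambda>R. \<zero>\<^bsub>F\<^esub>) (intervals :: 'p set set)"
    by (rule M.finsum_cong') (use neg idem_Lambda(1) in \<open>auto simp: regular_module_def\<close>)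
  finally show False using f by simp
qed

text \<open>Acting on \<open>e = idem R \<odot> f\<close> maps \<open>P(R)\<close> onto
  \<open>F\<close>, and the kernel is proper, so it lies in the radical. The image of the radical is
  0 or \<open>F\<close>. In the latter case some element of the radical has the same image as
  \<open>idem R\<close> and differs from it by an element of the kernel, which would put
  \<open>idem R\<close> into the radical.\<close>

lemma simple_iso_simp_top:
  fixes F :: "(('p::{finite,order}, 'k::field) endo, 'm) module"
  assumes F: "left_module Lambda_alg F" "simple_module Lambda_alg F" and R: "R \<in> intervals"
    and f: "f \<in> carrier F" "idem R \<odot>\<^bsub>F\<^esub> f \<noteq> \<zero>\<^bsub>F\<^esub>"
  shows "lmod_iso Lambda_alg F (simp_top R)"
proof -
  interpret F: left_module Lambda_alg F by (rule F)
  interpret P: left_module Lambda_alg "proj R" by (rule left_module_proj[OF R])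
  define e where "e = idem R \<odot>\<^bsub>F\<^esub> f"
  have e: "e \<in> carrier F" "e \<noteq> \<zero>\<^bsub>F\<^esub>"
    using f F.smult_closed[OF idem_Lambda(1)[OF R] f(1)] by (auto simp: e_def)
  have PL: "h \<in> carrier Lambda_alg" if "h \<in> carrier (proj R)" for h :: "('p, 'k) endo"
    using that by (simp add: carrier_proj[OF R])
  have ie: "idem R \<odot>\<^bsub>F\<^esub> e = e"
    using F.smult_assoc[OF idem_Lambda(1)[OF R] idem_Lambda(1)[OF R] f(1)] proj_mult_idem[OF R idem_proj[OF R]]
    unfolding e_def by metis
  define \<theta> where "\<theta> = (\<lambda>h\<in>carrier (proj R). h \<odot>\<^bsub>F\<^esub> e)"
  have \<theta>: "\<theta> \<in> lmod_hom Lambda_alg (proj R) F" unfolding \<theta>_def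
    by (rule lmod_homI[OF _ _ _ P.left_module])
      (use e PL in \<open>auto simp: F.smult_closed proj_simps F.smult_l_distr F.smult_assoc\<close>)
  have \<theta>i: "\<theta> (idem R) = e" by (simp add: \<theta>_def idem_proj[OF R] ie)
  have sub: "submodule N Lambda_alg F \<Longrightarrow> N = {\<zero>\<^bsub>F\<^esub>} \<or> N = carrier F" for N
    using F(2) by (simp add: simple_module_def)
  have surj: "\<theta> ` carrier (proj R) = carrier F"
    using sub[OF image_submodule[OF P.left_module F(1) \<theta> P.carrier_submodule]] \<theta>i e idem_proj[OF R]
    by (metis imageI singletonD)
  let ?K = "{h \<in> carrier (proj R). \<theta> h = \<zero>\<^bsub>F\<^esub>}"
  have "idem R \<notin> ?K" using \<theta>i e by simp
  then have K: "?K \<subseteq> rad_proj R"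
    using submodule_proj_cases[OF R kernel_submodule[OF P.left_module F(1) \<theta>]] idem_proj[OF R] by blast
  have "\<theta> ` rad_proj R \<noteq> carrier F"
  proof
    assume "\<theta> ` rad_proj R = carrier F"
    then have "e \<in> \<theta> ` rad_proj R" using e by simp
    then obtain h where h: "h \<in> rad_proj R" "\<theta> h = e" by auto
    have hc: "h \<in> carrier (proj R)" using h by (simp add: rad_proj_def)
    have "\<theta> (idem R \<ominus>\<^bsub>proj R\<^esub> h) = \<zero>\<^bsub>F\<^esub>"
      using lmod_hom_minus(2)[OF P.left_module F(1) \<theta> idem_proj[OF R] hc] h \<theta>i e F.diff_eq_zero_iff by simp
    then have "idem R \<ominus>\<^bsub>proj R\<^esub> h \<in> rad_proj R" using K hc idem_proj[OF R] by auto
    then have "(idem R \<ominus>\<^bsub>proj R\<^esub> h) \<oplus>\<^bsub>proj R\<^esub> h \<in> rad_proj R"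
      using P.submoduleD(3)[OF rad_proj_submodule[OF R]] h(1) by blast
    then have "(idem R :: ('p, 'k) endo) \<in> rad_proj R"
      using hc idem_proj[OF R, where 'b = 'k] by (simp add: a_minus_def P.M.add.m_assoc P.M.l_neg)
    then show False using idem_not_rad[OF R, where 'b = 'k] by blast
  qed
  then have "\<theta> ` rad_proj R = {\<zero>\<^bsub>F\<^esub>}"
    using sub[OF image_submodule[OF P.left_module F(1) \<theta> rad_proj_submodule[OF R]]] by blast
  then have K': "\<theta> h = \<zero>\<^bsub>F\<^esub> \<longleftrightarrow> h \<in> rad_proj R" if "h \<in> carrier (proj R)" for h
    using K that by blast
  show ?thesis unfolding simp_top_eq[OF R]
  proof (rule lmod_iso_same_kernel[OF P.left_module F(1) left_module_quot[OF P.left_module rad_proj_submodule[OF R]]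
        \<theta> surj quot_map_hom[OF P.left_module rad_proj_submodule[OF R]]])
    show "(\<lambda>x\<in>carrier (proj R). rad_proj R +>\<^bsub>proj R\<^esub> x) ` carrier (proj R) = carrier (quot_module (proj R) (rad_proj R))"
      by (auto simp: P.carrier_quot)
    show "\<theta> h = \<zero>\<^bsub>F\<^esub> \<longleftrightarrow> (\<lambda>x\<in>carrier (proj R). rad_proj R +>\<^bsub>proj R\<^esub> x) h = \<zero>\<^bsub>quot_module (proj R) (rad_proj R)\<^esub>"
      if "h \<in> carrier (proj R)" for h
      using K'[OF that] that P.coset_eq_zero_iff[OF rad_proj_submodule[OF R] that] by (simp add: P.zero_quot)
  qed
qed

section \<open>Composition series and the standard modules\<close>

lemma submodule_of_restrict:
  assumes M: "left_module R M" and B: "submodule B R M" and N: "submodule N R (M\<lparr>carrier := B\<rparr>)"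
  shows "submodule N R M" "N \<subseteq> B"
proof -
  interpret left_module R M by (rule M)
  interpret B: left_module R "M\<lparr>carrier := B\<rparr>" by (rule left_module_restrict[OF B])
  show "N \<subseteq> B" using B.submoduleD(1)[OF N] by simp
  then show "submodule N R M"
    using B.submoduleD[OF N] submoduleD(1)[OF B] by (intro submoduleI) auto
qed

lemma subquotient_facts:
  assumes M: "left_module R M" and AB: "submodule A R M" "submodule B R M" "A \<subseteq> B"
  defines "q \<equiv> \<lambda>u. A +>\<^bsub>M\<lparr>carrier := B\<rparr>\<^esub> u"
  shows "carrier (subquotient M B A) = q ` B"
    and "u \<in> B \<Longrightarrow> q u = \<zero>\<^bsub>subquotient M B A\<^esub> \<longleftrightarrow> u \<in> A"
    and "a \<in> carrier R \<Longrightarrow> u \<in> B \<Longrightarrow> a \<odot>\<^bsub>subquotient M B A\<^esub> q u = q (a \<odot>\<^bsub>M\<^esub> u)"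
proof -
  interpret left_module R M by (rule M)
  interpret B: left_module R "M\<lparr>carrier := B\<rparr>" by (rule left_module_restrict[OF AB(2)])
  note A = submodule_restrict[OF AB(1) AB(3) AB(2)]
  show "carrier (subquotient M B A) = q ` B" by (simp add: subquotient_def B.carrier_quot q_def)
  show "q u = \<zero>\<^bsub>subquotient M B A\<^esub> \<longleftrightarrow> u \<in> A" if "u \<in> B"
    using B.coset_eq_zero_iff[OF A, of u] that by (simp add: subquotient_def B.zero_quot q_def)
  show "a \<odot>\<^bsub>subquotient M B A\<^esub> q u = q (a \<odot>\<^bsub>M\<^esub> u)" if "a \<in> carrier R" "u \<in> B"
    using B.smult_quot[OF A that(1), of u] that by (simp add: subquotient_def q_def)
qed

text \<open>A submodule of the subquotient is pulled back to one between \<open>A\<close> and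
  \<open>B\<close>, where the covering assumption decides.\<close>

lemma simple_subquotient:
  assumes M: "left_module R M" and AB: "submodule A R M" "submodule B R M" "A \<subset> B"
    and cover: "\<And>N. \<lbrakk>submodule N R M; A \<subseteq> N; N \<subseteq> B\<rbrakk> \<Longrightarrow> N = A \<or> N = B"
  shows "simple_module R (subquotient M B A)"
proof -
  interpret left_module R M by (rule M)
  let ?F = "subquotient M B A" and ?q = "\<lambda>u. A +>\<^bsub>M\<lparr>carrier := B\<rparr>\<^esub> u"
  have AB': "A \<subseteq> B" using AB(3) by blast
  note q = subquotient_facts[OF M AB(1,2) AB']
  have MB: "left_module R (M\<lparr>carrier := B\<rparr>)" by (rule left_module_restrict[OF AB(2)])
  have F: "left_module R ?F" by (rule left_module_subquotient[OF M AB(1,2) AB'])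
  interpret F: left_module R ?F by (rule F)
  have qh: "(\<lambda>x\<in>carrier (M\<lparr>carrier := B\<rparr>). ?q x) \<in> lmod_hom R (M\<lparr>carrier := B\<rparr>) ?F"
    unfolding subquotient_def by (rule quot_map_hom[OF MB submodule_restrict[OF AB(1) AB' AB(2)]])
  have "carrier ?F \<noteq> {\<zero>\<^bsub>?F\<^esub>}"
  proof
    assume e: "carrier ?F = {\<zero>\<^bsub>?F\<^esub>}"
    obtain b where b: "b \<in> B" "b \<notin> A" using AB(3) by blast
    then have "?q b \<in> carrier ?F" unfolding q(1) by blast
    then show False using e q(2)[OF b(1)] b(2) by blast
  qed
  moreover have "N = {\<zero>\<^bsub>?F\<^esub>} \<or> N = carrier ?F" if N: "submodule N R ?F" for N
  proof -
    let ?V = "{u \<in> carrier (M\<lparr>carrier := B\<rparr>). (\<lambda>x\<in>carrier (M\<lparr>carrier := B\<rparr>). ?q x) u \<in> N}"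
    have V: "?V = {u \<in> B. ?q u \<in> N}" by auto
    have sV: "submodule ?V R M" "?V \<subseteq> B"
      using submodule_of_restrict[OF M AB(2) vimage_submodule[OF MB F qh N]] by auto
    have "A \<subseteq> ?V"
    proof
      fix u assume u: "u \<in> A"
      then have "?q u = \<zero>\<^bsub>?F\<^esub>" using q(2)[of u] AB' by blast
      then show "u \<in> ?V" using u AB' F.submoduleD(2)[OF N] unfolding V by auto
    qed
    then consider "?V = A" | "?V = B" using cover[OF sV(1) _ sV(2)] by blast
    then show ?thesis
    proof cases
      case 1
      have "N \<subseteq> {\<zero>\<^bsub>?F\<^esub>}"
      proof
        fix y assume y: "y \<in> N"
        then obtain u where u: "u \<in> B" "y = ?q u" using F.submoduleD(1)[OF N] q(1) by blast
        then have "u \<in> A" using y 1 unfolding V by blast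
        then show "y \<in> {\<zero>\<^bsub>?F\<^esub>}" using q(2)[OF u(1)] u(2) by simp
      qed
      then show ?thesis using F.submoduleD(2)[OF N] by blast
    next
      case 2
      then have "carrier ?F \<subseteq> N" unfolding q(1) V by blast
      then show ?thesis using F.submoduleD(1)[OF N] by blast
    qed
  qed
  ultimately show ?thesis unfolding simple_module_def by blast
qed

text \<open>Any strictly monotone measure can play the role of the dimension: a submodule of least
  length among those strictly above \<open>A\<close> covers \<open>A\<close>, and the induction runs
  on the length still missing.\<close>

lemma exists_composition_series:
  fixes M :: "('a, 'm) module" and len :: "'m set \<Rightarrow> nat"
  assumes M: "left_module R M"
    and len: "\<And>A B. \<lbrakk>submodule A R M; submodule B R M; A \<subset> B\<rbrakk> \<Longrightarrow> len A < len B"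
  shows "\<exists>l c. composition_series R M l c"
proof -
  interpret left_module R M by (rule M)
  have "\<exists>l c. c 0 = A \<and> c l = carrier M \<and> (\<forall>i\<le>l. submodule (c i) R M) \<and>
      (\<forall>i<l. c i \<subseteq> c (Suc i) \<and> simple_module R (subquotient M (c (Suc i)) (c i)))"
    if "submodule A R M" for A
    using that
  proof (induction "len (carrier M) - len A" arbitrary: A rule: less_induct)
    case less
    show ?case
    proof (cases "A = carrier M")
      case True
      then show ?thesis using less.prems by (intro exI[of _ 0] exI[of _ "\<lambda>_. A"]) simp
    next
      case False
      let ?P = "\<lambda>B. submodule B R M \<and> A \<subset> B"
      have "?P (carrier M)" using False submoduleD(1)[OF less.prems] carrier_submodule by blast
      then obtain B where B: "?P B" "\<And>B'. ?P B' \<Longrightarrow> len B \<le> len B'"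
        using ex_has_least_nat[of ?P "carrier M" len] by blast
      have simp: "simple_module R (subquotient M B A)"
      proof (rule simple_subquotient[OF M less.prems])
        show "N = A \<or> N = B" if "submodule N R M" "A \<subseteq> N" "N \<subseteq> B" for N
          using B(2)[of N] len[of N B] that B(1) by fastforce
      qed (use B in auto)
      have "len A < len B" using len less.prems B(1) by blast
      moreover have "len B \<le> len (carrier M)" using B(2) \<open>?P (carrier M)\<close> by blast
      ultimately have "len (carrier M) - len B < len (carrier M) - len A" by linarith
      from less.hyps[OF this] B(1) obtain l c where c: "c 0 = B" "c l = carrier M"
        "\<forall>i\<le>l. submodule (c i) R M"
        "\<forall>i<l. c i \<subseteq> c (Suc i) \<and> simple_module R (subquotient M (c (Suc i)) (c i))" by blast
      let ?c = "\<lambda>i. case i of 0 \<Rightarrow> A | Suc j \<Rightarrow> c j"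
      have "\<forall>i\<le>Suc l. submodule (?c i) R M" using c(3) less.prems by (auto split: nat.split)
      moreover have "?c i \<subseteq> ?c (Suc i) \<and> simple_module R (subquotient M (?c (Suc i)) (?c i))" if "i < Suc l" for i
        using that c simp B(1) by (cases i) auto
      ultimately show ?thesis using c by (intro exI[of _ "Suc l"] exI[of _ ?c]) auto
    qed
  qed
  from this[OF zero_submodule] show ?thesis unfolding composition_series_def by blast
qed

text \<open>
  The length of a submodule of \<open>P(S)\<close> is its number of pivots: the positions, in a fixed enumeration
  of the coordinates, at which an element of the submodule has its first nonzero coordinate.
\<close>

lemma exists_length_proj:
  fixes S :: "'p::{finite,order} set"
  assumes S: "S \<in> intervals"
  shows "\<exists>len :: ('p, 'k::field) endo set \<Rightarrow> nat. \<forall>A B. submodule A Lambda_alg (proj S) \<and>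
    submodule B Lambda_alg (proj S) \<and> A \<subset> B \<longrightarrow> len A < len B"
proof -
  obtain \<nu> :: "'p set \<times> 'p \<Rightarrow> nat" and K where \<nu>: "range \<nu> = {i. i < K}" "inj \<nu>"
    using finite_imp_inj_to_nat_seg[of "UNIV :: ('p set \<times> 'p) set"] by auto
  interpret P: left_module Lambda_alg "proj S :: (('p, 'k) endo, ('p, 'k) endo) module"
    by (rule left_module_proj[OF S])
  define co where "co g i = cf g (fst i) S (snd i)" for g :: "('p, 'k) endo" and i
  define piv where "piv V = {i. \<exists>v\<in>V. co v i \<noteq> 0 \<and> (\<forall>j. \<nu> j < \<nu> i \<longrightarrow> co v j = 0)}" for V
  have piv_mono: "piv A \<subseteq> piv B" if "A \<subseteq> B" for A B using that unfolding piv_def by blast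
  have eq: "B \<subseteq> A" if A: "submodule A Lambda_alg (proj S)" and B: "submodule B Lambda_alg (proj S)"
    and AB: "A \<subseteq> B" and p: "piv A = piv B" for A B
  proof -
    note A' = P.submoduleD[OF A] and B' = P.submoduleD[OF B]
    have BL: "b \<in> carrier Lambda_alg" if "b \<in> B" for b
      using that B'(1) by (auto simp: carrier_proj[OF S])
    have sA: "scal c a \<in> A" if "a \<in> A" for c a
      using A'(4)[OF cf_smult(1)[OF one_Lambda] that] by (simp add: scal_def proj_simps)
    \<comment> \<open>Gaussian elimination from the last coordinate backwards. An element of
      \<open>B\<close> whose first \<open>K - Suc k\<close> coordinates vanish has, unless the next
      coordinate is 0 too, a pivot shared by some \<open>a\<close> in \<open>A\<close>; subtracting
      a multiple of \<open>a\<close> clears it.\<close>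
    have step: "\<forall>b\<in>B. (\<forall>i. \<nu> i < K - k \<longrightarrow> co b i = 0) \<longrightarrow> b \<in> A" for k
    proof (induction k)
      case 0
      show ?case
      proof (intro ballI impI)
        fix b assume b: "b \<in> B" "\<forall>i. \<nu> i < K - 0 \<longrightarrow> co b i = 0"
        have K: "\<nu> i < K" for i using \<nu>(1) by (metis mem_Collect_eq rangeI)
        have "co b i = 0" for i using b(2)[rule_format, of i] K[of i] by simp
        then have "b = \<zero>\<^bsub>proj S\<^esub>"
          using b(1) B'(1) P.M.zero_closed
          by (intro proj_eqI[OF S]) (auto simp: co_def proj_simps(1) cf_zero)
        then show "b \<in> A" using A'(2) by simp
      qed
    next
      case (Suc k)
      show ?case
      proof (intro ballI impI)
        fix b assume b: "b \<in> B" "\<forall>i. \<nu> i < K - Suc k \<longrightarrow> co b i = 0"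
        show "b \<in> A"
        proof (cases "\<exists>i. \<nu> i < K - k \<and> co b i \<noteq> 0")
          case False
          then show ?thesis using Suc.IH b(1) by blast
        next
          case True
          then obtain i where i: "\<nu> i < K - k" "co b i \<noteq> 0" by blast
          have "\<not> \<nu> i < K - Suc k" using b(2) i(2) by blast
          then have i': "\<nu> i = K - Suc k" using i(1) by linarith
          have "i \<in> piv B" unfolding piv_def using b i(2) i' by auto
          then obtain a where a: "a \<in> A" "co a i \<noteq> 0" "\<And>j. \<nu> j < \<nu> i \<Longrightarrow> co a j = 0"
            using p unfolding piv_def by blast
          have aL: "a \<in> carrier Lambda_alg" using a(1) AB BL by blast
          let ?s = "scal (- co b i / co a i) a"
          have sL: "?s \<in> carrier Lambda_alg" using sA[OF a(1)] AB BL by blast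
          let ?b = "b \<oplus>\<^bsub>proj S\<^esub> ?s"
          have bB: "?b \<in> B" using B'(3)[OF b(1)] sA[OF a(1)] AB by blast
          have co: "co ?b j = co b j - co b i / co a i * co a j" for j
          proof -
            have "co ?b j = cf b (fst j) S (snd j) + cf ?s (fst j) S (snd j)"
              unfolding proj_simps(2) co_def[of "b \<oplus>\<^bsub>Lambda_alg\<^esub> ?s"]
              by (rule cf_add(2)[OF BL[OF b(1)] sL])
            then show ?thesis unfolding cf_scal[OF aL] by (simp add: co_def)
          qed
          have "co ?b j = 0" if "\<nu> j < K - k" for j
          proof (cases "\<nu> j < \<nu> i")
            case True
            then show ?thesis unfolding co using a(3)[OF True] b(2)[rule_format, of j] i' by simp
          next
            case False
            then have "\<nu> j = \<nu> i" using that i' by linarith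
            then have "j = i" using \<nu>(2) by (simp add: inj_eq)
            then show ?thesis unfolding co using a(2) by simp
          qed
          then have bA: "?b \<in> A" using Suc.IH bB by blast
          have cs: "b \<in> carrier (proj S)" "?s \<in> carrier (proj S)" using b(1) B'(1) sA[OF a(1)] A'(1) by auto
          have "b = ?b \<oplus>\<^bsub>proj S\<^esub> (\<ominus>\<^bsub>proj S\<^esub> ?s)" using cs by (simp add: P.M.add.m_assoc P.M.r_neg)
          then show ?thesis using A'(3)[OF bA A'(5)[OF sA[OF a(1)]]] by metis
        qed
      qed
    qed
    show ?thesis using step[of K] by auto
  qed
  have "card (piv A) < card (piv B)" if "submodule A Lambda_alg (proj S)" "submodule B Lambda_alg (proj S)"
    "A \<subset> B" for A B
  proof (rule psubset_card_mono)
    show "piv A \<subset> piv B" using eq[OF that(1,2)] piv_mono[of A B] that(3) by blast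
  qed simp
  then show ?thesis by (intro exI[of _ "\<lambda>V. card (piv V)"]) blast
qed

text \<open>Submodules of the quotient are measured by the lengths of their preimages in
  \<open>P(S)\<close>, which preserve strict inclusions.\<close>

lemma exists_composition_series_quot:
  fixes S :: "'p::{finite,order} set" and N :: "('p, 'k::field) endo set"
  assumes S: "S \<in> intervals" and N: "submodule N Lambda_alg (proj S)"
  shows "\<exists>l c. composition_series Lambda_alg (quot_module (proj S) N) l c"
proof -
  interpret P: left_module Lambda_alg "proj S :: (('p, 'k) endo, ('p, 'k) endo) module"
    by (rule left_module_proj[OF S])
  let ?M = "quot_module (proj S) N"
  let ?q = "\<lambda>x\<in>carrier (proj S). N +>\<^bsub>proj S\<^esub> x"
  have M: "left_module Lambda_alg ?M" by (rule left_module_quot[OF P.left_module N])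
  obtain len :: "('p, 'k) endo set \<Rightarrow> nat" where len: "\<And>A B. submodule A Lambda_alg (proj S) \<Longrightarrow>
    submodule B Lambda_alg (proj S) \<Longrightarrow> A \<subset> B \<Longrightarrow> len A < len B"
    using exists_length_proj[OF S, where 'k = 'k] by blast
  let ?v = "\<lambda>A. {g \<in> carrier (proj S). ?q g \<in> A}"
  show ?thesis
  proof (rule exists_composition_series[OF M, where len = "\<lambda>A. len (?v A)"])
    fix A B assume A: "submodule A Lambda_alg ?M" and B: "submodule B Lambda_alg ?M" and AB: "A \<subset> B"
    note v = vimage_submodule[OF P.left_module M quot_map_hom[OF P.left_module N]]
    obtain y where y: "y \<in> B" "y \<notin> A" using AB by blast
    then obtain g where "g \<in> carrier (proj S)" "y = N +>\<^bsub>proj S\<^esub> g"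
      using left_module.submoduleD(1)[OF M B] P.carrier_quot[of N] by blast
    then have "g \<in> ?v B" "g \<notin> ?v A" using y by auto
    then have "?v A \<subset> ?v B" using AB by blast
    then show "len (?v A) < len (?v B)" by (rule len[OF v[OF A] v[OF B]])
  qed
qed

text \<open>On \<open>L(R)\<close> the idempotent of \<open>E\<close> acts as the scalar
  \<open>top_coord R (idem E)\<close>, and this is 0 for \<open>E\<close> different from
  \<open>R\<close>.\<close>

lemma idem_on_simp_top:
  fixes F :: "(('p::{finite,order}, 'k::field) endo, 'm) module"
  assumes F: "left_module Lambda_alg F" and R: "R \<in> intervals" and E: "E \<in> intervals"
    and iso: "lmod_iso Lambda_alg F (simp_top R :: (('p, 'k) endo, ('p, 'k) endo set) module)"
    and f: "f \<in> carrier F" "idem E \<odot>\<^bsub>F\<^esub> f \<noteq> \<zero>\<^bsub>F\<^esub>"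
  shows "R = E"
proof (rule ccontr)
  assume ne: "R \<noteq> E"
  let ?L = "simp_top R :: (('p, 'k) endo, ('p, 'k) endo set) module"
  interpret F: left_module Lambda_alg F by (rule F)
  obtain h where h: "h \<in> lmod_hom Lambda_alg F ?L" "bij_betw h (carrier F) (carrier ?L)"
    using iso by (auto simp: lmod_iso_def)
  have L: "left_module Lambda_alg ?L" by (rule left_module_simp_top[OF R])
  interpret L: left_module Lambda_alg ?L by (rule L)
  have hf: "h f \<in> carrier ?L" by (rule lmod_homD(1)[OF h(1) f(1)])
  have c: "idem E \<odot>\<^bsub>F\<^esub> f \<in> carrier F" by (rule F.smult_closed[OF idem_Lambda(1)[OF E] f(1)])
  have "top_value R (h (idem E \<odot>\<^bsub>F\<^esub> f)) = top_coord R (idem E) * top_value R (h f)"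
    unfolding lmod_homD(3)[OF h(1) idem_Lambda(1)[OF E] f(1)]
    by (rule top_value_smult[OF R idem_Lambda(1)[OF E] hf])
  also have "\<dots> = top_value R \<zero>\<^bsub>?L\<^esub>" using ne by (simp add: top_coord_simps(3)[OF R E] top_value_zero[OF R])
  finally have "h (idem E \<odot>\<^bsub>F\<^esub> f) = \<zero>\<^bsub>?L\<^esub>"
    using inj_onD[OF bij_betw_imp_inj_on[OF top_value_bij[OF R, where 'k = 'k]] _ lmod_homD(1)[OF h(1) c] L.M.zero_closed]
    by blast
  then have "h (idem E \<odot>\<^bsub>F\<^esub> f) = h \<zero>\<^bsub>F\<^esub>" using lmod_hom_zero[OF F L h(1)] by simp
  then have "idem E \<odot>\<^bsub>F\<^esub> f = \<zero>\<^bsub>F\<^esub>"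
    by (rule inj_onD[OF bij_betw_imp_inj_on[OF h(2)] _ c F.M.zero_closed])
  then show False using f(2) by simp
qed

text \<open>Climbing the series, there is a first step at which \<open>idem E\<close> stops acting
  as 0; let \<open>w\<close> witness this. Then \<open>idem E \<odot> w\<close> is not in the lower
  term, because there a further multiplication by \<open>idem E\<close> would give 0, while
  idempotence gives \<open>idem E \<odot> w\<close> again.\<close>

lemma composition_factor_exists:
  fixes M :: "(('p::{finite,order}, 'k::field) endo, 'm) module"
  assumes M: "left_module Lambda_alg M" and c: "composition_series Lambda_alg M l c"
    and E: "E \<in> intervals" and u: "u \<in> carrier M" "idem E \<odot>\<^bsub>M\<^esub> u \<noteq> \<zero>\<^bsub>M\<^esub>"
  shows "\<exists>i<l. \<exists>f\<in>carrier (subquotient M (c (Suc i)) (c i)).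
    idem E \<odot>\<^bsub>subquotient M (c (Suc i)) (c i)\<^esub> f \<noteq> \<zero>\<^bsub>subquotient M (c (Suc i)) (c i)\<^esub>"
proof -
  interpret left_module Lambda_alg M by (rule M)
  define Z where "Z j \<longleftrightarrow> (\<forall>u\<in>c j. idem E \<odot>\<^bsub>M\<^esub> u = \<zero>\<^bsub>M\<^esub>)" for j
  have Z0: "Z 0" using c smult_r_null[OF idem_Lambda(1)[OF E]] by (simp add: Z_def composition_series_def)
  have Zl: "\<not> Z l" using c u unfolding Z_def composition_series_def by metis
  have "\<exists>i<l. Z i \<and> \<not> Z (Suc i)"
  proof (rule ccontr)
    assume neg: "\<not> (\<exists>i<l. Z i \<and> \<not> Z (Suc i))"
    have "i \<le> l \<Longrightarrow> Z i" for i by (induction i) (use Z0 neg in auto)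
    then show False using Zl by blast
  qed
  then obtain i where i: "i < l" "Z i" "\<not> Z (Suc i)" by blast
  then obtain w where w: "w \<in> c (Suc i)" "idem E \<odot>\<^bsub>M\<^esub> w \<noteq> \<zero>\<^bsub>M\<^esub>" unfolding Z_def by blast
  have s: "submodule (c i) Lambda_alg M" "submodule (c (Suc i)) Lambda_alg M" "c i \<subseteq> c (Suc i)"
    using c i(1) by (auto simp: composition_series_def)
  have wc: "w \<in> carrier M" using w(1) submoduleD(1)[OF s(2)] by blast
  have "idem E \<odot>\<^bsub>M\<^esub> w \<notin> c i"
  proof
    assume "idem E \<odot>\<^bsub>M\<^esub> w \<in> c i"
    then have "idem E \<odot>\<^bsub>M\<^esub> (idem E \<odot>\<^bsub>M\<^esub> w) = \<zero>\<^bsub>M\<^esub>" using i(2) by (simp add: Z_def)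
    then show False
      using smult_assoc[OF idem_Lambda(1)[OF E] idem_Lambda(1)[OF E] wc] w(2)
        proj_mult_idem[OF E idem_proj[OF E]] by metis
  qed
  then have "idem E \<odot>\<^bsub>subquotient M (c (Suc i)) (c i)\<^esub> (c i +>\<^bsub>M\<lparr>carrier := c (Suc i)\<rparr>\<^esub> w) \<noteq>
      \<zero>\<^bsub>subquotient M (c (Suc i)) (c i)\<^esub>"
    unfolding subquotient_facts(3)[OF M s idem_Lambda(1)[OF E] w(1)]
      subquotient_facts(2)[OF M s submoduleD(4)[OF s(2) idem_Lambda(1)[OF E] w(1)]] .
  moreover have "c i +>\<^bsub>M\<lparr>carrier := c (Suc i)\<rparr>\<^esub> w \<in> carrier (subquotient M (c (Suc i)) (c i))"
    unfolding subquotient_facts(1)[OF M s] using w(1) by blast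
  ultimately show ?thesis using i(1) by blast
qed

text \<open>A morphism to the interval representation of \<open>T\<close> factors through those of
  smaller intervals unless some connected piece of its support is all of \<open>T\<close>, and this
  requires \<open>T \<subseteq> R\<close>. So precisely the rows \<open>R\<close> that contain
  \<open>T\<close> should survive in the standard module.\<close>

definition standard_kernel :: "'p::{finite,order} set \<Rightarrow> ('p, 'k::field) endo set" where
  "standard_kernel T = {g \<in> carrier (proj T). \<forall>R x. T \<subseteq> R \<longrightarrow> cf g R T x = 0}"

text \<open>Suppose that a product through \<open>Q\<close> from a row containing \<open>T\<close>
  is nonzero at one point of \<open>T\<close>. By \<open>cf_const\<close> it is nonzero on all of
  \<open>T\<close>, which forces \<open>T \<subseteq> Q\<close>; but in such rows the second factor
  vanishes.\<close>

lemma standard_kernel_submodule: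
  fixes T :: "'p::{finite,order} set"
  assumes T: "T \<in> intervals"
  shows "submodule (standard_kernel T) Lambda_alg (proj T :: (('p, 'k::field) endo, ('p, 'k) endo) module)"
proof -
  interpret left_module Lambda_alg "proj T :: (('p, 'k) endo, ('p, 'k) endo) module"
    by (rule left_module_proj[OF T])
  have gL: "g \<in> carrier Lambda_alg" if "g \<in> carrier (proj T)" for g using that by (simp add: carrier_proj[OF T])
  note T' = intervalsD[OF T]
  show ?thesis
  proof (rule submoduleI)
    show "standard_kernel T \<subseteq> carrier (proj T)" by (auto simp: standard_kernel_def)
    show "\<zero>\<^bsub>proj T\<^esub> \<in> (standard_kernel T :: ('p, 'k) endo set)"
      using M.zero_closed unfolding standard_kernel_def proj_simps(1) by (simp add: cf_zero)
    show "g \<oplus>\<^bsub>proj T\<^esub> h \<in> standard_kernel T" if "g \<in> standard_kernel T" "h \<in> standard_kernel T"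
      for g h :: "('p, 'k) endo"
      using that M.a_closed[of g h] by (simp add: standard_kernel_def proj_simps(2) cf_add(2) gL)
    show "a \<odot>\<^bsub>proj T\<^esub> g \<in> standard_kernel T" if a: "a \<in> carrier Lambda_alg" and g: "g \<in> standard_kernel T"
      for a g :: "('p, 'k) endo"
    proof -
      have gp: "g \<in> carrier (proj T)" and g0: "\<And>Q x. T \<subseteq> Q \<Longrightarrow> cf g Q T x = 0"
        using g by (auto simp: standard_kernel_def)
      have "cf a R Q x * cf g Q T x = 0" if RT: "T \<subseteq> R" and Q: "Q \<in> intervals" for R Q x
      proof (rule ccontr)
        assume ne: "cf a R Q x * cf g Q T x \<noteq> 0"
        let ?c = "a \<otimes>\<^bsub>Lambda_alg\<^esub> idem Q \<otimes>\<^bsub>Lambda_alg\<^esub> g"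
        have c: "?c \<in> carrier Lambda_alg" by (intro cf_mult(1) a idem_Lambda(1)[OF Q] gL[OF gp])
        have x: "x \<in> T" using ne admissibleD(3)[OF admissible_cf[OF gL[OF gp]], of x T Q] by auto
        have "cf g Q T y \<noteq> 0" if "y \<in> T" for y
          using cf_const[OF c T'(2) RT order_refl x that] ne
          by (auto simp: cf_mult_idem(1)[OF Q a gL[OF gp]])
        then have "T \<subseteq> Q" using admissibleD(2)[OF admissible_cf[OF gL[OF gp]], of _ Q T] by blast
        then show False using g0 ne by simp
      qed
      then show ?thesis
        using smult_closed[OF a gp]
        by (auto simp: standard_kernel_def proj_simps(3) cf_mult(2)[OF a gL[OF gp]] intro!: sum.neutral)
    qed
  qed
qed

lemma incl_mem_proj:
  assumes "D \<in> intervals" "D' \<in> intervals" "relative_upset D D'"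
  shows "incl D D' \<in> carrier (proj D')"
  using assms by (auto simp: carrier_proj incl_Lambda)

text \<open>
  A morphism into \<open>\<I>\<^sub>T\<close> is a sum over its connected supports \<open>E\<close>, and each summand factors through
  \<open>\<I>\<^sub>E \<rightarrow> \<I>\<^sub>T\<close>. A support equal to \<open>T\<close> is excluded by the kernel condition.
\<close>

lemma standard_kernel_generated:
  fixes T :: "'p::{finite,order} set" and g :: "('p, 'k::field) endo"
  assumes T: "T \<in> intervals" and N: "submodule N Lambda_alg (proj T)"
    and gen: "\<And>E. \<lbrakk>E \<in> intervals; relative_upset E T; E \<noteq> T\<rbrakk> \<Longrightarrow> incl E T \<in> N"
    and g: "g \<in> standard_kernel T" and R: "R \<in> intervals" and gR: "\<And>Q x. Q \<noteq> R \<Longrightarrow> cf g Q T x = 0"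
  shows "g \<in> N"
proof -
  interpret P: left_module Lambda_alg "proj T :: (('p, 'k) endo, ('p, 'k) endo) module"
    by (rule left_module_proj[OF T])
  note N' = P.submoduleD[OF N]
  have gp: "g \<in> carrier (proj T)" and g0: "\<And>Q x. T \<subseteq> Q \<Longrightarrow> cf g Q T x = 0"
    using g by (auto simp: standard_kernel_def)
  have gL: "g \<in> carrier Lambda_alg" using gp by (simp add: carrier_proj[OF T])
  note ad = admissibleD[OF admissible_cf[OF gL]]
  have RTc: "order_convex (R \<inter> T)"
    using intervalsD(3)[OF R] intervalsD(3)[OF T] unfolding order_convex_def by blast
  define EE where "EE = {E \<in> pi0 (R \<inter> T). \<exists>x\<in>E. cf g R T x \<noteq> 0}"
  \<comment> \<open>The restriction of \<open>g\<close> to one connected piece \<open>E\<close> of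
    \<open>R \<inter> T\<close>, regarded as a morphism to the representation of \<open>E\<close>.
    Composed with the inclusion of \<open>E\<close>, these pieces add up to
    \<open>g\<close>.\<close>
  define b where "b E = endo_of (\<lambda>R' S' x. if R' = R \<and> S' = E \<and> x \<in> E then cf g R T x else 0)" for E
  have EI: "E \<in> intervals" "E \<subseteq> R \<inter> T" "poset_connected E" if "E \<in> pi0 (R \<inter> T)" for E
    using that component_interval[OF RTc] pi0D[OF that] by (auto simp: pi0_eq)
  have Eup: "relative_upset E T" and ET: "E \<noteq> T" if E: "E \<in> EE" for E
  proof -
    have Ep: "E \<in> pi0 (R \<inter> T)" using E by (simp add: EE_def)
    obtain x where x: "x \<in> E" "cf g R T x \<noteq> 0" using E by (auto simp: EE_def)
    have nz: "cf g R T y \<noteq> 0" if "y \<in> E" for y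
      using cf_const[OF gL EI(3)[OF Ep], of R T x y] EI(2)[OF Ep] x that by auto
    show "relative_upset E T" unfolding relative_upset_def
    proof (intro conjI ballI impI)
      show "E \<subseteq> T" using EI(2)[OF Ep] by blast
      fix y z assume y: "y \<in> E" and z: "z \<in> T" "y \<le> z"
      have "cf g R T z \<noteq> 0" using ad(6)[OF z(2), of R T] nz[OF y] y z(1) EI(2)[OF Ep] by auto
      then have "z \<in> R \<inter> T" using ad(2)[of z R T] z(1) by blast
      then show "z \<in> E" using component_closed[of y "R \<inter> T" y z] pi0_component[OF Ep y] y z(2) by auto
    qed
    show "E \<noteq> T" using g0[of R x] EI(2)[OF Ep] x(2) by blast
  qed
  have bad: "admissible (\<lambda>R' S' x. if R' = R \<and> S' = E \<and> x \<in> E then cf g R T x else 0)"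
    if Ep: "E \<in> pi0 (R \<inter> T)" for E
  proof (rule admissibleI)
    show "R' \<in> intervals \<and> S' \<in> intervals \<and> x \<in> R' \<and> x \<in> S'"
      if "(if R' = R \<and> S' = E \<and> x \<in> E then cf g R T x else 0) \<noteq> 0" for R' S' x
      using that EI[OF Ep] R by (auto split: if_splits)
    show "(if R' = R \<and> S' = E \<and> x \<in> E then cf g R T x else 0) =
        (if R' = R \<and> S' = E \<and> y \<in> E then cf g R T y else 0)"
      if xy: "x \<le> y" "x \<in> R'" "y \<in> S'" for R' S' x y
    proof (cases "R' = R \<and> S' = E")
      case True
      have yT: "y \<in> T" "y \<in> E" "y \<in> R \<inter> T" using True xy EI(2)[OF Ep] by auto
      have e: "cf g R T x = cf g R T y" using ad(6)[OF xy(1), of R T] True xy yT by blast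
      show ?thesis
      proof (cases "x \<in> T")
        case True
        then have "x \<in> E"
          using component_closed[of y "R \<inter> T" y x] pi0_component[OF Ep yT(2)] yT xy \<open>R' = R \<and> S' = E\<close> by auto
        then show ?thesis using e yT(2) by simp
      next
        case False
        then show ?thesis using e ad(3)[of x T R] by simp
      qed
    qed auto
  qed
  have bL: "b E \<in> carrier Lambda_alg"
    "cf (b E) R' S' x = (if R' = R \<and> S' = E \<and> x \<in> E then cf g R T x else 0)" if "E \<in> pi0 (R \<inter> T)" for E R' S' x
    unfolding b_def cf_endo_of[OF bad[OF that]] by (rule endo_of_mem[OF bad[OF that]]) simp
  define w where "w E = b E \<otimes>\<^bsub>Lambda_alg\<^esub> incl E T" for E
  have wN: "w E \<in> N" if E: "E \<in> EE" for E
  proof -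
    have Ep: "E \<in> pi0 (R \<inter> T)" using E by (simp add: EE_def)
    have "b E \<odot>\<^bsub>proj T\<^esub> incl E T \<in> N"
      by (rule N'(4)[OF bL(1)[OF Ep] gen[OF EI(1)[OF Ep] Eup[OF E] ET[OF E]]])
    then show ?thesis by (simp add: w_def proj_simps)
  qed
  have wc: "w \<in> EE \<rightarrow> carrier (proj T)" using wN N'(1) by blast
  have "g = finsum (proj T) w EE"
  proof (rule proj_eqI[OF T gp P.M.finsum_closed[OF wc]])
    fix Q x
    have "cf (finsum (proj T) w EE) Q T x = (\<Sum>E\<in>EE. cf (w E) Q T x)"
      by (rule additive_finsum[OF P.M.abelian_monoid_axioms _ _ wc])
        (simp_all add: proj_simps cf_zero cf_add carrier_proj[OF T])
    also have "\<dots> = (\<Sum>E\<in>EE. if E = component (R \<inter> T) x then (if Q = R then cf g R T x else 0) else 0)"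
    proof (rule sum.cong[OF refl])
      fix E assume E: "E \<in> EE"
      have Ep: "E \<in> pi0 (R \<inter> T)" using E by (simp add: EE_def)
      have "cf (w E) Q T x = (if Q = R \<and> x \<in> E then cf g R T x else 0)"
        unfolding w_def by (simp add: cf_mult_incl[OF EI(1)[OF Ep] T Eup[OF E] bL(1)[OF Ep]] bL(2)[OF Ep])
      moreover have "x \<in> E \<longleftrightarrow> E = component (R \<inter> T) x" if "cf g R T x \<noteq> 0"
        using that pi0_component[OF Ep, of x] component_self[of x "R \<inter> T"] ad(2)[of x R T] ad(3)[of x T R] by blast
      ultimately show "cf (w E) Q T x =
          (if E = component (R \<inter> T) x then (if Q = R then cf g R T x else 0) else 0)" by auto
    qed
    also have "\<dots> = (if component (R \<inter> T) x \<in> EE then (if Q = R then cf g R T x else 0) else 0)"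
      by simp
    also have "\<dots> = cf g Q T x"
    proof (cases "cf g R T x = 0")
      case True
      then show ?thesis using gR[of Q x] by (cases "Q = R") auto
    next
      case False
      then have "x \<in> R \<inter> T" using ad(2)[of x R T] ad(3)[of x T R] by blast
      then have "component (R \<inter> T) x \<in> EE"
        using False component_self[of x "R \<inter> T"] unfolding EE_def pi0_eq by blast
      then show ?thesis using gR[of Q x] by auto
    qed
    finally show "cf g Q T x = cf (finsum (proj T) w EE) Q T x" by simp
  qed
  then show ?thesis using submodule_finsum[OF P.left_module N, of w EE] wN by auto
qed

lemma standard_eq:
  fixes T :: "'p::{finite,order} set"
  assumes T: "T \<in> intervals"
  shows "(standard T :: (('p, 'k::field) endo, ('p, 'k) endo set) module) =
    quot_module (proj T) (standard_kernel T)"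
proof -
  interpret P: left_module Lambda_alg "proj T :: (('p, 'k) endo, ('p, 'k) endo) module"
    by (rule left_module_proj[OF T])
  note K = standard_kernel_submodule[OF T, where 'k = 'k]
  \<comment> \<open>Membership can be tested row by row, because the idempotents detect nonzero
    elements of the quotient.\<close>
  have idem_in: "x \<in> N" if N: "submodule N Lambda_alg (proj T)" and x: "x \<in> carrier (proj T)"
    and all: "\<And>R. R \<in> intervals \<Longrightarrow> idem R \<otimes>\<^bsub>Lambda_alg\<^esub> x \<in> N" for N and x :: "('p, 'k) endo"
  proof (rule ccontr)
    assume "x \<notin> N"
    then have "N +>\<^bsub>proj T\<^esub> x \<noteq> \<zero>\<^bsub>quot_module (proj T) N\<^esub>"
      by (simp add: P.zero_quot P.coset_eq_zero_iff[OF N x])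
    moreover have "N +>\<^bsub>proj T\<^esub> x \<in> carrier (quot_module (proj T) N)" using x by (auto simp: P.carrier_quot)
    ultimately obtain R where R: "R \<in> intervals"
      "idem R \<odot>\<^bsub>quot_module (proj T) N\<^esub> (N +>\<^bsub>proj T\<^esub> x) \<noteq> \<zero>\<^bsub>quot_module (proj T) N\<^esub>"
      using exists_idem_nonzero[OF left_module_quot[OF P.left_module N]] by blast
    have "idem R \<odot>\<^bsub>proj T\<^esub> x \<notin> N"
      using R(2) P.coset_eq_zero_iff[OF N P.smult_closed[OF idem_Lambda(1)[OF R(1)] x]]
      unfolding P.smult_quot[OF N idem_Lambda(1)[OF R(1)] x] P.zero_quot by blast
    then show False using all[OF R(1)] by (simp add: proj_simps)
  qed
  show ?thesis unfolding standard_def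
  proof (rule arg_cong[where f = "quot_module (proj T)"], rule Least_equality)
    let ?M = "quot_module (proj T) (standard_kernel T) :: (('p, 'k) endo, ('p, 'k) endo set) module"
    have M: "left_module Lambda_alg ?M" by (rule left_module_quot[OF P.left_module K])
    interpret M: left_module Lambda_alg ?M by (rule M)
    show "submodule (standard_kernel T) Lambda_alg (proj T :: (('p, 'k) endo, ('p, 'k) endo) module) \<and>
      (\<forall>l c i. composition_series Lambda_alg ?M l c \<and> i < l \<longrightarrow>
        (\<exists>R\<in>intervals. qh_le R T \<and>
          lmod_iso Lambda_alg (subquotient ?M (c (Suc i)) (c i))
            (simp_top R :: (('p, 'k) endo, ('p, 'k) endo set) module)))"
    proof (intro conjI allI impI K)
      fix l c i assume c: "composition_series Lambda_alg ?M l c \<and> i < l"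
      let ?F = "subquotient ?M (c (Suc i)) (c i)"
      have s: "submodule (c i) Lambda_alg ?M" "submodule (c (Suc i)) Lambda_alg ?M" "c i \<subseteq> c (Suc i)"
        "simple_module Lambda_alg ?F"
        using c by (auto simp: composition_series_def)
      have F: "left_module Lambda_alg ?F" by (rule left_module_subquotient[OF M s(1-3)])
      interpret F: left_module Lambda_alg ?F by (rule F)
      obtain f where f: "f \<in> carrier ?F" "f \<noteq> \<zero>\<^bsub>?F\<^esub>"
        using s(4) F.M.zero_closed unfolding simple_module_def by blast
      obtain R where R: "R \<in> intervals" "idem R \<odot>\<^bsub>?F\<^esub> f \<noteq> \<zero>\<^bsub>?F\<^esub>"
        using exists_idem_nonzero[OF F f] by blast
      note q = subquotient_facts[OF M s(1-3)]
      obtain u where u: "u \<in> c (Suc i)" "f = c i +>\<^bsub>?M\<lparr>carrier := c (Suc i)\<rparr>\<^esub> u"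
        using f(1) q(1) by blast
      obtain g where g: "g \<in> carrier (proj T)" "u = standard_kernel T +>\<^bsub>proj T\<^esub> g"
        using u(1) M.submoduleD(1)[OF s(2)] P.carrier_quot by blast
      have gL: "g \<in> carrier Lambda_alg" using g(1) by (simp add: carrier_proj[OF T])
      have ig: "idem R \<odot>\<^bsub>proj T\<^esub> g \<in> carrier (proj T)" by (rule P.smult_closed[OF idem_Lambda(1)[OF R(1)] g(1)])
      have "idem R \<odot>\<^bsub>proj T\<^esub> g \<notin> standard_kernel T"
      proof
        assume "idem R \<odot>\<^bsub>proj T\<^esub> g \<in> standard_kernel T"
        then have "idem R \<odot>\<^bsub>?M\<^esub> u = \<zero>\<^bsub>?M\<^esub>"
          unfolding g(2) P.smult_quot[OF K idem_Lambda(1)[OF R(1)] g(1)] P.zero_quot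
          by (simp add: P.coset_eq_zero_iff[OF K ig])
        then have "idem R \<odot>\<^bsub>?F\<^esub> f = c i +>\<^bsub>?M\<lparr>carrier := c (Suc i)\<rparr>\<^esub> \<zero>\<^bsub>?M\<^esub>"
          unfolding u(2) q(3)[OF idem_Lambda(1)[OF R(1)] u(1)] by simp
        also have "\<dots> = \<zero>\<^bsub>?F\<^esub>"
          using q(2)[OF M.submoduleD(2)[OF s(2)]] M.submoduleD(2)[OF s(1)] by simp
        finally show False using R(2) by simp
      qed
      then obtain Q x where Q: "T \<subseteq> Q" "cf (idem R \<otimes>\<^bsub>Lambda_alg\<^esub> g) Q T x \<noteq> 0"
        using ig by (auto simp: standard_kernel_def proj_simps)
      then have "Q = R" by (simp add: cf_mult_idem(2)[OF R(1) gL gL] split: if_splits)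
      then have "qh_le R T" using Q(1) psubset_card_mono[of R T] by (auto simp: qh_le_def)
      then show "\<exists>R\<in>intervals. qh_le R T \<and> lmod_iso Lambda_alg ?F
          (simp_top R :: (('p, 'k) endo, ('p, 'k) endo set) module)"
        using simple_iso_simp_top[OF F s(4) R(1) f(1) R(2)] R(1) by blast
    qed
  next
    fix N :: "('p, 'k) endo set"
    let ?M = "quot_module (proj T) N"
    assume N: "submodule N Lambda_alg (proj T) \<and>
      (\<forall>l c i. composition_series Lambda_alg ?M l c \<and> i < l \<longrightarrow>
        (\<exists>R\<in>intervals. qh_le R T \<and>
          lmod_iso Lambda_alg (subquotient ?M (c (Suc i)) (c i))
            (simp_top R :: (('p, 'k) endo, ('p, 'k) endo set) module)))"
    have sN: "submodule N Lambda_alg (proj T)" using N by blast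
    have M: "left_module Lambda_alg ?M" by (rule left_module_quot[OF P.left_module sN])
    \<comment> \<open>The assumption on \<open>N\<close> quantifies over composition series of the
      quotient; it can be exploited because there is one.\<close>
    obtain l c where c: "composition_series Lambda_alg ?M l c"
      using exists_composition_series_quot[OF T sN] by blast
    have gen: "incl E T \<in> N" if E: "E \<in> intervals" "relative_upset E T" "E \<noteq> T" for E
    proof (rule ccontr)
      assume nN: "incl E T \<notin> N"
      have ip: "incl E T \<in> carrier (proj T :: (('p, 'k) endo, ('p, 'k) endo) module)"
        by (rule incl_mem_proj[OF E(1) T E(2)])
      have iL: "incl E T \<in> carrier (Lambda_alg :: ('k, ('p, 'k) endo) module)" by (rule incl_Lambda(1)[OF E(1) T E(2)])
      have ii: "idem E \<odot>\<^bsub>proj T\<^esub> incl E T = (incl E T :: ('p, 'k) endo)"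
        unfolding proj_simps
        by (rule Lambda_eqI[OF cf_mult(1)[OF idem_Lambda(1)[OF E(1)] iL] iL])
          (auto simp: cf_mult_idem(2)[OF E(1) iL iL] incl_Lambda(2)[OF E(1) T E(2)])
      let ?u = "N +>\<^bsub>proj T\<^esub> incl E T"
      have u: "?u \<in> carrier ?M" using ip by (auto simp: P.carrier_quot)
      have "idem E \<odot>\<^bsub>?M\<^esub> ?u \<noteq> \<zero>\<^bsub>?M\<^esub>"
        unfolding P.smult_quot[OF sN idem_Lambda(1)[OF E(1)] ip] ii P.zero_quot
        using P.coset_eq_zero_iff[OF sN ip] nN by simp
      then obtain i f where i: "i < l" and f: "f \<in> carrier (subquotient ?M (c (Suc i)) (c i))"
        "idem E \<odot>\<^bsub>subquotient ?M (c (Suc i)) (c i)\<^esub> f \<noteq> \<zero>\<^bsub>subquotient ?M (c (Suc i)) (c i)\<^esub>"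
        using composition_factor_exists[OF M c E(1) u] by blast
      have s: "submodule (c i) Lambda_alg ?M" "submodule (c (Suc i)) Lambda_alg ?M" "c i \<subseteq> c (Suc i)"
        using c i by (auto simp: composition_series_def)
      obtain R where R: "R \<in> intervals" "qh_le R T"
        "lmod_iso Lambda_alg (subquotient ?M (c (Suc i)) (c i))
            (simp_top R :: (('p, 'k) endo, ('p, 'k) endo set) module)"
        using N c i by blast
      have "R = E" by (rule idem_on_simp_top[OF left_module_subquotient[OF M s] R(1) E(1) R(3) f])
      moreover have "card E < card T"
        using E(2,3) by (intro psubset_card_mono) (auto simp: relative_upset_def)
      ultimately show False using R(2) E(3) by (simp add: qh_le_def)
    qed
    show "standard_kernel T \<le> N"
    proof
      fix g :: "('p, 'k) endo" assume g: "g \<in> standard_kernel T"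
      then have gp: "g \<in> carrier (proj T)" by (simp add: standard_kernel_def)
      then have gL: "g \<in> carrier Lambda_alg" by (simp add: carrier_proj[OF T])
      show "g \<in> N"
      proof (rule idem_in[OF sN gp])
        fix R :: "'p set" assume R: "R \<in> intervals"
        show "idem R \<otimes>\<^bsub>Lambda_alg\<^esub> g \<in> N"
        proof (rule standard_kernel_generated[OF T sN gen _ R])
          show "idem R \<otimes>\<^bsub>Lambda_alg\<^esub> g \<in> standard_kernel T"
            using P.submoduleD(4)[OF K idem_Lambda(1)[OF R] g] by (simp add: proj_simps)
          show "cf (idem R \<otimes>\<^bsub>Lambda_alg\<^esub> g) Q T x = 0" if "Q \<noteq> R" for Q x
            using that by (simp add: cf_mult_idem(2)[OF R gL gL])
        qed
      qed
    qed
  qed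
qed

lemma left_module_standard: "T \<in> intervals \<Longrightarrow> left_module Lambda_alg (standard T)"
  unfolding standard_eq by (intro left_module_quot left_module_proj standard_kernel_submodule)

section \<open>The resolution of a standard module\<close>

context upset_cover
begin

abbreviation idx :: "int \<Rightarrow> (nat set \<times> 'p set) set" where "idx q \<equiv> Q_index T U m q"

abbreviation summand :: "nat set \<times> 'p set \<Rightarrow> (('p, 'k::field) endo, ('p, 'k) endo) module" where
  "summand \<equiv> \<lambda>(J, D). proj D"

lemma idx_iff: "(J, D) \<in> idx q \<longleftrightarrow> J \<subseteq> {1..m} \<and> int (card J) = q \<and> D \<in> pi0 (UJ J)"
  by (simp add: Q_index_def)

lemma finite_idx: "finite (idx q)"
proof (rule finite_subset)
  show "idx q \<subseteq> Pow {1..m} \<times> UNIV" by (auto simp: Q_index_def)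
qed simp

lemma idx_interval: "(J, D) \<in> idx q \<Longrightarrow> D \<in> intervals"
  using pi0_UJ_interval by (auto simp: idx_iff)

lemma left_module_summand: "p \<in> idx q \<Longrightarrow> left_module Lambda_alg (summand p)"
  using idx_interval left_module_proj by (cases p) auto

lemma left_module_Q: "left_module Lambda_alg (Q_obj T U m q)"
  unfolding Q_obj_def by (rule left_module_direct_sum[OF ring_Lambda left_module_summand])

lemma Q_mem:
  assumes "f \<in> carrier (Q_obj T U m q)" "(J, D) \<in> idx q"
  shows "f (J, D) \<in> carrier (proj D)" "f (J, D) \<in> carrier Lambda_alg"
proof -
  show "f (J, D) \<in> carrier (proj D)"
    using direct_sum_mem[of f "idx q" summand "(J, D)"] assms by (simp add: Q_obj_def)
  then show "f (J, D) \<in> carrier Lambda_alg" using carrier_proj[OF idx_interval[OF assms(2)]] by blast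
qed

text \<open>
  Coordinates on \<open>Q\<^sub>q\<close>: the components at the summands \<open>(J, D)\<close>, \<open>D \<in> \<pi>\<^sub>0(U\<^sub>J)\<close>, are collected into
  one function on \<open>U\<^sub>J\<close>, that is, a morphism from \<open>\<I>\<^sub>R\<close> to the indicator of \<open>U\<^sub>J\<close>. In these coordinates
  the differential does not mention components any more.
\<close>

definition hcoord :: "(nat set \<times> 'p set \<Rightarrow> ('p, 'k::field) endo) \<Rightarrow> nat set \<Rightarrow> 'p set \<Rightarrow> 'p \<Rightarrow> 'k" where
  "hcoord f J R x = (if x \<in> UJ J then cf (f (J, component (UJ J) x)) R (component (UJ J) x) x else 0)"

text \<open>Since \<open>U_J\<close> is an upset of \<open>T\<close>, a morphism to its indicator is
  a morphism to the representation of \<open>T\<close> that is supported on \<open>U_J\<close>.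
  Naturality can therefore be stated with \<open>y \<in> T\<close> for every \<open>J\<close>, which
  makes functions for different \<open>J\<close> comparable.\<close>

definition Hset :: "'p set \<Rightarrow> nat set \<Rightarrow> ('p \<Rightarrow> 'k::field) set" where
  "Hset R J = {h. (\<forall>x. h x \<noteq> 0 \<longrightarrow> R \<in> intervals \<and> x \<in> R \<and> x \<in> UJ J) \<and>
    (\<forall>x y. x \<le> y \<and> x \<in> R \<and> y \<in> T \<longrightarrow> h x = h y)}"

lemma HsetD:
  assumes "h \<in> Hset R J"
  shows "h x \<noteq> 0 \<Longrightarrow> R \<in> intervals \<and> x \<in> R \<and> x \<in> UJ J"
    and "x \<notin> R \<or> x \<notin> UJ J \<Longrightarrow> h x = 0"
    and "x \<le> y \<Longrightarrow> x \<in> R \<Longrightarrow> y \<in> T \<Longrightarrow> h x = h y"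
  using assms unfolding Hset_def by blast+

lemma component_idx: "J \<subseteq> {1..m} \<Longrightarrow> int (card J) = q \<Longrightarrow> x \<in> UJ J \<Longrightarrow> (J, component (UJ J) x) \<in> idx q"
  by (auto simp: idx_iff pi0_eq)

lemma hcoord_Hset:
  fixes f :: "nat set \<times> 'p set \<Rightarrow> ('p, 'k::field) endo"
  assumes f: "f \<in> carrier (Q_obj T U m q)" and J: "J \<subseteq> {1..m}" "int (card J) = q"
  shows "hcoord f J R \<in> Hset R J"
  unfolding Hset_def mem_Collect_eq
proof (intro conjI allI impI)
  let ?c = "component (UJ J)"
  have ad: "admissible (cf (f (J, ?c x)))" if "x \<in> UJ J" for x
    by (rule admissible_cf[OF Q_mem(2)[OF f component_idx[OF J that]]])
  fix x assume ne: "hcoord f J R x \<noteq> 0"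
  then have x: "x \<in> UJ J" unfolding hcoord_def by presburger
  then have "cf (f (J, ?c x)) R (?c x) x \<noteq> 0" using ne by (simp add: hcoord_def)
  from admissibleD(1)[OF ad[OF x] this] x show "R \<in> intervals" "x \<in> R" "x \<in> UJ J" by auto
next
  let ?c = "component (UJ J)"
  have ad: "admissible (cf (f (J, ?c x)))" if "x \<in> UJ J" for x
    by (rule admissible_cf[OF Q_mem(2)[OF f component_idx[OF J that]]])
  fix x y assume xy: "x \<le> y \<and> x \<in> R \<and> y \<in> T"
  show "hcoord f J R x = hcoord f J R y"
  proof (cases "x \<in> UJ J")
    case True
    then have y: "y \<in> UJ J" using UJ_upset[OF J(1)] xy unfolding relative_upset_def by blast
    then have yc: "y \<in> ?c x" using component_closed[OF component_self[OF True]] xy by blast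
    then have "?c y = ?c x" by (rule component_eq)
    then show ?thesis
      using admissibleD(6)[OF ad[OF True], of x y R "?c x"] xy yc True y by (simp add: hcoord_def)
  next
    case x: False
    show ?thesis
    proof (cases "y \<in> UJ J")
      case True
      \<comment> \<open>The value at \<open>y\<close> has to be 0: naturality equates it with the
        coefficient at \<open>x\<close>, and \<open>x\<close> lies outside the target
        component.\<close>
      have "x \<notin> ?c y" using x component_subset by blast
      then have "cf (f (J, ?c y)) R (?c y) y = 0"
        using admissibleD(6)[OF ad[OF True], of x y R "?c y"] xy component_self[OF True]
          admissibleD(3)[OF ad[OF True], of x "?c y" R] by simp
      then show ?thesis using x by (simp add: hcoord_def)
    qed (use x in \<open>simp add: hcoord_def\<close>)
  qed
qed

lemma hcoord_summand:
  assumes f: "f \<in> carrier (Q_obj T U m q)" and p: "(J, D) \<in> idx q"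
  shows "cf (f (J, D)) R D x = (if x \<in> D then hcoord f J R x else 0)"
proof (cases "x \<in> D")
  case True
  have D: "D \<in> pi0 (UJ J)" using p by (simp add: idx_iff)
  have "x \<in> UJ J" using pi0D(2)[OF D] True by blast
  moreover have "D = component (UJ J) x" by (rule pi0_component[OF D True])
  ultimately show ?thesis using True by (simp add: hcoord_def)
next
  case False
  then show ?thesis using admissibleD(3)[OF admissible_cf[OF Q_mem(2)[OF f p]], of x D R] by simp
qed

lemma Q_eqI:
  assumes f: "f \<in> carrier (Q_obj T U m q)" and g: "g \<in> carrier (Q_obj T U m q)"
    and eq: "\<And>J R x. J \<subseteq> {1..m} \<Longrightarrow> int (card J) = q \<Longrightarrow> hcoord f J R x = hcoord g J R x"
  shows "f = g"
proof (rule extensionalityI[of _ "idx q"])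
  show "f \<in> extensional (idx q)" "g \<in> extensional (idx q)"
    using f g direct_sum_extensional unfolding Q_obj_def by blast+
  fix p assume p: "p \<in> idx q"
  obtain J D where JD: "p = (J, D)" by (cases p)
  have p': "(J, D) \<in> idx q" using p JD by simp
  have "f (J, D) = g (J, D)"
    by (rule proj_eqI[OF idx_interval[OF p'] Q_mem(1)[OF f p'] Q_mem(1)[OF g p']])
      (use p' in \<open>simp add: hcoord_summand[OF f p'] hcoord_summand[OF g p'] eq idx_iff\<close>)
  then show "f p = g p" by (simp add: JD)
qed

text \<open>Cutting a function down to a component \<open>D\<close> keeps naturality, because a
  point of \<open>U_J\<close> below a point of \<open>D\<close> belongs to \<open>D\<close> as
  well.\<close>

lemma exists_hcoord:
  fixes h :: "nat set \<Rightarrow> 'p set \<Rightarrow> 'p \<Rightarrow> 'k::field"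
  assumes h: "\<And>J R. J \<subseteq> {1..m} \<Longrightarrow> int (card J) = q \<Longrightarrow> h J R \<in> Hset R J"
  shows "\<exists>f\<in>carrier (Q_obj T U m q). \<forall>J R x. J \<subseteq> {1..m} \<and> int (card J) = q \<longrightarrow> hcoord f J R x = h J R x"
proof -
  let ?c = "\<lambda>J D R S x. if S = D \<and> x \<in> D then h J R x else 0"
  have ad: "admissible (?c J D)" if p: "(J, D) \<in> idx q" for J D
  proof (rule admissibleI)
    have J: "J \<subseteq> {1..m}" "int (card J) = q" and D: "D \<in> pi0 (UJ J)" using p by (auto simp: idx_iff)
    note H = HsetD[OF h[OF J]]
    show "R \<in> intervals \<and> S \<in> intervals \<and> x \<in> R \<and> x \<in> S" if "?c J D R S x \<noteq> 0" for R S x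
      using that H(1)[of R x] idx_interval[OF p] by (auto split: if_splits)
    show "?c J D R S x = ?c J D R S y" if xy: "x \<le> y" "x \<in> R" "y \<in> S" for R S x y
    proof (cases "S = D")
      case True
      have y: "y \<in> D" "y \<in> UJ J" "y \<in> T" using xy(3) True pi0D(2)[OF D] UJ_subset by auto
      have e: "h J R x = h J R y" by (rule H(3)[OF xy(1,2) y(3)])
      show ?thesis
      proof (cases "x \<in> D")
        case False
        have "x \<notin> UJ J"
          using False component_closed[of y "UJ J" y x] pi0_component[OF D y(1)] y(1) xy(1) by auto
        then show ?thesis using H(2)[of x R] e False y by simp
      qed (use e y in simp)
    qed simp
  qed
  define f where "f = (\<lambda>p\<in>idx q. case p of (J, D) \<Rightarrow> endo_of (?c J D))"
  have fp: "f (J, D) = endo_of (?c J D)" if "(J, D) \<in> idx q" for J D using that by (simp add: f_def)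
  have "f \<in> carrier (Q_obj T U m q)" unfolding Q_obj_def f_def
  proof (rule direct_sum_memI)
    fix p assume p: "p \<in> idx q"
    obtain J D where JD: "p = (J, D)" by (cases p)
    have p': "(J, D) \<in> idx q" using p JD by simp
    show "(case p of (J, D) \<Rightarrow> endo_of (?c J D)) \<in> carrier (summand p)"
      using endo_of_mem[OF ad[OF p']] by (simp add: JD carrier_proj[OF idx_interval[OF p']] cf_endo_of[OF ad[OF p']])
  qed
  moreover have "hcoord f J R x = h J R x" if J: "J \<subseteq> {1..m}" "int (card J) = q" for J R x
  proof (cases "x \<in> UJ J")
    case True
    note p = component_idx[OF J True]
    show ?thesis using True component_self[OF True] by (simp add: hcoord_def fp[OF p] cf_endo_of[OF ad[OF p]])
  next
    case False
    then show ?thesis using HsetD(2)[OF h[OF J], of x R] by (simp add: hcoord_def)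
  qed
  ultimately show ?thesis by blast
qed

lemma
  assumes f: "f \<in> carrier (Q_obj T U m q)" and J: "J \<subseteq> {1..m}" "int (card J) = q"
  shows hcoord_add: "g \<in> carrier (Q_obj T U m q) \<Longrightarrow>
      hcoord (f \<oplus>\<^bsub>Q_obj T U m q\<^esub> g) J R x = hcoord f J R x + hcoord g J R x"
    and hcoord_smult: "a \<in> carrier Lambda_alg \<Longrightarrow>
      hcoord (a \<odot>\<^bsub>Q_obj T U m q\<^esub> f) J R x = (\<Sum>Q\<in>intervals. cf a R Q x * hcoord f J Q x)"
proof -
  show "hcoord (f \<oplus>\<^bsub>Q_obj T U m q\<^esub> g) J R x = hcoord f J R x + hcoord g J R x"
    if g: "g \<in> carrier (Q_obj T U m q)"
  proof (cases "x \<in> UJ J")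
    case True
    note p = component_idx[OF J True]
    have "(f \<oplus>\<^bsub>Q_obj T U m q\<^esub> g) (J, component (UJ J) x) =
        f (J, component (UJ J) x) \<oplus>\<^bsub>Lambda_alg\<^esub> g (J, component (UJ J) x)"
      using direct_sum_apply(1)[OF p, where M = summand and f = f and g = g] by (simp add: Q_obj_def proj_simps)
    then show ?thesis using True by (simp add: hcoord_def cf_add(2)[OF Q_mem(2)[OF f p] Q_mem(2)[OF g p]])
  qed (simp add: hcoord_def)
  show "hcoord (a \<odot>\<^bsub>Q_obj T U m q\<^esub> f) J R x = (\<Sum>Q\<in>intervals. cf a R Q x * hcoord f J Q x)"
    if a: "a \<in> carrier Lambda_alg"
  proof (cases "x \<in> UJ J")
    case True
    note p = component_idx[OF J True]
    have "(a \<odot>\<^bsub>Q_obj T U m q\<^esub> f) (J, component (UJ J) x) = a \<otimes>\<^bsub>Lambda_alg\<^esub> f (J, component (UJ J) x)"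
      using direct_sum_apply(2)[OF p, where M = summand and f = f and a = a] by (simp add: Q_obj_def proj_simps)
    then show ?thesis using True by (simp add: hcoord_def cf_mult(2)[OF a Q_mem(2)[OF f p]])
  qed (simp add: hcoord_def)
qed

lemma hcoord_zero:
  assumes J: "J \<subseteq> {1..m}" "int (card J) = q"
  shows "hcoord \<zero>\<^bsub>Q_obj T U m q\<^esub> J R x = (0 :: 'k::field)"
proof (cases "x \<in> UJ J")
  case True
  note p = component_idx[OF J True]
  have "\<zero>\<^bsub>Q_obj T U m q\<^esub> (J, component (UJ J) x) = (\<zero>\<^bsub>Lambda_alg\<^esub> :: ('p, 'k) endo)"
    using direct_sum_apply(3)[OF p, where M = "summand :: _ \<Rightarrow> (('p, 'k) endo, ('p, 'k) endo) module"] by (simp add: Q_obj_def proj_simps)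
  then show ?thesis using True by (simp add: hcoord_def cf_zero)
qed (simp add: hcoord_def)

section \<open>The differential in coordinates\<close>

definition diff_term :: "int \<Rightarrow> (nat set \<times> 'p set \<Rightarrow> ('p, 'k::field) endo) \<Rightarrow> nat set \<times> 'p set \<Rightarrow> nat \<Rightarrow>
    (nat set \<times> 'p set \<Rightarrow> ('p, 'k) endo)" where
  "diff_term q f p i = (let J' = fst p - {i}; D' = component_containing (UJ J') (snd p);
     y = push (snd p) D' (j_map (snd p) D') (f p)
     in summand_inj (idx (q - 1)) summand (J', D')
          (if even (card {j \<in> fst p. j < i}) then y else \<ominus>\<^bsub>proj D'\<^esub> y))"

lemma Q_diff_eq:
  "f \<in> carrier (Q_obj T U m q) \<Longrightarrow> Q_diff T U m q f =
    finsum (Q_obj T U m (q - 1)) (\<lambda>p. finsum (Q_obj T U m (q - 1)) (diff_term q f p) (fst p)) (idx q)"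
  by (simp add: Q_diff_def diff_term_def[abs_def] case_prod_beta')

lemma face_idx:
  assumes p: "(J, D) \<in> idx q" and i: "i \<in> J"
  defines "D' \<equiv> component_containing (UJ (J - {i})) D"
  shows "(J - {i}, D') \<in> idx (q - 1)" "relative_upset D D'" "D \<in> intervals" "D' \<in> intervals"
proof -
  have J: "J \<subseteq> {1..m}" "int (card J) = q" and D: "D \<in> pi0 (UJ J)" using p by (auto simp: idx_iff)
  have "Suc (card (J - {i})) = card J" using J(1) i by (intro card_Suc_Diff1) (auto intro: finite_subset)
  then show *: "(J - {i}, D') \<in> idx (q - 1)"
    using J component_containing_pi0[OF D, of "J - {i}"] by (auto simp: idx_iff D'_def)
  show "D \<in> intervals" "D' \<in> intervals" by (rule idx_interval[OF p], rule idx_interval[OF *])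
  have "D \<subseteq> D'" unfolding D'_def by (rule component_containing_supset[OF D]) blast
  moreover have "D' \<subseteq> T" using pi0D(2)[of D' "UJ (J - {i})"] * UJ_subset by (auto simp: idx_iff)
  ultimately show "relative_upset D D'"
    using pi0_UJ_upset[OF J(1) D] unfolding relative_upset_def by blast
qed

text \<open>If \<open>x\<close> lies in \<open>D\<close> and in \<open>E\<close>, then the component
  of \<open>U_K\<close> that contains \<open>D\<close> is the component of \<open>x\<close>, hence
  \<open>E\<close>. So the target component is found by looking at the point alone, and the formula
  mentions only whether \<open>x\<close> belongs to \<open>D\<close>.\<close>

lemma
  fixes f :: "nat set \<times> 'p set \<Rightarrow> ('p, 'k::field) endo"
  assumes f: "f \<in> carrier (Q_obj T U m q)" and p: "(J, D) \<in> idx q" and i: "i \<in> J"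
  shows diff_term_closed: "diff_term q f (J, D) i \<in> carrier (Q_obj T U m (q - 1))"
    and diff_term_coord: "(K, E) \<in> idx (q - 1) \<Longrightarrow> x \<in> E \<Longrightarrow> cf (diff_term q f (J, D) i (K, E)) R E x =
      (if J - {i} = K \<and> x \<in> D then pos_sign i J * hcoord f J R x else 0)"
proof -
  let ?D' = "component_containing (UJ (J - {i})) D"
  let ?y = "push D ?D' (j_map D ?D') (f (J, D))"
  let ?z = "if even (card {j \<in> J. j < i}) then ?y else \<ominus>\<^bsub>proj ?D'\<^esub> ?y"
  note fi = face_idx[OF p i]
  note pj = push_j_map[OF fi(3,4,2) Q_mem(1)[OF f p]]
  interpret P: left_module Lambda_alg "proj ?D' :: (('p, 'k) endo, ('p, 'k) endo) module"
    by (rule left_module_proj[OF fi(4)])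
  have z: "?z \<in> carrier (proj ?D')" using pj(2) P.M.a_inv_closed[OF pj(2)] by simp
  have t: "diff_term q f (J, D) i = summand_inj (idx (q - 1)) summand (J - {i}, ?D') ?z"
    by (simp add: diff_term_def Let_def)
  show "diff_term q f (J, D) i \<in> carrier (Q_obj T U m (q - 1))"
    unfolding t Q_obj_def
    by (rule summand_inj_closed[of "idx (q - 1)" Lambda_alg summand, OF left_module_summand]) (use z in simp_all)
  assume KE: "(K, E) \<in> idx (q - 1)" and xE: "x \<in> E"
  have sgn: "cf ?z R E x = pos_sign i J * cf ?y R E x" for R E x
    by (simp add: minus_proj[OF fi(4) pj(2)] pos_sign_def)
  have D: "D \<in> pi0 (UJ J)" and E: "E \<in> pi0 (UJ K)" using p KE by (auto simp: idx_iff)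
  show "cf (diff_term q f (J, D) i (K, E)) R E x =
      (if J - {i} = K \<and> x \<in> D then pos_sign i J * hcoord f J R x else 0)"
  proof (cases "J - {i} = K \<and> ?D' = E")
    case True
    then have e: "K = J - {i}" "E = ?D'" by auto
    have "diff_term q f (J, D) i (K, E) = ?z" using KE unfolding t e by (simp add: summand_inj_def)
    then have "cf (diff_term q f (J, D) i (K, E)) R E x = cf ?z R E x" by simp
    also have "\<dots> = (if J - {i} = K \<and> x \<in> D then pos_sign i J * hcoord f J R x else 0)"
      unfolding sgn pj(3) e by (simp add: hcoord_summand[OF f p])
    finally show ?thesis .
  next
    case False
    then have "diff_term q f (J, D) i (K, E) = \<zero>\<^bsub>Lambda_alg\<^esub>"
      using KE by (auto simp: t summand_inj_def proj_simps)
    moreover have "\<not> (J - {i} = K \<and> x \<in> D)"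
    proof
      assume *: "J - {i} = K \<and> x \<in> D"
      then have "?D' = component (UJ K) x" using component_containing_UJ[OF D, of x "J - {i}"] by auto
      then show False using False * pi0_component[OF E xE] by simp
    qed
    ultimately show ?thesis by (auto simp: cf_zero)
  qed
qed

lemma Q_diff_closed:
  assumes f: "f \<in> carrier (Q_obj T U m q)"
  shows "Q_diff T U m q f \<in> carrier (Q_obj T U m (q - 1))"
proof -
  interpret L: left_module Lambda_alg "Q_obj T U m (q - 1)" by (rule left_module_Q)
  show ?thesis unfolding Q_diff_eq[OF f]
  proof (intro L.M.finsum_closed Pi_I)
    fix p i assume "p \<in> idx q" "i \<in> fst p"
    then show "diff_term q f p i \<in> carrier (Q_obj T U m (q - 1))"
      using diff_term_closed[OF f, of "fst p" "snd p" i] by simp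
  qed
qed

text \<open>At a fixed point \<open>x\<close>, each index set has at most one component through
  \<open>x\<close>. So the summands and deleted vertices that contribute at \<open>(J, x)\<close>
  correspond to the vertices \<open>i\<close> outside \<open>J\<close> with \<open>x\<close> in the
  intersection for \<open>insert i J\<close>; for other \<open>i\<close> the coordinate is 0 by
  definition.\<close>

lemma hcoord_Q_diff:
  fixes f :: "nat set \<times> 'p set \<Rightarrow> ('p, 'k::field) endo"
  assumes f: "f \<in> carrier (Q_obj T U m q)" and J: "J \<subseteq> {1..m}" "int (card J) = q - 1"
  shows "hcoord (Q_diff T U m q f) J R x = face_sum {1..m} (\<lambda>K. hcoord f K R x) J"
proof (cases "x \<in> UJ J")
  case False
  then have "x \<notin> UJ (insert i J)" for i by (simp add: UJ_insert)
  then show ?thesis using False by (simp add: hcoord_def face_sum_def)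
next
  case x: True
  let ?E = "component (UJ J) x"
  note p = component_idx[OF J x]
  note xE = component_self[OF x]
  interpret L: left_module Lambda_alg "Q_obj T U m (q - 1) :: (('p, 'k) endo, nat set \<times> 'p set \<Rightarrow> ('p, 'k) endo) module"
    by (rule left_module_Q)
  define \<theta> where "\<theta> F = cf (F (J, ?E)) R ?E x" for F :: "nat set \<times> 'p set \<Rightarrow> ('p, 'k) endo"
  have \<theta>h: "\<theta> F = hcoord F J R x" for F using x by (simp add: \<theta>_def hcoord_def)
  have \<theta>: "\<theta> \<zero>\<^bsub>Q_obj T U m (q - 1)\<^esub> = 0"
    "\<And>F G. F \<in> carrier (Q_obj T U m (q - 1)) \<Longrightarrow> G \<in> carrier (Q_obj T U m (q - 1)) \<Longrightarrow>
      \<theta> (F \<oplus>\<^bsub>Q_obj T U m (q - 1)\<^esub> G) = \<theta> F + \<theta> G"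
    unfolding \<theta>h using hcoord_zero[OF J] hcoord_add[OF _ J] by auto
  have cl: "diff_term q f p i \<in> carrier (Q_obj T U m (q - 1))" if "p \<in> idx q" "i \<in> fst p" for p i
    using diff_term_closed[OF f, of "fst p" "snd p" i] that by simp
  have inner: "\<theta> (finsum (Q_obj T U m (q - 1)) (diff_term q f p) (fst p)) = (\<Sum>i\<in>fst p. \<theta> (diff_term q f p i))"
    if "p \<in> idx q" for p
    by (rule additive_finsum[where \<theta> = \<theta>, OF L.M.abelian_monoid_axioms \<theta>]) (use cl[OF that] in auto)
  have fin1: "finite (fst p)" if "p \<in> idx q" for p
    using that by (cases p) (auto simp: idx_iff intro: finite_subset)
  define g where "g a = \<theta> (diff_term q f (fst a) (snd a))" for a
  have g: "g ((J1, D), i) = (if J1 - {i} = J \<and> x \<in> D then pos_sign i J1 * hcoord f J1 R x else 0)"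
    if "(J1, D) \<in> idx q" "i \<in> J1" for J1 D i
    unfolding g_def \<theta>_def using diff_term_coord[OF f that p xE] by simp
  let ?A = "Sigma (idx q) fst"
  let ?B = "{i \<in> {1..m} - J. x \<in> UJ (insert i J)}"
  let ?\<phi> = "\<lambda>i. ((insert i J, component (UJ (insert i J)) x), i)"
  have cJ: "int (card (insert i J)) = q" if "i \<in> {1..m} - J" for i
    using that J finite_subset[OF J(1)] by simp
  have "hcoord (Q_diff T U m q f) J R x = (\<Sum>p\<in>idx q. \<theta> (finsum (Q_obj T U m (q - 1)) (diff_term q f p) (fst p)))"
    unfolding \<theta>h[symmetric] Q_diff_eq[OF f]
    by (rule additive_finsum[where \<theta> = \<theta>, OF L.M.abelian_monoid_axioms \<theta>]) (use cl in \<open>auto intro!: L.M.finsum_closed\<close>)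
  also have "\<dots> = (\<Sum>p\<in>idx q. \<Sum>i\<in>fst p. g (p, i))"
    by (rule sum.cong[OF refl]) (simp add: inner g_def)
  also have "\<dots> = (\<Sum>a\<in>?A. g a)"
    by (subst sum.Sigma) (use finite_idx fin1 in auto)
  also have "\<dots> = (\<Sum>a\<in>?\<phi> ` ?B. g a)"
  proof (rule sum.mono_neutral_right)
    show "finite ?A" using finite_idx fin1 by (intro finite_SigmaI) auto
    show "?\<phi> ` ?B \<subseteq> ?A"
    proof (rule image_subsetI)
      fix i assume i: "i \<in> ?B"
      then have "(insert i J, component (UJ (insert i J)) x) \<in> idx q"
        using J(1) cJ by (intro component_idx) auto
      then show "?\<phi> i \<in> ?A" by simp
    qed
    show "\<forall>a\<in>?A - ?\<phi> ` ?B. g a = 0"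
    proof
      fix a assume a: "a \<in> ?A - ?\<phi> ` ?B"
      obtain J1 D i where e: "a = ((J1, D), i)" by (metis surj_pair)
      have a': "(J1, D) \<in> idx q" "i \<in> J1" using a e by auto
      have "\<not> (J1 - {i} = J \<and> x \<in> D)"
      proof
        assume *: "J1 - {i} = J \<and> x \<in> D"
        then have J1: "J1 = insert i J" "i \<notin> J" using a'(2) by auto
        have D: "D \<in> pi0 (UJ J1)" "J1 \<subseteq> {1..m}" using a'(1) by (auto simp: idx_iff)
        have "D = component (UJ J1) x" "x \<in> UJ J1"
          using pi0_component[OF D(1)] pi0D(2)[OF D(1)] * by auto
        then have "a = ?\<phi> i" "i \<in> ?B" using e J1 D(2) a'(2) by auto
        then show False using a by blast
      qed
      then show "g a = 0" using g[OF a'] e by auto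
    qed
  qed
  also have "\<dots> = (\<Sum>i\<in>?B. g (?\<phi> i))"
    by (subst sum.reindex) (auto intro: inj_onI)
  also have "\<dots> = (\<Sum>i\<in>?B. pos_sign i J * hcoord f (insert i J) R x)"
  proof (rule sum.cong[OF refl])
    fix i assume i: "i \<in> ?B"
    then have "(insert i J, component (UJ (insert i J)) x) \<in> idx q"
      using J(1) cJ by (intro component_idx) auto
    from g[OF this, of i] show "g (?\<phi> i) = pos_sign i J * hcoord f (insert i J) R x"
      using i component_self[of x "UJ (insert i J)"] by (simp add: pos_sign_insert_self)
  qed
  also have "\<dots> = face_sum {1..m} (\<lambda>K. hcoord f K R x) J"
    unfolding face_sum_def by (rule sum.mono_neutral_left) (auto simp: hcoord_def)
  finally show ?thesis .
qed

text \<open>At each point the algebra acts on the row index \<open>R\<close> by a matrix, whereas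
  the differential acts on the index set \<open>J\<close>; the two operations commute.\<close>

lemma Q_diff_hom:
  "Q_diff T U m q \<in> lmod_hom Lambda_alg (Q_obj T U m q)
    (Q_obj T U m (q - 1) :: (('p, 'a::field) endo, nat set \<times> 'p set \<Rightarrow> ('p, 'a) endo) module)"
proof -
  interpret L: left_module Lambda_alg "Q_obj T U m q :: (('p, 'a) endo, nat set \<times> 'p set \<Rightarrow> ('p, 'a) endo) module"
    by (rule left_module_Q)
  interpret L': left_module Lambda_alg "Q_obj T U m (q - 1) :: (('p, 'a) endo, nat set \<times> 'p set \<Rightarrow> ('p, 'a) endo) module"
    by (rule left_module_Q)
  have ci: "int (card (insert i J)) = q" "insert i J \<subseteq> {1..m}"
    if "i \<in> {1..m} - J" "J \<subseteq> {1..m}" "int (card J) = q - 1" for i J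
    using that finite_subset[OF that(2)] by auto
  have "restrict (Q_diff T U m q) (carrier (Q_obj T U m q)) \<in> lmod_hom Lambda_alg (Q_obj T U m q)
      (Q_obj T U m (q - 1) :: (('p, 'a) endo, nat set \<times> 'p set \<Rightarrow> ('p, 'a) endo) module)"
  proof (rule lmod_homI[OF Q_diff_closed _ _ left_module_Q])
    fix f g :: "nat set \<times> 'p set \<Rightarrow> ('p, 'a) endo"
    assume f: "f \<in> carrier (Q_obj T U m q)" and g: "g \<in> carrier (Q_obj T U m q)"
    show "Q_diff T U m q (f \<oplus>\<^bsub>Q_obj T U m q\<^esub> g) = Q_diff T U m q f \<oplus>\<^bsub>Q_obj T U m (q - 1)\<^esub> Q_diff T U m q g"
    proof (rule Q_eqI[OF Q_diff_closed[OF L.M.a_closed[OF f g]] L'.M.a_closed[OF Q_diff_closed[OF f] Q_diff_closed[OF g]]])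
      fix J R x assume J: "J \<subseteq> {1..m}" "int (card J) = q - 1"
      show "hcoord (Q_diff T U m q (f \<oplus>\<^bsub>Q_obj T U m q\<^esub> g)) J R x =
          hcoord (Q_diff T U m q f \<oplus>\<^bsub>Q_obj T U m (q - 1)\<^esub> Q_diff T U m q g) J R x"
        unfolding hcoord_Q_diff[OF L.M.a_closed[OF f g] J] hcoord_add[OF Q_diff_closed[OF f] J Q_diff_closed[OF g]]
          hcoord_Q_diff[OF f J] hcoord_Q_diff[OF g J] face_sum_def sum.distrib[symmetric]
        by (rule sum.cong[OF refl]) (simp add: hcoord_add[OF f ci(2,1)[OF _ J] g] distrib_left)
    qed
  next
    fix a :: "('p, 'a) endo" and f :: "nat set \<times> 'p set \<Rightarrow> ('p, 'a) endo"
    assume a: "a \<in> carrier Lambda_alg" and f: "f \<in> carrier (Q_obj T U m q)"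
    show "Q_diff T U m q (a \<odot>\<^bsub>Q_obj T U m q\<^esub> f) = a \<odot>\<^bsub>Q_obj T U m (q - 1)\<^esub> Q_diff T U m q f"
    proof (rule Q_eqI[OF Q_diff_closed[OF L.smult_closed[OF a f]] L'.smult_closed[OF a Q_diff_closed[OF f]]])
      fix J R x assume J: "J \<subseteq> {1..m}" "int (card J) = q - 1"
      have "hcoord (Q_diff T U m q (a \<odot>\<^bsub>Q_obj T U m q\<^esub> f)) J R x =
          (\<Sum>i\<in>{1..m} - J. \<Sum>Q\<in>intervals. cf a R Q x * (pos_sign i J * hcoord f (insert i J) Q x))"
        unfolding hcoord_Q_diff[OF L.smult_closed[OF a f] J] face_sum_def
        by (rule sum.cong[OF refl])
          (simp add: hcoord_smult[OF f ci(2,1)[OF _ J] a] sum_distrib_left mult.left_commute)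
      also have "\<dots> = (\<Sum>Q\<in>intervals. cf a R Q x * hcoord (Q_diff T U m q f) J Q x)"
        unfolding hcoord_Q_diff[OF f J] face_sum_def sum_distrib_left by (rule sum.swap)
      finally show "hcoord (Q_diff T U m q (a \<odot>\<^bsub>Q_obj T U m q\<^esub> f)) J R x =
          hcoord (a \<odot>\<^bsub>Q_obj T U m (q - 1)\<^esub> Q_diff T U m q f) J R x"
        unfolding hcoord_smult[OF Q_diff_closed[OF f] J a] .
    qed
  qed
  then show ?thesis by (simp add: Q_diff_def)
qed

text \<open>A function in \<open>Hset\<close> is constant along chains in
  \<open>R \<inter> T\<close>, so it is nonzero on all of \<open>E\<close> and \<open>E\<close> lies
  in its support. Going up from \<open>E\<close> inside \<open>T\<close> preserves the value, so the
  point reached is still in \<open>R\<close> and, being comparable, in \<open>E\<close>.\<close>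

lemma Hset_support:
  assumes h: "h \<in> Hset R J" and J: "J \<subseteq> {1..m}" and x: "h x \<noteq> 0"
  defines "E \<equiv> component (R \<inter> T) x"
  shows "x \<in> E" "E \<subseteq> UJ J" "E \<in> upset_intervals T"
proof -
  note H = HsetD[OF h]
  have RT: "R \<in> intervals" "x \<in> R \<inter> T" using H(1)[OF x] UJ_subset by auto
  show xE: "x \<in> E" unfolding E_def by (rule component_self[OF RT(2)])
  have nz: "h y \<noteq> 0" if "y \<in> E" for y
  proof -
    have "joined_in (R \<inter> T) x y" using that by (simp add: E_def component_def)
    then have "h y = h x" unfolding joined_in_def
    proof (induction rule: rtranclp_induct)
      case (step y z)
      have yz: "y \<in> R" "z \<in> T" "z \<in> R" "y \<in> T" "y \<le> z \<or> z \<le> y" using step.hyps by auto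
      then have "h y = h z" using H(3)[OF _ yz(1,2)] H(3)[OF _ yz(3,4)] by metis
      with step.IH show ?case by simp
    qed simp
    then show ?thesis using x by simp
  qed
  show EJ: "E \<subseteq> UJ J" using nz H(1) by blast
  have "order_convex (R \<inter> T)"
    using intervalsD(3)[OF RT(1)] intervalsD(3)[OF T] unfolding order_convex_def by blast
  then have "E \<in> intervals" unfolding E_def by (rule component_interval[OF _ RT(2)])
  moreover have "relative_upset E T" unfolding relative_upset_def
  proof (intro conjI ballI impI)
    show "E \<subseteq> T" using EJ UJ_subset by blast
    fix y z assume y: "y \<in> E" and z: "z \<in> T" "y \<le> z"
    have "y \<in> R" using H(1)[OF nz[OF y]] by blast
    then have "h z \<noteq> 0" using H(3)[OF z(2) _ z(1)] nz[OF y] by simp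
    then have "z \<in> R \<inter> T" using H(1) z(1) by blast
    then show "z \<in> E" using component_closed[of y "R \<inter> T" x z] y z(2) by (auto simp: E_def)
  qed
  ultimately show "E \<in> upset_intervals T" by (simp add: upset_intervals_def)
qed

section \<open>Contraction and exactness\<close>

lemma UJ_proper:
  assumes "J \<subseteq> {1..m}" "J \<noteq> {}" shows "\<not> T \<subseteq> UJ J"
proof
  assume *: "T \<subseteq> UJ J"
  obtain j where j: "j \<in> J" using assms(2) by blast
  have "UJ J \<subseteq> U j" using j by (auto simp: U_inter_def)
  then have "T = U j" using * U_upset(4)[of j] assms(1) j by blast
  then show False using U_upset(2)[of j] assms(1) j by auto
qed

text \<open>
  The contraction: at a point \<open>x\<close> with \<open>R\<close>-component \<open>E\<close> in \<open>T\<close>, the cone over a vertex \<open>i\<close> with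
  \<open>E \<subseteq> U\<^sub>i\<close>. The choice depends only on \<open>E\<close>, so the result is again a morphism.
\<close>

lemma Q_contraction:
  fixes f :: "nat set \<times> 'p set \<Rightarrow> ('p, 'k::field) endo"
  assumes f: "f \<in> carrier (Q_obj T U m q)"
    and ne: "\<And>J R x. \<lbrakk>J \<subseteq> {1..m}; int (card J) = q; hcoord f J R x \<noteq> 0\<rbrakk> \<Longrightarrow> component (R \<inter> T) x \<noteq> T"
    and cyc: "\<And>J R x. \<lbrakk>J \<subseteq> {1..m}; int (card J) = q - 1\<rbrakk> \<Longrightarrow>
      face_sum {1..m} (\<lambda>K. hcoord f K R x) J = 0"
  shows "\<exists>g\<in>carrier (Q_obj T U m (q + 1)). Q_diff T U m (q + 1) g = f"
proof -
  \<comment> \<open>An arbitrary number if no \<open>U i\<close> contains \<open>E\<close>; its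
    properties are claimed only where some coordinate at \<open>(R, x)\<close> is nonzero.\<close>
  define v where "v E = (SOME i. i \<in> {1..m} \<and> E \<subseteq> U i)" for E
  define h where "h J R x = cone (v (component (R \<inter> T) x)) (\<lambda>K. hcoord f K R x) J" for J R x
  note H = hcoord_Hset[OF f]
  have v: "v (component (R \<inter> T) x) \<in> {1..m}" "component (R \<inter> T) x \<subseteq> U (v (component (R \<inter> T) x))"
    if K: "K \<subseteq> {1..m}" "int (card K) = q" "hcoord f K R x \<noteq> 0" for K R x
  proof -
    have "\<exists>i. i \<in> {1..m} \<and> component (R \<inter> T) x \<subseteq> U i"
      using exists_cover[OF Hset_support(3)[OF H[OF K(1,2)] K(1,3)] ne[OF K]] by blast
    from someI_ex[OF this] show "v (component (R \<inter> T) x) \<in> {1..m}"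
      "component (R \<inter> T) x \<subseteq> U (v (component (R \<inter> T) x))" unfolding v_def by blast+
  qed
  have cm: "J - {i} \<subseteq> {1..m}" "int (card (J - {i})) = q"
    if "J \<subseteq> {1..m}" "int (card J) = q + 1" "i \<in> J" for J i
    using that card_Suc_Diff1[OF finite_subset[OF that(1)] that(3)] by auto
  have hH: "h J R \<in> Hset R J" if J: "J \<subseteq> {1..m}" "int (card J) = q + 1" for J R
    unfolding Hset_def mem_Collect_eq
  proof (intro conjI allI impI)
    fix x assume nz: "h J R x \<noteq> 0"
    let ?E = "component (R \<inter> T) x"
    let ?a = "v ?E"
    have a: "?a \<in> J" and hc: "hcoord f (J - {?a}) R x \<noteq> 0"
      using nz by (auto simp: h_def cone_def split: if_splits)
    note K = cm[OF J a]
    have R: "R \<in> intervals" "x \<in> R" "x \<in> UJ (J - {?a})" using HsetD(1)[OF H[OF K] hc] by auto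
    have "x \<in> ?E" by (rule Hset_support(1)[OF H[OF K] K(1) hc])
    then have "x \<in> U ?a" using v(2)[OF K hc] by blast
    moreover have "UJ J = U ?a \<inter> UJ (J - {?a})"
      using UJ_insert[of ?a "J - {?a}"] a by (simp add: insert_absorb)
    ultimately show "R \<in> intervals" "x \<in> R" "x \<in> UJ J" using R by simp_all
  next
    fix x y assume xy: "x \<le> y \<and> x \<in> R \<and> y \<in> T"
    have e: "hcoord f K R x = hcoord f K R y" if "K \<subseteq> {1..m}" "int (card K) = q" for K
      using HsetD(3)[OF H[OF that]] xy by blast
    show "h J R x = h J R y"
    proof (cases "x \<in> T \<and> y \<in> R")
      case True
      then have "y \<in> component (R \<inter> T) x"
        using component_closed[OF component_self, of x "R \<inter> T" y] xy by blast
      then have "component (R \<inter> T) y = component (R \<inter> T) x" by (rule component_eq)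
      then show ?thesis using e cm[OF J] by (simp add: h_def cone_def)
    next
      case False
      have z: "hcoord f K R x = 0" "hcoord f K R y = 0" if K: "K \<subseteq> {1..m}" "int (card K) = q" for K
        using False e[OF K] HsetD(2)[OF H[OF K], of x R] HsetD(2)[OF H[OF K], of y R] UJ_subset by auto
      then show ?thesis using cm[OF J] by (simp add: h_def cone_def)
    qed
  qed
  have "\<exists>g\<in>carrier (Q_obj T U m (q + 1)). \<forall>J R x. J \<subseteq> {1..m} \<and> int (card J) = q + 1 \<longrightarrow> hcoord g J R x = h J R x"
    by (rule exists_hcoord[OF hH])
  then obtain g where g: "g \<in> carrier (Q_obj T U m (q + 1))"
    "\<And>J R x. J \<subseteq> {1..m} \<Longrightarrow> int (card J) = q + 1 \<Longrightarrow> hcoord g J R x = h J R x" by blast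
  have dg: "Q_diff T U m (q + 1) g \<in> carrier (Q_obj T U m q)" using Q_diff_closed[OF g(1)] by simp
  have "Q_diff T U m (q + 1) g = f"
  proof (rule Q_eqI[OF dg f])
    fix J R x assume J: "J \<subseteq> {1..m}" "int (card J) = q"
    have J': "int (card J) = q + 1 - 1" using J by simp
    have fJ: "finite J" using J(1) finite_subset by blast
    let ?a = "v (component (R \<inter> T) x)" and ?h = "\<lambda>K. hcoord f K R x"
    have ins: "insert i J \<subseteq> {1..m}" "int (card (insert i J)) = q + 1" if "i \<in> {1..m} - J" for i
      using that J fJ by auto
    have "hcoord (Q_diff T U m (q + 1) g) J R x = face_sum {1..m} (cone ?a ?h) J"
      unfolding hcoord_Q_diff[OF g(1) J(1) J'] face_sum_def
      by (rule sum.cong[OF refl]) (simp add: g(2)[OF ins] h_def)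
    also have "\<dots> = ?h J"
    \<comment> \<open>The cone identity needs an apex in \<open>{1..m}\<close>, which a nonzero
      coordinate at \<open>(R, x)\<close> guarantees. If all of them vanish, so do both sides,
      whatever the apex is.\<close>
    proof (cases "\<exists>K. K \<subseteq> {1..m} \<and> int (card K) = q \<and> ?h K \<noteq> 0")
      case True
      then have a: "?a \<in> {1..m}" using v(1) by blast
      have "cone ?a (face_sum {1..m} ?h) J = 0"
      proof (cases "?a \<in> J")
        case True
        have "int (card (J - {?a})) = q - 1" using card_Suc_Diff1[OF fJ True] J(2) by linarith
        then show ?thesis using cyc[of "J - {?a}" R x] J(1) True by (auto simp: cone_def)
      qed (simp add: cone_def)
      then show ?thesis using face_sum_cone[OF finite_atLeastAtMost J(1) a, of ?h] by simp
    next
      case False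
      have "cone ?a ?h (insert i J) = 0" if "i \<in> {1..m} - J" for i
        using False cm[OF ins[OF that], of ?a] by (auto simp: cone_def)
      then have "face_sum {1..m} (cone ?a ?h) J = 0" by (simp add: face_sum_def)
      then show ?thesis using False J by auto
    qed
    finally show "hcoord (Q_diff T U m (q + 1) g) J R x = hcoord f J R x" .
  qed
  then show ?thesis using g(1) by blast
qed

text \<open>Right multiplication by the idempotent retracts the algebra onto each
  \<open>P(D)\<close>.\<close>

lemma fg_projective_Q: "fg_projective Lambda_alg (Q_obj T U m q :: (('p, 'k::field) endo, _) module)"
  unfolding Q_obj_def
proof (rule fg_projective_direct_sum[OF ring_Lambda left_module_summand finite_idx])
  fix p assume p: "p \<in> idx q"
  obtain J D where JD: "p = (J, D)" by (cases p)
  have D: "D \<in> intervals" using p JD idx_interval by blast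
  have reg: "left_module Lambda_alg (regular_module Lambda_alg)" by (rule left_module_regular[OF ring_Lambda])
  have "restrict (\<lambda>g. g) (carrier (proj D)) \<in> lmod_hom Lambda_alg (proj D) (regular_module Lambda_alg :: (('p, 'k) endo, ('p, 'k) endo) module)"
    by (rule lmod_homI[OF _ _ _ left_module_proj[OF D]]) (auto simp: carrier_proj[OF D] regular_module_def proj_simps)
  then show "restrict (\<lambda>g. g) (carrier (summand p)) \<in> lmod_hom Lambda_alg (summand p) (regular_module Lambda_alg :: (('p, 'k) endo, ('p, 'k) endo) module)"
    by (simp add: JD)
  interpret ring "Lambda_alg :: ('k, ('p, 'k) endo) module" by (rule ring_Lambda)
  have "restrict (\<lambda>a. a \<otimes>\<^bsub>Lambda_alg\<^esub> idem D) (carrier (regular_module Lambda_alg)) \<in>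
      lmod_hom Lambda_alg (regular_module Lambda_alg) (proj D :: (('p, 'k) endo, ('p, 'k) endo) module)"
    by (rule lmod_homI[OF _ _ _ reg])
      (use idem_Lambda(1)[OF D, where 'b = 'k] in \<open>auto simp: regular_module_def proj_def l_distr m_assoc\<close>)
  then show "restrict (\<lambda>a. a \<otimes>\<^bsub>Lambda_alg\<^esub> idem (snd p)) (carrier (regular_module Lambda_alg)) \<in>
      lmod_hom Lambda_alg (regular_module Lambda_alg) (summand p :: (('p, 'k) endo, ('p, 'k) endo) module)"
    by (simp add: JD)
  fix g :: "('p, 'k) endo" assume g: "g \<in> carrier (summand p)"
  then have gD: "g \<in> carrier (proj D)" by (simp add: JD)
  then have "g \<in> carrier Lambda_alg" by (simp add: carrier_proj[OF D])
  then show "restrict (\<lambda>a. a \<otimes>\<^bsub>Lambda_alg\<^esub> idem (snd p)) (carrier (regular_module Lambda_alg))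
      (restrict (\<lambda>g. g) (carrier (summand p)) g) = g"
    using gD proj_mult_idem[OF D gD] by (simp add: JD regular_module_def)
qed

lemma idx_neg: "q < 0 \<Longrightarrow> idx q = {}"
  by (auto simp: Q_index_def)

lemma idx_zero: "idx 0 = {({}, T)}"
proof -
  have "J = {}" if "J \<subseteq> {1..m}" "card J = 0" for J using that finite_subset by fastforce
  moreover have "pi0 (UJ {}) = {T}"
    unfolding UJ_empty using intervalsD(1,2)[OF T] by (rule pi0_connected)
  ultimately show ?thesis by (auto simp: Q_index_def)
qed

lemma component_T: "T \<subseteq> R \<Longrightarrow> x \<in> T \<Longrightarrow> component (R \<inter> T) x = T"
  using connected_subset_component[OF intervalsD(2)[OF T], of "R \<inter> T" x] component_subset[of "R \<inter> T" x] by blast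

lemma Q_exact:
  fixes f :: "nat set \<times> 'p set \<Rightarrow> ('p, 'k::field) endo"
  assumes q: "1 \<le> q"
  shows "{f \<in> carrier (Q_obj T U m q). Q_diff T U m q f = \<zero>\<^bsub>Q_obj T U m (q - 1)\<^esub>} =
    Q_diff T U m (q + 1) ` carrier (Q_obj T U m (q + 1) :: (('p, 'k) endo, _) module)"
proof (intro equalityI subsetI)
  fix f :: "nat set \<times> 'p set \<Rightarrow> ('p, 'k) endo"
  assume "f \<in> {f \<in> carrier (Q_obj T U m q). Q_diff T U m q f = \<zero>\<^bsub>Q_obj T U m (q - 1)\<^esub>}"
  then have f: "f \<in> carrier (Q_obj T U m q)" and df: "Q_diff T U m q f = \<zero>\<^bsub>Q_obj T U m (q - 1)\<^esub>" by auto
  have "\<exists>g\<in>carrier (Q_obj T U m (q + 1)). Q_diff T U m (q + 1) g = f"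
  proof (rule Q_contraction[OF f])
    fix J R x assume J: "J \<subseteq> {1..m}" "int (card J) = q" and nz: "hcoord f J R x \<noteq> 0"
    have "J \<noteq> {}" using J(2) q by auto
    then show "component (R \<inter> T) x \<noteq> T"
      using Hset_support(2)[OF hcoord_Hset[OF f J] J(1) nz] UJ_proper[OF J(1)] by blast
  next
    fix J R x assume J: "J \<subseteq> {1..m}" "int (card J) = q - 1"
    show "face_sum {1..m} (\<lambda>K. hcoord f K R x) J = 0"
      unfolding hcoord_Q_diff[OF f J, symmetric] df by (rule hcoord_zero[OF J])
  qed
  then show "f \<in> Q_diff T U m (q + 1) ` carrier (Q_obj T U m (q + 1))" by blast
next
  fix f :: "nat set \<times> 'p set \<Rightarrow> ('p, 'k) endo"
  assume "f \<in> Q_diff T U m (q + 1) ` carrier (Q_obj T U m (q + 1))"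
  then obtain g where g: "g \<in> carrier (Q_obj T U m (q + 1))" "f = Q_diff T U m (q + 1) g" by blast
  have f: "f \<in> carrier (Q_obj T U m q)" using Q_diff_closed[OF g(1)] g(2) by simp
  interpret L: left_module Lambda_alg "Q_obj T U m (q - 1) :: (('p, 'k) endo, nat set \<times> 'p set \<Rightarrow> ('p, 'k) endo) module"
    by (rule left_module_Q)
  have "Q_diff T U m q f = \<zero>\<^bsub>Q_obj T U m (q - 1)\<^esub>"
  proof (rule Q_eqI[OF Q_diff_closed[OF f] L.M.zero_closed])
    fix J R x assume J: "J \<subseteq> {1..m}" "int (card J) = q - 1"
    have "hcoord (Q_diff T U m q f) J R x = face_sum {1..m} (face_sum {1..m} (\<lambda>K. hcoord g K R x)) J"
      unfolding hcoord_Q_diff[OF f J] face_sum_def[of _ _ J]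
    proof (rule sum.cong[OF refl])
      fix i assume i: "i \<in> {1..m} - J"
      have "insert i J \<subseteq> {1..m}" "int (card (insert i J)) = q + 1 - 1"
        using i J finite_subset[OF J(1)] by auto
      from hcoord_Q_diff[OF g(1) this] show "pos_sign i J * hcoord f (insert i J) R x =
          pos_sign i J * face_sum {1..m} (\<lambda>K. hcoord g K R x) (insert i J)" by (simp add: g(2))
    qed
    also have "\<dots> = 0" by (rule face_sum_face_sum[OF finite_atLeastAtMost J(1)])
    finally show "hcoord (Q_diff T U m q f) J R x = hcoord \<zero>\<^bsub>Q_obj T U m (q - 1)\<^esub> J R x"
      by (simp add: hcoord_zero[OF J])
  qed
  with f show "f \<in> {f \<in> carrier (Q_obj T U m q). Q_diff T U m q f = \<zero>\<^bsub>Q_obj T U m (q - 1)\<^esub>}" by blast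
qed

section \<open>Augmentation onto the standard module\<close>

definition augmentation :: "(nat set \<times> 'p set \<Rightarrow> ('p, 'k::field) endo) \<Rightarrow> ('p, 'k) endo set" where
  "augmentation = (\<lambda>f\<in>carrier (Q_obj T U m 0). standard_kernel T +>\<^bsub>proj T\<^esub> f ({}, T))"

lemma augmentation_kernel:
  "{f \<in> carrier (Q_obj T U m 0). f ({}, T) \<in> standard_kernel T} =
    Q_diff T U m 1 ` carrier (Q_obj T U m 1 :: (('p, 'k::field) endo, _) module)"
proof (intro equalityI subsetI)
  have i0: "({}, T) \<in> idx 0" by (simp add: idx_zero)
  fix f :: "nat set \<times> 'p set \<Rightarrow> ('p, 'k) endo"
  assume "f \<in> {f \<in> carrier (Q_obj T U m 0). f ({}, T) \<in> standard_kernel T}"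
  then have f: "f \<in> carrier (Q_obj T U m 0)" and k: "f ({}, T) \<in> standard_kernel T" by auto
  have "\<exists>g\<in>carrier (Q_obj T U m (0 + 1)). Q_diff T U m (0 + 1) g = f"
  \<comment> \<open>In degree 0 the cycle condition is vacuous, as no set has cardinality -1.
    Membership in \<open>standard_kernel T\<close> takes its place by excluding the component
    \<open>T\<close>, over which there is no cone.\<close>
  proof (rule Q_contraction[OF f])
    fix J R x assume J: "J \<subseteq> {1..m}" "int (card J) = 0" and nz: "hcoord f J R x \<noteq> 0"
    have J0: "J = {}" using J finite_subset[OF J(1)] by simp
    note S = Hset_support[OF hcoord_Hset[OF f J] J(1) nz]
    show "component (R \<inter> T) x \<noteq> T"
    proof
      assume e: "component (R \<inter> T) x = T"
      then have "T \<subseteq> R" using component_subset[of "R \<inter> T" x] by blast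
      then have "cf (f ({}, T)) R T x = 0" using k by (simp add: standard_kernel_def)
      then show False using hcoord_summand[OF f i0, of R x] S(1) e nz J0 by simp
    qed
  qed simp
  then show "f \<in> Q_diff T U m 1 ` carrier (Q_obj T U m 1)" by auto
next
  have i0: "({}, T) \<in> idx 0" by (simp add: idx_zero)
  fix f :: "nat set \<times> 'p set \<Rightarrow> ('p, 'k) endo"
  assume "f \<in> Q_diff T U m 1 ` carrier (Q_obj T U m 1)"
  then obtain g where g: "g \<in> carrier (Q_obj T U m 1)" "f = Q_diff T U m 1 g" by blast
  have f: "f \<in> carrier (Q_obj T U m 0)" using Q_diff_closed[OF g(1)] g(2) by simp
  have "cf (f ({}, T)) R T x = 0" if "T \<subseteq> R" for R x
  proof (cases "x \<in> T")
    case True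
    \<comment> \<open>With \<open>T \<subseteq> R\<close> the component of \<open>x\<close> in
      \<open>R \<inter> T\<close> is \<open>T\<close> itself, so a nonzero coordinate would force
      the proper subset \<open>U i\<close> to contain \<open>T\<close>.\<close>
    have z: "hcoord g (insert i {}) R x = 0" if i: "i \<in> {1..m} - {}" for i
    proof (rule ccontr)
      assume nz: "hcoord g (insert i {}) R x \<noteq> 0"
      have J: "insert i {} \<subseteq> {1..m}" "int (card (insert i {})) = 1" using i by auto
      have "T \<subseteq> UJ (insert i {})"
        using Hset_support(2)[OF hcoord_Hset[OF g(1) J] J(1) nz] component_T[OF \<open>T \<subseteq> R\<close> True] by simp
      then show False using UJ_proper[OF J(1)] by blast
    qed
    have "hcoord f {} R x = face_sum {1..m} (\<lambda>K. hcoord g K R x) {}"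
      unfolding g(2) by (rule hcoord_Q_diff[OF g(1)]) auto
    also have "\<dots> = 0" unfolding face_sum_def by (rule sum.neutral) (use z in simp)
    finally show ?thesis by (simp add: hcoord_summand[OF f i0])
  next
    case False
    then show ?thesis by (simp add: hcoord_summand[OF f i0])
  qed
  then have "f ({}, T) \<in> standard_kernel T" using Q_mem(1)[OF f i0] by (simp add: standard_kernel_def)
  with f show "f \<in> {f \<in> carrier (Q_obj T U m 0). f ({}, T) \<in> standard_kernel T}" by blast
qed

theorem Q_resolution:
  "projective_resolution Lambda_alg (Q_complex T U m) augmentation
    (standard T :: (('p, 'k::field) endo, ('p, 'k) endo set) module)"
proof -
  have i0: "({}, T) \<in> idx 0" by (simp add: idx_zero)
  interpret P: left_module Lambda_alg "proj T :: (('p, 'k) endo, ('p, 'k) endo) module"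
    by (rule left_module_proj[OF T])
  note K = standard_kernel_submodule[OF T, where 'k = 'k]
  have Qm: "f ({}, T) \<in> carrier (proj T)" if "f \<in> carrier (Q_obj T U m 0)" for f :: "nat set \<times> 'p set \<Rightarrow> ('p, 'k) endo"
    by (rule Q_mem(1)[OF that i0])
  have Qadd: "(f \<oplus>\<^bsub>Q_obj T U m 0\<^esub> g) ({}, T) = f ({}, T) \<oplus>\<^bsub>proj T\<^esub> g ({}, T)"
    and Qsm: "(a \<odot>\<^bsub>Q_obj T U m 0\<^esub> f) ({}, T) = a \<odot>\<^bsub>proj T\<^esub> f ({}, T)" for f g :: "nat set \<times> 'p set \<Rightarrow> ('p, 'k) endo" and a
    using direct_sum_apply(1)[OF i0, where M = summand and f = f and g = g]
      direct_sum_apply(2)[OF i0, where M = summand and f = f and a = a]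
    by (simp_all add: Q_obj_def)
  show ?thesis unfolding projective_resolution_def Q_complex_def graded_complex.simps standard_eq[OF T]
  proof (intro conjI allI impI)
    show "fg_projective Lambda_alg (Q_obj T U m q :: (('p, 'k) endo, _) module)" for q by (rule fg_projective_Q)
    show "carrier (Q_obj T U m q) = {\<zero>\<^bsub>Q_obj T U m q :: (('p, 'k) endo, _) module\<^esub>}" if "q < 0" for q
      unfolding Q_obj_def idx_neg[OF that] by (auto simp: direct_sum_def)
    show "Q_diff T U m q \<in> lmod_hom Lambda_alg (Q_obj T U m q) (Q_obj T U m (q - 1) :: (('p, 'k) endo, _) module)" for q
      by (rule Q_diff_hom)
    show "{f \<in> carrier (Q_obj T U m q). Q_diff T U m q f = \<zero>\<^bsub>Q_obj T U m (q - 1)\<^esub>} =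
      Q_diff T U m (q + 1) ` carrier (Q_obj T U m (q + 1) :: (('p, 'k) endo, _) module)" if "1 \<le> q" for q
      by (rule Q_exact[OF that])
    show "(augmentation :: _ \<Rightarrow> ('p, 'k) endo set) \<in> lmod_hom Lambda_alg (Q_obj T U m 0) (quot_module (proj T) (standard_kernel T))"
      unfolding augmentation_def
      by (rule lmod_homI[OF _ _ _ left_module_Q])
        (simp_all add: P.carrier_quot Qm Qadd Qsm P.add_quot[OF K] P.smult_quot[OF K])
    show "(augmentation :: _ \<Rightarrow> ('p, 'k) endo set) ` carrier (Q_obj T U m 0) = carrier (quot_module (proj T) (standard_kernel T))"
    proof (intro equalityI subsetI)
      fix Y :: "('p, 'k) endo set" assume "Y \<in> carrier (quot_module (proj T) (standard_kernel T))"
      then obtain g where g: "g \<in> carrier (proj T)" "Y = standard_kernel T +>\<^bsub>proj T\<^esub> g"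
        by (auto simp: P.carrier_quot)
      have "(\<lambda>p\<in>idx 0. g) \<in> carrier (Q_obj T U m 0)" unfolding Q_obj_def
        by (rule direct_sum_memI) (use g in \<open>auto simp: idx_zero\<close>)
      moreover from this have "Y = augmentation (\<lambda>p\<in>idx 0. g)" using g(2) i0 by (simp add: augmentation_def)
      ultimately show "Y \<in> augmentation ` carrier (Q_obj T U m 0)" by blast
    qed (auto simp: augmentation_def P.carrier_quot Qm)
    have "{f \<in> carrier (Q_obj T U m 0). augmentation f = \<zero>\<^bsub>quot_module (proj T) (standard_kernel T)\<^esub>} =
        {f \<in> carrier (Q_obj T U m 0). f ({}, T) \<in> (standard_kernel T :: ('p, 'k) endo set)}"
      by (rule Collect_cong) (auto simp: augmentation_def P.zero_quot P.coset_eq_zero_iff[OF K Qm])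
    then show "{f \<in> carrier (Q_obj T U m 0). augmentation f = \<zero>\<^bsub>quot_module (proj T) (standard_kernel T)\<^esub>} =
        Q_diff T U m 1 ` carrier (Q_obj T U m 1 :: (('p, 'k) endo, _) module)"
      unfolding augmentation_kernel .
  qed
qed

text \<open>An extensional family over a finite index set is determined by its values, so listing
  the indices by naturals encodes it as a sequence of algebra elements, the carrier type on which
  \<open>Ext\<close> is computed.\<close>

lemma exists_embedding_Q:
  "\<exists>\<tau> :: int \<Rightarrow> (nat set \<times> 'p set \<Rightarrow> ('p, 'k::field) endo) \<Rightarrow> nat \<Rightarrow> ('p, 'k) endo.
    \<forall>q. inj_on (\<tau> q) (carrier (Q_obj T U m q))"
proof -
  have "\<exists>b :: nat \<Rightarrow> nat set \<times> 'p set. idx q \<subseteq> range b" for q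
  proof -
    obtain b where "bij_betw b {..<card (idx q)} (idx q)"
      using ex_bij_betw_nat_finite[OF finite_idx, of q] by (auto simp: atLeast0LessThan)
    then show ?thesis by (intro exI[of _ b]) (auto simp: bij_betw_def)
  qed
  then obtain b :: "int \<Rightarrow> nat \<Rightarrow> nat set \<times> 'p set" where b: "\<And>q. idx q \<subseteq> range (b q)" by metis
  have "inj_on (\<lambda>f k. f (b q k)) (carrier (Q_obj T U m q :: (('p, 'k) endo, _) module))" for q
  proof (rule inj_onI)
    fix f g :: "nat set \<times> 'p set \<Rightarrow> ('p, 'k) endo"
    assume f: "f \<in> carrier (Q_obj T U m q)" and g: "g \<in> carrier (Q_obj T U m q)"
      and e: "(\<lambda>k. f (b q k)) = (\<lambda>k. g (b q k))"
    show "f = g"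
    proof (rule extensionalityI[of _ "idx q"])
      show "f \<in> extensional (idx q)" "g \<in> extensional (idx q)"
        using f g direct_sum_extensional unfolding Q_obj_def by blast+
      fix p assume "p \<in> idx q"
      then obtain k where "p = b q k" using b[of q] by blast
      then show "f p = g p" using fun_cong[OF e, of k] by simp
    qed
  qed
  then show ?thesis by (intro exI[of _ "\<lambda>q f k. f (b q k)"]) blast
qed

end

section \<open>Homomorphisms from the resolution to a simple module\<close>

text \<open>Cocycles and coboundaries of \<open>L\<close> are the images of those of
  \<open>K\<close>, so their closure properties are transported rather than assumed. The
  differential of \<open>K\<close> is restricted in the assumption because the field
  \<open>diff\<close> is not extensional in general.\<close>

lemma cochain_iso_cohomology:
  assumes iso: "cochain_iso R K L"
    and K: "\<And>q. left_module R (obj K q)" and L: "\<And>q. left_module R (obj L q)"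
    and d: "\<And>q. restrict (diff K q) (carrier (obj K q)) \<in> lmod_hom R (obj K q) (obj K (q + 1))"
    and dd: "\<And>x. x \<in> carrier (obj K (n - 1)) \<Longrightarrow> diff K n (diff K (n - 1) x) = \<zero>\<^bsub>obj K (n + 1)\<^esub>"
  shows "lmod_iso R (cohomology K n) (cohomology L n)"
proof -
  obtain \<phi> where hom: "\<And>q. \<phi> q \<in> lmod_hom R (obj K q) (obj L q)"
    and bij: "\<And>q. bij_betw (\<phi> q) (carrier (obj K q)) (carrier (obj L q))"
    and comm: "\<And>q x. x \<in> carrier (obj K q) \<Longrightarrow> \<phi> (q + 1) (diff K q x) = diff L q (\<phi> q x)"
    using iso unfolding cochain_iso_def by blast
  let ?ZK = "{x \<in> carrier (obj K n). diff K n x = \<zero>\<^bsub>obj K (n + 1)\<^esub>}"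
  let ?BK = "diff K (n - 1) ` carrier (obj K (n - 1))"
  let ?ZL = "{x \<in> carrier (obj L n). diff L n x = \<zero>\<^bsub>obj L (n + 1)\<^esub>}"
  let ?BL = "diff L (n - 1) ` carrier (obj L (n - 1))"
  have dc: "diff K q x \<in> carrier (obj K (q + 1))" if "x \<in> carrier (obj K q)" for q x
    using lmod_homD(1)[OF d that] that by simp
  have im: "carrier (obj L q) = \<phi> q ` carrier (obj K q)" for q using bij[of q] by (simp add: bij_betw_def)
  have inj: "inj_on (\<phi> q) (carrier (obj K q))" for q using bij[of q] by (simp add: bij_betw_def)
  have comm': "diff L (n - 1) (\<phi> (n - 1) x) = \<phi> n (diff K (n - 1) x)" if "x \<in> carrier (obj K (n - 1))" for x
    using comm[OF that] by simp
  have dc': "diff K (n - 1) x \<in> carrier (obj K n)" if "x \<in> carrier (obj K (n - 1))" for x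
    using dc[OF that] by simp
  have zero: "\<phi> q x = \<zero>\<^bsub>obj L q\<^esub> \<longleftrightarrow> x = \<zero>\<^bsub>obj K q\<^esub>" if "x \<in> carrier (obj K q)" for q x
  proof -
    have "\<zero>\<^bsub>obj K q\<^esub> \<in> carrier (obj K q)"
      using left_module.axioms(2)[OF K] by (rule abelian_groupE(2))
    then show ?thesis
      using inj_on_eq_iff[OF inj that] lmod_hom_zero[OF K L hom] by metis
  qed
  have ZL: "?ZL = \<phi> n ` ?ZK"
  proof (intro equalityI subsetI)
    fix y assume y: "y \<in> ?ZL"
    then obtain x where x: "x \<in> carrier (obj K n)" "y = \<phi> n x" using im[of n] by blast
    have "\<phi> (n + 1) (diff K n x) = \<zero>\<^bsub>obj L (n + 1)\<^esub>" using y comm[OF x(1)] x(2) by simp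
    then have "x \<in> ?ZK" using zero[OF dc[OF x(1)]] x(1) by simp
    then show "y \<in> \<phi> n ` ?ZK" using x(2) by blast
  next
    fix y assume "y \<in> \<phi> n ` ?ZK"
    then obtain x where x: "x \<in> carrier (obj K n)" "diff K n x = \<zero>\<^bsub>obj K (n + 1)\<^esub>" "y = \<phi> n x" by blast
    then have "diff L n y = \<zero>\<^bsub>obj L (n + 1)\<^esub>" using comm[OF x(1)] lmod_hom_zero[OF K L hom] by simp
    then show "y \<in> ?ZL" using lmod_homD(1)[OF hom x(1)] x(3) by simp
  qed
  have BL: "?BL = \<phi> n ` ?BK"
    unfolding im[of "n - 1"] image_image using comm' by (intro image_cong) simp_all
  have "?ZK = {x \<in> carrier (obj K n). restrict (diff K n) (carrier (obj K n)) x = \<zero>\<^bsub>obj K (n + 1)\<^esub>}" by auto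
  then have sZ: "submodule ?ZK R (obj K n)" using kernel_submodule[OF K K d] by simp
  have "?BK = restrict (diff K (n - 1)) (carrier (obj K (n - 1))) ` carrier (obj K (n - 1))" by simp
  then have sB: "submodule ?BK R (obj K n)"
    using image_submodule[OF K K d[of "n - 1"] left_module.carrier_submodule[OF K]] by simp
  have BZ: "?BK \<subseteq> ?ZK" using dd dc' by blast
  show ?thesis unfolding cohomology_def
  proof (rule lmod_iso_subquotient[OF K L sB sZ BZ, where f = "\<phi> n"])
    show "submodule ?BL R (obj L n)" unfolding BL by (rule image_submodule[OF K L hom sB])
    show "submodule ?ZL R (obj L n)" unfolding ZL by (rule image_submodule[OF K L hom sZ])
    show "?BL \<subseteq> ?ZL" unfolding BL ZL using BZ by (rule image_mono)
    fix x assume x: "x \<in> ?ZK"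
    then show "\<phi> n x \<in> ?ZL" unfolding ZL by (rule imageI)
    show "\<phi> n x \<in> ?BL \<longleftrightarrow> x \<in> ?BK"
      unfolding BL by (rule inj_on_image_mem_iff[OF inj]) (use x dc' in auto)
  next
    show "\<phi> n (x \<oplus>\<^bsub>obj K n\<^esub> y) = \<phi> n x \<oplus>\<^bsub>obj L n\<^esub> \<phi> n y" if "x \<in> ?ZK" "y \<in> ?ZK" for x y
      using lmod_homD(2)[OF hom] that by blast
    show "\<phi> n (a \<odot>\<^bsub>obj K n\<^esub> x) = a \<odot>\<^bsub>obj L n\<^esub> \<phi> n x" if "a \<in> carrier R" "x \<in> ?ZK" for a x
      using lmod_homD(3)[OF hom] that by blast
  next
    fix y assume y: "y \<in> ?ZL"
    then obtain x where x: "x \<in> ?ZK" "y = \<phi> n x" unfolding ZL by blast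
    interpret L: left_module R "obj L n" by (rule L)
    have "\<zero>\<^bsub>obj L n\<^esub> \<in> ?BL" unfolding BL by (rule L.submoduleD(2)[OF image_submodule[OF K L hom sB]])
    moreover have "y = \<zero>\<^bsub>obj L n\<^esub> \<oplus>\<^bsub>obj L n\<^esub> \<phi> n x" using x y by simp
    ultimately show "\<exists>x\<in>?ZK. \<exists>a\<in>?BL. y = a \<oplus>\<^bsub>obj L n\<^esub> \<phi> n x" using x(1) by blast
  qed
qed

section \<open>Coordinates of homomorphisms to a simple module\<close>

context upset_cover
begin

definition gen :: "int \<Rightarrow> nat set \<Rightarrow> 'p set \<Rightarrow> nat set \<times> 'p set \<Rightarrow> ('p, 'k::field) endo" where
  "gen q J D = summand_inj (idx q) summand (J, D) (idem D)"

lemma gen_closed: "(J, D) \<in> idx q \<Longrightarrow> gen q J D \<in> carrier (Q_obj T U m q)"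
  unfolding gen_def Q_obj_def
  by (rule summand_inj_closed[of "idx q" Lambda_alg summand, OF left_module_summand])
    (simp_all add: idem_proj idx_interval)

lemma gen_apply:
  "(K, E) \<in> idx q \<Longrightarrow> gen q J D (K, E) = (if K = J \<and> E = D then idem D else \<zero>\<^bsub>Lambda_alg\<^esub>)"
  by (simp add: gen_def summand_inj_def proj_simps)

lemma smult_gen:
  assumes p: "(J, D) \<in> idx q" and g: "g \<in> carrier (proj D)"
  shows "summand_inj (idx q) summand (J, D) g = g \<odot>\<^bsub>Q_obj T U m q\<^esub> gen q J D"
proof -
  have D: "D \<in> intervals" by (rule idx_interval[OF p])
  have gL: "g \<in> carrier Lambda_alg" using g by (simp add: carrier_proj[OF D])
  have "summand_inj (idx q) summand (J, D) g = summand_inj (idx q) summand (J, D) (g \<odot>\<^bsub>summand (J, D)\<^esub> idem D)"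
    using proj_mult_idem[OF D g] by (simp add: proj_simps)
  also have "\<dots> = g \<odot>\<^bsub>direct_sum (idx q) summand\<^esub> summand_inj (idx q) summand (J, D) (idem D)"
    by (rule summand_inj_smult[OF left_module_summand gL])
  finally show ?thesis by (simp add: gen_def Q_obj_def)
qed

text \<open>The generators \<open>gen q J D\<close> determine a homomorphism. Those with
  \<open>D\<close> different from \<open>C\<close> are sent to 0, since their images are fixed by
  \<open>idem D\<close>, which acts as 0 on \<open>L(C)\<close>.\<close>

lemma Hom_simp_top_expand:
  fixes f :: "(nat set \<times> 'p set \<Rightarrow> ('p, 'k::field) endo) \<Rightarrow> ('p, 'k) endo set"
  assumes C: "C \<in> intervals" and f: "f \<in> lmod_hom Lambda_alg (Q_obj T U m q) (simp_top C)"
    and F: "F \<in> carrier (Q_obj T U m q)"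
  shows "top_value C (f F) = (\<Sum>J\<in>{J. (J, C) \<in> idx q}. top_coord C (F (J, C)) * top_value C (f (gen q J C)))"
proof -
  let ?Q = "Q_obj T U m q :: (('p, 'k) endo, nat set \<times> 'p set \<Rightarrow> ('p, 'k) endo) module"
  let ?L = "simp_top C :: (('p, 'k) endo, ('p, 'k) endo set) module"
  interpret Q: left_module Lambda_alg ?Q by (rule left_module_Q)
  have L: "left_module Lambda_alg ?L" by (rule left_module_simp_top[OF C])
  define \<theta> where "\<theta> G = top_value C (f G)" for G
  have \<theta>0: "\<theta> \<zero>\<^bsub>?Q\<^esub> = 0"
    unfolding \<theta>_def lmod_hom_zero[OF Q.left_module L f] by (rule top_value_zero[OF C])
  have \<theta>a: "\<theta> (G \<oplus>\<^bsub>?Q\<^esub> H) = \<theta> G + \<theta> H" if "G \<in> carrier ?Q" "H \<in> carrier ?Q" for G H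
    unfolding \<theta>_def lmod_homD(2)[OF f that]
    by (rule top_value_add[OF C lmod_homD(1)[OF f that(1)] lmod_homD(1)[OF f that(2)]])
  have \<theta>s: "\<theta> (a \<odot>\<^bsub>?Q\<^esub> G) = top_coord C a * \<theta> G" if "a \<in> carrier Lambda_alg" "G \<in> carrier ?Q" for a G
    unfolding \<theta>_def lmod_homD(3)[OF f that] by (rule top_value_smult[OF C that(1) lmod_homD(1)[OF f that(2)]])
  have \<theta>g: "\<theta> (summand_inj (idx q) summand p (F p)) =
      (if snd p = C then top_coord C (F p) * \<theta> (gen q (fst p) C) else 0)" if p: "p \<in> idx q" for p
  proof -
    obtain J D where JD: "p = (J, D)" by (cases p)
    have p': "(J, D) \<in> idx q" using p JD by simp
    have D: "D \<in> intervals" by (rule idx_interval[OF p'])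
    have 1: "\<theta> (summand_inj (idx q) summand p (F p)) = top_coord C (F p) * \<theta> (gen q J D)"
      unfolding JD smult_gen[OF p' Q_mem(1)[OF F p']] by (rule \<theta>s[OF Q_mem(2)[OF F p'] gen_closed[OF p']])
    \<comment> \<open>The generator is fixed by its own idempotent; applying the homomorphism shows
      that its value is multiplied by the scalar \<open>top_coord C (idem D)\<close>.\<close>
    have "gen q J D = idem D \<odot>\<^bsub>?Q\<^esub> gen q J D"
      using smult_gen[OF p' idem_proj[OF D]] by (simp only: gen_def[symmetric])
    from arg_cong[OF this, of \<theta>] have "\<theta> (gen q J D) = top_coord C (idem D) * \<theta> (gen q J D)"
      unfolding \<theta>s[OF idem_Lambda(1)[OF D] gen_closed[OF p']] .
    then have "D \<noteq> C \<Longrightarrow> \<theta> (gen q J D) = 0" by (simp add: top_coord_simps(3)[OF C D])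
    then show ?thesis using 1 by (auto simp: JD)
  qed
  have cl: "(\<lambda>p. summand_inj (idx q) summand p (F p)) \<in> idx q \<rightarrow> carrier ?Q"
  proof (rule Pi_I)
    fix p assume p: "p \<in> idx q"
    show "summand_inj (idx q) summand p (F p) \<in> carrier ?Q" unfolding Q_obj_def
      by (rule summand_inj_closed[of "idx q" Lambda_alg summand, OF left_module_summand])
        (use direct_sum_mem[OF F[unfolded Q_obj_def] p] in simp_all)
  qed
  have "F = finsum ?Q (\<lambda>p. summand_inj (idx q) summand p (F p)) (idx q)"
    using direct_sum_decomp[OF ring_Lambda left_module_summand finite_idx F[unfolded Q_obj_def]]
    by (simp add: Q_obj_def)
  then have "\<theta> F = \<theta> (finsum ?Q (\<lambda>p. summand_inj (idx q) summand p (F p)) (idx q))" by simp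
  also have "\<dots> = (\<Sum>p\<in>idx q. \<theta> (summand_inj (idx q) summand p (F p)))"
    by (rule additive_finsum[where \<theta> = \<theta>, OF Q.M.abelian_monoid_axioms \<theta>0 \<theta>a cl])
  also have "\<dots> = (\<Sum>p\<in>idx q. if snd p = C then top_coord C (F p) * \<theta> (gen q (fst p) C) else 0)"
    by (rule sum.cong[OF refl \<theta>g])
  also have "\<dots> = (\<Sum>p\<in>(\<lambda>J. (J, C)) ` {J. (J, C) \<in> idx q}. top_coord C (F p) * \<theta> (gen q (fst p) C))"
    by (rule sum.mono_neutral_cong_right[OF finite_idx]) auto
  also have "\<dots> = (\<Sum>J\<in>{J. (J, C) \<in> idx q}. top_coord C (F (J, C)) * \<theta> (gen q J C))"
    by (subst sum.reindex) (auto intro: inj_onI)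
  finally show ?thesis by (simp add: \<theta>_def)
qed

lemma finite_face_idx: "finite {J. (J, C) \<in> idx q}"
proof (rule finite_subset)
  show "{J. (J, C) \<in> idx q} \<subseteq> Pow {1..m}" by (auto simp: idx_iff)
qed simp

text \<open>The sign accounts for the negated differential of the shifted complex.\<close>

definition degree_sign :: "int \<Rightarrow> 'k::comm_ring_1" where
  "degree_sign n = (if even n then 1 else - 1)"

lemma degree_sign_square: "degree_sign n * degree_sign n = 1"
  by (simp add: degree_sign_def)

lemma degree_sign_Suc: "degree_sign (n + 1) = - degree_sign n"
  by (simp add: degree_sign_def)

definition to_cochain :: "'p set \<Rightarrow> int \<Rightarrow> ((nat set \<times> 'p set \<Rightarrow> ('p, 'k::field) endo) \<Rightarrow> ('p, 'k) endo set) \<Rightarrow>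
    nat set \<Rightarrow> 'k" where
  "to_cochain C n f F = (if (F, C) \<in> idx n then degree_sign n * top_value C (f (gen n F C)) else 0)"

lemma top_coord_gen:
  assumes C: "C \<in> intervals" and K: "(K, C) \<in> idx q"
  shows "top_coord C (gen q J C (K, C)) = (if K = J then 1 else 0)"
  by (simp add: gen_apply[OF K] top_coord_simps(1)[OF C] top_coord_simps(3)[OF C C])

lemma to_cochain_bij:
  fixes C :: "'p set"
  assumes C: "C \<in> intervals"
  shows "restrict (to_cochain C n) (lmod_hom Lambda_alg (Q_obj T U m n) (simp_top C)) \<in>
      lmod_hom (scalars :: 'k::field ring) (Hom_space Lambda_alg (Q_obj T U m n) (simp_top C))
        (functions_on {F. (F, C) \<in> idx n})"
    and "bij_betw (to_cochain C n :: _ \<Rightarrow> nat set \<Rightarrow> 'k) (lmod_hom Lambda_alg (Q_obj T U m n) (simp_top C))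
        (carrier (functions_on {F. (F, C) \<in> idx n}))"
proof -
  let ?Q = "Q_obj T U m n :: (('p, 'k) endo, nat set \<times> 'p set \<Rightarrow> ('p, 'k) endo) module"
  let ?L = "simp_top C :: (('p, 'k) endo, ('p, 'k) endo set) module"
  let ?H = "lmod_hom Lambda_alg ?Q ?L"
  interpret A: unital_algebra "Lambda_alg :: ('k, ('p, 'k) endo) module" by (rule unital_algebra_Lambda)
  interpret Q: left_module Lambda_alg ?Q by (rule left_module_Q)
  have L: "left_module Lambda_alg ?L" by (rule left_module_simp_top[OF C])
  interpret L: left_module Lambda_alg ?L by (rule L)
  have val: "f (gen n F C) \<in> carrier ?L" if "f \<in> ?H" "(F, C) \<in> idx n" for f F
    by (rule lmod_homD(1)[OF that(1) gen_closed[OF that(2)]])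
  \<comment> \<open>Scalars act on \<open>Hom_space\<close> through multiples of 1 in the algebra,
    and on \<open>L(C)\<close> such a multiple acts as the original scalar.\<close>
  have sc: "top_coord C (c \<odot>\<^bsub>Lambda_alg\<^esub> \<one>\<^bsub>Lambda_alg\<^esub> :: ('p, 'k) endo) = c" for c
    using C intervalsD(1)[OF C] by (simp add: top_coord_def cf_smult(2)[OF one_Lambda] cf_one some_in_eq)
  have "restrict (to_cochain C n) (carrier (Hom_space Lambda_alg ?Q ?L)) \<in>
      lmod_hom (scalars :: 'k ring) (Hom_space Lambda_alg ?Q ?L) (functions_on {F. (F, C) \<in> idx n})"
  proof (rule lmod_homI[OF _ _ _ A.left_module_Hom_space[OF Q.left_module L]])
    show "to_cochain C n f \<in> carrier (functions_on {F. (F, C) \<in> idx n})" for f :: "_ \<Rightarrow> ('p, 'k) endo set"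
      by (simp add: functions_on_simps to_cochain_def)
  next
    fix f g assume "f \<in> carrier (Hom_space Lambda_alg ?Q ?L)" "g \<in> carrier (Hom_space Lambda_alg ?Q ?L)"
    then have fg: "f \<in> ?H" "g \<in> ?H" by (simp_all add: Hom_space_simps)
    show "to_cochain C n (f \<oplus>\<^bsub>Hom_space Lambda_alg ?Q ?L\<^esub> g) =
        to_cochain C n f \<oplus>\<^bsub>functions_on {F. (F, C) \<in> idx n}\<^esub> to_cochain C n g"
    proof
      fix F
      show "to_cochain C n (f \<oplus>\<^bsub>Hom_space Lambda_alg ?Q ?L\<^esub> g) F =
          (to_cochain C n f \<oplus>\<^bsub>functions_on {F. (F, C) \<in> idx n}\<^esub> to_cochain C n g) F"
      proof (cases "(F, C) \<in> idx n")
        case True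
        have "top_value C ((f \<oplus>\<^bsub>Hom_space Lambda_alg ?Q ?L\<^esub> g) (gen n F C)) =
            top_value C (f (gen n F C)) + top_value C (g (gen n F C))"
          using top_value_add[OF C val[OF fg(1) True] val[OF fg(2) True]] gen_closed[OF True, where 'a = 'k]
          by (simp add: Hom_space_simps)
        then show ?thesis using True by (simp add: to_cochain_def functions_on_simps distrib_left)
      qed (simp add: to_cochain_def functions_on_simps)
    qed
  next
    fix c :: 'k and f assume "f \<in> carrier (Hom_space Lambda_alg ?Q ?L)"
    then have f: "f \<in> ?H" by (simp add: Hom_space_simps)
    show "to_cochain C n (c \<odot>\<^bsub>Hom_space Lambda_alg ?Q ?L\<^esub> f) =
        c \<odot>\<^bsub>functions_on {F. (F, C) \<in> idx n}\<^esub> to_cochain C n f"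
    proof
      fix F
      show "to_cochain C n (c \<odot>\<^bsub>Hom_space Lambda_alg ?Q ?L\<^esub> f) F =
          (c \<odot>\<^bsub>functions_on {F. (F, C) \<in> idx n}\<^esub> to_cochain C n f) F"
      proof (cases "(F, C) \<in> idx n")
        case True
        have "top_value C ((c \<odot>\<^bsub>Hom_space Lambda_alg ?Q ?L\<^esub> f) (gen n F C)) = c * top_value C (f (gen n F C))"
          using top_value_smult[OF C cf_smult(1)[OF one_Lambda] val[OF f True], of c] sc[of c]
            gen_closed[OF True, where 'a = 'k]
          by (simp add: Hom_space_simps)
        then show ?thesis using True by (simp add: to_cochain_def functions_on_simps mult.left_commute)
      qed (simp add: to_cochain_def functions_on_simps)
    qed
  qed
  then show "restrict (to_cochain C n) ?H \<in>
      lmod_hom (scalars :: 'k ring) (Hom_space Lambda_alg ?Q ?L) (functions_on {F. (F, C) \<in> idx n})"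
    by (simp add: Hom_space_simps)
  note tb = top_value_bij[OF C, where 'k = 'k]
  have tinj: "y = z" if "y \<in> carrier ?L" "z \<in> carrier ?L" "top_value C y = top_value C z" for y z
    using inj_onD[OF bij_betw_imp_inj_on[OF tb]] that by blast
  define ti where "ti = inv_into (carrier ?L) (top_value C)"
  have ti: "ti c \<in> carrier ?L" "top_value C (ti c) = c" for c :: 'k
  proof -
    have "c \<in> top_value C ` carrier ?L" using tb by (simp add: bij_betw_def)
    then show "ti c \<in> carrier ?L" "top_value C (ti c) = c"
      unfolding ti_def by (rule inv_into_into, rule f_inv_into_f)
  qed
  show "bij_betw (to_cochain C n) ?H (carrier (functions_on {F. (F, C) \<in> idx n}))"
  proof (rule bij_betw_imageI)
    show "inj_on (to_cochain C n) ?H"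
    proof (rule inj_onI)
      fix f g assume f: "f \<in> ?H" and g: "g \<in> ?H" and e: "to_cochain C n f = to_cochain C n g"
      have "top_value C (f (gen n J C)) = top_value C (g (gen n J C))" if "(J, C) \<in> idx n" for J
        using fun_cong[OF e, of J] that by (auto simp: to_cochain_def degree_sign_def split: if_splits)
      then have "top_value C (f F) = top_value C (g F)" if "F \<in> carrier ?Q" for F
        unfolding Hom_simp_top_expand[OF C f that] Hom_simp_top_expand[OF C g that]
        by (intro sum.cong refl) auto
      then show "f = g"
        by (intro lmod_hom_eqI[OF f g] tinj) (use lmod_homD(1)[OF f] lmod_homD(1)[OF g] in auto)
    qed
    have surj: "\<exists>f\<in>?H. \<psi> = to_cochain C n f" if \<psi>: "\<psi> \<in> carrier (functions_on {F. (F, C) \<in> idx n})" for \<psi>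
    proof -
      \<comment> \<open>The expansion \<open>Hom_simp_top_expand\<close> dictates this formula for a
        homomorphism with prescribed values on the generators; \<open>degree_sign\<close> is its own
        inverse.\<close>
      define s where "s F = (\<Sum>J\<in>{J. (J, C) \<in> idx n}. top_coord C (F (J, C)) * (degree_sign n * \<psi> J))"
        for F :: "nat set \<times> 'p set \<Rightarrow> ('p, 'k) endo"
      have sadd: "s (F \<oplus>\<^bsub>?Q\<^esub> G) = s F + s G" if F: "F \<in> carrier ?Q" and G: "G \<in> carrier ?Q" for F G
        unfolding s_def sum.distrib[symmetric]
      proof (rule sum.cong[OF refl])
        fix J assume "J \<in> {J. (J, C) \<in> idx n}"
        then have p: "(J, C) \<in> idx n" by simp
        have "(F \<oplus>\<^bsub>?Q\<^esub> G) (J, C) = F (J, C) \<oplus>\<^bsub>Lambda_alg\<^esub> G (J, C)"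
          using direct_sum_apply(1)[OF p, where M = summand and f = F and g = G] by (simp add: Q_obj_def proj_simps)
        then show "top_coord C ((F \<oplus>\<^bsub>?Q\<^esub> G) (J, C)) * (degree_sign n * \<psi> J) =
            top_coord C (F (J, C)) * (degree_sign n * \<psi> J) + top_coord C (G (J, C)) * (degree_sign n * \<psi> J)"
          by (simp add: top_coord_simps(2)[OF C Q_mem(2)[OF F p] Q_mem(2)[OF G p]] distrib_right)
      qed
      have ssm: "s (a \<odot>\<^bsub>?Q\<^esub> F) = top_coord C a * s F" if a: "a \<in> carrier Lambda_alg" and F: "F \<in> carrier ?Q" for a F
        unfolding s_def sum_distrib_left
      proof (rule sum.cong[OF refl])
        fix J assume "J \<in> {J. (J, C) \<in> idx n}"
        then have p: "(J, C) \<in> idx n" by simp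
        have "(a \<odot>\<^bsub>?Q\<^esub> F) (J, C) = a \<otimes>\<^bsub>Lambda_alg\<^esub> F (J, C)"
          using direct_sum_apply(2)[OF p, where M = summand and f = F and a = a] by (simp add: Q_obj_def proj_simps)
        then show "top_coord C ((a \<odot>\<^bsub>?Q\<^esub> F) (J, C)) * (degree_sign n * \<psi> J) =
            top_coord C a * (top_coord C (F (J, C)) * (degree_sign n * \<psi> J))"
          by (simp add: top_coord_mult[OF C a Q_mem(2)[OF F p]] mult.assoc)
      qed
      have f: "restrict (\<lambda>F. ti (s F)) (carrier ?Q) \<in> ?H"
      proof (rule lmod_homI[OF ti(1) _ _ Q.left_module])
        show "ti (s (F \<oplus>\<^bsub>?Q\<^esub> G)) = ti (s F) \<oplus>\<^bsub>?L\<^esub> ti (s G)" if "F \<in> carrier ?Q" "G \<in> carrier ?Q" for F G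
          by (rule tinj[OF ti(1) L.M.a_closed[OF ti(1) ti(1)]])
            (simp add: top_value_add[OF C ti(1) ti(1)] ti(2) sadd[OF that])
        show "ti (s (a \<odot>\<^bsub>?Q\<^esub> F)) = a \<odot>\<^bsub>?L\<^esub> ti (s F)" if "a \<in> carrier Lambda_alg" "F \<in> carrier ?Q" for a F
          by (rule tinj[OF ti(1) L.smult_closed[OF that(1) ti(1)]])
            (simp add: top_value_smult[OF C that(1) ti(1)] ti(2) ssm[OF that])
      qed
      have "\<psi> = to_cochain C n (restrict (\<lambda>F. ti (s F)) (carrier ?Q))"
      proof
        fix F
        show "\<psi> F = to_cochain C n (restrict (\<lambda>F. ti (s F)) (carrier ?Q)) F"
        proof (cases "(F, C) \<in> idx n")
          case True
          have "s (gen n F C) = (\<Sum>J\<in>{J. (J, C) \<in> idx n}. if J = F then degree_sign n * \<psi> F else 0)"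
            unfolding s_def by (rule sum.cong[OF refl]) (simp add: top_coord_gen[OF C])
          also have "\<dots> = degree_sign n * \<psi> F" using True finite_face_idx by simp
          finally show ?thesis using True gen_closed[OF True, where 'a = 'k]
            by (simp add: to_cochain_def ti(2) degree_sign_square flip: mult.assoc)
        next
          case False
          then show ?thesis using \<psi> by (simp add: to_cochain_def functions_on_simps)
        qed
      qed
      with f show ?thesis by blast
    qed
    have "to_cochain C n f \<in> carrier (functions_on {F. (F, C) \<in> idx n})" for f :: "_ \<Rightarrow> ('p, 'k) endo set"
      by (simp add: functions_on_simps to_cochain_def)
    then show "to_cochain C n ` ?H = carrier (functions_on {F. (F, C) \<in> idx n})" using surj by blast
  qed
qed

text \<open>The incidence number of the faces \<open>F\<close> and \<open>J\<close>: at most one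
  \<open>i\<close> contributes. Written as a sum over \<open>F\<close>, it can be exchanged with the
  sum over \<open>J\<close> in the expansion of a homomorphism.\<close>

lemma top_coord_diff_gen:
  assumes C: "C \<in> intervals" and F: "(F, C) \<in> idx (n + 1)" and J: "(J, C) \<in> idx n"
  shows "top_coord C (Q_diff T U m (n + 1) (gen (n + 1) F C) (J, C)) =
    (\<Sum>i\<in>F. if F - {i} = J then pos_sign i F else (0 :: 'k::field))"
proof -
  let ?e = "gen (n + 1) F C :: nat set \<times> 'p set \<Rightarrow> ('p, 'k) endo"
  have e: "?e \<in> carrier (Q_obj T U m (n + 1))" by (rule gen_closed[OF F])
  have de: "Q_diff T U m (n + 1) ?e \<in> carrier (Q_obj T U m n)" using Q_diff_closed[OF e] by simp
  obtain x where x: "x \<in> C" using intervalsD(1)[OF C] by blast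
  have J': "J \<subseteq> {1..m}" "int (card J) = n + 1 - 1" "C \<in> pi0 (UJ J)" using J by (auto simp: idx_iff)
  have F': "F \<subseteq> {1..m}" "int (card F) = n + 1" "C \<in> pi0 (UJ F)" using F by (auto simp: idx_iff)
  have fin: "finite F" "finite J" using F'(1) J'(1) finite_subset by auto
  have he: "hcoord ?e K C x = (if K = F then 1 else 0)" if K: "K \<subseteq> {1..m}" "int (card K) = n + 1" for K
  proof (cases "x \<in> UJ K")
    case True
    note p = component_idx[OF K True]
    have "component (UJ F) x = C" using pi0_component[OF F'(3) x] by simp
    then show ?thesis using True x
      by (auto simp: hcoord_def gen_apply[OF p] cf_zero idem_Lambda(2)[OF C])
  next
    case False
    then show ?thesis using pi0D(2)[OF F'(3)] x by (auto simp: hcoord_def)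
  qed
  have ins: "insert i J \<subseteq> {1..m}" "int (card (insert i J)) = n + 1" if "i \<in> {1..m} - J" for i
    using that J' fin by auto
  have "top_coord C (Q_diff T U m (n + 1) ?e (J, C)) = cf (Q_diff T U m (n + 1) ?e (J, C)) C C x"
    by (rule top_coord_eq[OF C Q_mem(2)[OF de J] x])
  also have "\<dots> = hcoord (Q_diff T U m (n + 1) ?e) J C x" using hcoord_summand[OF de J] x by simp
  also have "\<dots> = (\<Sum>i\<in>{1..m} - J. pos_sign i J * hcoord ?e (insert i J) C x)"
    unfolding hcoord_Q_diff[OF e J'(1,2)] face_sum_def ..
  also have "\<dots> = (\<Sum>i\<in>{1..m} - J. if insert i J = F then pos_sign i J else 0)"
    by (rule sum.cong[OF refl]) (simp add: he[OF ins])
  also have "\<dots> = (\<Sum>i\<in>{i \<in> F. F - {i} = J}. pos_sign i F)"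
  proof (rule sum.mono_neutral_cong_right)
    show "{i \<in> F. F - {i} = J} \<subseteq> {1..m} - J" using F'(1) by auto
    show "\<forall>i\<in>{1..m} - J - {i \<in> F. F - {i} = J}. (if insert i J = F then pos_sign i J else 0) = 0" by auto
    show "(if insert i J = F then pos_sign i J else (0 :: 'k)) = pos_sign i F" if "i \<in> {i \<in> F. F - {i} = J}" for i
    proof -
      have "insert i J = F" using that by auto
      then show ?thesis using pos_sign_insert_self[of i J, where 'a = 'k] by auto
    qed
  qed simp
  also have "\<dots> = (\<Sum>i\<in>F. if F - {i} = J then pos_sign i F else 0)"
    using fin(1) by (simp add: sum.inter_filter)
  finally show ?thesis .
qed

text \<open>For \<open>F\<close> outside \<open>Gamma_minus\<close> the incidence numbers reproduce
  the coboundary. For \<open>F\<close> in \<open>Gamma_minus\<close> the left side is 0 by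
  definition, and so is the right side, because all facets of \<open>F\<close> lie in
  \<open>Gamma_minus\<close> as well, where the cochain vanishes.\<close>

lemma to_cochain_diff:
  fixes f :: "(nat set \<times> 'p set \<Rightarrow> ('p, 'k::field) endo) \<Rightarrow> ('p, 'k) endo set"
  assumes C: "C \<in> upset_intervals T" and f: "f \<in> lmod_hom Lambda_alg (Q_obj T U m n) (simp_top C)"
  defines "I \<equiv> I_set U m C"
  shows "to_cochain C (n + 1) (\<lambda>x\<in>carrier (Q_obj T U m (n + 1)). f (Q_diff T U m (n + 1) x)) F =
    - (if F \<in> faces (Pow I) n then coface_sum (to_cochain C n f) F else 0)"
proof -
  have CI: "C \<in> intervals" using C by (simp add: upset_intervals_def)
  note G = not_Gamma_iff[OF C]
  \<comment> \<open>A set of \<open>q\<close> vertices is a face of dimension \<open>q - 1\<close>;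
    this is the origin of the shift.\<close>
  have idx: "(F, C) \<in> idx q \<longleftrightarrow> F \<in> faces (Pow I) (q - 1) - Gamma_minus T U m C" for F q
    using G[of F] by (auto simp: idx_iff faces_def I_def)
  show ?thesis
  proof (cases "(F, C) \<in> idx (n + 1)")
    case True
    let ?e = "gen (n + 1) F C :: nat set \<times> 'p set \<Rightarrow> ('p, 'k) endo"
    have e: "?e \<in> carrier (Q_obj T U m (n + 1))" by (rule gen_closed[OF True])
    have de: "Q_diff T U m (n + 1) ?e \<in> carrier (Q_obj T U m n)" using Q_diff_closed[OF e] by simp
    let ?t = "\<lambda>J. top_value C (f (gen n J C))"
    have fin: "finite F" using True finite_subset[of F "{1..m}"] by (simp add: idx_iff)
    have "top_value C (f (Q_diff T U m (n + 1) ?e)) =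
        (\<Sum>J\<in>{J. (J, C) \<in> idx n}. (\<Sum>i\<in>F. if F - {i} = J then pos_sign i F else 0) * ?t J)"
      unfolding Hom_simp_top_expand[OF CI f de]
      by (rule sum.cong[OF refl]) (simp add: top_coord_diff_gen[OF CI True])
    also have "\<dots> = (\<Sum>i\<in>F. \<Sum>J\<in>{J. (J, C) \<in> idx n}. if J = F - {i} then pos_sign i F * ?t (F - {i}) else 0)"
      unfolding sum_distrib_right by (subst sum.swap) (intro sum.cong refl, auto)
    also have "\<dots> = (\<Sum>i\<in>F. pos_sign i F * (if (F - {i}, C) \<in> idx n then ?t (F - {i}) else 0))"
      using finite_face_idx by (intro sum.cong refl) simp
    also have "degree_sign (n + 1) * \<dots> = - coface_sum (to_cochain C n f) F"
      unfolding degree_sign_Suc coface_sum_def to_cochain_def sum_distrib_left sum_negf[symmetric]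
      by (intro sum.cong refl) simp
    finally have "degree_sign (n + 1) * top_value C (f (Q_diff T U m (n + 1) ?e)) =
        - coface_sum (to_cochain C n f) F" .
    then show ?thesis using True e idx[of F "n + 1"] by (simp add: to_cochain_def)
  next
    case False
    have "coface_sum (to_cochain C n f) F = 0" if "F \<in> faces (Pow I) n"
    proof -
      have FG: "F \<in> Gamma_minus T U m C" using False that idx[of F "n + 1"] by simp
      have "F - {i} \<in> Gamma_minus T U m C" for i
        using bspec[OF simplicial_Gamma[OF C, unfolded simplicial_def] FG] Diff_subset[of F "{i}"] by simp
      then have "(F - {i}, C) \<notin> idx n" for i using idx[of "F - {i}" n] by simp
      then show ?thesis by (simp add: coface_sum_def to_cochain_def)
    qed
    then show ?thesis using False by (simp add: to_cochain_def)
  qed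
qed

section \<open>The isomorphism of complexes and the Ext spaces\<close>

theorem Hom_complex_iso:
  assumes C: "C \<in> upset_intervals T"
  shows "cochain_iso (scalars :: 'k::field ring) (Hom_complex Lambda_alg (Q_complex T U m) (simp_top C))
    (shift (rel_cochains (Pow (I_set U m C)) (Gamma_minus T U m C)))"
proof -
  let ?I = "I_set U m C" and ?G = "Gamma_minus T U m C"
  let ?L = "simp_top C :: (('p, 'k) endo, ('p, 'k) endo set) module"
  let ?H = "\<lambda>n. lmod_hom Lambda_alg (Q_obj T U m n) ?L"
  have CI: "C \<in> intervals" using C by (simp add: upset_intervals_def)
  have idx: "{F. (F, C) \<in> idx q} = faces (Pow ?I) (q - 1) - ?G" for q
    using not_Gamma_iff[OF C] by (auto simp: idx_iff faces_def)
  let ?\<phi> = "\<lambda>n. restrict (to_cochain C n) (?H n)"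
  note tb = to_cochain_bij[OF CI, where 'k = 'k, unfolded idx]
  show ?thesis unfolding cochain_iso_def
  proof (intro exI[of _ ?\<phi>] allI conjI ballI)
    fix n
    show "?\<phi> n \<in> lmod_hom (scalars :: 'k ring) (obj (Hom_complex Lambda_alg (Q_complex T U m) ?L) n)
        (obj (shift (rel_cochains (Pow ?I) ?G)) n)"
      using tb(1)[of n] by (simp add: Hom_complex_def Q_complex_def shift_def rel_cochains_simps)
    show "bij_betw (?\<phi> n) (carrier (obj (Hom_complex Lambda_alg (Q_complex T U m) ?L) n))
        (carrier (obj (shift (rel_cochains (Pow ?I) ?G)) n))"
    proof -
      have "bij_betw (?\<phi> n) (?H n) (carrier (functions_on (faces (Pow ?I) (n - 1) - ?G)))"
        by (rule bij_betw_cong[THEN iffD2, OF _ tb(2)]) simp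
      then show ?thesis by (simp add: Hom_complex_def Q_complex_def shift_def rel_cochains_simps Hom_space_simps)
    qed
    fix f assume "f \<in> carrier (obj (Hom_complex Lambda_alg (Q_complex T U m) ?L) n)"
    then have f: "f \<in> ?H n" by (simp add: Hom_complex_def Q_complex_def Hom_space_simps)
    let ?df = "\<lambda>x\<in>carrier (Q_obj T U m (n + 1)). f (Q_diff T U m (n + 1) x)"
    have d: "Q_diff T U m (n + 1) \<in> lmod_hom Lambda_alg (Q_obj T U m (n + 1))
        (Q_obj T U m n :: (('p, 'k) endo, _) module)"
      using Q_diff_hom[of "n + 1"] by simp
    have df: "?df \<in> ?H (n + 1)" by (rule lmod_hom_comp[OF d f left_module_Q])
    let ?c = "\<lambda>F. if F \<in> faces (Pow ?I) n then coface_sum (to_cochain C n f) F else 0"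
    have c: "to_cochain C (n + 1) ?df = (\<lambda>F. - ?c F)" by (rule ext) (rule to_cochain_diff[OF C f])
    \<comment> \<open>The shifted differential uses the inverse in the module record, which is known
      to be pointwise negation only on the carrier; hence membership is established before the signs
      are compared.\<close>
    have "to_cochain C (n + 1) ?df \<in> carrier (functions_on (faces (Pow ?I) n - ?G))"
      using bij_betwE[OF tb(2)[of "n + 1"]] df by simp
    then have "?c \<in> carrier (functions_on (faces (Pow ?I) n - ?G))"
      unfolding c functions_on_simps by simp
    then have "\<ominus>\<^bsub>functions_on (faces (Pow ?I) n - ?G)\<^esub> ?c = to_cochain C (n + 1) ?df"
      unfolding c by (rule minus_functions_on)
    then show "?\<phi> (n + 1) (diff (Hom_complex Lambda_alg (Q_complex T U m) ?L) n f) =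
        diff (shift (rel_cochains (Pow ?I) ?G)) n (?\<phi> n f)"
      using f df by (simp add: Hom_complex_def Q_complex_def shift_def rel_cochains_simps)
  qed
qed

text \<open>The degree drops twice, once by the shift and once by the connecting map of the pair.
  Properness of \<open>C\<close> yields a vertex of \<open>I_set U m C\<close>, the apex over which
  the full simplex is contracted.\<close>

theorem Ext_standard_simple:
  assumes C: "C \<in> upset_intervals T" "C \<noteq> T" and n: "n \<ge> 1"
  shows "lmod_iso (scalars :: 'k::field ring) (Ext Lambda_alg n (standard T) (simp_top C))
    (reduced_cohomology (Gamma_minus T U m C) (int n - 2))"
proof -
  let ?I = "I_set U m C" and ?G = "Gamma_minus T U m C"
  let ?L = "simp_top C :: (('p, 'k) endo, ('p, 'k) endo set) module"
  let ?H = "Hom_complex Lambda_alg (Q_complex T U m) ?L"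
  let ?R = "rel_cochains (Pow ?I) ?G :: ('k, nat set \<Rightarrow> 'k) graded_complex"
  interpret A: unital_algebra "Lambda_alg :: ('k, ('p, 'k) endo) module" by (rule unital_algebra_Lambda)
  have CI: "C \<in> intervals" using C by (simp add: upset_intervals_def)
  have L: "left_module Lambda_alg ?L" by (rule left_module_simp_top[OF CI])
  obtain \<tau> :: "int \<Rightarrow> (nat set \<times> 'p set \<Rightarrow> ('p, 'k) endo) \<Rightarrow> nat \<Rightarrow> ('p, 'k) endo"
    where "\<And>q. inj_on (\<tau> q) (carrier (Q_obj T U m q))" using exists_embedding_Q by blast
  then have \<tau>: "\<And>q. inj_on (\<tau> q) (carrier (obj (Q_complex T U m) q))" by (simp add: Q_complex_def)
  note E = A.Ext_iso_cohomology[OF Q_resolution left_module_standard[OF T] L \<tau> n]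
  have "lmod_iso (scalars :: 'k ring) (cohomology ?H (int n)) (cohomology (shift ?R) (int n))"
  proof (rule cochain_iso_cohomology[OF Hom_complex_iso[OF C(1)]])
    fix q
    have o: "obj ?H q = Hom_space Lambda_alg (Q_obj T U m q) ?L" for q by (simp add: Hom_complex_def Q_complex_def)
    show "left_module (scalars :: 'k ring) (obj ?H q)" unfolding o
      by (rule A.left_module_Hom_space[OF left_module_Q L])
    show "left_module (scalars :: 'k ring) (obj (shift ?R) q)"
      by (simp add: shift_def rel_cochains_simps left_module_functions_on)
    have d: "Q_diff T U m (q + 1) \<in> lmod_hom Lambda_alg (Q_obj T U m (q + 1))
        (Q_obj T U m q :: (('p, 'k) endo, _) module)"
      using Q_diff_hom[of "q + 1"] by simp
    show "restrict (diff ?H q) (carrier (obj ?H q)) \<in> lmod_hom (scalars :: 'k ring) (obj ?H q) (obj ?H (q + 1))"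
      using A.precompose_hom[OF left_module_Q left_module_Q L d]
      by (simp add: Hom_complex_def Q_complex_def Hom_space_simps)
  next
    fix f assume "f \<in> carrier (obj ?H (int n - 1))"
    then have f: "f \<in> lmod_hom Lambda_alg (Q_obj T U m (int n - 1)) ?L"
      by (simp add: Hom_complex_def Q_complex_def Hom_space_simps)
    have "Q_diff T U m (int n) (Q_diff T U m (int n + 1) x) = \<zero>\<^bsub>Q_obj T U m (int n - 1)\<^esub>"
      and "Q_diff T U m (int n + 1) x \<in> carrier (Q_obj T U m (int n))"
      if "x \<in> carrier (Q_obj T U m (int n + 1))" for x :: "nat set \<times> 'p set \<Rightarrow> ('p, 'k) endo"
      using Q_exact[of "int n", where 'k = 'k] n that by auto
    then show "diff ?H (int n) (diff ?H (int n - 1) f) = \<zero>\<^bsub>obj ?H (int n + 1)\<^esub>"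
      using lmod_hom_zero[OF left_module_Q L f]
      by (simp add: Hom_complex_def Q_complex_def Hom_space_simps restrict_eq_const_iff)
  qed
  then have 1: "lmod_iso (scalars :: 'k ring) (Ext Lambda_alg n (standard T) ?L) (cohomology ?R (int n - 1))"
    unfolding cohomology_shift_rel_cochains[OF simplicial_Gamma[OF C(1)]] by (rule lmod_iso_trans[OF E(1) _ E(2)])
  obtain a where a: "a \<in> ?I" using exists_cover[OF C] by (auto simp: I_set_def)
  have "finite ?I" by (simp add: I_set_def)
  from relative_simplex_cohomology(1)[OF this a _ simplicial_Gamma[OF C(1)], of "int n - 1", where 'k = 'k]
  have "lmod_iso (scalars :: 'k ring) (cohomology ?R (int n - 1)) (reduced_cohomology ?G (int n - 2))"
    by (simp add: Gamma_minus_def Collect_mono_iff Pow_def)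
  with 1 show ?thesis by (rule lmod_iso_trans[OF _ _ E(2)])
qed

end

theorem proposition5p6:
  fixes T C :: "'p::{finite,order} set" and U :: "nat \<Rightarrow> 'p set" and m :: nat
  assumes "poset_connected (UNIV :: 'p set)"
    and "T \<in> intervals"
    and "C \<in> upset_intervals T" and "C \<noteq> T"
    and "bij_betw U {1..m} (maximal_proper_upsets T)"
  shows "cochain_iso (scalars :: 'k::field ring)
           (Hom_complex Lambda_alg (Q_complex T U m) (simp_top C))
           (shift (rel_cochains (Pow (I_set U m C)) (Gamma_minus T U m C)))
       \<and> (\<forall>n\<ge>1. lmod_iso (scalars :: 'k ring)
           (Ext Lambda_alg n (standard T) (simp_top C))
           (reduced_cohomology (Gamma_minus T U m C) (int n - 2)))"
proof -
  interpret upset_cover T U m by (rule upset_cover.intro[OF assms(2,5)])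
  show ?thesis using Hom_complex_iso[OF assms(3)] Ext_standard_simple[OF assms(3,4)] by blast
qed

end
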